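(* Let $n\ge1$ and let $k:\mathbb R^n\to\mathbb R$ satisfy $k\in C(\mathbb R^n)\cap L^\infty(\mathbb R^n)$, $k\ge0$, $k(0)>0$, $\int_{\mathbb R^n}k(x)\,dx=1$. Assume that the Fourier transform $\hat k(\xi)=\int_{\mathbb R^n}e^{-ix\cdot\xi}k(x)\,dx$ satisfies $$\hat k(\xi)=1-A|\xi|^2+o(|\xi|^2)\quad\text{as }\xi\to0$$ for some constant $A>0$. Let $\Omega_0$ be a smooth bounded domain in $\mathbb R^n$, $\ell_0>0$ a constant, and let $\gamma_0\in L^\infty(\mathbb R^n)$ satisfy $\gamma_0(x)=-\ell_0$ for $x\in\mathbb R^n\setminus\bar\Omega_0$, $\gamma_0|_{\bar\Omega_0}\ge0$, $\gamma_0|_{\bar\Omega_0}\not\equiv0$. For $\epsilon>0$ let $k_\epsilon(x)=\epsilon^{-n}k(x/\epsilon)$ and let $\gamma_\epsilon$ be the solution of $$\begin{cases}\displaystyle \gamma_{\epsilon t}(t,x)=\frac1{\epsilon^2}\int_{\mathbb R^n}k_\epsilon(x-y)\gamma_\epsilon^+(t,y)\,dy-\frac1{\epsilon^2}\gamma_\epsilon^+(t,x), & t>0,\ x\in\mathbb R^n,\\ \gamma_\epsilon(0,x)=\gamma_0(x), & x\in\mathbb R^n,\end{cases}$$ where $\gamma_\epsilon^+=\gamma_\epsilon\chi_{\{\gamma_\epsilon>0\}}$. Let $\theta$, with free boundary at time $t$ given by $s(x)=t$, be the solution of the classical one-phase Stefan problem $$\begin{cases}\theta_t(t,x)=A\Delta\theta(t,x),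 & t>0,\ x\in\{\theta(t,\cdot)>0\},\\ \nabla_x\theta\cdot\nabla_xs=-\ell_0, & t>0,\ x\in\partial\{\theta(t,\cdot)>0\},\\ \theta=0, & t>0,\ x\in\partial\{\theta(t,\cdot)>0\},\\ \theta(0,x)=\gamma_0(x), & x\in\bar\Omega_0.\end{cases}$$ Then for any given $T>0$, $\gamma_\epsilon^+$ converges to $\theta$ as $\epsilon\to0$ in the following sense: $$\int_0^t\gamma_\epsilon^+(\tau,x)\,d\tau\ \longrightarrow\ \int_{\min\{s(x),t\}}^t\theta(\tau,x)\,d\tau\qquad\text{a.e. in }(0,T)\times\mathbb R^n.$$
   Context: The solution $\gamma_\epsilon$ is the unique function in $C([0,\infty);L^\infty(\mathbb R^n))$ satisfying the time-integrated form of the equation, $\gamma_\epsilon(t,x)=\gamma_0(x)+\epsilon^{-2}\int_0^t\big(\int_{\mathbb R^n}k_\epsilon(x-y)\gamma_\epsilon^+(\tau,y)\,dy-\gamma_\epsilon^+(\tau,x)\big)\,d\tau$. In the classical Stefan problem, $s(x)=0$ for $x\in\bar\Omega_0$, and for $x\notin\bar\Omega_0$, $s(x)\in(0,+\infty]$ is the time at which the free boundary $\partial\{\theta(t,\cdot)>0\}$ reaches $x$ ($+\infty$ if never). The solution is understood through the standard reduction to a parabolic variational inequality: the function $$v(t,x)=\int_{\min\{s(x),t\}}^t\theta(\tau,x)\,d\tau$$ (equal to $\int_0^t\theta\,d\tau$ for $x\in\bar\Omega_0$; equal to $0$ for $x\notin\bar\Omega_0$, $t\le s(x)$; equal to $\int_{s(x)}^t\theta\,d\tau$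 for $x\notin\bar\Omega_0$, $t>s(x)$) is the unique function with $v(0,\cdot)=0$ and $D_xv,\ D_x^2v,\ D_tv\in L^\infty((0,T);L^p(\mathbb R^n))$ for $p<\infty$ that satisfies, a.e. in $(0,T)\times\mathbb R^n$, $$v_t-A\Delta v\ge\bar f,\qquad v\ge0,\qquad (v_t-A\Delta v-\bar f)\,v=0,\qquad\text{with }\bar f(t,x)=\gamma_0(x).$$
   Formalization: For A≠1 the displayed condition ∇θ·∇s=−ℓ₀ contradicts the variational inequality for v=∫θ, which encodes A∇θ·∇s=−ℓ₀; the Stefan solution is therefore taken through the variational inequality with right-hand side γ₀, and the displayed condition is not imposed. *)

theory Defs
  imports "HOL-Probability.Essential_Supremum" "HOL-Library.Landau_Symbols"
begin

section \<open>Smooth functions and smooth domains\<close>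

definition partial :: "'a::euclidean_space \<Rightarrow> ('a \<Rightarrow> real) \<Rightarrow> 'a \<Rightarrow> real" where
  "partial b f x = frechet_derivative f (at x) b"

text \<open>Meant for open \<open>S\<close> only. The continuity of the derivatives of order below \<open>m\<close> is implied
  by their differentiability.\<close>

primrec Ck_on :: "nat \<Rightarrow> 'a::euclidean_space set \<Rightarrow> ('a \<Rightarrow> real) \<Rightarrow> bool" where
  "Ck_on 0 S f \<longleftrightarrow> continuous_on S f"
| "Ck_on (Suc m) S f \<longleftrightarrow> f differentiable_on S \<and> (\<forall>b\<in>Basis. Ck_on m S (partial b f))"

definition smooth_on :: "'a::euclidean_space set \<Rightarrow> ('a \<Rightarrow> real) \<Rightarrow> bool" where
  "smooth_on S f \<longleftrightarrow> (\<forall>m. Ck_on m S f)"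

text \<open>The boundary is \<open>C\<^sup>\<infinity>\<close> in the sense of local defining functions: near each boundary point the
  domain is the sublevel set of a smooth function with nonvanishing gradient (equivalently, it lies
  on one side of a smooth hypersurface).\<close>

definition smooth_bounded_domain :: "'a::euclidean_space set \<Rightarrow> bool" where
  "smooth_bounded_domain \<Omega> \<longleftrightarrow>
     open \<Omega> \<and> connected \<Omega> \<and> \<Omega> \<noteq> {} \<and> bounded \<Omega> \<and>
     (\<forall>p\<in>frontier \<Omega>. \<exists>U \<rho>. open U \<and> p \<in> U \<and> smooth_on U \<rho> \<and>
        (\<forall>x\<in>U. \<exists>b\<in>Basis. partial b \<rho> x \<noteq> 0) \<and> \<Omega> \<inter> U = {x\<in>U. \<rho> x < 0})"


section \<open>The nonlocal problem\<close>

definition fourier :: "('a::euclidean_space \<Rightarrow> real) \<Rightarrow> 'a \<Rightarrow> complex" where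
  "fourier k \<xi> = (LINT x|lebesgue. exp (- (\<i> * complex_of_real (x \<bullet> \<xi>))) * complex_of_real (k x))"

definition rescale :: "real \<Rightarrow> ('a::euclidean_space \<Rightarrow> real) \<Rightarrow> 'a \<Rightarrow> real" where
  "rescale \<epsilon> k x = k (x /\<^sub>R \<epsilon>) / \<epsilon> ^ DIM('a)"

definition Linf_norm :: "('a::euclidean_space \<Rightarrow> real) \<Rightarrow> ereal" where
  "Linf_norm f = esssup lebesgue (\<lambda>x. ereal \<bar>f x\<bar>)"

definition Linf :: "('a::euclidean_space \<Rightarrow> real) \<Rightarrow> bool" where
  "Linf f \<longleftrightarrow> f \<in> borel_measurable lebesgue \<and> Linf_norm f < \<infinity>"

text \<open>\<open>g \<in> C([0,\<infinity>); L\<^sup>\<infinity>)\<close> solves the time-integrated equation for all times \<open>t \<ge> 0\<close> and all \<open>x\<close>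
  outside the null set \<open>N\<close>. An element of \<open>C([0,\<infinity>); L\<^sup>\<infinity>)\<close> solving the equation has such a
  representative \<open>g\<close>, given by the equation itself. The set \<open>N\<close> is an argument because the almost
  everywhere limit over the continuum of all \<open>\<epsilon> > 0\<close> has a meaning only if the pointwise values
  are not changed on null sets that depend on \<open>\<epsilon>\<close>. Integrability in time is required since the
  Bochner integral of a non-integrable function is \<open>0\<close> by convention.\<close>

definition nonlocal_solution ::
  "('a::euclidean_space \<Rightarrow> real) \<Rightarrow> ('a \<Rightarrow> real) \<Rightarrow> 'a set \<Rightarrow> real \<Rightarrow> (real \<Rightarrow> 'a \<Rightarrow> real) \<Rightarrow> bool" where
  "nonlocal_solution k \<gamma>\<^sub>0 N \<epsilon> g \<longleftrightarrow>
     (\<forall>t\<ge>0. Linf (g t)) \<and>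
     (\<forall>t\<ge>0. ((\<lambda>r. Linf_norm (\<lambda>x. g r x - g t x)) \<longlongrightarrow> 0) (at t within {0..})) \<and>
     (\<forall>t\<ge>0. \<forall>x. x \<notin> N \<longrightarrow>
        set_integrable lebesgue {0..t} (\<lambda>\<tau>. max (g \<tau> x) 0) \<and>
        g t x = \<gamma>\<^sub>0 x + 1 / \<epsilon>\<^sup>2 *
          (LINT \<tau>:{0..t}|lebesgue.
             (LINT y|lebesgue. rescale \<epsilon> k (x - y) * max (g \<tau> y) 0) - max (g \<tau> x) 0))"


section \<open>The parabolic variational inequality\<close>

definition test_function :: "'a::euclidean_space set \<Rightarrow> ('a \<Rightarrow> real) \<Rightarrow> bool" where
  "test_function Q \<phi> \<longleftrightarrow>
     smooth_on UNIV \<phi> \<and> compact (closure {z. \<phi> z \<noteq> 0}) \<and> closure {z. \<phi> z \<noteq> 0} \<subseteq> Q"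

definition locally_integrable :: "'a::euclidean_space set \<Rightarrow> ('a \<Rightarrow> real) \<Rightarrow> bool" where
  "locally_integrable Q f \<longleftrightarrow> (\<forall>K. compact K \<and> K \<subseteq> Q \<longrightarrow> set_integrable lebesgue K f)"

definition weak_partial ::
  "'a::euclidean_space set \<Rightarrow> 'a \<Rightarrow> ('a \<Rightarrow> real) \<Rightarrow> ('a \<Rightarrow> real) \<Rightarrow> bool" where
  "weak_partial Q b f g \<longleftrightarrow>
     locally_integrable Q f \<and> locally_integrable Q g \<and>
     (\<forall>\<phi>. test_function Q \<phi> \<longrightarrow>
        (LINT z:Q|lebesgue. f z * partial b \<phi> z) = - (LINT z:Q|lebesgue. g z * \<phi> z))"

text \<open>Functions on space-time take a pair \<open>(t, x)\<close>.\<close>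

abbreviation cylinder :: "real \<Rightarrow> (real \<times> 'a) set" where
  "cylinder T \<equiv> {0<..<T} \<times> UNIV"

text \<open>\<open>f \<in> L\<^sup>\<infinity>((0,T); L\<^sup>p(\<real>\<^sup>n))\<close> for every finite exponent \<open>p \<ge> 1\<close>.\<close>

definition Linf_Lp :: "real \<Rightarrow> (real \<times> 'a::euclidean_space \<Rightarrow> real) \<Rightarrow> bool" where
  "Linf_Lp T f \<longleftrightarrow>
     f \<in> borel_measurable (lebesgue_on (cylinder T)) \<and>
     (\<forall>p::real. 1 \<le> p \<longrightarrow>
        (\<exists>C. AE t in lebesgue_on {0<..<T}.
           integrable lebesgue (\<lambda>x. \<bar>f (t, x)\<bar> powr p) \<and>
           (LINT x|lebesgue. \<bar>f (t, x)\<bar> powr p) \<le> C))"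

text \<open>A function with \<open>D\<^sub>t v \<in> L\<^sup>\<infinity>((0,T); L\<^sup>p)\<close> has a representative that is continuous in time for
  almost every \<open>x\<close>; this gives the condition \<open>v(0,\<cdot>) = 0\<close> its meaning.\<close>

definition variational_solution ::
  "real \<Rightarrow> (real^'n \<Rightarrow> real) \<Rightarrow> real \<Rightarrow> (real \<times> (real^'n) \<Rightarrow> real) \<Rightarrow> bool" where
  "variational_solution A f T v \<longleftrightarrow>
     (AE x in lebesgue. v (0, x) = 0 \<and> continuous_on {0..<T} (\<lambda>t. v (t, x))) \<and>
     (\<exists>vt vx vxx.
        weak_partial (cylinder T) (1, 0) v vt \<and> Linf_Lp T vt \<and>
        (\<forall>i. weak_partial (cylinder T) (0, axis i 1) v (vx i) \<and> Linf_Lp T (vx i)) \<and>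
        (\<forall>i j. weak_partial (cylinder T) (0, axis j 1) (vx i) (vxx i j) \<and> Linf_Lp T (vxx i j)) \<and>
        (AE (t, x) in lebesgue_on (cylinder T).
           vt (t, x) - A * (\<Sum>i\<in>UNIV. vxx i i (t, x)) \<ge> f x \<and>
           v (t, x) \<ge> 0 \<and>
           (vt (t, x) - A * (\<Sum>i\<in>UNIV. vxx i i (t, x)) - f x) * v (t, x) = 0))"


section \<open>The one-phase Stefan problem\<close>

text \<open>The first time at which the free boundary reaches \<open>x\<close>; the infimum of the empty set is \<open>\<infinity>\<close>.\<close>

definition arrival_time :: "'a::euclidean_space set \<Rightarrow> (real \<Rightarrow> 'a \<Rightarrow> real) \<Rightarrow> 'a \<Rightarrow> ereal" where
  "arrival_time \<Omega>\<^sub>0 \<theta> x =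
     (if x \<in> closure \<Omega>\<^sub>0 then 0
      else Inf {ereal t |t. 0 < t \<and> x \<in> frontier {y. \<theta> t y > 0}})"

definition stefan_integral ::
  "(real \<Rightarrow> 'a::euclidean_space \<Rightarrow> real) \<Rightarrow> ('a \<Rightarrow> ereal) \<Rightarrow> real \<Rightarrow> 'a \<Rightarrow> real" where
  "stefan_integral \<theta> s t x =
     (LINT \<tau>:{real_of_ereal (min (s x) (ereal t))..t}|lebesgue. \<theta> \<tau> x)"

definition positivity_set :: "(real \<Rightarrow> 'a \<Rightarrow> real) \<Rightarrow> (real \<times> 'a) set" where
  "positivity_set \<theta> = {(t, x). 0 < t \<and> \<theta> t x > 0}"

text \<open>The solution of the Stefan problem is understood through the variational inequality for the
  time-integrated temperature. The latent heat \<open>l\<^sub>0\<close> enters there as the value \<open>-l\<^sub>0\<close> of \<open>\<gamma>\<^sub>0\<close>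
  outside the initial domain, and the inequality is the weak form of the Stefan condition
  \<open>A \<nabla>\<theta> \<bullet> \<nabla>s = -l\<^sub>0\<close> on the free boundary, where \<open>\<nabla>\<theta>\<close> and \<open>\<nabla>s\<close> need not exist classically.
  (Often written without the factor \<open>A\<close>; a pointwise condition without it would contradict the
  inequality unless \<open>A = 1\<close>, so no pointwise condition is imposed.)\<close>

definition stefan_solution ::
  "real \<Rightarrow> (real^'n) set \<Rightarrow> (real^'n \<Rightarrow> real) \<Rightarrow> (real \<Rightarrow> real^'n \<Rightarrow> real) \<Rightarrow>
   (real^'n \<Rightarrow> ereal) \<Rightarrow> bool" where
  "stefan_solution A \<Omega>\<^sub>0 \<gamma>\<^sub>0 \<theta> s \<longleftrightarrow>
     (\<forall>t\<ge>0. \<forall>x. \<theta> t x \<ge> 0) \<and>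
     open (positivity_set \<theta>) \<and> Ck_on 2 (positivity_set \<theta>) (\<lambda>(t, x). \<theta> t x) \<and>
     (\<forall>z\<in>positivity_set \<theta>.
        partial (1, 0) (\<lambda>(t, x). \<theta> t x) z =
        A * (\<Sum>i\<in>UNIV. partial (0, axis i 1) (partial (0, axis i 1) (\<lambda>(t, x). \<theta> t x)) z)) \<and>
     (\<forall>t>0. \<forall>x\<in>frontier {y. \<theta> t y > 0}. \<theta> t x = 0) \<and>
     (AE x in lebesgue. x \<in> closure \<Omega>\<^sub>0 \<longrightarrow> \<theta> 0 x = \<gamma>\<^sub>0 x) \<and>
     s = arrival_time \<Omega>\<^sub>0 \<theta> \<and>
     (\<forall>x. x \<notin> closure \<Omega>\<^sub>0 \<longrightarrow> 0 < s x \<and> (\<forall>t>0. ereal t \<le> s x \<longrightarrow> \<theta> t x = 0)) \<and>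
     (AE x in lebesgue. \<forall>t>0. set_integrable lebesgue {0..t} (\<lambda>\<tau>. \<theta> \<tau> x)) \<and>
     (\<forall>T>0. variational_solution A \<gamma>\<^sub>0 T (\<lambda>(t, x). stefan_integral \<theta> s t x))"

end

theory Submission
  imports Defs
begin

text \<open>
  Let \<open>w\<close> be the time integral of the positive part of the nonlocal solution and \<open>v\<close> the time
  integral of the Stefan temperature. The theorem holds because \<open>w\<close> and \<open>v\<close> solve two obstacle
  problems with the same datum whose operators agree to leading order, and because \<open>w\<close> is, up to
  an error of size \<open>\<epsilon>\<close>, Lipschitz continuous uniformly in \<open>\<epsilon>\<close>.

  At a point where the nonlocal solution is negative its time derivative is nonnegative, so it
  has been negative since time \<open>0\<close> and \<open>w\<close> vanishes there. The integrated equation says that the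
  solution equals \<open>\<gamma>\<^sub>0 + L w\<close> with \<open>L w = (k\<^sub>\<epsilon> * w - w) / \<epsilon>\<^sup>2\<close>; therefore \<open>\<partial>\<^sub>t w \<ge> \<gamma>\<^sub>0 + L w\<close>, with
  equality where \<open>w > 0\<close> (\<open>nonlocal_solution_structure\<close>). The variational inequality is the same
  statement for \<open>v\<close> with \<open>A \<Delta>\<close> in place of \<open>L\<close> (\<open>stefan_solution_structure\<close>).

  Subtract the two problems and integrate against \<open>(T - t) (w - v)\<close>. The complementarity terms
  have a favourable sign, averaging with the probability density \<open>k\<close> is a contraction of \<open>L\<^sup>2\<close>,
  and the time derivative produces half the square of the norm. This gives
  \<open>\<parallel>w - v\<parallel>\<^sup>2 \<le> 4 T\<^sup>2 \<parallel>L v - A \<Delta> v\<parallel>\<^sup>2\<close> (\<open>energy_estimate\<close>). The expansion of the Fourier transform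
  at the origin means that \<open>k\<close> has vanishing first moments and second moments \<open>2 A \<delta>\<^sub>i\<^sub>j\<close>
  (\<open>fourier_expansion_moments\<close>). By Taylor's formula the residual \<open>L v - A \<Delta> v\<close> is then a
  weighted average of increments of the second derivatives of \<open>v\<close> under translations of size
  \<open>\<epsilon>\<close>, and these tend to \<open>0\<close> because translation is continuous in \<open>L\<^sup>2\<close> (\<open>nonlocal_consistency\<close>).

  Mean square convergence yields convergence almost everywhere only along sequences, with a
  null set that depends on the sequence, whereas \<open>\<epsilon>\<close> runs through a continuum here. The solution
  obeys the bounds of its initial datum, so \<open>L w\<close> is bounded at every point outside one null
  set. As \<open>k\<close> is bounded below near the origin, the averages at two nearby points share a
  portion of their mass, and a discrete convexity argument turns the bound into
  \<open>\<bar>w(x) - w(x')\<bar> \<le> C (\<bar>x - x'\<bar> + \<epsilon>)\<close> (\<open>almost_lipschitz_of_averaging\<close>). Functions with this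
  property that converge in mean square form a Cauchy family at each point outside the common
  null set (\<open>pointwise_limit_of_almost_equicontinuous\<close>).
\<close>

section \<open>Lebesgue measure under affine maps\<close>

lemma nn_integral_lborel_affine:
  fixes f :: "'a::euclidean_space \<Rightarrow> ennreal"
  assumes [measurable]: "f \<in> borel_measurable borel" and c: "c \<noteq> 0"
  shows "(\<integral>\<^sup>+x. f x \<partial>lborel) = ennreal (\<bar>c\<bar> ^ DIM('a)) * (\<integral>\<^sup>+x. f (t + c *\<^sub>R x) \<partial>lborel)"
  by (subst lborel_affine[OF c, of t])
     (simp add: nn_integral_density nn_integral_distr nn_integral_cmult)

lemma nn_integral_lborel_shift:
  fixes f :: "'a::euclidean_space \<Rightarrow> ennreal"
  assumes "f \<in> borel_measurable borel"
  shows "(\<integral>\<^sup>+x. f (x + t) \<partial>lborel) = (\<integral>\<^sup>+x. f x \<partial>lborel)"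
    and "(\<integral>\<^sup>+x. f (x - t) \<partial>lborel) = (\<integral>\<^sup>+x. f x \<partial>lborel)"
  using nn_integral_lborel_affine[OF assms, of 1 t] nn_integral_lborel_affine[OF assms, of 1 "- t"]
  by (simp_all add: add.commute)

lemma AE_lborel_affine:
  fixes P :: "'a::euclidean_space \<Rightarrow> bool"
  assumes "AE x in lborel. P x" and c: "c \<noteq> 0"
  shows "AE x in lborel. P (t + c *\<^sub>R x)"
proof -
  obtain N where N: "N \<in> null_sets lborel" "{x. \<not> P x} \<subseteq> N"
    using assms(1) by (auto elim!: AE_E intro: that simp: null_sets_def)
  then have [measurable]: "N \<in> sets borel" by auto
  have "0 = (\<integral>\<^sup>+x. indicator N x \<partial>lborel)" using N by (auto simp: null_sets_def)
  also have "\<dots> = ennreal (\<bar>c\<bar> ^ DIM('a)) * (\<integral>\<^sup>+x. indicator N (t + c *\<^sub>R x) \<partial>lborel)"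
    using c by (intro nn_integral_lborel_affine) auto
  finally have "(\<integral>\<^sup>+x. indicator N (t + c *\<^sub>R x) \<partial>lborel) = (0::ennreal)"
    using c by (simp add: power_0_left)
  then have "AE x in lborel. indicator N (t + c *\<^sub>R x) = (0::ennreal)"
    by (subst (asm) nn_integral_0_iff_AE) auto
  then show ?thesis by eventually_elim (use N in \<open>auto simp: indicator_def split: if_splits\<close>)
qed

lemma AE_lborel_shift:
  fixes P :: "'a::euclidean_space \<Rightarrow> bool"
  assumes "AE x in lborel. P x"
  shows "AE x in lborel. P (x + t)" and "AE x in lborel. P (x - t)" and "AE x in lborel. P (t - x)"
  using AE_lborel_affine[OF assms, of 1 t] AE_lborel_affine[OF assms, of 1 "-t"]
    AE_lborel_affine[OF assms, of "-1" t]
  by (simp_all add: add.commute)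

lemma AE_lborel_ex:
  fixes P :: "'a::euclidean_space \<Rightarrow> bool"
  assumes "AE x in lborel. P x"
  shows "\<exists>x. P x"
proof (rule eventually_happens'[OF _ assms])
  show "ae_filter (lborel :: 'a measure) \<noteq> bot"
    by (simp add: ae_filter_eq_bot_iff emeasure_lborel_UNIV)
qed

lemma integrable_lborel_affine:
  fixes f :: "'a::euclidean_space \<Rightarrow> real"
  assumes f: "integrable lborel f" and c: "c \<noteq> 0"
  shows "integrable lborel (\<lambda>x. f (t + c *\<^sub>R x))"
proof (rule integrableI_bounded)
  have [measurable]: "f \<in> borel_measurable borel" using f by auto
  show "(\<lambda>x. f (t + c *\<^sub>R x)) \<in> borel_measurable lborel" by measurable
  have "(\<integral>\<^sup>+x. ennreal (norm (f x)) \<partial>lborel) < \<infinity>" using f by (auto simp: integrable_iff_bounded)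
  then show "(\<integral>\<^sup>+x. ennreal (norm (f (t + c *\<^sub>R x))) \<partial>lborel) < \<infinity>"
    using c by (subst (asm) nn_integral_lborel_affine[where t=t and c=c])
      (auto simp: ennreal_mult_less_top)
qed

lemma integral_lborel_affine:
  fixes f :: "'a::euclidean_space \<Rightarrow> real"
  assumes [measurable]: "f \<in> borel_measurable borel" and c: "c \<noteq> 0"
  shows "(LINT x|lborel. f x) = \<bar>c\<bar> ^ DIM('a) * (LINT x|lborel. f (t + c *\<^sub>R x))"
  by (subst lborel_affine[OF c, of t])
     (simp add: integral_density integral_distr)

lemma integral_lborel_shift:
  fixes f :: "'a::euclidean_space \<Rightarrow> real"
  assumes "f \<in> borel_measurable borel"
  shows "(LINT x|lborel. f (x + t)) = (LINT x|lborel. f x)"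
    and "(LINT x|lborel. f (x - t)) = (LINT x|lborel. f x)"
  using integral_lborel_affine[OF assms, of 1 t] integral_lborel_affine[OF assms, of 1 "- t"]
  by (simp_all add: add.commute)

lemma abs_integral_le_AE:
  fixes f g :: "'a \<Rightarrow> real"
  assumes f: "integrable M f" and g: "integrable M g" and ae: "AE x in M. \<bar>f x\<bar> \<le> g x"
  shows "\<bar>LINT x|M. f x\<bar> \<le> (LINT x|M. g x)"
proof -
  have "\<bar>LINT x|M. f x\<bar> \<le> (LINT x|M. \<bar>f x\<bar>)" by (rule integral_abs_bound)
  also have "\<dots> \<le> (LINT x|M. g x)" by (intro integral_mono_AE g ae) (use f in auto)
  finally show ?thesis .
qed

lemma integrable_mult_bounded:
  fixes k f :: "'a \<Rightarrow> real"
  assumes k: "integrable M k" and [measurable]: "f \<in> borel_measurable M" and B: "\<And>x. \<bar>f x\<bar> \<le> B"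
  shows "integrable M (\<lambda>x. k x * f x)"
proof (rule Bochner_Integration.integrable_bound)
  have [measurable]: "k \<in> borel_measurable M" using k by auto
  show "(\<lambda>x. k x * f x) \<in> borel_measurable M" by measurable
  show "integrable M (\<lambda>x. B * k x)" using k by auto
  have "B \<ge> 0" using B[of undefined] by linarith
  then show "AE x in M. norm (k x * f x) \<le> norm (B * k x)"
    using B by (auto simp: abs_mult mult.commute intro!: mult_right_mono)
qed

lemma AE_lborel_null:
  assumes "AE x in lborel. P x"
  obtains N where "N \<in> sets borel" "emeasure lborel N = 0" "\<And>x. x \<notin> N \<Longrightarrow> P x"
proof -
  obtain N where "{x. \<not> P x} \<subseteq> N" "emeasure lborel N = 0" "N \<in> sets borel"
    using assms by (auto elim!: AE_E)
  then show ?thesis by (intro that[of N]) auto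
qed

lemma AE_lborel_snd:
  fixes P :: "'b::euclidean_space \<Rightarrow> bool"
  assumes "AE x in lborel. P x"
  shows "AE z in (lborel :: ('a::euclidean_space \<times> 'b) measure). P (snd z)"
proof -
  obtain N where N: "N \<in> sets borel" "emeasure lborel N = 0" "\<And>x. x \<notin> N \<Longrightarrow> P x"
    using AE_lborel_null[OF assms] by blast
  have "emeasure (lborel \<Otimes>\<^sub>M lborel) ((UNIV :: 'a set) \<times> N) = emeasure lborel (UNIV :: 'a set) * emeasure lborel N"
    using N by (intro lborel.emeasure_pair_measure_Times) auto
  then have "(UNIV :: 'a set) \<times> N \<in> null_sets lborel"
    using N(1,2) by (auto simp: null_sets_def lborel_prod borel_prod[symmetric] simp del: lborel_eq_real)
  moreover have "{z \<in> space lborel. \<not> P (snd z)} \<subseteq> (UNIV :: 'a set) \<times> N"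
    using N(3) by (fastforce simp: mem_Times_iff)
  ultimately show ?thesis by (rule AE_I')
qed

section \<open>Time primitives and spatial averages\<close>

text \<open>
  Valued in the extended nonnegative reals, so that \<open>sqnorm f < \<infinity>\<close> expresses membership in
  \<open>L\<^sup>2\<close>.
\<close>

abbreviation sqnorm :: "('a::euclidean_space \<Rightarrow> real) \<Rightarrow> ennreal" where
  "sqnorm f \<equiv> \<integral>\<^sup>+z. ennreal ((f z)\<^sup>2) \<partial>lborel"

definition time_primitive :: "(real \<times> 'a \<Rightarrow> real) \<Rightarrow> real \<times> 'a \<Rightarrow> real" where
  "time_primitive G z = (LINT \<tau>|lborel. indicator {0..fst z} \<tau> * G (\<tau>, snd z))"

definition space_average :: "('a::euclidean_space \<Rightarrow> real) \<Rightarrow> real \<Rightarrow> (real \<times> 'a \<Rightarrow> real) \<Rightarrow> real \<times> 'a \<Rightarrow> real" where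
  "space_average k \<epsilon> w z = (LINT y|lborel. k y * w (fst z, snd z - \<epsilon> *\<^sub>R y))"

text \<open>
  The operator \<open>L\<close> that approximates \<open>A \<Delta>\<close> as \<open>\<epsilon> \<rightarrow> 0\<close>.
\<close>

abbreviation nonlocal_diffusion :: "('a::euclidean_space \<Rightarrow> real) \<Rightarrow> real \<Rightarrow> (real \<times> 'a \<Rightarrow> real) \<Rightarrow> real \<times> 'a \<Rightarrow> real" where
  "nonlocal_diffusion k \<epsilon> w z \<equiv> (space_average k \<epsilon> w z - w z) / \<epsilon>\<^sup>2"

text \<open>
  The pointwise form of an obstacle problem: \<open>g\<close> is the time derivative of the nonnegative
  function \<open>w\<close>, and \<open>f\<close> is the source together with the diffusion of \<open>w\<close>.
\<close>

abbreviation complementary :: "real \<Rightarrow> real \<Rightarrow> real \<Rightarrow> bool" where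
  "complementary f g w \<equiv> f \<le> g \<and> (g - f) * w = 0"

lemma integrable_indicator_Icc[simp]: "integrable lborel (indicat_real {a..b::real})"
  by (intro integrable_real_indicator) (auto simp: emeasure_lborel_Icc_eq)

lemma borel_measurable_Icc_indicator[measurable]:
  "(\<lambda>p. indicat_real {0..f p} (g p)) \<in> borel_measurable M"
  if [measurable]: "f \<in> borel_measurable M" "g \<in> borel_measurable M" for f g :: "'b \<Rightarrow> real"
proof -
  have "(\<lambda>p. indicat_real {0..f p} (g p)) = (\<lambda>p. if 0 \<le> g p \<and> g p \<le> f p then 1 else 0)"
    by (auto simp: indicator_def)
  then show ?thesis by simp
qed

lemma time_primitive_measurable[measurable]:
  fixes G :: "real \<times> 'a::euclidean_space \<Rightarrow> real"
  assumes [measurable]: "G \<in> borel_measurable borel"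
  shows "time_primitive G \<in> borel_measurable borel"
proof -
  have [measurable]: "G \<in> borel_measurable (borel \<Otimes>\<^sub>M borel)" by (simp add: borel_prod)
  have "(\<lambda>z. LINT \<tau>|lborel. indicator {0..fst z} \<tau> * G (\<tau>, snd z)) \<in> borel_measurable ((borel \<Otimes>\<^sub>M borel) :: (real \<times> 'a) measure)"
    by (rule lborel.borel_measurable_lebesgue_integral) measurable
  then show ?thesis by (simp add: time_primitive_def[abs_def] borel_prod)
qed

lemma space_average_measurable[measurable]:
  fixes k :: "'a::euclidean_space \<Rightarrow> real"
  assumes [measurable]: "k \<in> borel_measurable borel" "w \<in> borel_measurable borel"
  shows "space_average k \<epsilon> w \<in> borel_measurable borel"
proof -
  have [measurable]: "w \<in> borel_measurable (borel \<Otimes>\<^sub>M borel)" by (simp add: borel_prod)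
  have "(\<lambda>z. LINT y|lborel. k y * w (fst z, snd z - \<epsilon> *\<^sub>R y)) \<in> borel_measurable ((borel \<Otimes>\<^sub>M borel) :: (real \<times> 'a) measure)"
    by (rule lborel.borel_measurable_lebesgue_integral) measurable
  then show ?thesis by (simp add: space_average_def[abs_def] borel_prod)
qed

text \<open>
  Stated with extended integrals because it serves to prove that functions are integrable.
\<close>

lemma nn_integral_space_average_le:
  fixes k f :: "'a::euclidean_space \<Rightarrow> real"
  assumes k[measurable]: "k \<in> borel_measurable borel" and kint: "integrable lborel k" and k1: "(LINT x|lborel. k x) = 1"
    and k0: "\<And>y. 0 \<le> k y" and f[measurable]: "f \<in> borel_measurable borel" and f0: "\<And>x. 0 \<le> f x"
  shows "(\<integral>\<^sup>+x. ennreal (LINT y|lborel. k y * f (x - \<epsilon> *\<^sub>R y)) \<partial>lborel) \<le> (\<integral>\<^sup>+x. ennreal (f x) \<partial>lborel)"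
proof -
  have "(\<integral>\<^sup>+x. ennreal (LINT y|lborel. k y * f (x - \<epsilon> *\<^sub>R y)) \<partial>lborel)
     \<le> (\<integral>\<^sup>+x. \<integral>\<^sup>+y. ennreal (k y * f (x - \<epsilon> *\<^sub>R y)) \<partial>lborel \<partial>lborel)"
  proof (rule nn_integral_mono)
    fix x :: 'a
    show "ennreal (LINT y|lborel. k y * f (x - \<epsilon> *\<^sub>R y)) \<le> (\<integral>\<^sup>+y. ennreal (k y * f (x - \<epsilon> *\<^sub>R y)) \<partial>lborel)"
    proof (cases "integrable lborel (\<lambda>y. k y * f (x - \<epsilon> *\<^sub>R y))")
      case True
      then show ?thesis using k0 f0 by (simp add: nn_integral_eq_integral)
    qed (simp add: not_integrable_integral_eq)
  qed
  also have "\<dots> = (\<integral>\<^sup>+y. \<integral>\<^sup>+x. ennreal (k y * f (x - \<epsilon> *\<^sub>R y)) \<partial>lborel \<partial>lborel)"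
    by (rule lborel_pair.Fubini') measurable
  also have "\<dots> = (\<integral>\<^sup>+y. ennreal (k y) * (\<integral>\<^sup>+x. ennreal (f x) \<partial>lborel) \<partial>lborel)"
  proof (rule nn_integral_cong)
    fix y :: 'a
    have "(\<integral>\<^sup>+x. ennreal (k y * f (x - \<epsilon> *\<^sub>R y)) \<partial>lborel) = ennreal (k y) * (\<integral>\<^sup>+x. ennreal (f (x - \<epsilon> *\<^sub>R y)) \<partial>lborel)"
      using k0 f0 by (simp add: ennreal_mult nn_integral_cmult)
    also have "(\<integral>\<^sup>+x. ennreal (f (x - \<epsilon> *\<^sub>R y)) \<partial>lborel) = (\<integral>\<^sup>+x. ennreal (f x) \<partial>lborel)"
      by (rule nn_integral_lborel_shift(2)) measurable
    finally show "(\<integral>\<^sup>+x. ennreal (k y * f (x - \<epsilon> *\<^sub>R y)) \<partial>lborel) = ennreal (k y) * (\<integral>\<^sup>+x. ennreal (f x) \<partial>lborel)" .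
  qed
  also have "\<dots> = (\<integral>\<^sup>+y. ennreal (k y) \<partial>lborel) * (\<integral>\<^sup>+x. ennreal (f x) \<partial>lborel)"
    by (rule nn_integral_multc) measurable
  also have "(\<integral>\<^sup>+y. ennreal (k y) \<partial>lborel) = 1"
    using nn_integral_eq_integral[OF kint] k0 k1 by simp
  finally show ?thesis by simp
qed

lemma integrable_product_functions:
  fixes f :: "'a \<Rightarrow> real" and g :: "'b \<Rightarrow> real"
  assumes "sigma_finite_measure M" "sigma_finite_measure N" and f: "integrable M f" and g: "integrable N g"
  shows "integrable (M \<Otimes>\<^sub>M N) (\<lambda>z. f (fst z) * g (snd z))"
proof -
  interpret pair_sigma_finite M N using assms(1,2) by (simp add: pair_sigma_finite_def)
  have [measurable]: "f \<in> borel_measurable M" "g \<in> borel_measurable N" using f g by auto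
  show ?thesis
  proof (rule Fubini_integrable)
    show "integrable M (\<lambda>x. LINT y|N. norm (f (fst (x, y)) * g (snd (x, y))))"
      using f by (simp add: abs_mult)
    show "AE x in M. integrable N (\<lambda>y. f (fst (x, y)) * g (snd (x, y)))" using g by simp
  qed measurable
qed

lemma cylinder_measurable[measurable]: "(cylinder T :: (real \<times> 'a::euclidean_space) set) \<in> sets borel"
  by (intro borel_open open_Times) auto

text \<open>
  The last claim reduces square integrability in space-time to integrability in space at the
  final time, because \<open>G\<^sup>2 \<le> M G\<close>.
\<close>

lemma bounded_time_primitive:
  fixes G :: "real \<times> 'a::euclidean_space \<Rightarrow> real"
  assumes G[measurable]: "G \<in> borel_measurable borel" and G0: "\<And>z. 0 \<le> G z" and GM: "\<And>z. G z \<le> M"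
  shows "integrable lborel (\<lambda>\<tau>. indicator {0..t} \<tau> * G (\<tau>, x))"
    and "0 \<le> time_primitive G z"
    and "s \<le> t \<Longrightarrow> time_primitive G (s, x) \<le> time_primitive G (t, x)"
    and "0 \<le> t \<Longrightarrow> time_primitive G (t, x) \<le> M * t"
    and "0 < T \<Longrightarrow> (\<integral>\<^sup>+z. ennreal (indicator (cylinder T) z * (G z)\<^sup>2) \<partial>lborel)
           \<le> ennreal M * (\<integral>\<^sup>+x. ennreal (time_primitive G (T, x)) \<partial>lborel)"
proof -
  have [measurable]: "G \<in> borel_measurable (borel \<Otimes>\<^sub>M borel)" "time_primitive G \<in> borel_measurable (borel \<Otimes>\<^sub>M borel)"
    by (simp_all add: borel_prod)
  have M0: "0 \<le> M" using order_trans[OF G0 GM] .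
  show int: "integrable lborel (\<lambda>\<tau>. indicator {0..t} \<tau> * G (\<tau>, x))" for t x
    by (rule integrable_mult_bounded[of _ _ _ M]) (use G0 GM in auto)
  show nonneg: "0 \<le> time_primitive G z" for z
    unfolding time_primitive_def using G0 by (intro integral_nonneg_AE) auto
  show "s \<le> t \<Longrightarrow> time_primitive G (s, x) \<le> time_primitive G (t, x)"
    unfolding time_primitive_def fst_conv snd_conv using G0 by (intro integral_mono int) (auto simp: indicator_def)
  show "0 \<le> t \<Longrightarrow> time_primitive G (t, x) \<le> M * t"
  proof -
    assume t: "0 \<le> t"
    have "time_primitive G (t, x) \<le> (LINT \<tau>|lborel. indicator {0..t} \<tau> * M)"
      unfolding time_primitive_def fst_conv snd_conv
      by (rule integral_mono[OF int integrable_mult_left[OF integrable_indicator_Icc]]) (use GM in \<open>auto intro!: mult_left_mono\<close>)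
    then show "time_primitive G (t, x) \<le> M * t" using t by (simp add: mult.commute)
  qed
  assume T: "0 < T"
  have "(\<integral>\<^sup>+z. ennreal (indicator (cylinder T) z * (G z)\<^sup>2) \<partial>lborel) \<le> (\<integral>\<^sup>+z. ennreal (M * (indicator {0..T} (fst z) * G z)) \<partial>lborel)"
  proof (intro nn_integral_mono ennreal_leI)
    fix z
    have "(G z)\<^sup>2 \<le> M * G z" unfolding power2_eq_square by (intro mult_right_mono GM G0)
    then show "indicator (cylinder T) z * (G z)\<^sup>2 \<le> M * (indicator {0..T} (fst z) * G z)"
      using M0 G0[of z] by (cases z) (auto simp: indicator_def)
  qed
  also have "\<dots> = (\<integral>\<^sup>+x. \<integral>\<^sup>+\<tau>. ennreal (M * (indicator {0..T} \<tau> * G (\<tau>, x))) \<partial>lborel \<partial>lborel)"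
    unfolding lborel_prod[symmetric] by (subst lborel_pair.nn_integral_snd[symmetric]) auto
  also have "\<dots> = (\<integral>\<^sup>+x. ennreal M * ennreal (time_primitive G (T, x)) \<partial>lborel)"
  proof (rule nn_integral_cong)
    fix x
    have "(\<integral>\<^sup>+\<tau>. ennreal (M * (indicator {0..T} \<tau> * G (\<tau>, x))) \<partial>lborel) = ennreal (LINT \<tau>|lborel. M * (indicator {0..T} \<tau> * G (\<tau>, x)))"
      using int M0 G0 by (intro nn_integral_eq_integral) auto
    then show "(\<integral>\<^sup>+\<tau>. ennreal (M * (indicator {0..T} \<tau> * G (\<tau>, x))) \<partial>lborel) = ennreal M * ennreal (time_primitive G (T, x))"
      using M0 nonneg by (simp add: time_primitive_def ennreal_mult'[symmetric])
  qed
  also have "\<dots> = ennreal M * (\<integral>\<^sup>+x. ennreal (time_primitive G (T, x)) \<partial>lborel)" by (rule nn_integral_cmult) measurable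
  finally show "(\<integral>\<^sup>+z. ennreal (indicator (cylinder T) z * (G z)\<^sup>2) \<partial>lborel) \<le> \<dots>" .
qed

section \<open>Moments of the kernel\<close>

lemma fourier_Re_Im:
  fixes k :: "'a::euclidean_space \<Rightarrow> real"
  assumes k: "integrable lborel k"
  shows "Re (fourier k \<xi>) = (LINT x|lborel. cos (x \<bullet> \<xi>) * k x)"
    and "Im (fourier k \<xi>) = - (LINT x|lborel. sin (x \<bullet> \<xi>) * k x)"
    and "integrable lborel (\<lambda>x. cos (x \<bullet> \<xi>) * k x)"
    and "integrable lborel (\<lambda>x. sin (x \<bullet> \<xi>) * k x)"
proof -
  let ?F = "\<lambda>x. exp (- (\<i> * complex_of_real (x \<bullet> \<xi>))) * complex_of_real (k x)"
  have [measurable]: "k \<in> borel_measurable borel" using k by auto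
  have F: "integrable lborel ?F"
    by (rule Bochner_Integration.integrable_bound[OF k]) (auto simp: norm_mult)
  have eq: "fourier k \<xi> = (LINT x|lborel. ?F x)"
    unfolding fourier_def by (rule integral_completion) simp
  have Re: "Re (?F x) = cos (x \<bullet> \<xi>) * k x" and Im: "Im (?F x) = - (sin (x \<bullet> \<xi>) * k x)" for x
    by (simp_all add: exp_eq_polar cis.code complex_eq_iff Re_exp Im_exp)
  show "Re (fourier k \<xi>) = (LINT x|lborel. cos (x \<bullet> \<xi>) * k x)"
    unfolding eq Re[symmetric] by (rule integral_Re[OF F, symmetric])
  have "Im (fourier k \<xi>) = (LINT x|lborel. - (sin (x \<bullet> \<xi>) * k x))"
    unfolding eq Im[symmetric] by (rule integral_Im[OF F, symmetric])
  then show "Im (fourier k \<xi>) = - (LINT x|lborel. sin (x \<bullet> \<xi>) * k x)" by simp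
  show "integrable lborel (\<lambda>x. cos (x \<bullet> \<xi>) * k x)" "integrable lborel (\<lambda>x. sin (x \<bullet> \<xi>) * k x)"
    by (rule Bochner_Integration.integrable_bound[OF k], auto simp: abs_mult mult_left_le_one_le)+
qed

lemma one_minus_cos_le: "1 - cos u \<le> u\<^sup>2 / (2::real)"
proof -
  have "1 - cos u = 2 * (sin (u/2))\<^sup>2" using cos_double_sin[of "u/2"] by simp
  also have "\<dots> \<le> 2 * (u/2)\<^sup>2"
    using abs_sin_x_le_abs_x[of "u/2"] by (intro mult_left_mono) (auto simp: abs_le_square_iff[symmetric])
  finally show ?thesis by (simp add: power2_eq_square)
qed

lemma one_minus_cos_lim: "((\<lambda>h. (1 - cos (h * u)) / h\<^sup>2) \<longlongrightarrow> u\<^sup>2 / (2::real)) (at 0)"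
proof (cases "u = 0")
  case False
  have l: "((\<lambda>h::real. sin h / h) \<longlongrightarrow> 1) (at 0)"
    using DERIV_sin[of "0::real"] by (simp add: DERIV_def)
  have g: "filterlim (\<lambda>h. h * u / 2) (at 0) (at 0)"
    using False by (auto simp: filterlim_at intro!: tendsto_eq_intros eventually_at_filter[THEN iffD2])
  have "((\<lambda>h. sin (h*u/2) / (h*u/2)) \<longlongrightarrow> 1) (at 0)"
    using filterlim_compose[OF l g] .
  then have "((\<lambda>h. (sin (h*u/2) / (h*u/2))\<^sup>2 * (u\<^sup>2/2)) \<longlongrightarrow> 1\<^sup>2 * (u\<^sup>2/2)) (at 0)"
    by (intro tendsto_intros)
  moreover have "\<forall>\<^sub>F h in at 0. (sin (h*u/2) / (h*u/2))\<^sup>2 * (u\<^sup>2/2) = (1 - cos (h * u)) / h\<^sup>2"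
  proof -
    have "(sin (h*u/2) / (h*u/2))\<^sup>2 * (u\<^sup>2/2) = (1 - cos (h * u)) / h\<^sup>2" if "h \<noteq> 0" for h
      using cos_double_sin[of "h*u/2"] that False by (simp add: field_simps power2_eq_square)
    then show ?thesis by (auto simp: eventually_at_filter)
  qed
  ultimately have "((\<lambda>h. (1 - cos (h * u)) / h\<^sup>2) \<longlongrightarrow> 1\<^sup>2 * (u\<^sup>2/2)) (at 0)"
    by (rule Lim_transform_eventually)
  then show ?thesis by simp
qed simp

lemma sin_quot_lim: "((\<lambda>h. sin (h * u) / h) \<longlongrightarrow> (u::real)) (at 0)"
proof -
  have "((\<lambda>h. sin (h * u)) has_real_derivative u) (at 0)"
    by (auto intro!: derivative_eq_intros)
  then show ?thesis by (simp add: DERIV_def)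
qed

text \<open>
  Along a sequence \<open>h \<rightarrow> 0\<close>, the expansion at \<open>h e\<close> says that \<open>(1 - cos (h e \<bullet> x)) / h\<^sup>2\<close> has
  \<open>k\<close>-average tending to \<open>A \<bar>e\<bar>\<^sup>2\<close>, while \<open>sin (h e \<bullet> x) / h\<close> has average tending to \<open>0\<close>. The
  pointwise limits are \<open>(e \<bullet> x)\<^sup>2 / 2\<close> and \<open>e \<bullet> x\<close>. Fatou's lemma shows first that the second
  moment is finite; then \<open>1 - cos u \<le> u\<^sup>2 / 2\<close> and \<open>\<bar>sin u\<bar> \<le> \<bar>u\<bar>\<close> allow dominated convergence.
\<close>

theorem fourier_expansion_moments:
  fixes k :: "'a::euclidean_space \<Rightarrow> real"
  assumes k: "integrable lborel k" and k0: "\<And>x. 0 \<le> k x" and k1: "(LINT x|lborel. k x) = 1"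
    and exp: "(\<lambda>\<xi>. fourier k \<xi> - complex_of_real (1 - A * (norm \<xi>)\<^sup>2))
           \<in> o[at 0](\<lambda>\<xi>. complex_of_real ((norm \<xi>)\<^sup>2))"
  shows "integrable lborel (\<lambda>x. (e \<bullet> x)\<^sup>2 * k x)"
    and "(LINT x|lborel. (e \<bullet> x)\<^sup>2 * k x) = 2 * A * (norm e)\<^sup>2"
    and "integrable lborel (\<lambda>x. (e \<bullet> x) * k x)"
    and "(LINT x|lborel. (e \<bullet> x) * k x) = 0"
proof -
  have [measurable]: "k \<in> borel_measurable borel" using k by auto
  define D where "D = (\<lambda>\<xi>. fourier k \<xi> - complex_of_real (1 - A * (norm \<xi>)\<^sup>2))"
  define h where "h = (\<lambda>n::nat. 1 / real (Suc n))"
  have hpos: "h n > 0" for n by (simp add: h_def)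
  have h0: "h \<longlonglongrightarrow> 0" unfolding h_def by (rule LIMSEQ_Suc[OF lim_1_over_n])
  have hat: "filterlim h (at 0) sequentially"
    using h0 hpos by (auto simp: filterlim_at intro!: always_eventually) (metis less_irrefl)
  have Dlim: "((\<lambda>n. D (h n *\<^sub>R e) / complex_of_real ((h n)\<^sup>2)) \<longlonglongrightarrow> 0)"
  proof (cases "e = 0")
    case True
    have "fourier k 0 = 1"
      unfolding complex_eq_iff using fourier_Re_Im[OF k, of 0] k1 by simp
    then show ?thesis using True by (simp add: D_def)
  next
    case False
    have "((\<lambda>\<xi>. D \<xi> / complex_of_real ((norm \<xi>)\<^sup>2)) \<longlongrightarrow> 0) (at 0)"
      using smalloD_tendsto[OF exp] by (simp add: D_def)
    moreover have "filterlim (\<lambda>n. h n *\<^sub>R e) (at 0) sequentially"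
      using hpos[THEN less_imp_neq] False
      by (auto simp: filterlim_at intro!: tendsto_eq_intros h0 always_eventually)
    ultimately have "(\<lambda>n. D (h n *\<^sub>R e) / complex_of_real ((norm (h n *\<^sub>R e))\<^sup>2)) \<longlonglongrightarrow> 0"
      by (rule filterlim_compose)
    then have "(\<lambda>n. complex_of_real ((norm e)\<^sup>2) * (D (h n *\<^sub>R e) / complex_of_real ((norm (h n *\<^sub>R e))\<^sup>2))) \<longlonglongrightarrow> complex_of_real ((norm e)\<^sup>2) * 0"
      by (intro tendsto_intros)
    then show ?thesis using False by (simp add: power_mult_distrib)
  qed
  have Re: "Re (D (h n *\<^sub>R e) / complex_of_real ((h n)\<^sup>2))
      = A * (norm e)\<^sup>2 - (LINT x|lborel. (1 - cos (h n * (e \<bullet> x))) / (h n)\<^sup>2 * k x)" for n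
  proof -
    have "(LINT x|lborel. (1 - cos (h n * (e \<bullet> x))) / (h n)\<^sup>2 * k x)
       = (LINT x|lborel. (k x - cos (x \<bullet> (h n *\<^sub>R e)) * k x) / (h n)\<^sup>2)"
      by (intro Bochner_Integration.integral_cong) (auto simp: algebra_simps inner_commute diff_divide_distrib)
    also have "\<dots> = (1 - Re (fourier k (h n *\<^sub>R e))) / (h n)\<^sup>2"
      using Bochner_Integration.integral_diff[OF k fourier_Re_Im(3)[OF k, of "h n *\<^sub>R e"]]
      by (simp add: fourier_Re_Im(1)[OF k] k1)
    finally show ?thesis using hpos[of n]
      by (simp add: D_def Re_divide_of_real power_mult_distrib field_simps flip: of_real_power)
  qed
  have Im: "Im (D (h n *\<^sub>R e) / complex_of_real ((h n)\<^sup>2)) * h n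
      = - (LINT x|lborel. sin (h n * (e \<bullet> x)) / h n * k x)" for n
  proof -
    have "(LINT x|lborel. sin (h n * (e \<bullet> x)) / h n * k x)
       = (LINT x|lborel. (sin (x \<bullet> (h n *\<^sub>R e)) * k x) / h n)"
      by (intro Bochner_Integration.integral_cong) (auto simp: algebra_simps inner_commute)
    also have "\<dots> = - Im (fourier k (h n *\<^sub>R e)) / h n"
      using fourier_Re_Im[OF k] by simp
    finally show ?thesis using hpos[of n]
      by (simp add: D_def Im_divide_of_real power2_eq_square flip: of_real_power)
  qed
  let ?C = "\<lambda>n x. (1 - cos (h n * (e \<bullet> x))) / (h n)\<^sup>2 * k x"
  let ?S = "\<lambda>n x. sin (h n * (e \<bullet> x)) / h n * k x"
  have Clim: "(\<lambda>n. LINT x|lborel. ?C n x) \<longlonglongrightarrow> A * (norm e)\<^sup>2"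
    using tendsto_diff[OF tendsto_const[of "A * (norm e)\<^sup>2"] tendsto_Re[OF Dlim]] unfolding Re by simp
  have Slim: "(\<lambda>n. LINT x|lborel. ?S n x) \<longlonglongrightarrow> 0"
    using tendsto_minus[OF tendsto_mult[OF tendsto_Im[OF Dlim] h0]] unfolding Im by simp
  have Cpt: "(\<lambda>n. ?C n x) \<longlonglongrightarrow> (e \<bullet> x)\<^sup>2 / 2 * k x" for x
    by (intro tendsto_intros filterlim_compose[OF one_minus_cos_lim hat])
  have Spt: "(\<lambda>n. ?S n x) \<longlonglongrightarrow> (e \<bullet> x) * k x" for x
    by (intro tendsto_intros filterlim_compose[OF sin_quot_lim hat])
  have Cpos: "0 \<le> ?C n x" for n x using k0 by simp
  have Cint: "integrable lborel (?C n)" for n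
    by (rule Bochner_Integration.integrable_bound[of _ "\<lambda>x. 2 / (h n)\<^sup>2 * k x"])
       (use k k0 in \<open>auto simp: abs_mult intro!: mult_right_mono divide_right_mono\<close>)
  have Cle: "?C n x \<le> (e \<bullet> x)\<^sup>2 / 2 * k x" for n x
    using one_minus_cos_le[of "h n * (e \<bullet> x)"] hpos[of n] k0[of x]
    by (intro mult_right_mono) (auto simp: field_simps power_mult_distrib)
  have "(\<integral>\<^sup>+x. ennreal ((e \<bullet> x)\<^sup>2 / 2 * k x) \<partial>lborel)
      = (\<integral>\<^sup>+x. liminf (\<lambda>n. ennreal (?C n x)) \<partial>lborel)"
  proof (intro nn_integral_cong)
    fix x
    have "(\<lambda>n. ennreal (?C n x)) \<longlonglongrightarrow> ennreal ((e \<bullet> x)\<^sup>2 / 2 * k x)"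
      using Cpt by (intro tendsto_ennrealI)
    then show "ennreal ((e \<bullet> x)\<^sup>2 / 2 * k x) = liminf (\<lambda>n. ennreal (?C n x))"
      by (simp add: lim_imp_Liminf)
  qed
  also have "\<dots> \<le> liminf (\<lambda>n. \<integral>\<^sup>+x. ennreal (?C n x) \<partial>lborel)"
    by (intro nn_integral_liminf) measurable
  also have "\<dots> = liminf (\<lambda>n. ennreal (LINT x|lborel. ?C n x))"
    using Cint Cpos by (simp add: nn_integral_eq_integral)
  also have "\<dots> = ennreal (A * (norm e)\<^sup>2)"
    using tendsto_ennrealI[OF Clim] by (simp add: lim_imp_Liminf)
  also have "\<dots> < \<infinity>" by simp
  finally have I2: "integrable lborel (\<lambda>x. (e \<bullet> x)\<^sup>2 / 2 * k x)"
    by (intro integrableI_nonneg) (auto simp: k0)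
  have "(\<lambda>n. LINT x|lborel. ?C n x) \<longlonglongrightarrow> (LINT x|lborel. (e \<bullet> x)\<^sup>2 / 2 * k x)"
  proof (rule integral_dominated_convergence[OF _ _ I2])
    show "AE x in lborel. norm (?C n x) \<le> (e \<bullet> x)\<^sup>2 / 2 * k x" for n
      unfolding real_norm_def abs_of_nonneg[OF Cpos] using Cle by (intro always_eventually allI)
  qed (use Cpt in auto)
  then have "(LINT x|lborel. (e \<bullet> x)\<^sup>2 / 2 * k x) = A * (norm e)\<^sup>2"
    using Clim LIMSEQ_unique by blast
  then show I2': "integrable lborel (\<lambda>x. (e \<bullet> x)\<^sup>2 * k x)"
     and "(LINT x|lborel. (e \<bullet> x)\<^sup>2 * k x) = 2 * A * (norm e)\<^sup>2"
    using Bochner_Integration.integrable_mult_right[OF I2, of 2] by simp_all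
  have I1': "integrable lborel (\<lambda>x. \<bar>e \<bullet> x\<bar> * k x)"
  proof (rule Bochner_Integration.integrable_bound)
    show "integrable lborel (\<lambda>x. k x + (e \<bullet> x)\<^sup>2 * k x)" using k I2' by auto
    have "\<bar>u\<bar> \<le> 1 + u\<^sup>2" for u :: real
      using zero_le_power2[of "\<bar>u\<bar> - 1"] zero_le_power2[of u] by (simp add: power2_eq_square algebra_simps)
    then have "\<bar>e \<bullet> x\<bar> * k x \<le> (1 + (e \<bullet> x)\<^sup>2) * k x" for x by (intro mult_right_mono k0)
    then show "AE x in lborel. norm (\<bar>e \<bullet> x\<bar> * k x) \<le> norm (k x + (e \<bullet> x)\<^sup>2 * k x)"
      using k0 by (auto simp: abs_mult distrib_right)
  qed measurable
  then show "integrable lborel (\<lambda>x. (e \<bullet> x) * k x)"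
    by (rule Bochner_Integration.integrable_bound) (auto simp: abs_mult k0)
  have "(\<lambda>n. LINT x|lborel. ?S n x) \<longlonglongrightarrow> (LINT x|lborel. (e \<bullet> x) * k x)"
  proof (rule integral_dominated_convergence[OF _ _ I1'])
    have "\<bar>sin (h n * (e \<bullet> x)) / h n\<bar> \<le> \<bar>e \<bullet> x\<bar>" for n x
      using abs_sin_x_le_abs_x[of "h n * (e \<bullet> x)"] hpos[of n] by (simp add: abs_mult field_simps)
    then have "\<bar>sin (h n * (e \<bullet> x)) / h n\<bar> * k x \<le> \<bar>e \<bullet> x\<bar> * k x" for n x by (intro mult_right_mono k0)
    then show "AE x in lborel. norm (?S n x) \<le> \<bar>e \<bullet> x\<bar> * k x" for n
      unfolding real_norm_def abs_mult[of _ "k _"] abs_of_nonneg[OF k0] by (intro AE_I2)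
  qed (use Spt in auto)
  then show "(LINT x|lborel. (e \<bullet> x) * k x) = 0"
    using Slim LIMSEQ_unique by blast
qed

section \<open>Almost Lipschitz continuity from averaging\<close>

text \<open>
  A sequence whose second differences are at least \<open>-D\<close> lies, between \<open>0\<close> and \<open>J\<close>, below the
  parabola with second difference \<open>-D\<close> that takes the values \<open>0\<close> and \<open>B\<close> there. Beyond \<open>J\<close> the
  bound \<open>B\<close> is stronger than the claim.
\<close>

lemma discrete_subsolution_bound:
  fixes S :: "nat \<Rightarrow> real"
  assumes S0: "S 0 = 0" and B: "\<And>j. S j \<le> B" and B0: "0 \<le> B" and D0: "0 \<le> D"
    and conv: "\<And>j. 2 * S (Suc j) \<le> S j + S (Suc (Suc j)) + D"
    and J: "0 < J"
  shows "S j \<le> real j * (B / real J + D * real J / 2)"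
proof (cases "j \<le> J")
  case False
  then have "1 * B \<le> real j * (B / real J)"
    using B0 J by (simp add: field_simps mult_left_mono)
  then have "B \<le> real j * (B / real J)" by simp
  then show ?thesis using B[of j] B0 D0 by (simp add: algebra_simps add_increasing2)
next
  case True
  define c d where "c = B / real J" and "d = D / 2"
  \<comment> \<open>The sequence minus the parabola is convex, vanishes at \<open>0\<close> and is nonpositive at \<open>J\<close>.\<close>
  define U where "U j = S j - real j * c - d * real j * (real J - real j)" for j
  have D: "D = 2 * d" by (simp add: d_def)
  have U0: "U 0 = 0" and UJ: "U J \<le> 0"
    using S0 B[of J] J by (auto simp: U_def c_def)
  have inc: "U (Suc j) - U j \<le> U (Suc (Suc j)) - U (Suc j)" for j
    using conv[of j, unfolded D] by (simp add: U_def algebra_simps)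
  have incs: "U (Suc i) - U i \<le> U (Suc l) - U l" if "i \<le> l" for i l
    using that by (induction rule: dec_induct) (use inc in \<open>auto intro: order_trans\<close>)
  have "U j \<le> 0"
  proof (rule ccontr)
    assume pos: "\<not> U j \<le> 0"
    have "\<exists>i<j. 0 < U (Suc i) - U i"
    proof (rule ccontr)
      assume "\<not> ?thesis"
      then have "U (Suc i) \<le> U i" if "i < j" for i using that by force
      then have "U i \<le> U 0" if "i \<le> j" for i
        using that by (induction i) (auto simp: Suc_le_eq intro: order_trans)
      then show False using pos U0 by force
    qed
    then obtain i where i: "i < j" "0 < U (Suc i) - U i" by blast
    have mono: "U l \<le> U (Suc l)" if "i \<le> l" for l using incs[OF that] i(2) by linarith
    have "U j \<le> U J"
      using True
    proof (induction rule: dec_induct)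
      case (step l)
      then show ?case using mono[of l] i(1) by linarith
    qed simp
    then show False using pos UJ by linarith
  qed
  then have "S j \<le> real j * (B / real J) + D / 2 * real j * (real J - real j)" by (simp add: U_def c_def d_def)
  also have "D / 2 * real j * (real J - real j) \<le> D / 2 * real j * real J"
    using D0 by (intro mult_left_mono) auto
  finally show ?thesis by (simp add: algebra_simps)
qed

text \<open>
  Split \<open>k = \<beta> + \<beta>(\<cdot> - e) + q\<close> with \<open>\<beta> = b\<close> on the ball of radius \<open>r\<close>, which the lower bound on
  \<open>k\<close> permits for \<open>\<bar>e\<bar> \<le> r\<close>. Let \<open>S j\<close> be the supremum of \<open>W (z + j \<epsilon> e) - W z\<close>. To compare the
  averages at \<open>z + j \<epsilon> e\<close> and \<open>z\<close>, pair the first portion at each point with the second portion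
  at the other, so that these are \<open>j + 1\<close> and \<open>j - 1\<close> steps apart, and the rest with the rest.
  With \<open>a\<close> the mass of \<open>\<beta>\<close> this reads
  \<open>S j \<le> a S (j + 1) + a S (j - 1) + (1 - 2 a) S j + 2 D \<epsilon>\<^sup>2\<close>, and \<open>discrete_subsolution_bound\<close>
  with \<open>J \<approx> 1 / \<epsilon>\<close> gives \<open>S j = O(j \<epsilon>)\<close>.

  The function \<open>W\<close> is distinguished from its measurable version \<open>w\<close> since the estimate must
  hold for the values of \<open>W\<close> at all points outside \<open>N\<close>, and not only almost everywhere.
\<close>

theorem almost_lipschitz_of_averaging:
  fixes k :: "'a::euclidean_space \<Rightarrow> real"
  assumes k[measurable]: "k \<in> borel_measurable borel" and kint: "integrable lborel k" and k1: "(LINT x|lborel. k x) = 1"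
    and b0: "0 < b" and r0: "0 < r" and kb: "\<And>y. 0 \<le> k y" "\<And>y. norm y < 2 * r \<Longrightarrow> 2 * b \<le> k y"
    and \<epsilon>: "0 < \<epsilon>" "\<epsilon> \<le> 1" and D0: "0 \<le> D" and B0: "0 \<le> B"
    and w[measurable]: "w \<in> borel_measurable borel" and wB: "\<And>x. 0 \<le> w x" "\<And>x. w x \<le> B"
    and AEeq: "AE x in lborel. x \<notin> N \<and> W x = w x"
    and WB: "\<And>x. x \<notin> N \<Longrightarrow> 0 \<le> W x" "\<And>x. x \<notin> N \<Longrightarrow> W x \<le> B"
    and avg: "\<And>x. x \<notin> N \<Longrightarrow> \<bar>(LINT y|lborel. k y * w (x - \<epsilon> *\<^sub>R y)) - W x\<bar> \<le> D * \<epsilon>\<^sup>2"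
    and xN: "x \<notin> N" "x' \<notin> N"
  shows "W x' - W x \<le> (norm (x' - x) / r + \<epsilon>) * (B + 2 * D / (b * measure lborel (ball (0::'a) r)))"
proof (cases "x' = x")
  case True
  then show ?thesis using \<epsilon> D0 B0 b0 by simp
next
  case False
  define h where "h = x' - x"
  have hpos: "norm h > 0" using False by (simp add: h_def)
  \<comment> \<open>The displacement is \<open>j0\<close> steps of size \<open>\<epsilon> e\<close>; rounding up ensures \<open>\<bar>e\<bar> \<le> r\<close> and costs
    at most one step, which is the term \<open>\<epsilon>\<close> in the bound.\<close>
  define J where "J = nat \<lceil>1 / \<epsilon>\<rceil>"
  define j0 where "j0 = nat \<lceil>norm h / (\<epsilon> * r)\<rceil>"
  define e where "e = h /\<^sub>R (real j0 * \<epsilon>)"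
  have q: "norm h / (\<epsilon> * r) > 0" using hpos \<epsilon> r0 by simp
  then have j0pos: "real j0 > 0" unfolding j0_def by simp
  have j0l: "norm h / (\<epsilon> * r) \<le> real j0" and j0u: "real j0 \<le> norm h / (\<epsilon> * r) + 1"
    using q unfolding j0_def by linarith+
  have he: "h = (real j0 * \<epsilon>) *\<^sub>R e" using j0pos \<epsilon> by (simp add: e_def field_simps)
  have er: "norm e \<le> r"
    using j0l j0pos \<epsilon> r0 by (simp add: e_def field_simps)
  define a where "a = b * measure lborel (ball (0::'a) r)"
  have mpos: "measure lborel (ball (0::'a) r) > 0"
    using content_ball_pos[OF r0, of "0::'a"] by (simp add: measure_completion)
  then have apos: "a > 0" using b0 by (simp add: a_def)
  define \<beta> where "\<beta> y = b * indicator (ball (0::'a) r) y" for y :: 'a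
  have \<beta>m[measurable]: "\<beta> \<in> borel_measurable borel" 
    unfolding \<beta>_def by (intro borel_measurable_times borel_measurable_indicator) auto
  have \<beta>int: "integrable lborel \<beta>" 
    unfolding \<beta>_def by (intro integrable_mult_right integrable_real_indicator)
      (use emeasure_lborel_ball_finite[of "0::'a" r] in auto)
  have \<beta>a: "(LINT y|lborel. \<beta> y) = a" by (simp add: \<beta>_def a_def)
  have \<beta>0: "0 \<le> \<beta> y" for y using b0 by (simp add: \<beta>_def)
  define \<beta>' where "\<beta>' y = \<beta> (y - e)" for y
  have \<beta>'m[measurable]: "\<beta>' \<in> borel_measurable borel" unfolding \<beta>'_def by measurable
  have \<beta>'int: "integrable lborel \<beta>'"
    using integrable_lborel_affine[OF \<beta>int, of 1 "-e"] by (simp add: \<beta>'_def[abs_def])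
  have \<beta>'a: "(LINT y|lborel. \<beta>' y) = a" 
    unfolding \<beta>'_def using integral_lborel_shift(2)[OF \<beta>m, of e] \<beta>a by simp
  define q where "q y = k y - \<beta> y - \<beta>' y" for y
  have qm[measurable]: "q \<in> borel_measurable borel" unfolding q_def by measurable
  have qint: "integrable lborel q" unfolding q_def using kint \<beta>int \<beta>'int by auto
  have qa: "(LINT y|lborel. q y) = 1 - 2 * a"
    unfolding q_def using kint \<beta>int \<beta>'int k1 \<beta>a \<beta>'a by (simp add: Bochner_Integration.integral_diff)
  have q0: "0 \<le> q y" for y
  proof (cases "norm y < 2 * r")
    case True
    have "\<beta> y \<le> b" "\<beta>' y \<le> b" using b0 by (auto simp: \<beta>_def \<beta>'_def indicator_def)
    then show ?thesis using kb(2)[OF True] by (simp add: q_def)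
  next
    case False
    then have "\<not> norm y < r" using r0 by simp
    moreover have "\<not> norm (y - e) < r" using False er norm_triangle_sub[of y e] by linarith
    ultimately have "\<beta> y = 0" "\<beta>' y = 0" by (auto simp: \<beta>_def \<beta>'_def indicator_def dist_norm norm_minus_commute)
    then show ?thesis using kb(1)[of y] by (simp add: q_def)
  qed
  have abs_w: "\<bar>w x\<bar> \<le> B" for x using wB[of x] B0 by linarith
  have conv_int: "integrable lborel (\<lambda>y. \<kappa> y * w (z - \<epsilon> *\<^sub>R y))" if "integrable lborel \<kappa>" for \<kappa> :: "'a \<Rightarrow> real" and z
    using that by (rule integrable_mult_bounded) (use abs_w in auto)
  define P where "P z = (LINT y|lborel. \<beta> y * w (z - \<epsilon> *\<^sub>R y))" for z
  define R where "R z = (LINT y|lborel. q y * w (z - \<epsilon> *\<^sub>R y))" for z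
  have K: "(LINT y|lborel. k y * w (z - \<epsilon> *\<^sub>R y)) = P z + P (z - \<epsilon> *\<^sub>R e) + R z" for z
  proof -
    have "(LINT y|lborel. k y * w (z - \<epsilon> *\<^sub>R y)) = 
      (LINT y|lborel. \<beta> y * w (z - \<epsilon> *\<^sub>R y) + \<beta>' y * w (z - \<epsilon> *\<^sub>R y) + q y * w (z - \<epsilon> *\<^sub>R y))"
      by (intro Bochner_Integration.integral_cong) (auto simp: q_def algebra_simps)
    also have "\<dots> = P z + (LINT y|lborel. \<beta>' y * w (z - \<epsilon> *\<^sub>R y)) + R z"
      by (simp add: P_def R_def conv_int \<beta>int \<beta>'int qint)
    also have "(LINT y|lborel. \<beta>' y * w (z - \<epsilon> *\<^sub>R y)) = (LINT y|lborel. \<beta>' (y + e) * w (z - \<epsilon> *\<^sub>R (y + e)))"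
      by (rule integral_lborel_shift(1)[symmetric]) measurable
    also have "\<dots> = P (z - \<epsilon> *\<^sub>R e)" by (simp add: P_def \<beta>'_def algebra_simps)
    finally show ?thesis .
  qed
  \<comment> \<open>Base points at which both values of \<open>W\<close> are controlled.\<close>
  define X where "X j = {z. z \<notin> N \<and> z + (real j * \<epsilon>) *\<^sub>R e \<notin> N}" for j :: nat
  define S where "S j = (SUP z\<in>X j. W (z + (real j * \<epsilon>) *\<^sub>R e) - W z)" for j :: nat
  have Xne: "X j \<noteq> {}" for j
  proof -
    have "AE z in lborel. z \<notin> N" using AEeq by eventually_elim auto
    then have "AE z in lborel. z \<notin> N \<and> z + (real j * \<epsilon>) *\<^sub>R e \<notin> N"
      using AE_lborel_shift(1)[of "\<lambda>z. z \<notin> N" "(real j * \<epsilon>) *\<^sub>R e"] by auto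
    then have "\<exists>z. z \<notin> N \<and> z + (real j * \<epsilon>) *\<^sub>R e \<notin> N"
      by (rule AE_lborel_ex)
    then show ?thesis by (auto simp: X_def)
  qed
  have Sbdd: "bdd_above ((\<lambda>z. W (z + (real j * \<epsilon>) *\<^sub>R e) - W z) ` X j)" for j
  proof (rule bdd_aboveI2[of _ _ B])
    fix z assume "z \<in> X j"
    then show "W (z + (real j * \<epsilon>) *\<^sub>R e) - W z \<le> B"
      using WB(2)[of "z + (real j * \<epsilon>) *\<^sub>R e"] WB(1)[of z] by (simp add: X_def)
  qed
  have Sge: "W (z + (real j * \<epsilon>) *\<^sub>R e) - W z \<le> S j" if "z \<notin> N" "z + (real j * \<epsilon>) *\<^sub>R e \<notin> N" for z j
    unfolding S_def using that by (intro cSUP_upper Sbdd) (auto simp: X_def)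
  have Sle: "S j \<le> c" if "\<And>z. z \<notin> N \<Longrightarrow> z + (real j * \<epsilon>) *\<^sub>R e \<notin> N \<Longrightarrow> W (z + (real j * \<epsilon>) *\<^sub>R e) - W z \<le> c" for j c
    unfolding S_def by (rule cSUP_least[OF Xne]) (use that in \<open>auto simp: X_def\<close>)
  have SB: "S j \<le> B" for j
  proof (rule Sle)
    fix z assume "z \<notin> N" "z + (real j * \<epsilon>) *\<^sub>R e \<notin> N"
    then show "W (z + (real j * \<epsilon>) *\<^sub>R e) - W z \<le> B"
      using WB(2)[of "z + (real j * \<epsilon>) *\<^sub>R e"] WB(1)[of z] by simp
  qed
  have S0: "S 0 = 0"
    unfolding S_def using Xne[of 0] by simp
  have diff: "(LINT y|lborel. \<kappa> y * w (z + (real j * \<epsilon>) *\<^sub>R e - \<epsilon> *\<^sub>R y)) - (LINT y|lborel. \<kappa> y * w (z - \<epsilon> *\<^sub>R y))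
     \<le> (LINT y|lborel. \<kappa> y) * S j" 
    if \<kappa>: "integrable lborel \<kappa>" "\<And>y. 0 \<le> \<kappa> y" for \<kappa> :: "'a \<Rightarrow> real" and z j
  proof -
    let ?h = "(real j * \<epsilon>) *\<^sub>R e"
    have "(LINT y|lborel. \<kappa> y * w (z + ?h - \<epsilon> *\<^sub>R y)) - (LINT y|lborel. \<kappa> y * w (z - \<epsilon> *\<^sub>R y))
       = (LINT y|lborel. \<kappa> y * w (z + ?h - \<epsilon> *\<^sub>R y) - \<kappa> y * w (z - \<epsilon> *\<^sub>R y))"
      by (rule Bochner_Integration.integral_diff[symmetric]) (rule conv_int[OF \<kappa>(1)])+
    also have "\<dots> \<le> (LINT y|lborel. \<kappa> y * S j)"
    proof (rule integral_mono_AE)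
      show "integrable lborel (\<lambda>y. \<kappa> y * w (z + ?h - \<epsilon> *\<^sub>R y) - \<kappa> y * w (z - \<epsilon> *\<^sub>R y))"
        by (rule Bochner_Integration.integrable_diff) (rule conv_int[OF \<kappa>(1)])+
      show "integrable lborel (\<lambda>y. \<kappa> y * S j)" using \<kappa> by auto
      have "AE y in lborel. z + (-\<epsilon>) *\<^sub>R y \<notin> N \<and> W (z + (-\<epsilon>) *\<^sub>R y) = w (z + (-\<epsilon>) *\<^sub>R y)"
        using AE_lborel_affine[OF AEeq, of "-\<epsilon>" z] \<epsilon> by simp
      moreover have "AE y in lborel. (z + ?h) + (-\<epsilon>) *\<^sub>R y \<notin> N \<and> W ((z + ?h) + (-\<epsilon>) *\<^sub>R y) = w ((z + ?h) + (-\<epsilon>) *\<^sub>R y)"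
        using AE_lborel_affine[OF AEeq, of "-\<epsilon>" "z + ?h"] \<epsilon> by simp
      ultimately show "AE y in lborel. \<kappa> y * w (z + ?h - \<epsilon> *\<^sub>R y) - \<kappa> y * w (z - \<epsilon> *\<^sub>R y) \<le> \<kappa> y * S j"
      proof eventually_elim
        case (elim y)
        have eq: "z + (-\<epsilon>) *\<^sub>R y = z - \<epsilon> *\<^sub>R y" "(z + ?h) + (-\<epsilon>) *\<^sub>R y = z - \<epsilon> *\<^sub>R y + ?h" "z + ?h - \<epsilon> *\<^sub>R y = z - \<epsilon> *\<^sub>R y + ?h"
          by simp_all
        have "w (z - \<epsilon> *\<^sub>R y + ?h) - w (z - \<epsilon> *\<^sub>R y) \<le> S j"
          using elim Sge[of "z - \<epsilon> *\<^sub>R y" j] unfolding eq by auto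
        then have "\<kappa> y * (w (z + ?h - \<epsilon> *\<^sub>R y) - w (z - \<epsilon> *\<^sub>R y)) \<le> \<kappa> y * S j"
          unfolding eq by (intro mult_left_mono \<kappa>)
        then show ?case by (simp add: right_diff_distrib)
      qed
    qed
    finally show ?thesis by simp
  qed
  have step: "2 * S (Suc j) \<le> S j + S (Suc (Suc j)) + 2 * D * \<epsilon>\<^sup>2 / a" for j
  proof -
    have "S (Suc j) \<le> a * S (Suc (Suc j)) + a * S j + (1 - 2 * a) * S (Suc j) + 2 * D * \<epsilon>\<^sup>2"
    proof (rule Sle)
      fix z let ?h = "(real (Suc j) * \<epsilon>) *\<^sub>R e"
      assume z: "z \<notin> N" "z + ?h \<notin> N"
      have "W (z + ?h) - W z \<le> (P (z + ?h) + P (z + ?h - \<epsilon> *\<^sub>R e) + R (z + ?h)) - (P z + P (z - \<epsilon> *\<^sub>R e) + R z) + 2 * D * \<epsilon>\<^sup>2"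
        using avg[OF z(1)] avg[OF z(2)] unfolding K by (auto simp: abs_le_iff)
      \<comment> \<open>The crossed pairing of the two equal portions.\<close>
      also have "\<dots> = (P (z + ?h) - P (z - \<epsilon> *\<^sub>R e)) + (P (z + ?h - \<epsilon> *\<^sub>R e) - P z) + (R (z + ?h) - R z) + 2 * D * \<epsilon>\<^sup>2" by simp
      also have "P (z + ?h) - P (z - \<epsilon> *\<^sub>R e) \<le> a * S (Suc (Suc j))"
      proof -
        have eq: "z - \<epsilon> *\<^sub>R e + (real (Suc (Suc j)) * \<epsilon>) *\<^sub>R e = z + ?h"
        proof -
          have "real (Suc (Suc j)) * \<epsilon> = \<epsilon> + real (Suc j) * \<epsilon>" by (simp add: distrib_right)
          then show ?thesis by (simp only: scaleR_left_distrib) simp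
        qed
        then show ?thesis
          using diff[OF \<beta>int \<beta>0, of "z - \<epsilon> *\<^sub>R e" "Suc (Suc j)"] unfolding P_def[symmetric] \<beta>a eq by simp
      qed
      also have "P (z + ?h - \<epsilon> *\<^sub>R e) - P z \<le> a * S j"
        using diff[OF \<beta>int \<beta>0, of z j] unfolding \<beta>a by (simp add: algebra_simps P_def)
      also have "R (z + ?h) - R z \<le> (1 - 2 * a) * S (Suc j)"
        using diff[OF qint q0, of z "Suc j"] unfolding qa by (simp add: R_def)
      finally show "W (z + ?h) - W z \<le> a * S (Suc (Suc j)) + a * S j + (1 - 2 * a) * S (Suc j) + 2 * D * \<epsilon>\<^sup>2" by simp
    qed
    then show ?thesis using apos by (simp add: field_simps)
  qed
  have "1 / \<epsilon> > 0" using \<epsilon> by simp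
  then have Jl: "1 / \<epsilon> \<le> real J" and Ju: "real J \<le> 1 / \<epsilon> + 1" and Jpos: "0 < J"
    unfolding J_def by linarith+
  have "x' = x + (real j0 * \<epsilon>) *\<^sub>R e" using he by (simp add: h_def algebra_simps)
  then have "W x' - W x \<le> S j0" using Sge[of x j0] xN by simp
  also have "\<dots> \<le> real j0 * (B / real J + (2 * D * \<epsilon>\<^sup>2 / a) * real J / 2)"
    using S0 SB B0 D0 apos step Jpos by (intro discrete_subsolution_bound) auto
  also have "\<dots> \<le> real j0 * (\<epsilon> * B + \<epsilon> * (2 * D / a))"
  proof (intro mult_left_mono add_mono)
    have "1 \<le> \<epsilon> * real J" using Jl \<epsilon> by (simp add: field_simps)
    then have "B * 1 \<le> B * (\<epsilon> * real J)" using B0 by (intro mult_left_mono) auto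
    then show "B / real J \<le> \<epsilon> * B" using Jpos by (simp add: field_simps)
    have "\<epsilon> * real J \<le> 2" using Ju \<epsilon> mult_left_mono[OF Ju, of \<epsilon>] by (simp add: algebra_simps)
    then have "(\<epsilon> * D / a) * (\<epsilon> * real J) \<le> (\<epsilon> * D / a) * 2"
      using \<epsilon> D0 apos by (intro mult_left_mono) auto
    then show "2 * D * \<epsilon>\<^sup>2 / a * real J / 2 \<le> \<epsilon> * (2 * D / a)" by (simp add: power2_eq_square algebra_simps)
  qed auto
  also have "\<dots> = (real j0 * \<epsilon>) * (B + 2 * D / a)" by (simp add: algebra_simps)
  also have "\<dots> \<le> (norm h / r + \<epsilon>) * (B + 2 * D / a)"
  proof (intro mult_right_mono)
    have "real j0 * \<epsilon> \<le> (norm h / (\<epsilon> * r) + 1) * \<epsilon>" using \<epsilon> by (intro mult_right_mono j0u) auto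
    also have "\<dots> = norm h / r + \<epsilon>" using \<epsilon> r0 by (simp add: distrib_right)
    finally show "real j0 * \<epsilon> \<le> norm h / r + \<epsilon>" .
  qed (use B0 D0 apos in auto)
  finally show ?thesis by (simp add: a_def h_def)
qed

section \<open>Scalar relaxation equations\<close>

lemma last_exit:
  fixes u :: "real \<Rightarrow> real"
  assumes cont: "continuous_on {s..t} u" and st: "s \<le> t" and us: "u s \<le> m"
  obtains \<sigma> where "s \<le> \<sigma>" "\<sigma> \<le> t" "u \<sigma> \<le> m" "\<And>r. \<sigma> < r \<Longrightarrow> r \<le> t \<Longrightarrow> m < u r"
proof -
  let ?X = "{r \<in> {s..t}. u r \<le> m}"
  have "closedin (top_of_set {s..t}) ({s..t} \<inter> u -` {..m})"
    by (rule continuous_closedin_preimage[OF cont]) simp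
  then have "compact ({s..t} \<inter> u -` {..m})"
    by (rule closedin_compact[OF compact_Icc])
  also have "{s..t} \<inter> u -` {..m} = ?X" by auto
  finally have "compact ?X" .
  moreover have "?X \<noteq> {}" using us st by auto
  ultimately obtain \<sigma> where \<sigma>: "\<sigma> \<in> ?X" "\<And>r. r \<in> ?X \<Longrightarrow> r \<le> \<sigma>" using compact_attains_sup[of ?X] by blast
  have "m < u r" if "\<sigma> < r" "r \<le> t" for r
    using \<sigma>(1) \<sigma>(2)[of r] that by force
  then show ?thesis using \<sigma>(1) by (intro that[of \<sigma>]) auto
qed

text \<open>
  For fixed \<open>x\<close>, the nonlocal equation is \<open>u' = c (a - u\<^sup>+)\<close> where \<open>a\<close> is the average of the
  positive part. Where \<open>u\<close> is negative it is nondecreasing, which gives the first two claims.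
  The third is one step of a contraction: after the last time at which \<open>u \<le> M\<close> the derivative is
  at most \<open>c E\<close>, so on an interval of length at most \<open>1 / (2 c)\<close> the excess over \<open>M\<close> is at most
  half of the excess of the average.
\<close>

lemma relaxation_ode:
  fixes u a :: "real \<Rightarrow> real"
  assumes cont: "continuous_on {0..} u" and c: "0 < c" and a0: "\<And>t. 0 < t \<Longrightarrow> 0 \<le> a t"
    and der: "\<And>t. 0 < t \<Longrightarrow> (u has_real_derivative c * (a t - max (u t) 0)) (at t)"
  shows "0 \<le> s \<Longrightarrow> s \<le> t \<Longrightarrow> u t < 0 \<Longrightarrow> u s < 0"
    and "0 \<le> t \<Longrightarrow> u t < 0 \<Longrightarrow> u 0 \<le> u t"
    and "0 \<le> s \<Longrightarrow> s \<le> t \<Longrightarrow> c * (t - s) \<le> 1/2 \<Longrightarrow> 0 \<le> M \<Longrightarrow> 0 \<le> E \<Longrightarrow> u s \<le> M \<Longrightarrow>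
       (\<And>r. s < r \<Longrightarrow> r < t \<Longrightarrow> a r \<le> M + E) \<Longrightarrow> u t \<le> M + E / 2"
proof -
  have mv: "\<exists>\<xi>. \<sigma> < \<xi> \<and> \<xi> < t \<and> u t - u \<sigma> = (t - \<sigma>) * (c * (a \<xi> - max (u \<xi>) 0))" if "0 \<le> \<sigma>" "\<sigma> < t" for \<sigma> t
  proof -
    have "\<exists>\<xi>. \<sigma> < \<xi> \<and> \<xi> < t \<and> u t - u \<sigma> = (\<lambda>h. c * (a \<xi> - max (u \<xi>) 0) * h) (t - \<sigma>)"
    proof (rule mvt[OF that(2)])
      show "continuous_on {\<sigma>..t} u" using that by (intro continuous_on_subset[OF cont]) auto
      show "(u has_derivative (\<lambda>h. c * (a \<xi> - max (u \<xi>) 0) * h)) (at \<xi>)" if "\<sigma> < \<xi>" "\<xi> < t" for \<xi>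
        using der[of \<xi>] that \<open>0 \<le> \<sigma>\<close> unfolding has_field_derivative_def by auto
    qed blast
    then show ?thesis by (auto simp: mult.commute)
  qed
  have cont': "continuous_on {s..t} u" if "0 \<le> s" for s t
    using that by (intro continuous_on_subset[OF cont]) auto
  show 1: "u s < 0" if st: "0 \<le> s" "s \<le> t" and neg: "u t < 0" for s t
  proof (rule ccontr)
    assume us: "\<not> u s < 0"
    obtain \<sigma> where \<sigma>: "s \<le> \<sigma>" "\<sigma> \<le> t" "- u \<sigma> \<le> 0" "\<And>r. \<sigma> < r \<Longrightarrow> r \<le> t \<Longrightarrow> 0 < - u r"
      using last_exit[OF continuous_on_minus[OF cont'[OF st(1), of t]] st(2), of 0] us by auto
    have "\<sigma> < t" using \<sigma> neg by (cases "\<sigma> = t") auto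
    then obtain \<xi> where \<xi>: "\<sigma> < \<xi>" "\<xi> < t" "u t - u \<sigma> = (t - \<sigma>) * (c * (a \<xi> - max (u \<xi>) 0))"
      using mv[of \<sigma> t] \<sigma> st by auto
    have "max (u \<xi>) 0 = 0" using \<sigma>(4)[of \<xi>] \<xi> by auto
    then have "0 \<le> u t - u \<sigma>" unfolding \<xi>(3) using \<xi> \<sigma> st c a0[of \<xi>] by simp
    then show False using \<sigma> neg by linarith
  qed
  show "u 0 \<le> u t" if "0 \<le> t" "u t < 0" for t
  proof (cases "t = 0")
    case False
    then have "0 < t" using that by simp
    then obtain \<xi> where \<xi>: "0 < \<xi>" "\<xi> < t" "u t - u 0 = t * (c * (a \<xi> - max (u \<xi>) 0))"
      using mv[of 0 t] by auto
    have "u \<xi> < 0" using 1[of \<xi> t] \<xi> that by auto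
    then have "0 \<le> u t - u 0" unfolding \<xi>(3) using \<xi> c a0[of \<xi>] that by simp
    then show ?thesis by simp
  qed simp
  show "u t \<le> M + E / 2" if st: "0 \<le> s" "s \<le> t" and small: "c * (t - s) \<le> 1/2" and M: "0 \<le> M" "0 \<le> E"
     and us: "u s \<le> M" and aM: "\<And>r. s < r \<Longrightarrow> r < t \<Longrightarrow> a r \<le> M + E" for s t M E
  proof -
    obtain \<sigma> where \<sigma>: "s \<le> \<sigma>" "\<sigma> \<le> t" "u \<sigma> \<le> M" "\<And>r. \<sigma> < r \<Longrightarrow> r \<le> t \<Longrightarrow> M < u r"
      using last_exit[OF cont'[OF st(1), of t] st(2) us] by blast
    show ?thesis
    proof (cases "\<sigma> = t")
      case True
      then show ?thesis using \<sigma> M by simp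
    next
      case False
      then obtain \<xi> where \<xi>: "\<sigma> < \<xi>" "\<xi> < t" "u t - u \<sigma> = (t - \<sigma>) * (c * (a \<xi> - max (u \<xi>) 0))"
        using mv[of \<sigma> t] \<sigma> st by auto
      have "a \<xi> - max (u \<xi>) 0 \<le> E" using aM[of \<xi>] \<sigma>(1) \<sigma>(4)[of \<xi>] \<xi> by auto
      then have "u t - u \<sigma> \<le> (t - \<sigma>) * (c * E)"
        unfolding \<xi>(3) using \<xi> c by (intro mult_left_mono) auto
      also have "\<dots> \<le> (t - s) * (c * E)" using \<sigma> c M by (intro mult_right_mono) auto
      also have "\<dots> = (c * (t - s)) * E" by simp
      also have "\<dots> \<le> (1/2) * E" using small M by (intro mult_right_mono) auto
      finally show ?thesis using \<sigma>(3) by simp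
    qed
  qed
qed

section \<open>The nonlocal problem as an obstacle problem\<close>

lemma convolution_change_of_variables:
  fixes k :: "'a::euclidean_space \<Rightarrow> real"
  assumes [measurable]: "k \<in> borel_measurable borel" "f \<in> borel_measurable lebesgue" "F \<in> borel_measurable borel"
    and ae: "AE y in lebesgue. f y = F y" and \<epsilon>: "0 < \<epsilon>"
  shows "(LINT y|lebesgue. rescale \<epsilon> k (x - y) * f y) = (LINT y|lborel. k y * F (x - \<epsilon> *\<^sub>R y))"
proof -
  have r[measurable]: "(\<lambda>y. rescale \<epsilon> k (x - y)) \<in> borel_measurable borel"
    unfolding rescale_def by measurable
  have [measurable]: "(\<lambda>y. rescale \<epsilon> k (x - y)) \<in> borel_measurable lebesgue" "F \<in> borel_measurable lebesgue"
    using r assms(3) by (auto intro: measurable_completion)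
  have "(LINT y|lebesgue. rescale \<epsilon> k (x - y) * f y) = (LINT y|lebesgue. rescale \<epsilon> k (x - y) * F y)"
    by (rule integral_cong_AE) (use ae in auto)
  also have "\<dots> = (LINT y|lborel. rescale \<epsilon> k (x - y) * F y)"
    by (rule integral_completion) measurable
  also have "\<dots> = \<bar>-\<epsilon>\<bar> ^ DIM('a) * (LINT y|lborel. rescale \<epsilon> k (x - (x + (-\<epsilon>) *\<^sub>R y)) * F (x + (-\<epsilon>) *\<^sub>R y))"
    using \<epsilon> by (intro integral_lborel_affine) auto
  also have "\<dots> = (LINT y|lborel. \<bar>-\<epsilon>\<bar> ^ DIM('a) * (rescale \<epsilon> k (x - (x + (-\<epsilon>) *\<^sub>R y)) * F (x + (-\<epsilon>) *\<^sub>R y)))"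
    by simp
  also have "\<dots> = (LINT y|lborel. k y * F (x - \<epsilon> *\<^sub>R y))"
    using \<epsilon> by (intro Bochner_Integration.integral_cong) (auto simp: rescale_def)
  finally show ?thesis .
qed

text \<open>
  Integrating the inequality \<open>f \<le> a + K f / 2\<close> gives the claim at once if \<open>f\<close> is integrable,
  because \<open>K\<close> preserves the integral; but \<open>f\<close> is only known to be bounded. The functions
  \<open>h\<^sub>0 = 0\<close>, \<open>h\<^sub>m\<^sub>+\<^sub>1 = min f (a + K h\<^sub>m / 2)\<close> are integrable with the bound claimed, and the
  distance to \<open>f\<close> is halved in each step.
\<close>

lemma half_average_L1_bound:
  fixes k f a :: "'a::euclidean_space \<Rightarrow> real"
  assumes k[measurable]: "k \<in> borel_measurable borel" and kint: "integrable lborel k" and k1: "(LINT x|lborel. k x) = 1"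
    and k0: "\<And>y. 0 \<le> k y" and \<epsilon>: "0 < \<epsilon>"
    and f[measurable]: "f \<in> borel_measurable borel" and f0: "\<And>x. 0 \<le> f x" and fB: "\<And>x. f x \<le> B"
    and a[measurable]: "a \<in> borel_measurable borel" and a0: "\<And>x. 0 \<le> a x"
    and sub: "AE x in lborel. f x \<le> a x + (LINT y|lborel. k y * f (x - \<epsilon> *\<^sub>R y)) / 2"
  shows "(\<integral>\<^sup>+x. ennreal (f x) \<partial>lborel) \<le> 2 * (\<integral>\<^sup>+x. ennreal (a x) \<partial>lborel)"
proof (cases "(\<integral>\<^sup>+x. ennreal (a x) \<partial>lborel) = \<infinity>")
  case True
  then show ?thesis by (simp add: ennreal_mult_top)
next
  case False
  let ?K = "\<lambda>h x. LINT y|lborel. k y * h (x - \<epsilon> *\<^sub>R y)"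
  let ?A = "\<integral>\<^sup>+x. ennreal (a x) \<partial>lborel"
  have Km: "?K h \<in> borel_measurable borel" if [measurable]: "h \<in> borel_measurable borel" for h
    by (rule lborel.borel_measurable_lebesgue_integral[unfolded borel_prod]) measurable
  have "\<exists>h. h \<in> borel_measurable borel \<and> (\<forall>x. 0 \<le> h x) \<and> (\<forall>x. h x \<le> f x) \<and> (AE x in lborel. f x \<le> h x + B / 2 ^ m) 
      \<and> (\<integral>\<^sup>+x. ennreal (h x) \<partial>lborel) \<le> 2 * ?A" for m :: nat
  proof (induction m)
    case 0
    show ?case using fB f0 by (intro exI[of _ "\<lambda>_. 0"]) auto
  next
    case (Suc m)
    then obtain h where h[measurable]: "h \<in> borel_measurable borel" and h0: "\<And>x. 0 \<le> h x" and hf: "\<And>x. h x \<le> f x"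
      and fh: "AE x in lborel. f x \<le> h x + B / 2 ^ m" and hA: "(\<integral>\<^sup>+x. ennreal (h x) \<partial>lborel) \<le> 2 * ?A" by blast
    have hint: "integrable lborel (\<lambda>y. k y * h (x - \<epsilon> *\<^sub>R y))" for x
    proof (rule integrable_mult_bounded[OF kint])
      show "\<bar>h (x - \<epsilon> *\<^sub>R y)\<bar> \<le> B" for y using h0[of "x - \<epsilon> *\<^sub>R y"] hf[of "x - \<epsilon> *\<^sub>R y"] fB[of "x - \<epsilon> *\<^sub>R y"] by auto
    qed measurable
    have fint: "integrable lborel (\<lambda>y. k y * f (x - \<epsilon> *\<^sub>R y))" for x
    proof (rule integrable_mult_bounded[OF kint])
      show "\<bar>f (x - \<epsilon> *\<^sub>R y)\<bar> \<le> B" for y using f0[of "x - \<epsilon> *\<^sub>R y"] fB[of "x - \<epsilon> *\<^sub>R y"] by auto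
    qed measurable
    define h' where "h' x = min (f x) (a x + ?K h x / 2)" for x
    have K0: "0 \<le> ?K h x" for x using k0 h0 by (intro integral_nonneg_AE) auto
    have Km'[measurable]: "?K h \<in> borel_measurable borel" by (rule Km[OF h])
    have [measurable]: "h' \<in> borel_measurable borel" unfolding h'_def by measurable
    have KK: "?K f x \<le> ?K h x + B / 2 ^ m" for x
    proof -
      have "?K f x \<le> (LINT y|lborel. k y * h (x - \<epsilon> *\<^sub>R y) + k y * (B / 2 ^ m))"
      proof (rule integral_mono_AE[OF fint])
        show "integrable lborel (\<lambda>y. k y * h (x - \<epsilon> *\<^sub>R y) + k y * (B / 2 ^ m))" using hint kint by auto
        have "AE y in lborel. f (x + (-\<epsilon>) *\<^sub>R y) \<le> h (x + (-\<epsilon>) *\<^sub>R y) + B / 2 ^ m"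
          by (rule AE_lborel_affine[OF fh]) (use \<epsilon> in simp)
        then show "AE y in lborel. k y * f (x - \<epsilon> *\<^sub>R y) \<le> k y * h (x - \<epsilon> *\<^sub>R y) + k y * (B / 2 ^ m)"
        proof eventually_elim
          case (elim y)
          then have "k y * f (x - \<epsilon> *\<^sub>R y) \<le> k y * (h (x - \<epsilon> *\<^sub>R y) + B / 2 ^ m)" using k0 by (intro mult_left_mono) auto
          then show ?case by (simp only: distrib_left)
        qed
      qed
      also have "\<dots> = ?K h x + B / 2 ^ m" 
        using Bochner_Integration.integral_add[OF hint[of x] Bochner_Integration.integrable_mult_left[OF kint, of "B / 2^m"]] k1 by simp
      finally show ?thesis .
    qed
    show ?case
    proof (intro exI[of _ h'] conjI allI)
      show "h' \<in> borel_measurable borel" by measurable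
      show "0 \<le> h' x" for x using f0 a0 K0 by (auto simp: h'_def)
      show "h' x \<le> f x" for x by (simp add: h'_def)
      show "AE x in lborel. f x \<le> h' x + B / 2 ^ Suc m"
        using sub
      proof eventually_elim
        case (elim x)
        have B0: "0 \<le> B" using f0[of x] fB[of x] by linarith
        have "f x \<le> a x + ?K h x / 2 + B / 2 ^ m / 2" 
          using elim divide_right_mono[OF KK[of x], of 2] by (simp add: add_divide_distrib)
        then show ?case using B0 by (auto simp: h'_def min_def)
      qed
      have "(\<integral>\<^sup>+x. ennreal (h' x) \<partial>lborel) \<le> (\<integral>\<^sup>+x. (ennreal (a x) + ennreal (1/2) * ennreal (?K h x)) \<partial>lborel)"
      proof (rule nn_integral_mono)
        fix x
        have "ennreal (h' x) \<le> ennreal (a x + (1/2) * ?K h x)" by (intro ennreal_leI) (simp add: h'_def)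
        also have "\<dots> = ennreal (a x) + ennreal (1/2) * ennreal (?K h x)"
          using ennreal_plus[OF a0[of x], of "(1/2) * ?K h x"] ennreal_mult[of "1/2" "?K h x"] K0[of x] by simp
        finally show "ennreal (h' x) \<le> ennreal (a x) + ennreal (1/2) * ennreal (?K h x)" .
      qed
      also have "\<dots> = ?A + ennreal (1/2) * (\<integral>\<^sup>+x. ennreal (?K h x) \<partial>lborel)"
        by (subst nn_integral_add) (auto simp: nn_integral_cmult)
      also have "\<dots> \<le> ?A + ennreal (1/2) * (2 * ?A)"
        using order_trans[OF nn_integral_space_average_le[OF k kint k1 k0 h h0, of \<epsilon>] hA]
        by (intro add_left_mono mult_left_mono) auto
      also have "ennreal (1/2) * (2 * ?A) = ?A"
      proof -
        have "ennreal (1/2) * 2 = ennreal (1/2) * ennreal 2" by simp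
        also have "\<dots> = 1" by (subst ennreal_mult[symmetric]) auto
        finally show ?thesis by (simp add: mult.assoc[symmetric])
      qed
      also have "?A + ?A = 2 * ?A" by (simp add: mult_2)
      finally show "(\<integral>\<^sup>+x. ennreal (h' x) \<partial>lborel) \<le> 2 * ?A" .
    qed
  qed
  \<comment> \<open>The iterates converge to \<open>f\<close> at almost every point; conclude by Fatou.\<close>
  then have "\<exists>h. \<forall>m. h m \<in> borel_measurable borel \<and> (\<forall>x. 0 \<le> h m x) \<and> (\<forall>x. h m x \<le> f x) \<and> (AE x in lborel. f x \<le> h m x + B / 2 ^ m) 
      \<and> (\<integral>\<^sup>+x. ennreal (h m x) \<partial>lborel) \<le> 2 * ?A"
    by (intro choice allI)
  then obtain h where h[measurable]: "\<And>m. h m \<in> borel_measurable borel" and h0: "\<And>m x. 0 \<le> h m x" and hf: "\<And>m x. h m x \<le> f x"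
      and fh: "\<And>m. AE x in lborel. f x \<le> h m x + B / 2 ^ m" and hA: "\<And>m. (\<integral>\<^sup>+x. ennreal (h m x) \<partial>lborel) \<le> 2 * ?A" for m :: nat
    by blast
  have "AE x in lborel. \<forall>m. f x \<le> h m x + B / 2 ^ m" using fh by (simp add: AE_all_countable)
  then have "AE x in lborel. ennreal (f x) = liminf (\<lambda>m. ennreal (h m x))"
  proof eventually_elim
    case (elim x)
    have "(\<lambda>m. h m x) \<longlonglongrightarrow> f x"
    proof (rule tendsto_sandwich)
      show "\<forall>\<^sub>F m in sequentially. f x - B * (1/2) ^ m \<le> h m x"
        using elim by (intro always_eventually) (simp add: power_divide algebra_simps)
      show "\<forall>\<^sub>F m in sequentially. h m x \<le> f x" using hf by simp
      have "(\<lambda>m. f x - B * (1/2) ^ m) \<longlonglongrightarrow> f x - B * 0"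
        by (intro tendsto_intros LIMSEQ_realpow_zero) auto
      then show "(\<lambda>m. f x - B * (1/2) ^ m) \<longlonglongrightarrow> f x" by simp
    qed simp
    then show ?case by (metis lim_imp_Liminf tendsto_ennrealI trivial_limit_sequentially)
  qed
  then have "(\<integral>\<^sup>+x. ennreal (f x) \<partial>lborel) = (\<integral>\<^sup>+x. liminf (\<lambda>m. ennreal (h m x)) \<partial>lborel)"
    by (rule nn_integral_cong_AE)
  also have "\<dots> \<le> liminf (\<lambda>m. \<integral>\<^sup>+x. ennreal (h m x) \<partial>lborel)"
    by (intro nn_integral_liminf) measurable
  also have "\<dots> \<le> 2 * ?A"
    using hA by (intro Liminf_le) auto
  finally show ?thesis .
qed

lemma Linf_normD:
  assumes "Linf_norm f < ereal c"
  shows "AE x in lebesgue. \<bar>f x\<bar> \<le> c"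
  using esssup_AE[of "\<lambda>x. ereal \<bar>f x\<bar>" lebesgue]
proof eventually_elim
  case (elim x)
  then have "ereal \<bar>f x\<bar> < ereal c" using assms unfolding Linf_norm_def by (rule le_less_trans)
  then show ?case by simp
qed

lemma Linf_bounded_AE:
  assumes "Linf f"
  obtains M where "0 \<le> M" "AE x in lebesgue. \<bar>f x\<bar> \<le> M"
proof -
  have "Linf_norm f < \<infinity>" using assms by (simp add: Linf_def)
  then obtain r where r: "Linf_norm f < ereal r" 
    using less_PInf_Ex_of_nat[of "Linf_norm f"] by auto
  show ?thesis by (rule that[of "max 0 r"]) (use Linf_normD[OF r] in \<open>auto elim!: eventually_mono\<close>)
qed

lemma borel_version:
  fixes f :: "'a::euclidean_space \<Rightarrow> real"
  assumes "f \<in> borel_measurable lebesgue"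
  obtains h where "h \<in> borel_measurable borel" "AE x in lborel. f x = h x"
proof -
  obtain h where "h \<in> borel_measurable lborel" "AE x in lborel. f x = h x"
    using completion_ex_borel_measurable_real[OF assms] by blast
  then show ?thesis by (intro that[of h]) auto
qed

text \<open>
  Compactness of the time interval in the form of Bolzano's bisection principle, since a bound
  at one time is valid nearby by continuity in the essential supremum norm.
\<close>

lemma uniform_Linf_bound:
  fixes g :: "real \<Rightarrow> 'a::euclidean_space \<Rightarrow> real"
  assumes L: "\<And>t. 0 \<le> t \<Longrightarrow> Linf (g t)"
    and C: "\<And>t. 0 \<le> t \<Longrightarrow> ((\<lambda>r. Linf_norm (\<lambda>x. g r x - g t x)) \<longlongrightarrow> 0) (at t within {0..})"
    and T: "0 \<le> T"
  obtains B where "0 \<le> B" "\<And>t. 0 \<le> t \<Longrightarrow> t \<le> T \<Longrightarrow> AE x in lebesgue. \<bar>g t x\<bar> \<le> B"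
proof -
  define P where "P a b \<longleftrightarrow> (\<exists>B\<ge>0. \<forall>t\<in>{a..b}. 0 \<le> t \<longrightarrow> (AE x in lebesgue. \<bar>g t x\<bar> \<le> B))" for a b
  have "P 0 T"
  proof (rule Bolzano[OF T])
    fix a b c assume "P a b" "P b c" and "a \<le> b" "b \<le> c"
    then obtain B B' where B: "B \<ge> 0" "\<And>t. a \<le> t \<Longrightarrow> t \<le> b \<Longrightarrow> 0 \<le> t \<Longrightarrow> AE x in lebesgue. \<bar>g t x\<bar> \<le> B"
        and B': "B' \<ge> 0" "\<And>t. b \<le> t \<Longrightarrow> t \<le> c \<Longrightarrow> 0 \<le> t \<Longrightarrow> AE x in lebesgue. \<bar>g t x\<bar> \<le> B'"
      by (auto simp: P_def)
    show "P a c" unfolding P_def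
    proof (intro exI[of _ "max B B'"] conjI ballI impI)
      fix t assume t: "t \<in> {a..c}" "0 \<le> t"
      show "AE x in lebesgue. \<bar>g t x\<bar> \<le> max B B'"
      proof (cases "t \<le> b")
        case True
        then show ?thesis using B(2)[of t] t by (auto elim!: eventually_mono)
      next
        case False
        then show ?thesis using B'(2)[of t] t by (auto elim!: eventually_mono)
      qed
    qed (use B(1) in auto)
  next
    fix t assume t: "0 \<le> t" "t \<le> T"
    obtain M where M: "0 \<le> M" "AE x in lebesgue. \<bar>g t x\<bar> \<le> M" using Linf_bounded_AE[OF L[OF t(1)]] .
    have "\<forall>\<^sub>F r in at t within {0..}. Linf_norm (\<lambda>x. g r x - g t x) < ereal 1"
      using order_tendstoD(2)[OF C[OF t(1)], of 1] by (simp add: one_ereal_def)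
    then obtain d where d: "0 < d" "\<And>r. 0 \<le> r \<Longrightarrow> r \<noteq> t \<Longrightarrow> dist r t < d \<Longrightarrow> Linf_norm (\<lambda>x. g r x - g t x) < ereal 1"
      by (auto simp: eventually_at)
    show "\<exists>d>0. \<forall>a b. a \<le> t \<and> t \<le> b \<and> b - a < d \<longrightarrow> P a b"
    proof (intro exI[of _ d] conjI allI impI)
      fix a b assume ab: "a \<le> t \<and> t \<le> b \<and> b - a < d"
      show "P a b" unfolding P_def
      proof (intro exI[of _ "M + 1"] conjI ballI impI)
        fix r assume r: "r \<in> {a..b}" "0 \<le> r"
        show "AE x in lebesgue. \<bar>g r x\<bar> \<le> M + 1"
        proof (cases "r = t")
          case True
          then show ?thesis using M(2) by (auto elim!: eventually_mono)
        next
          case False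
          then have "AE x in lebesgue. \<bar>g r x - g t x\<bar> \<le> 1"
            using d(2)[of r] r ab by (intro Linf_normD) (auto simp: dist_real_def)
          then show ?thesis using M(2) by eventually_elim auto
        qed
      qed (use M in auto)
    qed (use d in auto)
  qed
  then show ?thesis using that by (auto simp: P_def)
qed

lemma set_lebesgue_eq_integral_Icc:
  fixes \<phi> :: "real \<Rightarrow> real"
  assumes "set_integrable lebesgue {0..t} \<phi>"
  shows "(LINT \<tau>:{0..t}|lebesgue. \<phi> \<tau>) = integral {0..t} \<phi>"
  using set_lebesgue_integral_eq_integral(2)[OF assms] .

lemma continuous_set_integrable_lebesgue:
  fixes \<phi> :: "real \<Rightarrow> real"
  assumes "continuous_on {0..t} \<phi>"
  shows "set_integrable lebesgue {0..t} \<phi>"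
  using borel_integrable_compact[OF compact_Icc assms]
  by (auto simp: set_integrable_def indicator_scaleR_eq_if intro!: integrable_completion[THEN iffD2])

text \<open>
  On a time interval of length \<open>\<epsilon>\<^sup>2 / 2\<close> the inequality for \<open>G\<close> integrates to
  \<open>w(t) \<le> w(s) + (\<epsilon>\<^sup>2 / 2) \<Gamma>\<^sup>+ + K w(t) / 2\<close>, as \<open>K w\<close> increases in time; \<open>half_average_L1_bound\<close>
  then passes integrability from \<open>s\<close> to \<open>t\<close>. The square integrability of \<open>w\<close> in the energy
  estimate rests on this lemma.
\<close>

lemma time_primitive_L1:
  fixes k \<Gamma> :: "'a::euclidean_space \<Rightarrow> real"
  assumes k[measurable]: "k \<in> borel_measurable borel" and kint: "integrable lborel k" and k1: "(LINT x|lborel. k x) = 1"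
    and k0: "\<And>y. 0 \<le> k y" and \<epsilon>: "0 < \<epsilon>"
    and G[measurable]: "G \<in> borel_measurable borel" and G0: "\<And>z. 0 \<le> G z" and GM: "\<And>z. G z \<le> M"
    and \<Gamma>m[measurable]: "\<Gamma> \<in> borel_measurable borel" and \<Gamma>L1: "(\<integral>\<^sup>+x. ennreal (max (\<Gamma> x) 0) \<partial>lborel) < \<infinity>"
    and Gle: "AE x in lborel. \<forall>t\<ge>0. G (t, x) \<le> max (\<Gamma> x) 0 + space_average k \<epsilon> (time_primitive G) (t, x) / \<epsilon>\<^sup>2"
    and t: "0 \<le> t"
  shows "(\<integral>\<^sup>+x. ennreal (time_primitive G (t, x)) \<partial>lborel) < \<infinity>"
proof -
  let ?w = "time_primitive G"
  note w = bounded_time_primitive[OF G G0 GM]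
  have [measurable]: "?w \<in> borel_measurable (borel \<Otimes>\<^sub>M borel)" by (simp add: borel_prod)
  have avg_int: "integrable lborel (\<lambda>y. k y * ?w (t, x - \<epsilon> *\<^sub>R y))" if "0 \<le> t" for t x
  proof (rule integrable_mult_bounded[OF kint])
    show "\<bar>?w (t, x - \<epsilon> *\<^sub>R y)\<bar> \<le> M * t" for y using w(2) w(4)[OF that] by (simp add: abs_of_nonneg)
  qed measurable
  have step: "(\<integral>\<^sup>+x. ennreal (?w (real n * (\<epsilon>\<^sup>2 / 2), x)) \<partial>lborel) < \<infinity>" for n :: nat
  proof (induction n)
    case 0
    have "?w (0, x) = 0" for x using w(2)[of "(0, x)"] w(4)[of 0 x] by simp
    then show ?case by simp
  next
    case (Suc n)
    define s h where "s = real n * (\<epsilon>\<^sup>2 / 2)" and "h = \<epsilon>\<^sup>2 / 2"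
    define t where "t = s + h"
    have h0: "0 < h" and s0: "0 \<le> s" and ch: "h / \<epsilon>\<^sup>2 = 1/2" using \<epsilon> by (auto simp: h_def s_def)
    have st: "s \<le> t" "0 \<le> t" using h0 s0 by (auto simp: t_def)
    define a where "a x = ?w (s, x) + h * max (\<Gamma> x) 0" for x
    have [measurable]: "a \<in> borel_measurable borel" unfolding a_def by measurable
    have "(\<integral>\<^sup>+x. ennreal (?w (t, x)) \<partial>lborel) \<le> 2 * (\<integral>\<^sup>+x. ennreal (a x) \<partial>lborel)"
    proof (rule half_average_L1_bound[OF k kint k1 k0 \<epsilon>])
      show "0 \<le> ?w (t, x)" "?w (t, x) \<le> M * t" for x using w st by auto
      show "0 \<le> a x" for x using w(2) h0 by (simp add: a_def)
      show "AE x in lborel. ?w (t, x) \<le> a x + (LINT y|lborel. k y * ?w (t, x - \<epsilon> *\<^sub>R y)) / 2"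
        using Gle
      proof eventually_elim
        case (elim x)
        define Kt where "Kt = space_average k \<epsilon> ?w (t, x)"
        have K0: "0 \<le> Kt" unfolding Kt_def space_average_def using w(2) k0 by (intro integral_nonneg_AE) auto
        have bound: "G (r, x) \<le> max (\<Gamma> x) 0 + Kt / \<epsilon>\<^sup>2" if r: "0 \<le> r" "r \<le> t" for r
        proof -
          have "space_average k \<epsilon> ?w (r, x) \<le> Kt" unfolding Kt_def space_average_def
            using avg_int[OF r(1), of x] avg_int[OF st(2), of x] w(3)[OF r(2)] k0 by (intro integral_mono) (auto intro!: mult_left_mono)
          then have "space_average k \<epsilon> ?w (r, x) / \<epsilon>\<^sup>2 \<le> Kt / \<epsilon>\<^sup>2" by (intro divide_right_mono) auto
          then show ?thesis using elim r(1) by force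
        qed
        have "?w (t, x) \<le> (LINT \<tau>|lborel. indicator {0..s} \<tau> * G (\<tau>, x) + indicator {s..t} \<tau> * (max (\<Gamma> x) 0 + Kt / \<epsilon>\<^sup>2))"
          unfolding time_primitive_def fst_conv snd_conv
        proof (rule integral_mono[OF w(1)])
          show "integrable lborel (\<lambda>\<tau>. indicator {0..s} \<tau> * G (\<tau>, x) + indicator {s..t} \<tau> * (max (\<Gamma> x) 0 + Kt / \<epsilon>\<^sup>2))"
            by (intro Bochner_Integration.integrable_add w(1) integrable_mult_left integrable_indicator_Icc)
          have "0 \<le> max (\<Gamma> x) 0 + Kt / \<epsilon>\<^sup>2" using K0 by simp
          then show "indicator {0..t} \<tau> * G (\<tau>, x) \<le> indicator {0..s} \<tau> * G (\<tau>, x) + indicator {s..t} \<tau> * (max (\<Gamma> x) 0 + Kt / \<epsilon>\<^sup>2)" for \<tau>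
            using bound[of \<tau>] G0[of "(\<tau>, x)"] st by (auto simp: indicator_def)
        qed
        also have "\<dots> = ?w (s, x) + (LINT \<tau>|lborel. indicator {s..t} \<tau> * (max (\<Gamma> x) 0 + Kt / \<epsilon>\<^sup>2))"
          unfolding time_primitive_def fst_conv snd_conv
          by (intro Bochner_Integration.integral_add w(1) integrable_mult_left integrable_indicator_Icc)
        also have "(LINT \<tau>|lborel. indicator {s..t} \<tau> * (max (\<Gamma> x) 0 + Kt / \<epsilon>\<^sup>2)) = h * (max (\<Gamma> x) 0 + Kt / \<epsilon>\<^sup>2)"
          using h0 by (simp add: t_def)
        also have "\<dots> = h * max (\<Gamma> x) 0 + Kt * (h / \<epsilon>\<^sup>2)" by (simp add: distrib_left)
        finally show ?case unfolding ch by (simp add: a_def space_average_def Kt_def)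
      qed
    qed measurable
    also have "(\<integral>\<^sup>+x. ennreal (a x) \<partial>lborel) = (\<integral>\<^sup>+x. ennreal (?w (s, x)) + ennreal h * ennreal (max (\<Gamma> x) 0) \<partial>lborel)"
    proof (rule nn_integral_cong)
      fix x
      show "ennreal (a x) = ennreal (?w (s, x)) + ennreal h * ennreal (max (\<Gamma> x) 0)"
        unfolding a_def using w(2)[of "(s,x)"] h0 by (subst ennreal_mult[symmetric]; simp add: ennreal_plus)
    qed
    also have "\<dots> = (\<integral>\<^sup>+x. ennreal (?w (s, x)) \<partial>lborel) + ennreal h * (\<integral>\<^sup>+x. ennreal (max (\<Gamma> x) 0) \<partial>lborel)"
      by (subst nn_integral_add) (auto simp: nn_integral_cmult)
    also have "2 * \<dots> < \<infinity>"
    proof -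
      have "(\<integral>\<^sup>+x. ennreal (?w (s, x)) \<partial>lborel) < \<infinity>" unfolding s_def by (rule Suc)
      then show ?thesis using \<Gamma>L1 by (simp add: ennreal_mult_less_top del: distrib_left_numeral)
    qed
    finally have "(\<integral>\<^sup>+x. ennreal (?w (t, x)) \<partial>lborel) < \<infinity>" .
    moreover have "t = real (Suc n) * (\<epsilon>\<^sup>2 / 2)" by (simp add: t_def s_def h_def algebra_simps)
    ultimately show ?case by simp
  qed
  obtain n :: nat where "t / (\<epsilon>\<^sup>2 / 2) \<le> real n" using real_arch_simple by blast
  then have "t \<le> real n * (\<epsilon>\<^sup>2 / 2)" using \<epsilon> by (simp add: field_simps)
  then have "(\<integral>\<^sup>+x. ennreal (?w (t, x)) \<partial>lborel) \<le> (\<integral>\<^sup>+x. ennreal (?w (real n * (\<epsilon>\<^sup>2 / 2), x)) \<partial>lborel)"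
    by (intro nn_integral_mono ennreal_leI w(3))
  then show ?thesis using step[of n] by (rule order.strict_trans1)
qed

text \<open>
  The maximum principle \<open>-M \<le> g \<le> M\<close> holds at every point outside \<open>N\<^sub>1\<close>, a null set independent
  of \<open>\<epsilon>\<close>; the estimates for \<open>W\<close> at the points outside \<open>N\<^sub>1\<close> follow from it and the integrated
  equation. The function \<open>G\<close> is a jointly Borel measurable version of the positive part of the
  solution, for which Fubini's theorem is available; only the claims about \<open>G\<close> have an
  exceptional set that may depend on \<open>\<epsilon>\<close>.
\<close>

theorem nonlocal_solution_structure:
  fixes k \<gamma>\<^sub>0 :: "'a::euclidean_space \<Rightarrow> real"
  assumes k[measurable]: "k \<in> borel_measurable borel" and kint: "integrable lborel k" and k1: "(LINT x|lborel. k x) = 1"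
    and k0: "\<And>y. 0 \<le> k y" and \<epsilon>: "0 < \<epsilon>"
    and M0: "0 \<le> M" and sub: "N \<subseteq> N\<^sub>1" and N1: "AE x in lborel. x \<notin> N\<^sub>1" and \<gamma>M: "\<And>x. x \<notin> N\<^sub>1 \<Longrightarrow> \<bar>\<gamma>\<^sub>0 x\<bar> \<le> M"
    and sol: "nonlocal_solution k \<gamma>\<^sub>0 N \<epsilon> g"
    and \<Gamma>m[measurable]: "\<Gamma> \<in> borel_measurable borel" and \<Gamma>: "AE x in lborel. \<gamma>\<^sub>0 x = \<Gamma> x"
    and \<Gamma>L1: "(\<integral>\<^sup>+x. ennreal (max (\<Gamma> x) 0) \<partial>lborel) < \<infinity>"
    and W_def: "\<And>t x. W t x = (LINT \<tau>:{0..t}|lebesgue. max (g \<tau> x) 0)"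
  obtains G where "G \<in> borel_measurable borel" "\<And>z. 0 \<le> G z" "\<And>z. G z \<le> M"
    "AE x in lborel. \<forall>t\<ge>0. W t x = time_primitive G (t, x)"
    "\<And>x s t. x \<notin> N\<^sub>1 \<Longrightarrow> 0 \<le> s \<Longrightarrow> s \<le> t \<Longrightarrow> 0 \<le> W t x - W s x"
    "\<And>x s t. x \<notin> N\<^sub>1 \<Longrightarrow> 0 \<le> s \<Longrightarrow> s \<le> t \<Longrightarrow> W t x - W s x \<le> M * (t - s)"
    "\<And>x t. x \<notin> N\<^sub>1 \<Longrightarrow> 0 \<le> t \<Longrightarrow> \<bar>space_average k \<epsilon> (time_primitive G) (t, x) - W t x\<bar> \<le> 2 * M * \<epsilon>\<^sup>2"
    "AE x in lborel. \<forall>t\<ge>0. 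
        complementary (\<Gamma> x + nonlocal_diffusion k \<epsilon> (time_primitive G) (t, x)) (G (t, x)) (time_primitive G (t, x))"
    "\<And>T. 0 < T \<Longrightarrow> (\<integral>\<^sup>+z. ennreal (indicator (cylinder T) z * (G z)\<^sup>2) \<partial>lborel) < \<infinity>"
proof -
  define c where "c = 1 / \<epsilon>\<^sup>2"
  have c0: "0 < c" using \<epsilon> by (simp add: c_def)
  define p where "p \<tau> y = max (g \<tau> y) 0" for \<tau> y
  define F where "F \<tau> x = (LINT y|lebesgue. rescale \<epsilon> k (x - y) * p \<tau> y)" for \<tau> x
  have L: "Linf (g t)" if "0 \<le> t" for t using sol that by (simp add: nonlocal_solution_def)
  have gm: "g t \<in> borel_measurable lebesgue" if "0 \<le> t" for t using L[OF that] by (simp add: Linf_def)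
  have C: "((\<lambda>r. Linf_norm (\<lambda>x. g r x - g t x)) \<longlongrightarrow> 0) (at t within {0..})" if "0 \<le> t" for t
    using sol that by (simp add: nonlocal_solution_def)
  have pint: "set_integrable lebesgue {0..t} (\<lambda>\<tau>. p \<tau> x)" 
    and geq: "g t x = \<gamma>\<^sub>0 x + c * (LINT \<tau>:{0..t}|lebesgue. F \<tau> x - p \<tau> x)" if "0 \<le> t" "x \<notin> N" for t x
    using sol that by (auto simp: nonlocal_solution_def p_def F_def c_def)
  \<comment> \<open>Borel versions at each fixed time, as yet without any regularity in time.\<close>
  have "\<exists>H. \<forall>t. 0 \<le> t \<longrightarrow> H t \<in> borel_measurable borel \<and> (AE y in lborel. g t y = H t y) \<and> (\<exists>B. \<forall>y. \<bar>H t y\<bar> \<le> B)"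
  proof (intro choice allI)
    fix t :: real
    show "\<exists>h. 0 \<le> t \<longrightarrow> h \<in> borel_measurable borel \<and> (AE y in lborel. g t y = h y) \<and> (\<exists>B. \<forall>y. \<bar>h y\<bar> \<le> B)"
    proof (cases "0 \<le> t")
      case True
      obtain h where h[measurable]: "h \<in> borel_measurable borel" and hg: "AE x in lborel. g t x = h x"
        using borel_version[OF gm[OF True]] .
      obtain B where B: "0 \<le> B" "AE x in lebesgue. \<bar>g t x\<bar> \<le> B" using Linf_bounded_AE[OF L[OF True]] .
      have "AE y in lborel. g t y = max (- B) (min B (h y))"
        using hg B(2)[unfolded AE_completion_iff] by eventually_elim auto
      moreover have "\<bar>max (- B) (min B (h y))\<bar> \<le> B" for y using B(1) by auto
      ultimately show ?thesis by (intro exI[of _ "\<lambda>y. max (- B) (min B (h y))"]) auto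
    qed auto
  qed
  then obtain H where Hm: "\<And>t. 0 \<le> t \<Longrightarrow> H t \<in> borel_measurable borel"
    and Hg: "\<And>t. 0 \<le> t \<Longrightarrow> AE y in lborel. g t y = H t y" and HB: "\<And>t. 0 \<le> t \<Longrightarrow> \<exists>B. \<forall>y. \<bar>H t y\<bar> \<le> B"
    by blast
  have FH: "F \<tau> x = (LINT y|lborel. k y * max (H \<tau> (x - \<epsilon> *\<^sub>R y)) 0)" if "0 \<le> \<tau>" for \<tau> x
    unfolding F_def
  proof (rule convolution_change_of_variables[OF k _ _ _ \<epsilon>])
    note [measurable] = gm[OF that] Hm[OF that]
    show "p \<tau> \<in> borel_measurable lebesgue" unfolding p_def by measurable
    show "(\<lambda>y. max (H \<tau> y) 0) \<in> borel_measurable borel" by measurable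
    show "AE y in lebesgue. p \<tau> y = max (H \<tau> y) 0"
      unfolding AE_completion_iff using Hg[OF that] by eventually_elim (simp add: p_def)
  qed
  have Hint: "integrable lborel (\<lambda>y. k y * max (H \<tau> (x - \<epsilon> *\<^sub>R y)) 0)" if \<tau>: "0 \<le> \<tau>" for \<tau> x
  proof -
    note [measurable] = Hm[OF \<tau>]
    obtain B where B: "\<And>y. \<bar>H \<tau> y\<bar> \<le> B" using HB[OF \<tau>] by blast
    have "\<bar>max (H \<tau> y) 0\<bar> \<le> B" for y using B[of y] by auto
    then show ?thesis by (intro integrable_mult_bounded[OF kint]) auto
  qed
  have F0: "0 \<le> F \<tau> x" if "0 \<le> \<tau>" for \<tau> x
    unfolding FH[OF that] using k0 by (intro integral_nonneg_AE) auto
  have Fle: "F \<tau> x \<le> b" if \<tau>: "0 \<le> \<tau>" and ae: "AE y in lborel. p \<tau> y \<le> b" for \<tau> x b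
  proof -
    have "AE y in lborel. max (H \<tau> y) 0 \<le> b" using Hg[OF \<tau>] ae by eventually_elim (simp add: p_def)
    then have "AE y in lborel. max (H \<tau> (x + (-\<epsilon>) *\<^sub>R y)) 0 \<le> b" by (rule AE_lborel_affine) (use \<epsilon> in simp)
    then have "AE y in lborel. k y * max (H \<tau> (x - \<epsilon> *\<^sub>R y)) 0 \<le> k y * b"
      by eventually_elim (use k0 in \<open>auto intro!: mult_left_mono\<close>)
    then have "F \<tau> x \<le> (LINT y|lborel. k y * b)"
      unfolding FH[OF \<tau>] by (intro integral_mono_AE Hint[OF \<tau>]) (use kint in auto)
    then show ?thesis using k1 by simp
  qed
  \<comment> \<open>The average is continuous in time at every \<open>x\<close>, because the solution is continuous in
    time with values in \<open>L\<^sup>\<infinity>\<close>. Hence for fixed \<open>x\<close> the integrated equation can be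
    differentiated.\<close>
  have Fcont: "continuous_on {0..} (\<lambda>\<tau>. F \<tau> x)" for x
    unfolding continuous_on_def
  proof (intro ballI tendstoI)
    fix t \<eta> :: real assume t: "t \<in> {0..}" and \<eta>: "0 < \<eta>"
    have "\<forall>\<^sub>F r in at t within {0..}. Linf_norm (\<lambda>x. g r x - g t x) < ereal (\<eta>/2)"
      using order_tendstoD(2)[OF C, of t "ereal (\<eta>/2)"] t \<eta> by simp
    moreover have "\<forall>\<^sub>F r in at t within {0..}. r \<in> {0..}" by (simp add: eventually_at_filter)
    ultimately show "\<forall>\<^sub>F r in at t within {0..}. dist (F r x) (F t x) < \<eta>"
    proof eventually_elim
      case (elim r)
      have r: "0 \<le> r" and t': "0 \<le> t" using elim t by auto
      have "AE y in lborel. \<bar>g r y - g t y\<bar> \<le> \<eta>/2" using Linf_normD[OF elim(1)] by (simp add: AE_completion_iff)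
      then have "AE y in lborel. \<bar>max (H r y) 0 - max (H t y) 0\<bar> \<le> \<eta>/2"
        using Hg[OF r] Hg[OF t'] by eventually_elim (smt (verit))
      then have ae: "AE y in lborel. \<bar>max (H r (x + (-\<epsilon>) *\<^sub>R y)) 0 - max (H t (x + (-\<epsilon>) *\<^sub>R y)) 0\<bar> \<le> \<eta>/2"
        by (rule AE_lborel_affine) (use \<epsilon> in simp)
      have "\<bar>F r x - F t x\<bar> = \<bar>LINT y|lborel. k y * max (H r (x - \<epsilon> *\<^sub>R y)) 0 - k y * max (H t (x - \<epsilon> *\<^sub>R y)) 0\<bar>"
        unfolding FH[OF r] FH[OF t'] by (subst Bochner_Integration.integral_diff[OF Hint[OF r] Hint[OF t']]) simp
      also have "\<dots> \<le> (LINT y|lborel. k y * (\<eta>/2))"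
      proof (rule abs_integral_le_AE)
        show "integrable lborel (\<lambda>y. k y * max (H r (x - \<epsilon> *\<^sub>R y)) 0 - k y * max (H t (x - \<epsilon> *\<^sub>R y)) 0)"
          using Hint[OF r] Hint[OF t'] by auto
        show "integrable lborel (\<lambda>y. k y * (\<eta>/2))" using kint by auto
        show "AE y in lborel. \<bar>k y * max (H r (x - \<epsilon> *\<^sub>R y)) 0 - k y * max (H t (x - \<epsilon> *\<^sub>R y)) 0\<bar> \<le> k y * (\<eta>/2)"
          using ae
        proof eventually_elim
          case (elim y)
          have "\<bar>k y * max (H r (x - \<epsilon> *\<^sub>R y)) 0 - k y * max (H t (x - \<epsilon> *\<^sub>R y)) 0\<bar> 
             = k y * \<bar>max (H r (x - \<epsilon> *\<^sub>R y)) 0 - max (H t (x - \<epsilon> *\<^sub>R y)) 0\<bar>"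
            using k0[of y] by (simp add: right_diff_distrib[symmetric] abs_mult)
          also have "\<dots> \<le> k y * (\<eta>/2)" using elim k0[of y] by (intro mult_left_mono) auto
          finally show ?case .
        qed
      qed
      also have "\<dots> = \<eta>/2" using k1 by simp
      finally show ?case using \<eta> by (simp add: dist_real_def)
    qed
  qed
  have Fsi: "set_integrable lebesgue {0..t} (\<lambda>\<tau>. F \<tau> x)" for t x
    by (rule continuous_set_integrable_lebesgue[OF continuous_on_subset[OF Fcont]]) auto
  have dint: "set_integrable lebesgue {0..t} (\<lambda>\<tau>. F \<tau> x - p \<tau> x)" if "0 \<le> t" "x \<notin> N" for t x
    by (rule set_integral_diff(1)[OF Fsi pint[OF that]])
  have geq': "g t x = \<gamma>\<^sub>0 x + c * integral {0..t} (\<lambda>\<tau>. F \<tau> x - p \<tau> x)" if "0 \<le> t" "x \<notin> N" for t x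
    using geq[OF that] set_lebesgue_eq_integral_Icc[OF dint[OF that]] by simp
  have gcontT: "continuous_on {0..t} (\<lambda>t. g t x)" if x: "x \<notin> N" and t: "0 \<le> t" for x t
  proof -
    have "(\<lambda>\<tau>. F \<tau> x - p \<tau> x) integrable_on {0..t}"
      using set_lebesgue_integral_eq_integral(1)[OF dint[OF t x]] .
    then have "continuous_on {0..t} (\<lambda>t. \<gamma>\<^sub>0 x + c * integral {0..t} (\<lambda>\<tau>. F \<tau> x - p \<tau> x))"
      by (intro continuous_intros indefinite_integral_continuous_1)
    then show ?thesis by (rule continuous_on_eq) (use geq' x in auto)
  qed
  have gcont: "continuous_on {0..} (\<lambda>t. g t x)" if x: "x \<notin> N" for x
    unfolding continuous_on_eq_continuous_within
  proof
    fix t :: real assume t: "t \<in> {0..}"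
    then have "continuous (at t within {0..t+1}) (\<lambda>t. g t x)"
      using gcontT[OF x, of "t+1"] by (auto simp: continuous_on_eq_continuous_within)
    moreover have "at t within {0..t+1} = at t within {0..}"
      by (rule at_within_nhd[of _ "{..<t+1}"]) auto
    ultimately show "continuous (at t within {0..}) (\<lambda>t. g t x)" by simp
  qed
  have pcont: "continuous_on {0..} (\<lambda>t. p t x)" if "x \<notin> N" for x
    unfolding p_def by (intro continuous_intros gcont that)
  have der: "((\<lambda>t. g t x) has_real_derivative c * (F t x - max (g t x) 0)) (at t)" if x: "x \<notin> N" and t: "0 < t" for x t
  proof -
    have "continuous_on {0..t+1} (\<lambda>\<tau>. F \<tau> x - p \<tau> x)"
      by (intro continuous_intros continuous_on_subset[OF Fcont] continuous_on_subset[OF pcont[OF x]]) auto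
    then have "((\<lambda>r. integral {0..r} (\<lambda>\<tau>. F \<tau> x - p \<tau> x)) has_real_derivative (F t x - p t x)) (at t within {0..t+1})"
      using t by (intro integral_has_real_derivative) auto
    then have "((\<lambda>r. integral {0..r} (\<lambda>\<tau>. F \<tau> x - p \<tau> x)) has_real_derivative (F t x - p t x)) (at t)"
      using t by (simp add: at_within_Icc_at)
    then have "((\<lambda>r. \<gamma>\<^sub>0 x + c * integral {0..r} (\<lambda>\<tau>. F \<tau> x - p \<tau> x)) has_real_derivative c * (F t x - p t x)) (at t)"
      by (auto intro!: derivative_eq_intros)
    then have "((\<lambda>t. g t x) has_real_derivative c * (F t x - p t x)) (at t)"
    proof (rule has_field_derivative_transform_within_open[of _ _ _ "{0<..}"])
      show "\<gamma>\<^sub>0 x + c * integral {0..r} (\<lambda>\<tau>. F \<tau> x - p \<tau> x) = g r x" if "r \<in> {0<..}" for r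
        using geq'[of r x] that x by simp
    qed (use t in auto)
    then show ?thesis by (simp add: p_def)
  qed
  have g0: "g 0 x = \<gamma>\<^sub>0 x" if "x \<notin> N" for x using geq'[of 0 x] that by simp
  note ode = relaxation_ode[OF gcont c0 F0[OF less_imp_le] der]
  have glow: "- M \<le> g t x" if x: "x \<notin> N\<^sub>1" and t: "0 \<le> t" for x t
  proof (cases "g t x < 0")
    case True
    have "x \<notin> N" using x sub by auto
    then have "g 0 x \<le> g t x" using ode(2)[of x t] t True by auto
    then show ?thesis using g0[OF \<open>x \<notin> N\<close>] \<gamma>M[OF x] by auto
  qed (use M0 in auto)
  \<comment> \<open>Upper bound, by induction over time steps of length \<open>1 / (2 c)\<close>. Within a step, a
    crude bound \<open>M + B\<close> improves to \<open>M + B / 2\<close>, \<open>M + B / 4\<close>, and so on.\<close>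
  have gup: "\<forall>t x. 0 \<le> t \<longrightarrow> c * t \<le> real j / 2 \<longrightarrow> x \<notin> N\<^sub>1 \<longrightarrow> g t x \<le> M" for j :: nat
  proof (induction j)
    case 0
    have "t = 0" if "0 \<le> t" "c * t \<le> 0" for t using that c0 by (simp add: mult_le_0_iff)
    moreover have "g 0 x \<le> M" if x: "x \<notin> N\<^sub>1" for x
    proof -
      have "x \<notin> N" using x sub by auto
      then show ?thesis using g0[of x] \<gamma>M[OF x] by simp
    qed
    ultimately show ?case by fastforce
  next
    case (Suc j)
    define s where "s = real j / (2 * c)"
    define T where "T = real (Suc j) / (2 * c)"
    have s0: "0 \<le> s" and cs: "c * s = real j / 2" and cT: "c * T = real (Suc j) / 2" and T0: "0 \<le> T" using c0 by (auto simp: s_def T_def)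
    obtain B where B: "0 \<le> B" "\<And>t. 0 \<le> t \<Longrightarrow> t \<le> T \<Longrightarrow> AE x in lebesgue. \<bar>g t x\<bar> \<le> B"
      by (rule uniform_Linf_bound[OF L C T0]) auto
    have half: "\<forall>t x. 0 \<le> t \<longrightarrow> t \<le> T \<longrightarrow> x \<notin> N\<^sub>1 \<longrightarrow> g t x \<le> M + E / 2"
      if E: "0 \<le> E" and ae: "\<And>t. 0 \<le> t \<Longrightarrow> t \<le> T \<Longrightarrow> AE x in lborel. g t x \<le> M + E" for E
    proof (intro allI impI)
      fix t x assume t: "0 \<le> t" "t \<le> T" and x: "x \<notin> N\<^sub>1"
      then have xN: "x \<notin> N" using sub by auto
      show "g t x \<le> M + E / 2"
      proof (cases "c * t \<le> real j / 2")
        case True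
        then have "g t x \<le> M" using Suc x t by blast
        then show ?thesis using E by simp
      next
        case False
        then have st: "s \<le> t" using cs c0 by (metis linear mult_le_cancel_left_pos)
        have "c * t \<le> c * T" using t c0 by simp
        then have small: "c * (t - s) \<le> 1/2" using cs cT by (simp add: right_diff_distrib)
        have "g s x \<le> M" using Suc x s0 cs by simp
        moreover have "F r x \<le> M + E" if "s < r" "r < t" for r
        proof (rule Fle)
          show "AE y in lborel. p r y \<le> M + E" using ae[of r] that s0 t by (auto simp: p_def M0 E elim!: eventually_mono)
        qed (use that s0 in auto)
        ultimately show ?thesis using ode(3)[of x s t M E] xN s0 st small M0 E by blast
      qed
    qed
    have it: "\<forall>t x. 0 \<le> t \<longrightarrow> t \<le> T \<longrightarrow> x \<notin> N\<^sub>1 \<longrightarrow> g t x \<le> M + B / 2 ^ Suc i" for i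
    proof (induction i)
      case 0
      have "AE x in lborel. g t x \<le> M + B" if "0 \<le> t" "t \<le> T" for t
        using B(2)[OF that] M0 by (auto simp: AE_completion_iff elim!: eventually_mono)
      then show ?case using half[OF B(1)] by simp
    next
      case (Suc i)
      have "AE x in lborel. g t x \<le> M + B / 2 ^ Suc i" if "0 \<le> t" "t \<le> T" for t
        using N1 by eventually_elim (use Suc that in auto)
      then show ?case using half[of "B / 2 ^ Suc i"] B(1) by (simp add: field_simps)
    qed
    show ?case
    proof (intro allI impI)
      fix t x assume t: "0 \<le> t" "c * t \<le> real (Suc j) / 2" and x: "x \<notin> N\<^sub>1"
      then have tT: "t \<le> T" using cT c0 by (metis mult_le_cancel_left_pos)
      have "(\<lambda>i. M + B * (1/2) ^ Suc i) \<longlonglongrightarrow> M + B * 0"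
        by (intro tendsto_intros LIMSEQ_Suc LIMSEQ_realpow_zero) auto
      moreover have "g t x \<le> M + B * (1/2) ^ Suc i" for i using it[of i] t tT x by (simp add: power_divide)
      ultimately show "g t x \<le> M" using LIMSEQ_le_const[of _ "M + B * 0" "g t x"] by auto
    qed
  qed
  have gM: "g t x \<le> M" if "0 \<le> t" "x \<notin> N\<^sub>1" for t x
  proof -
    obtain j :: nat where "2 * (c * t) \<le> real j" using real_arch_simple by blast
    then show ?thesis using gup[of j] that by (auto simp: field_simps)
  qed
  have p0M: "0 \<le> p t x" "p t x \<le> M" if "0 \<le> t" "x \<notin> N\<^sub>1" for t x using gM[OF that] M0 by (auto simp: p_def)
  \<comment> \<open>A jointly measurable version: outside the null set \<open>N\<^sub>3\<close> the solution agrees with the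
    Borel versions at all rational times, and it is continuous in time, so it is a limit of
    step functions in time.\<close>
  have "AE x in lborel. x \<notin> N\<^sub>1 \<and> \<gamma>\<^sub>0 x = \<Gamma> x \<and> (\<forall>n i :: nat. g (real i / real (Suc n)) x = H (real i / real (Suc n)) x)"
    using N1 \<Gamma> Hg by (simp add: AE_all_countable)
  then obtain N\<^sub>3 where N3[measurable]: "N\<^sub>3 \<in> sets borel" and N3z: "emeasure lborel N\<^sub>3 = 0"
    and N3': "\<And>x. x \<notin> N\<^sub>3 \<Longrightarrow> x \<notin> N\<^sub>1 \<and> \<gamma>\<^sub>0 x = \<Gamma> x \<and> (\<forall>n i :: nat. g (real i / real (Suc n)) x = H (real i / real (Suc n)) x)"
    using AE_lborel_null by blast
  have AE3: "AE x in lborel. x \<notin> N\<^sub>3" using N3z N3 by (auto intro!: AE_I'[of N\<^sub>3] simp: null_sets_def)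
  have N31: "x \<notin> N\<^sub>1" "x \<notin> N" if "x \<notin> N\<^sub>3" for x using N3'[OF that] sub by auto
  define G where "G z = (if 0 \<le> fst z \<and> snd z \<notin> N\<^sub>3 then p (fst z) (snd z) else 0)" for z
  have Gm[measurable]: "G \<in> borel_measurable borel"
  proof -
    define Gn where "Gn n z = (if 0 \<le> fst z \<and> snd z \<notin> N\<^sub>3 then max (H (real (nat \<lfloor>real (Suc n) * fst z\<rfloor>) / real (Suc n)) (snd z)) 0 else 0)" for n and z :: "real \<times> 'a"
    have "Gn n \<in> borel_measurable (borel \<Otimes>\<^sub>M borel)" for n
    proof -
      have Hi[measurable]: "H (real i / real (Suc n)) \<in> borel_measurable borel" for i :: nat by (rule Hm) simp
      have "(\<lambda>z. H (real (nat \<lfloor>real (Suc n) * fst z\<rfloor>) / real (Suc n)) (snd z)) \<in> borel_measurable ((borel \<Otimes>\<^sub>M borel) :: (real \<times> 'a) measure)"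
        by (rule measurable_compose_countable[where f = "\<lambda>i z. H (real i / real (Suc n)) (snd z)" and g = "\<lambda>z. nat \<lfloor>real (Suc n) * fst z\<rfloor>"]) measurable
      then show ?thesis unfolding Gn_def by measurable
    qed
    moreover have "(\<lambda>n. Gn n z) \<longlonglongrightarrow> G z" for z
    proof (cases "0 \<le> fst z \<and> snd z \<notin> N\<^sub>3")
      case True
      let ?t = "fst z" and ?x = "snd z"
      define q where "q n = real (nat \<lfloor>real (Suc n) * ?t\<rfloor>) / real (Suc n)" for n
      have "Gn n z = p (q n) ?x" for n
      proof -
        have "g (q n) ?x = H (q n) ?x" unfolding q_def using N3'[of ?x] True by blast
        moreover have "Gn n z = max (H (q n) ?x) 0" using True[THEN conjunct1] True[THEN conjunct2] by (simp only: Gn_def q_def simp_thms if_True)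
        ultimately show ?thesis by (simp only: p_def)
      qed
      moreover have "(\<lambda>n. p (q n) ?x) \<longlonglongrightarrow> p ?t ?x"
      proof (rule continuous_on_tendsto_compose[OF pcont])
        show "?x \<notin> N" using N31 True by auto
        have qb: "?t - 1 / real (Suc n) \<le> q n" "q n \<le> ?t" for n
        proof -
          have "0 \<le> real (Suc n) * ?t" using True by simp
          then have "real (nat \<lfloor>real (Suc n) * ?t\<rfloor>) \<le> real (Suc n) * ?t" "real (Suc n) * ?t - 1 \<le> real (nat \<lfloor>real (Suc n) * ?t\<rfloor>)" by linarith+
          then have "q n \<le> (real (Suc n) * ?t) / real (Suc n)" "(real (Suc n) * ?t - 1) / real (Suc n) \<le> q n"
            unfolding q_def by (intro divide_right_mono; simp)+
          then show "q n \<le> ?t" "?t - 1 / real (Suc n) \<le> q n" by (simp_all add: diff_divide_distrib)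
        qed
        show "q \<longlonglongrightarrow> ?t"
        proof (rule tendsto_sandwich[of "\<lambda>n. ?t - 1 / real (Suc n)" q sequentially "\<lambda>_. ?t"])
          have "(\<lambda>n. ?t - 1 / real (Suc n)) \<longlonglongrightarrow> ?t - 0" by (intro tendsto_intros LIMSEQ_Suc[OF lim_1_over_n])
          then show "(\<lambda>n. ?t - 1 / real (Suc n)) \<longlonglongrightarrow> ?t" by simp
        qed (use qb in auto)
        show "?t \<in> {0..}" using True by simp
        show "\<forall>\<^sub>F n in sequentially. q n \<in> {0..}" by (simp add: q_def)
      qed
      ultimately show ?thesis using True by (simp add: G_def)
    qed (auto simp: Gn_def G_def)
    ultimately have "G \<in> borel_measurable (borel \<Otimes>\<^sub>M borel)" by (rule borel_measurable_LIMSEQ_metric)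
    then show ?thesis by (simp add: borel_prod)
  qed
  have Gm'[measurable]: "G \<in> borel_measurable (borel \<Otimes>\<^sub>M borel)" by (simp add: borel_prod)
  have G0: "0 \<le> G z" and GM: "G z \<le> M" for z using p0M N31 M0 by (auto simp: G_def)
  have Gp: "G (t, x) = p t x" if "0 \<le> t" "x \<notin> N\<^sub>3" for t x using that by (simp add: G_def)
  let ?w = "time_primitive G"
  have wW: "W t x = ?w (t, x)" if t: "0 \<le> t" and x: "x \<notin> N\<^sub>3" for t x
  proof -
    have "W t x = (LINT \<tau>|lebesgue. indicator {0..t} \<tau> * G (\<tau>, x))"
      unfolding W_def set_lebesgue_integral_def
      by (intro Bochner_Integration.integral_cong) (use Gp x in \<open>auto simp: indicator_def p_def\<close>)
    also have "\<dots> = (LINT \<tau>|lborel. indicator {0..t} \<tau> * G (\<tau>, x))"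
      by (rule integral_completion) measurable
    finally show ?thesis by (simp add: time_primitive_def)
  qed
  note w0 = bounded_time_primitive(2)[OF Gm G0 GM]
  \<comment> \<open>Averaging in space commutes with integration in time.\<close>
  have Favg: "(LINT \<tau>:{0..t}|lebesgue. F \<tau> x) = space_average k \<epsilon> ?w (t, x)" if t: "0 \<le> t" for t x
  proof -
    have FG: "F \<tau> x = (LINT y|lborel. k y * G (\<tau>, x - \<epsilon> *\<^sub>R y))" if "0 \<le> \<tau>" for \<tau>
      unfolding FH[OF that]
    proof (rule integral_cong_AE)
      note [measurable] = Hm[OF that]
      show "(\<lambda>y. k y * max (H \<tau> (x - \<epsilon> *\<^sub>R y)) 0) \<in> borel_measurable lborel" by measurable
      have "AE y in lborel. max (H \<tau> y) 0 = G (\<tau>, y)"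
        using Hg[OF that] AE3 by eventually_elim (simp add: Gp[OF that] p_def)
      then have "AE y in lborel. max (H \<tau> (x + (-\<epsilon>) *\<^sub>R y)) 0 = G (\<tau>, x + (-\<epsilon>) *\<^sub>R y)"
        by (rule AE_lborel_affine) (use \<epsilon> in simp)
      then show "AE y in lborel. k y * max (H \<tau> (x - \<epsilon> *\<^sub>R y)) 0 = k y * G (\<tau>, x - \<epsilon> *\<^sub>R y)" by eventually_elim simp
    qed measurable
    have I: "integrable (lborel \<Otimes>\<^sub>M lborel) (\<lambda>(\<tau>, y). indicator {0..t} \<tau> * (k y * G (\<tau>, x - \<epsilon> *\<^sub>R y)))"
    proof (rule Bochner_Integration.integrable_bound)
      show "integrable (lborel \<Otimes>\<^sub>M lborel) (\<lambda>z. indicat_real {0..t} (fst z) * (M * k (snd z)))"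
        by (rule integrable_product_functions) (use kint in \<open>auto intro: lborel.sigma_finite_measure_axioms\<close>)
      show "AE z in lborel \<Otimes>\<^sub>M lborel. norm (case z of (\<tau>, y) \<Rightarrow> indicator {0..t} \<tau> * (k y * G (\<tau>, x - \<epsilon> *\<^sub>R y))) \<le> norm (indicat_real {0..t} (fst z) * (M * k (snd z)))"
      proof (intro always_eventually allI)
        fix z :: "real \<times> 'a"
        obtain \<tau> y where z: "z = (\<tau>, y)" by (cases z)
        have "k y * G (\<tau>, x - \<epsilon> *\<^sub>R y) \<le> k y * M" by (intro mult_left_mono GM k0)
        then show "norm (case z of (\<tau>, y) \<Rightarrow> indicator {0..t} \<tau> * (k y * G (\<tau>, x - \<epsilon> *\<^sub>R y))) \<le> norm (indicat_real {0..t} (fst z) * (M * k (snd z)))"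
          using G0 k0[of y] M0 by (simp add: z indicator_def abs_mult abs_of_nonneg mult.commute[of M])
      qed
    qed measurable
    have "(LINT \<tau>:{0..t}|lebesgue. F \<tau> x) = (LINT \<tau>|lebesgue. (LINT y|lborel. indicator {0..t} \<tau> * (k y * G (\<tau>, x - \<epsilon> *\<^sub>R y))))"
      unfolding set_lebesgue_integral_def
      by (intro Bochner_Integration.integral_cong) (auto simp: FG indicator_def)
    also have "\<dots> = (LINT \<tau>|lborel. (LINT y|lborel. indicator {0..t} \<tau> * (k y * G (\<tau>, x - \<epsilon> *\<^sub>R y))))"
      by (rule integral_completion) measurable
    also have "\<dots> = (LINT y|lborel. (LINT \<tau>|lborel. indicator {0..t} \<tau> * (k y * G (\<tau>, x - \<epsilon> *\<^sub>R y))))"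
      by (rule lborel_pair.Fubini_integral[OF I, symmetric])
    also have "\<dots> = (LINT y|lborel. k y * ?w (t, x - \<epsilon> *\<^sub>R y))"
    proof (rule Bochner_Integration.integral_cong)
      fix y
      have "(LINT \<tau>|lborel. indicator {0..t} \<tau> * (k y * G (\<tau>, x - \<epsilon> *\<^sub>R y))) = (LINT \<tau>|lborel. k y * (indicator {0..t} \<tau> * G (\<tau>, x - \<epsilon> *\<^sub>R y)))"
        by (simp add: mult.left_commute)
      then show "(LINT \<tau>|lborel. indicator {0..t} \<tau> * (k y * G (\<tau>, x - \<epsilon> *\<^sub>R y))) = k y * ?w (t, x - \<epsilon> *\<^sub>R y)"
        by (simp add: time_primitive_def)
    qed simp
    finally show ?thesis by (simp add: space_average_def)
  qed
  have gW: "g t x = \<gamma>\<^sub>0 x + c * (space_average k \<epsilon> ?w (t, x) - W t x)" if "0 \<le> t" "x \<notin> N" for t x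
    using geq[OF that] set_integral_diff(2)[OF Fsi pint[OF that], of x] Favg[OF that(1), of x] by (simp add: W_def p_def)
  have Wdiff: "0 \<le> W t x - W s x \<and> W t x - W s x \<le> M * (t - s)" if x: "x \<notin> N\<^sub>1" and st: "0 \<le> s" "s \<le> t" for x s t
  proof -
    have xN: "x \<notin> N" using x sub by auto
    have pc: "continuous_on {a..b} (\<lambda>\<tau>. p \<tau> x)" if "0 \<le> a" for a b
      by (rule continuous_on_subset[OF pcont[OF xN]]) (use that in auto)
    have Wi: "W r x = integral {0..r} (\<lambda>\<tau>. p \<tau> x)" if "0 \<le> r" for r
      using set_lebesgue_eq_integral_Icc[OF pint[OF that xN]] by (simp add: W_def p_def)
    have "integral {0..s} (\<lambda>\<tau>. p \<tau> x) + integral {s..t} (\<lambda>\<tau>. p \<tau> x) = integral {0..t} (\<lambda>\<tau>. p \<tau> x)"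
      using st by (intro Henstock_Kurzweil_Integration.integral_combine integrable_continuous_real pc) auto
    then have eq: "W t x - W s x = integral {s..t} (\<lambda>\<tau>. p \<tau> x)" using Wi st by simp
    have "0 \<le> integral {s..t} (\<lambda>\<tau>. p \<tau> x)"
      using st p0M x by (intro integral_nonneg integrable_continuous_real pc) auto
    moreover have "integral {s..t} (\<lambda>\<tau>. p \<tau> x) \<le> integral {s..t} (\<lambda>\<tau>. M)"
      using st p0M x by (intro integral_le integrable_continuous_real pc) auto
    ultimately show ?thesis using eq st by (simp add: mult.commute)
  qed
  have avg: "\<bar>space_average k \<epsilon> ?w (t, x) - W t x\<bar> \<le> 2 * M * \<epsilon>\<^sup>2" if x: "x \<notin> N\<^sub>1" and t: "0 \<le> t" for x t
  proof -
    have "x \<notin> N" using x sub by auto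
    then have "c * (space_average k \<epsilon> ?w (t, x) - W t x) = g t x - \<gamma>\<^sub>0 x" using gW t by simp
    then have "space_average k \<epsilon> ?w (t, x) - W t x = (g t x - \<gamma>\<^sub>0 x) * \<epsilon>\<^sup>2" using \<epsilon> by (simp add: c_def field_simps)
    moreover have "\<bar>g t x - \<gamma>\<^sub>0 x\<bar> \<le> 2 * M" using glow[OF x t] gM[OF t x] \<gamma>M[OF x] by auto
    ultimately show ?thesis by (simp add: abs_mult mult_right_mono)
  qed
  \<comment> \<open>If the solution is negative at time \<open>t\<close>, it is negative on \<open>[0, t]\<close>, so \<open>w\<close> vanishes;
    otherwise \<open>G\<close> equals the solution.\<close>
  have compl: "\<forall>t\<ge>0. complementary (\<Gamma> x + nonlocal_diffusion k \<epsilon> ?w (t, x)) (G (t, x)) (?w (t, x))" if x: "x \<notin> N\<^sub>3" for x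
  proof (intro allI impI)
    fix t :: real assume t: "0 \<le> t"
    have xN: "x \<notin> N" using N31[OF x] by simp
    have eq: "\<Gamma> x + nonlocal_diffusion k \<epsilon> ?w (t, x) = g t x"
      using gW[OF t xN] wW[OF t x] N3'[OF x] by (simp add: c_def)
    have Gg: "G (t, x) = max (g t x) 0" using Gp[OF t x] by (simp add: p_def)
    have "?w (t, x) = 0" if neg: "g t x < 0"
    proof -
      have "g \<tau> x < 0" if "0 \<le> \<tau>" "\<tau> \<le> t" for \<tau> using ode(1)[of x \<tau> t] xN that neg by auto
      then have "p \<tau> x = 0" if "0 \<le> \<tau>" "\<tau> \<le> t" for \<tau> using that by (fastforce simp: p_def)
      then have "indicator {0..t} \<tau> * G (\<tau>, x) = 0" for \<tau> using Gp x by (auto simp: indicator_def)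
      then show ?thesis by (simp only: time_primitive_def fst_conv snd_conv Bochner_Integration.integral_zero)
    qed
    then show "complementary (\<Gamma> x + nonlocal_diffusion k \<epsilon> ?w (t, x)) (G (t, x)) (?w (t, x))"
      unfolding eq Gg by (cases "g t x < 0") auto
  qed
  have "AE x in lborel. \<forall>t\<ge>0. G (t, x) \<le> max (\<Gamma> x) 0 + space_average k \<epsilon> ?w (t, x) / \<epsilon>\<^sup>2"
    using AE3
  proof eventually_elim
    case (elim x)
    show ?case
    proof (intro allI impI)
      fix t :: real assume t: "0 \<le> t"
      have "g t x = \<Gamma> x + nonlocal_diffusion k \<epsilon> ?w (t, x)"
        using gW[OF t, of x] wW[OF t elim] N31[OF elim] N3'[OF elim] by (simp add: c_def)
      moreover have "nonlocal_diffusion k \<epsilon> ?w (t, x) \<le> space_average k \<epsilon> ?w (t, x) / \<epsilon>\<^sup>2"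
        using w0[of "(t, x)"] by (intro divide_right_mono) auto
      moreover have "0 \<le> space_average k \<epsilon> ?w (t, x) / \<epsilon>\<^sup>2"
        unfolding space_average_def using w0 k0 by (intro divide_nonneg_nonneg integral_nonneg_AE) auto
      ultimately show "G (t, x) \<le> max (\<Gamma> x) 0 + space_average k \<epsilon> ?w (t, x) / \<epsilon>\<^sup>2"
        using Gp[OF t elim] unfolding p_def by linarith
    qed
  qed
  note L1 = time_primitive_L1[OF k kint k1 k0 \<epsilon> Gm G0 GM \<Gamma>m \<Gamma>L1 this]
  have GL: "(\<integral>\<^sup>+z. ennreal (indicator (cylinder T) z * (G z)\<^sup>2) \<partial>lborel) < \<infinity>" if T: "0 < T" for T
    using bounded_time_primitive(5)[OF Gm G0 GM T] L1[of T] T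
    by (auto elim!: order.strict_trans1 simp: ennreal_mult_less_top)
  show ?thesis
  proof (rule that[of G])
    show "AE x in lborel. \<forall>t\<ge>0. W t x = ?w (t, x)" using AE3 by eventually_elim (use wW in auto)
    show "AE x in lborel. \<forall>t\<ge>0. complementary (\<Gamma> x + nonlocal_diffusion k \<epsilon> ?w (t, x)) (G (t, x)) (?w (t, x))"
      using AE3 by eventually_elim (rule compl)
  qed (use Gm G0 GM Wdiff avg GL in auto)
qed

section \<open>Smooth bump functions and the fundamental lemma\<close>

lemma partial_eq: "(f has_derivative f') (at x) \<Longrightarrow> partial b f x = f' b"
  unfolding partial_def by (metis frechet_derivative_at)

lemma Ck_on_SucI:
  assumes "\<And>x. (f has_derivative f' x) (at x)" and "\<And>b. b \<in> Basis \<Longrightarrow> Ck_on m UNIV (\<lambda>x. f' x b)"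
  shows "Ck_on (Suc m) UNIV f"
proof -
  have "partial b f = (\<lambda>x. f' x b)" for b using partial_eq[OF assms(1)] by auto
  then show ?thesis using assms by (auto simp: differentiable_on_def differentiable_def intro: has_derivative_at_withinI)
qed

lemma Ck_on_SucD:
  assumes "Ck_on (Suc m) UNIV f"
  shows "(f has_derivative (\<lambda>h. frechet_derivative f (at x) h)) (at x)" and "b \<in> Basis \<Longrightarrow> Ck_on m UNIV (partial b f)"
  using assms by (auto simp: differentiable_on_def frechet_derivative_works[symmetric])

lemma Ck_on_continuous: "Ck_on m UNIV f \<Longrightarrow> continuous_on UNIV f"
  by (cases m) (auto intro: differentiable_imp_continuous_on)

lemma Ck_on_mono: "Ck_on (Suc m) UNIV f \<Longrightarrow> Ck_on m UNIV f"
proof (induction m arbitrary: f)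
  case 0
  then show ?case using Ck_on_continuous by fastforce
next
  case (Suc m)
  then show ?case unfolding Ck_on.simps(2)[of "Suc m"] by (simp only: Ck_on.simps(2)[of m]) blast
qed

lemma Ck_on_const: "Ck_on m UNIV (\<lambda>x. c)"
proof (induction m arbitrary: c)
  case (Suc m)
  show ?case by (rule Ck_on_SucI[where f' = "\<lambda>_ _. 0"]) (use Suc in \<open>auto intro: derivative_eq_intros\<close>)
qed auto

lemma Ck_on_inner: "Ck_on m UNIV (\<lambda>x. x \<bullet> c)"
proof (cases m)
  case (Suc n)
  show ?thesis unfolding Suc by (rule Ck_on_SucI[where f' = "\<lambda>_ h. h \<bullet> c"]) (auto intro: derivative_eq_intros Ck_on_const)
qed (auto intro: continuous_intros)

lemma Ck_on_add: "Ck_on m UNIV f \<Longrightarrow> Ck_on m UNIV g \<Longrightarrow> Ck_on m UNIV (\<lambda>x. f x + g x)"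
proof (induction m arbitrary: f g)
  case (Suc m)
  have "Ck_on m UNIV (\<lambda>x. partial b f x + partial b g x)" if "b \<in> Basis" for b
    using Suc that by auto
  then show ?case
    by (intro Ck_on_SucI[where f' = "\<lambda>x h. frechet_derivative f (at x) h + frechet_derivative g (at x) h"])
       (auto intro!: has_derivative_add Ck_on_SucD(1) Suc.prems simp: partial_def simp del: Ck_on.simps)
qed (auto intro: continuous_intros)

lemma Ck_on_mult: "Ck_on m UNIV f \<Longrightarrow> Ck_on m UNIV g \<Longrightarrow> Ck_on m UNIV (\<lambda>x. f x * g x)"
proof (induction m arbitrary: f g)
  case (Suc m)
  have "Ck_on m UNIV (\<lambda>x. f x * partial b g x + partial b f x * g x)" if "b \<in> Basis" for b
    using Suc.IH Suc.prems that Ck_on_mono by (intro Ck_on_add Suc.IH) auto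
  then show ?case
    by (intro Ck_on_SucI[where f' = "\<lambda>x h. f x * frechet_derivative g (at x) h + frechet_derivative f (at x) h * g x"])
       (auto intro!: has_derivative_mult Ck_on_SucD(1) Suc.prems simp: partial_def simp del: Ck_on.simps)
qed (auto intro: continuous_intros)

lemma Ck_on_prod: "finite I \<Longrightarrow> (\<And>i. i \<in> I \<Longrightarrow> Ck_on m UNIV (f i)) \<Longrightarrow> Ck_on m UNIV (\<lambda>x. \<Prod>i\<in>I. f i x)"
  by (induction I rule: finite_induct) (auto intro: Ck_on_const Ck_on_mult)

text \<open>
  The functions \<open>p(1/s) exp(-1/s)\<close> continued by \<open>0\<close>: a family closed under differentiation,
  which makes their smoothness an induction.
\<close>

definition flat :: "real poly \<Rightarrow> real \<Rightarrow> real" where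
  "flat p s = (if 0 < s then poly p (1 / s) * exp (- (1 / s)) else 0)"

lemma poly_exp_decay: "((\<lambda>x. poly p x * exp (- x)) \<longlongrightarrow> 0) (at_top :: real filter)"
proof -
  have "((\<lambda>x. \<Sum>i\<le>degree p. coeff p i * (x ^ i / exp x)) \<longlongrightarrow> (\<Sum>i\<le>degree p. coeff p i * 0)) at_top"
    by (intro tendsto_intros tendsto_power_div_exp_0)
  moreover have "(\<Sum>i\<le>degree p. coeff p i * (x ^ i / exp x)) = poly p x * exp (- x)" for x
    by (simp add: poly_altdef sum_distrib_right exp_minus divide_inverse mult.assoc)
  ultimately show ?thesis by simp
qed

lemma has_derivative_flat:
  "(flat p has_real_derivative flat ([:0, 0, 1:] * (p - pderiv p)) s) (at s)"
proof (cases s "0 :: real" rule: linorder_cases)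
  case greater
  have "((\<lambda>s. poly p (1 / s) * exp (- (1 / s))) has_real_derivative flat ([:0, 0, 1:] * (p - pderiv p)) s) (at s)"
    using greater by (auto intro!: derivative_eq_intros DERIV_chain2[OF poly_DERIV] simp: flat_def field_simps power2_eq_square)
  then show ?thesis
    by (rule has_field_derivative_transform_within_open[of _ _ _ "{0<..}"]) (use greater in \<open>auto simp: flat_def\<close>)
next
  case less
  have "((\<lambda>s. 0) has_real_derivative flat ([:0, 0, 1:] * (p - pderiv p)) s) (at s)"
    using less by (simp add: flat_def)
  then show ?thesis
    by (rule has_field_derivative_transform_within_open[of _ _ _ "{..<0}"]) (use less in \<open>auto simp: flat_def\<close>)
next
  case equal
  have "((\<lambda>h. flat p h / h) \<longlongrightarrow> 0) (at 0)"
    unfolding filterlim_at_split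
  proof
    have "\<forall>\<^sub>F h in at_left (0::real). 0 = flat p h / h"
      by (auto simp: eventually_at_filter flat_def)
    then show "((\<lambda>h. flat p h / h) \<longlongrightarrow> 0) (at_left 0)" by (rule Lim_transform_eventually[OF tendsto_const])
    have "((\<lambda>h. poly ([:0,1:] * p) (inverse h) * exp (- inverse h)) \<longlongrightarrow> 0) (at_right (0::real))"
      by (rule filterlim_compose[OF poly_exp_decay filterlim_inverse_at_top_right])
    moreover have "\<forall>\<^sub>F h in at_right (0::real). poly ([:0,1:] * p) (inverse h) * exp (- inverse h) = flat p h / h"
      by (auto simp: eventually_at_filter flat_def field_simps)
    ultimately show "((\<lambda>h. flat p h / h) \<longlongrightarrow> 0) (at_right 0)" by (rule Lim_transform_eventually)
  qed
  then show ?thesis using equal by (simp add: DERIV_def flat_def)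
qed

lemma Ck_on_flat_comp:
  assumes "\<And>m. Ck_on m UNIV u"
  shows "Ck_on m UNIV (\<lambda>x. flat p (u x))"
proof (induction m arbitrary: p)
  case 0
  have "continuous_on UNIV (flat p)" by (rule DERIV_continuous_on) (rule has_field_derivative_at_within[OF has_derivative_flat])
  then show ?case using Ck_on_continuous[OF assms[of 0]] by (auto intro: continuous_on_compose2)
next
  case (Suc m)
  let ?q = "[:0, 0, 1:] * (p - pderiv p)"
  have d: "((\<lambda>x. flat p (u x)) has_derivative (\<lambda>h. flat ?q (u x) * frechet_derivative u (at x) h)) (at x)" for x
    using has_derivative_compose[OF Ck_on_SucD(1)[OF assms[of 1, unfolded One_nat_def]], of "flat p" "(*) (flat ?q (u x))" x]
      has_derivative_flat[of p "u x"] unfolding has_field_derivative_def by simp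
  have "Ck_on m UNIV (\<lambda>x. flat ?q (u x) * partial b u x)" if "b \<in> Basis" for b
    using Suc.IH Ck_on_SucD(2)[OF assms that] by (intro Ck_on_mult)
  then show ?case by (intro Ck_on_SucI[OF d]) (simp add: partial_def)
qed

text \<open>
  If \<open>a\<close> is below \<open>c\<close> in every coordinate and \<open>j > 0\<close>, this is positive exactly in the open box
  between them, and it increases to the indicator of the box as \<open>j \<rightarrow> \<infinity>\<close>.
\<close>

definition box_bump :: "'a::euclidean_space \<Rightarrow> 'a \<Rightarrow> real \<Rightarrow> 'a \<Rightarrow> real" where
  "box_bump a c j z = (\<Prod>b\<in>Basis. flat 1 (j * ((z \<bullet> b - a \<bullet> b) * (c \<bullet> b - z \<bullet> b))))"

lemma flat1: "0 \<le> flat 1 s" "flat 1 s \<le> 1" "flat 1 s = 0 \<longleftrightarrow> s \<le> 0"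
  by (auto simp: flat_def)

lemma flat1_lim: "0 < s \<Longrightarrow> (\<lambda>j. flat 1 (real (Suc j) * s)) \<longlonglongrightarrow> 1"
proof -
  assume s: "0 < s"
  have "(\<lambda>j. exp (- (1 / real (Suc j) * (1 / s)))) \<longlonglongrightarrow> exp (- (0 * (1 / s)))"
    by (intro tendsto_intros LIMSEQ_Suc[OF lim_1_over_n])
  then show ?thesis using s by (simp add: flat_def)
qed

context
  fixes a c :: "'a::euclidean_space"
  assumes ac: "\<And>b. b \<in> Basis \<Longrightarrow> a \<bullet> b < c \<bullet> b"
begin

lemma box_bump_bounds: "0 \<le> box_bump a c j z" "box_bump a c j z \<le> 1"
  unfolding box_bump_def by (auto intro!: prod_nonneg prod_le_1 flat1)

lemma box_bump_factor_pos: "b \<in> Basis \<Longrightarrow> 0 < (z \<bullet> b - a \<bullet> b) * (c \<bullet> b - z \<bullet> b) \<longleftrightarrow> a \<bullet> b < z \<bullet> b \<and> z \<bullet> b < c \<bullet> b"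
  using ac[of b] by (auto simp: zero_less_mult_iff)

lemma box_bump_nonzero: "0 < j \<Longrightarrow> box_bump a c j z \<noteq> 0 \<longleftrightarrow> z \<in> box a c"
  unfolding box_bump_def by (auto simp: prod_zero_iff flat1(3) not_le zero_less_mult_iff[of j] box_bump_factor_pos mem_box)

lemma box_bump_lim: "(\<lambda>j. box_bump a c (real (Suc j)) z) \<longlonglongrightarrow> indicator (box a c) z"
proof (cases "z \<in> box a c")
  case True
  have "(\<lambda>j. box_bump a c (real (Suc j)) z) \<longlonglongrightarrow> (\<Prod>b\<in>(Basis::'a set). 1)"
    unfolding box_bump_def by (intro tendsto_prod flat1_lim) (use True in \<open>auto simp: box_bump_factor_pos mem_box\<close>)
  then show ?thesis using True by simp
next
  case False
  then show ?thesis using box_bump_nonzero[of "real (Suc _)" z] by (auto simp: tendsto_eventually)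
qed

lemma box_bump_smooth: "Ck_on m UNIV (box_bump a c j)"
proof -
  have "Ck_on m UNIV (\<lambda>z. j * ((z \<bullet> b + (- (a \<bullet> b))) * (c \<bullet> b + (-1) * (z \<bullet> b))))" for m b
    by (intro Ck_on_mult Ck_on_add Ck_on_const Ck_on_inner)
  then have "Ck_on m UNIV (\<lambda>z. flat 1 (j * ((z \<bullet> b - a \<bullet> b) * (c \<bullet> b - z \<bullet> b))))" for b
    by (intro Ck_on_flat_comp) simp
  then show ?thesis unfolding box_bump_def[abs_def] by (intro Ck_on_prod) auto
qed

lemma box_bump_test:
  assumes "0 < j" "cbox a c \<subseteq> Q"
  shows "test_function Q (box_bump a c j)"
proof -
  have "{z. box_bump a c j z \<noteq> 0} = box a c" using box_bump_nonzero[OF assms(1)] by auto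
  then have sub: "closure {z. box_bump a c j z \<noteq> 0} \<subseteq> cbox a c"
    using closure_minimal[OF box_subset_cbox closed_cbox, of a c] by simp
  then have "compact (closure {z. box_bump a c j z \<noteq> 0})"
    using bounded_subset[OF bounded_cbox] by (simp add: compact_eq_bounded_closed)
  then show ?thesis using sub assms(2) box_bump_smooth by (auto simp: test_function_def smooth_on_def)
qed

end

text \<open>
  Testing with \<open>box_bump\<close> and letting \<open>j \<rightarrow> \<infinity>\<close> shows that \<open>f\<close> has integral \<open>0\<close> over every box in
  \<open>Q\<close>. By Lebesgue's differentiation theorem \<open>f\<close> is then \<open>0\<close> almost everywhere.
\<close>

theorem fundamental_lemma_variations:
  fixes f :: "'a::euclidean_space \<Rightarrow> real"
  assumes Q: "open Q" and f[measurable]: "f \<in> borel_measurable borel"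
    and loc: "\<And>a c. cbox a c \<subseteq> Q \<Longrightarrow> integrable lborel (\<lambda>z. indicator (cbox a c) z * f z)"
    and test: "\<And>\<phi>. test_function Q \<phi> \<Longrightarrow> (LINT z|lborel. f z * \<phi> z) = 0"
  shows "AE z in lborel. z \<in> Q \<longrightarrow> f z = 0"
proof -
  have box0: "(LINT z|lborel. indicator (box a c) z * f z) = 0"
    if sub: "cbox a c \<subseteq> Q" and ac: "\<And>b. b \<in> Basis \<Longrightarrow> a \<bullet> b < c \<bullet> b" for a c
  proof -
    have bm[measurable]: "box_bump a c j \<in> borel_measurable borel" for j
      using Ck_on_continuous[OF box_bump_smooth[OF ac, of 0]] by (rule borel_measurable_continuous_onI)
    have "(\<lambda>j. LINT z|lborel. f z * box_bump a c (real (Suc j)) z) \<longlonglongrightarrow> (LINT z|lborel. f z * indicator (box a c) z)"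
    proof (rule integral_dominated_convergence)
      show "integrable lborel (\<lambda>z. \<bar>indicator (cbox a c) z * f z\<bar>)" using loc[OF sub] by (rule integrable_abs)
      show "AE z in lborel. (\<lambda>j. f z * box_bump a c (real (Suc j)) z) \<longlonglongrightarrow> f z * indicator (box a c) z"
        by (intro always_eventually allI tendsto_mult tendsto_const box_bump_lim ac)
      show "AE z in lborel. norm (f z * box_bump a c (real (Suc j)) z) \<le> \<bar>indicator (cbox a c) z * f z\<bar>" for j
      proof (intro always_eventually allI)
        fix z
        show "norm (f z * box_bump a c (real (Suc j)) z) \<le> \<bar>indicator (cbox a c) z * f z\<bar>"
        proof (cases "z \<in> box a c")
          case True
          then have "z \<in> cbox a c" using box_subset_cbox by blast
          then show ?thesis using box_bump_bounds[OF ac, of "real (Suc j)" z]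
            by (simp add: abs_mult mult_left_le)
        next
          case False
          then have "box_bump a c (real (Suc j)) z = 0" using box_bump_nonzero[OF ac, of "real (Suc j)" z] by auto
          then show ?thesis by simp
        qed
      qed
    qed measurable
    moreover have "(LINT z|lborel. f z * box_bump a c (real (Suc j)) z) = 0" for j
      by (intro test box_bump_test ac sub) auto
    ultimately show ?thesis by (simp add: mult.commute LIMSEQ_const_iff)
  qed
  have local0: "AE z in lborel. z \<in> box A C \<longrightarrow> f z = 0" if sub: "cbox A C \<subseteq> Q" for A C
  proof -
    \<comment> \<open>The differentiation theorem is applied to \<open>f\<close> cut off outside the box; cubes that
      start at an interior point stay inside the box when they are small.\<close>
    define g where "g z = (if z \<in> box A C then f z else 0)" for z
    have fi: "set_integrable lebesgue (cbox A C) f"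
      using loc[OF sub] by (simp add: set_integrable_def integrable_completion)
    then have fi': "set_integrable lebesgue (box A C) f"
      by (rule set_integrable_subset) (auto intro: box_subset_cbox[THEN subsetD])
    have "f integrable_on box A C" using set_lebesgue_integral_eq_integral(1)[OF fi'] .
    then have "g integrable_on UNIV" unfolding g_def[abs_def] using integrable_restrict_UNIV[of "box A C" f] by (simp add: if_distrib)
    then have "g integrable_on cbox p q" for p q by (rule integrable_on_subcbox) auto
    then obtain N where N: "negligible N" and lim: "\<And>x e. x \<notin> N \<Longrightarrow> 0 < e \<Longrightarrow>
          \<exists>d>0. \<forall>h. 0 < h \<and> h < d \<longrightarrow> norm (integral (cbox x (x + h *\<^sub>R One)) g /\<^sub>R h ^ DIM('a) - g x) < e"
      using integrable_ccontinuous_explicit[of g] by blast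
    have "f x = 0" if x: "x \<in> box A C" "x \<notin> N" for x
    proof (rule ccontr)
      assume "f x \<noteq> 0"
      then obtain d where d: "d > 0" "\<And>h. 0 < h \<Longrightarrow> h < d \<Longrightarrow> norm (integral (cbox x (x + h *\<^sub>R One)) g /\<^sub>R h ^ DIM('a) - g x) < \<bar>f x\<bar>"
        using lim[OF x(2), of "\<bar>f x\<bar>"] by auto
      define m where "m = Min ((\<lambda>b. C \<bullet> b - x \<bullet> b) ` (Basis :: 'a set))"
      have m: "0 < m" "\<And>b. b \<in> Basis \<Longrightarrow> m \<le> C \<bullet> b - x \<bullet> b" using x(1) by (auto simp: m_def mem_box)
      define h where "h = min d m / 2"
      have h: "0 < h" "h < d" "h < m" using d m by (auto simp: h_def)
      let ?q = "x + h *\<^sub>R One"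
      have lt: "x \<bullet> b < ?q \<bullet> b" if "b \<in> Basis" for b using h that by (simp add: inner_add_left)
      have inbox: "cbox x ?q \<subseteq> box A C"
      proof
        fix y assume y: "y \<in> cbox x ?q"
        show "y \<in> box A C" unfolding mem_box
        proof
          fix b :: 'a assume b: "b \<in> Basis"
          have "x \<bullet> b \<le> y \<bullet> b" "y \<bullet> b \<le> x \<bullet> b + h" using y b by (auto simp: mem_box inner_add_left)
          moreover have "A \<bullet> b < x \<bullet> b" using x(1) b by (auto simp: mem_box)
          ultimately show "A \<bullet> b < y \<bullet> b \<and> y \<bullet> b < C \<bullet> b" using m(2)[OF b] h by auto
        qed
      qed
      then have subQ: "cbox x ?q \<subseteq> Q" using sub box_subset_cbox by blast
      have "set_integrable lebesgue (cbox x ?q) f" using loc[OF subQ] by (simp add: set_integrable_def integrable_completion)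
      then have si: "set_integrable lebesgue (box x ?q) f"
        by (rule set_integrable_subset) (auto intro: box_subset_cbox[THEN subsetD])
      have "integral (cbox x ?q) g = integral (cbox x ?q) f"
        by (rule Henstock_Kurzweil_Integration.integral_cong) (use inbox in \<open>auto simp: g_def\<close>)
      also have "\<dots> = integral (box x ?q) f" by (rule integral_open_interval[symmetric])
      also have "\<dots> = (LINT z:box x ?q|lebesgue. f z)" by (rule set_lebesgue_integral_eq_integral(2)[OF si, symmetric])
      also have "\<dots> = (LINT z|lborel. indicator (box x ?q) z * f z)"
        unfolding set_lebesgue_integral_def by (subst integral_completion) auto
      also have "\<dots> = 0" by (rule box0[OF subQ lt])
      finally show False using d(2)[OF h(1,2)] x(1) by (simp add: g_def)
    qed
    moreover have "AE z in lebesgue. z \<notin> N" using N by (auto simp: negligible_iff_null_sets intro!: AE_I'[of N])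
    ultimately show ?thesis by (auto simp: AE_completion_iff elim!: eventually_mono)
  qed
  obtain D where D: "countable D" "D \<subseteq> Pow Q" "\<And>X. X \<in> D \<Longrightarrow> \<exists>a b. X = cbox a b" "\<Union>D = Q"
    using open_countable_Union_open_cbox[OF Q] by metis
  have "AE z in lborel. \<forall>X\<in>D. z \<in> X \<longrightarrow> f z = 0"
  proof (subst AE_ball_countable[OF D(1)], intro ballI)
    fix X assume X: "X \<in> D"
    then obtain A C where AC: "X = cbox A C" using D(3) by blast
    have "AE z in lborel. z \<notin> cbox A C - box A C"
      by (rule AE_I'[of "cbox A C - box A C"]) (auto simp: null_sets_def emeasure_Diff emeasure_lborel_cbox_eq emeasure_lborel_box_eq box_subset_cbox)
    moreover have "AE z in lborel. z \<in> box A C \<longrightarrow> f z = 0" using local0[of A C] D(2) X AC by auto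
    ultimately show "AE z in lborel. z \<in> X \<longrightarrow> f z = 0" unfolding AC by eventually_elim auto
  qed
  then show ?thesis by eventually_elim (use D(4) in blast)
qed

section \<open>Translations in \<open>L\<^sup>2\<close>\<close>

lemma square_add3_le: "(a + b + c)\<^sup>2 \<le> 3 * a\<^sup>2 + 3 * b\<^sup>2 + 3 * (c::real)\<^sup>2"
  using zero_le_power2[of "a - b"] zero_le_power2[of "b - c"] zero_le_power2[of "a - c"]
  by (simp add: power2_eq_square algebra_simps)

lemma square_diff_le: "(a - b)\<^sup>2 \<le> 2 * a\<^sup>2 + 2 * (b::real)\<^sup>2"
  using zero_le_power2[of "a + b"] by (simp add: power2_eq_square algebra_simps)

lemma nn_integral_seq_small:
  assumes "(\<lambda>n. \<integral>\<^sup>+z. f n z \<partial>M) \<longlonglongrightarrow> 0" "0 < (\<eta>::real)"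
  shows "\<exists>n::nat. (\<integral>\<^sup>+z. f n z \<partial>M) \<le> ennreal \<eta>"
proof -
  have "\<forall>\<^sub>F n in sequentially. (\<integral>\<^sup>+z. f n z \<partial>M) < ennreal \<eta>"
    using order_tendstoD(2)[OF assms(1), of "ennreal \<eta>"] assms(2) by simp
  then show ?thesis by (auto simp: eventually_sequentially intro: less_imp_le)
qed

text \<open>
  Truncate \<open>f\<close> in range and domain, approximate the truncation pointwise by continuous
  functions, and truncate these in the same way, so that dominated convergence applies.
\<close>

lemma L2_continuous_approximation:
  fixes f :: "'a::euclidean_space \<Rightarrow> real"
  assumes f[measurable]: "f \<in> borel_measurable borel" and fL2: "sqnorm f < \<infinity>" and \<eta>: "0 < \<eta>"
  obtains g R where "continuous_on UNIV g" "\<And>z. R < norm z \<Longrightarrow> g z = 0" "(\<integral>\<^sup>+z. ennreal ((f z - g z)\<^sup>2) \<partial>lborel) \<le> ennreal \<eta>"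
proof -
  define F where "F n z = (if norm z \<le> real n then max (- real n) (min (real n) (f z)) else 0)" for n :: nat and z
  have Fm[measurable]: "F n \<in> borel_measurable borel" for n unfolding F_def by measurable
  have "(\<lambda>n. \<integral>\<^sup>+z. ennreal ((f z - F n z)\<^sup>2) \<partial>lborel) \<longlonglongrightarrow> (\<integral>\<^sup>+z. 0 \<partial>(lborel :: 'a measure))"
  proof (rule nn_integral_dominated_convergence[where w = "\<lambda>z. ennreal ((f z)\<^sup>2)"])
    show "AE z in lborel. ennreal ((f z - F n z)\<^sup>2) \<le> ennreal ((f z)\<^sup>2)" for n
      by (intro always_eventually allI ennreal_leI) (auto simp: F_def abs_le_square_iff[symmetric])
    show "AE z in lborel. (\<lambda>n. ennreal ((f z - F n z)\<^sup>2)) \<longlonglongrightarrow> 0"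
    proof (rule AE_I2, rule tendsto_eventually)
      fix z
      obtain n0 :: nat where "max (norm z) \<bar>f z\<bar> \<le> real n0" using real_arch_simple by blast
      then have "f z - F n z = 0" if "n0 \<le> n" for n using that by (auto simp: F_def)
      then show "\<forall>\<^sub>F n in sequentially. ennreal ((f z - F n z)\<^sup>2) = 0" unfolding eventually_sequentially by fastforce
    qed
  qed (use fL2 in auto)
  then obtain n where n: "(\<integral>\<^sup>+z. ennreal ((f z - F n z)\<^sup>2) \<partial>lborel) \<le> ennreal (\<eta>/4)"
    using nn_integral_seq_small[of lborel "\<lambda>n z. ennreal ((f z - F n z)\<^sup>2)" "\<eta>/4"] \<eta> by auto
  have "F n \<in> borel_measurable (lebesgue_on UNIV)" by (auto simp: lebesgue_on_UNIV_eq intro: measurable_completion)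
  then have "F n measurable_on UNIV" by (subst measurable_on_iff_borel_measurable) auto
  then obtain N g where N: "negligible N" and g: "\<And>m::nat. continuous_on UNIV (g m)" and lim: "\<And>z. z \<notin> N \<Longrightarrow> (\<lambda>m. g m z) \<longlonglongrightarrow> F n z"
    by (auto simp: measurable_on_def)
  define cutoff where "cutoff z = max 0 (min 1 (real n + 1 - norm z))" for z :: 'a
  define h where "h m z = max (- real n) (min (real n) (g m z)) * cutoff z" for m z
  have hc: "continuous_on UNIV (h m)" for m unfolding h_def cutoff_def by (intro continuous_intros g)
  have hm[measurable]: "h m \<in> borel_measurable borel" for m using hc by (rule borel_measurable_continuous_onI)
  have "(\<lambda>m. \<integral>\<^sup>+z. ennreal ((F n z - h m z)\<^sup>2) \<partial>lborel) \<longlonglongrightarrow> (\<integral>\<^sup>+z. 0 \<partial>(lborel :: 'a measure))"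
  proof (rule nn_integral_dominated_convergence[where w = "\<lambda>z. ennreal ((2 * real n)\<^sup>2) * indicator (cball 0 (real n + 1)) z"])
    show "AE z in lborel. ennreal ((F n z - h m z)\<^sup>2) \<le> ennreal ((2 * real n)\<^sup>2) * indicator (cball 0 (real n + 1)) z" for m
    proof (intro always_eventually allI)
      fix z :: 'a
      show "ennreal ((F n z - h m z)\<^sup>2) \<le> ennreal ((2 * real n)\<^sup>2) * indicator (cball 0 (real n + 1)) z"
      proof (cases "norm z \<le> real n + 1")
        case True
        have "\<bar>F n z\<bar> \<le> real n" by (auto simp: F_def)
        moreover have "\<bar>h m z\<bar> \<le> real n * 1"
          unfolding h_def abs_mult by (intro mult_mono) (auto simp: cutoff_def)
        ultimately have "\<bar>F n z - h m z\<bar> \<le> \<bar>2 * real n\<bar>" by linarith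
        then have "(F n z - h m z)\<^sup>2 \<le> (2 * real n)\<^sup>2" by (simp only: abs_le_square_iff)
        then show ?thesis using True by (simp add: ennreal_leI)
      qed (auto simp: F_def h_def cutoff_def)
    qed
    have "AE z in lebesgue. z \<notin> N" using N by (auto simp: negligible_iff_null_sets intro!: AE_I'[of N])
    then have "AE z in lborel. z \<notin> N" by (simp add: AE_completion_iff)
    then show "AE z in lborel. (\<lambda>m. ennreal ((F n z - h m z)\<^sup>2)) \<longlonglongrightarrow> 0"
    proof eventually_elim
      case (elim z)
      have "(\<lambda>m. h m z) \<longlonglongrightarrow> max (- real n) (min (real n) (F n z)) * cutoff z"
        unfolding h_def by (intro tendsto_intros lim elim)
      moreover have "max (- real n) (min (real n) (F n z)) * cutoff z = F n z" by (auto simp: F_def cutoff_def)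
      ultimately have "(\<lambda>m. ennreal ((F n z - h m z)\<^sup>2)) \<longlonglongrightarrow> ennreal ((F n z - F n z)\<^sup>2)"
        by (intro tendsto_ennrealI tendsto_intros) simp
      then show ?case by simp
    qed
    have "emeasure lborel (cball (0::'a) (real n + 1)) < \<infinity>" by (rule emeasure_lborel_cball_finite)
    then show "(\<integral>\<^sup>+z. ennreal ((2 * real n)\<^sup>2) * indicator (cball 0 (real n + 1)) z \<partial>(lborel::'a measure)) < \<infinity>"
      by (subst nn_integral_cmult_indicator) (auto simp: ennreal_mult_less_top)
  qed (auto intro!: borel_measurable_times_ennreal borel_measurable_indicator)
  then obtain m where m: "(\<integral>\<^sup>+z. ennreal ((F n z - h m z)\<^sup>2) \<partial>lborel) \<le> ennreal (\<eta>/4)"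
    using nn_integral_seq_small[of lborel "\<lambda>m z. ennreal ((F n z - h m z)\<^sup>2)" "\<eta>/4"] \<eta> by auto
  show ?thesis
  proof (rule that[of "h m" "real n + 1"])
    show "h m z = 0" if "real n + 1 < norm z" for z using that by (simp add: h_def cutoff_def)
    have "(\<integral>\<^sup>+z. ennreal ((f z - h m z)\<^sup>2) \<partial>lborel) \<le> (\<integral>\<^sup>+z. 2 * ennreal ((f z - F n z)\<^sup>2) + 2 * ennreal ((F n z - h m z)\<^sup>2) \<partial>lborel)"
    proof (rule nn_integral_mono)
      fix z
      have "ennreal ((f z - h m z)\<^sup>2) \<le> ennreal (2 * (f z - F n z)\<^sup>2 + 2 * (F n z - h m z)\<^sup>2)"
        using square_diff_le[of "f z - F n z" "h m z - F n z"] by (intro ennreal_leI) (simp add: power2_commute)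
      also have "\<dots> = 2 * ennreal ((f z - F n z)\<^sup>2) + 2 * ennreal ((F n z - h m z)\<^sup>2)"
        by (simp add: ennreal_plus ennreal_mult')
      finally show "ennreal ((f z - h m z)\<^sup>2) \<le> 2 * ennreal ((f z - F n z)\<^sup>2) + 2 * ennreal ((F n z - h m z)\<^sup>2)" .
    qed
    also have "\<dots> = 2 * (\<integral>\<^sup>+z. ennreal ((f z - F n z)\<^sup>2) \<partial>lborel) + 2 * (\<integral>\<^sup>+z. ennreal ((F n z - h m z)\<^sup>2) \<partial>lborel)"
      by (subst nn_integral_add) (auto simp: nn_integral_cmult)
    also have "\<dots> \<le> 2 * ennreal (\<eta>/4) + 2 * ennreal (\<eta>/4)" by (intro add_mono mult_left_mono n m) auto
    also have "\<dots> = ennreal \<eta>"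
    proof -
      have "2 * ennreal (\<eta>/4) = ennreal (\<eta>/2)" using ennreal_mult'[of 2 "\<eta>/4"] by simp
      then show ?thesis using ennreal_plus[of "\<eta>/2" "\<eta>/2"] \<eta> by simp
    qed
    finally show "(\<integral>\<^sup>+z. ennreal ((f z - h m z)\<^sup>2) \<partial>lborel) \<le> ennreal \<eta>" .
  qed (rule hc)
qed

text \<open>
  Clear for a continuous function of compact support, by uniform continuity; the approximation
  error enters twice, since translation preserves the norm.
\<close>

theorem L2_translation_continuous:
  fixes f :: "'a::euclidean_space \<Rightarrow> real"
  assumes f[measurable]: "f \<in> borel_measurable borel" and fL2: "sqnorm f < \<infinity>"
  shows "((\<lambda>h. \<integral>\<^sup>+z. ennreal ((f (z - h) - f z)\<^sup>2) \<partial>lborel) \<longlongrightarrow> 0) (at 0)"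
proof (rule order_tendstoI)
  fix e :: ennreal assume "0 < e"
  then obtain \<eta> :: real where \<eta>: "0 < \<eta>" "ennreal \<eta> < e"
  proof -
    obtain c where c: "0 < c" "c < e" using dense[OF \<open>0 < e\<close>] by blast
    then show ?thesis by (cases c) (auto intro: that)
  qed
  obtain g R where g: "continuous_on UNIV g" "\<And>z. R < norm z \<Longrightarrow> g z = 0" and fg: "(\<integral>\<^sup>+z. ennreal ((f z - g z)\<^sup>2) \<partial>lborel) \<le> ennreal (\<eta>/9)"
    using L2_continuous_approximation[OF f fL2, of "\<eta>/9"] \<eta> by auto
  have gm[measurable]: "g \<in> borel_measurable borel" using g(1) by (rule borel_measurable_continuous_onI)
  define V where "V = measure lborel (cball (0::'a) (R + 1))"
  have VE: "emeasure lborel (cball (0::'a) (R + 1)) = ennreal V"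
    unfolding V_def using emeasure_lborel_cball_finite[of "0::'a" "R+1"] by (intro emeasure_eq_ennreal_measure) auto
  \<comment> \<open>A third of \<open>\<eta>\<close> for each of the three terms, after the factor \<open>3\<close> from squaring a sum
    of three terms; \<open>s\<close> bounds the increment of \<open>g\<close> on a ball of volume \<open>V\<close>.\<close>
  define s where "s = sqrt (\<eta> / (9 * (V + 1)))"
  have V0: "0 \<le> V" by (simp add: V_def)
  have s: "0 < s" "s\<^sup>2 * V \<le> \<eta> / 9" using \<eta> V0 by (auto simp: s_def field_simps)
  have "uniformly_continuous_on (cball 0 (R + 2)) g"
    by (rule compact_uniformly_continuous) (auto intro: continuous_on_subset[OF g(1)])
  then obtain d where d: "0 < d" "\<And>x y. x \<in> cball 0 (R+2) \<Longrightarrow> y \<in> cball 0 (R+2) \<Longrightarrow> dist y x < d \<Longrightarrow> dist (g y) (g x) < s"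
    using s(1) unfolding uniformly_continuous_on_def by blast
  have small: "(\<integral>\<^sup>+z. ennreal ((f (z - h) - f z)\<^sup>2) \<partial>lborel) < e" if h: "norm h < min d 1" for h
  proof -
    have gd: "(g (z - h) - g z)\<^sup>2 \<le> s\<^sup>2 * indicator (cball 0 (R + 1)) z" for z
    proof (cases "norm z \<le> R + 1")
      case True
      have "norm (z - h) \<le> R + 2" using True h norm_triangle_ineq4[of z h] by simp
      then have "dist (g (z - h)) (g z) < s" using True h by (intro d(2)) (auto simp: dist_norm norm_minus_commute)
      then have "\<bar>g (z - h) - g z\<bar> \<le> \<bar>s\<bar>" using s by (simp add: dist_real_def)
      then show ?thesis using True by (simp only: abs_le_square_iff) simp
    next
      case False
      have "norm z \<le> norm (z - h) + norm h" using norm_triangle_sub[of z h] by (simp add: norm_minus_commute add.commute)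
      then have "R < norm (z - h)" using False h by simp
      then show ?thesis using g(2) False by simp
    qed
    have "(\<integral>\<^sup>+z. ennreal ((f (z - h) - f z)\<^sup>2) \<partial>lborel)
       \<le> (\<integral>\<^sup>+z. 3 * ennreal ((f (z - h) - g (z - h))\<^sup>2) + 3 * (ennreal (s\<^sup>2) * indicator (cball 0 (R + 1)) z) + 3 * ennreal ((f z - g z)\<^sup>2) \<partial>lborel)"
    proof (rule nn_integral_mono)
      fix z
      have "(f (z - h) - f z)\<^sup>2 \<le> 3 * (f (z - h) - g (z - h))\<^sup>2 + 3 * (g (z - h) - g z)\<^sup>2 + 3 * (g z - f z)\<^sup>2"
        using square_add3_le[of "f (z - h) - g (z - h)" "g (z - h) - g z" "g z - f z"] by simp
      also have "\<dots> \<le> 3 * (f (z - h) - g (z - h))\<^sup>2 + 3 * (s\<^sup>2 * indicator (cball 0 (R + 1)) z) + 3 * (f z - g z)\<^sup>2"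
        using gd[of z] by (simp add: power2_commute)
      finally have "ennreal ((f (z - h) - f z)\<^sup>2) \<le> ennreal (3 * (f (z - h) - g (z - h))\<^sup>2 + 3 * (s\<^sup>2 * indicator (cball 0 (R + 1)) z) + 3 * (f z - g z)\<^sup>2)"
        by (rule ennreal_leI)
      also have "\<dots> = 3 * ennreal ((f (z - h) - g (z - h))\<^sup>2) + 3 * (ennreal (s\<^sup>2) * indicator (cball 0 (R + 1)) z) + 3 * ennreal ((f z - g z)\<^sup>2)"
        by (simp add: ennreal_plus ennreal_mult' ennreal_indicator)
      finally show "ennreal ((f (z - h) - f z)\<^sup>2) \<le> \<dots>" .
    qed
    also have "\<dots> = 3 * (\<integral>\<^sup>+z. ennreal ((f (z - h) - g (z - h))\<^sup>2) \<partial>lborel) + 3 * (ennreal (s\<^sup>2) * ennreal V) + 3 * (\<integral>\<^sup>+z. ennreal ((f z - g z)\<^sup>2) \<partial>lborel)"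
    proof -
      have [measurable]: "(\<lambda>z. ennreal ((f (z - h) - g (z - h))\<^sup>2)) \<in> borel_measurable lborel"
        "(\<lambda>z. ennreal ((f z - g z)\<^sup>2)) \<in> borel_measurable lborel" by auto
      have [measurable]: "(\<lambda>z. ennreal (s\<^sup>2) * indicator (cball 0 (R + 1)) z) \<in> borel_measurable (lborel :: 'a measure)"
        by (intro borel_measurable_times_ennreal borel_measurable_indicator) auto
      show ?thesis
        by (subst nn_integral_add, measurable, subst nn_integral_add, measurable)
           (simp add: nn_integral_cmult nn_integral_cmult_indicator VE)
    qed
    also have "(\<integral>\<^sup>+z. ennreal ((f (z - h) - g (z - h))\<^sup>2) \<partial>lborel) = (\<integral>\<^sup>+z. ennreal ((f z - g z)\<^sup>2) \<partial>lborel)"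
      by (rule nn_integral_lborel_shift(2)) measurable
    also have "3 * (\<integral>\<^sup>+z. ennreal ((f z - g z)\<^sup>2) \<partial>lborel) + 3 * (ennreal (s\<^sup>2) * ennreal V) + 3 * (\<integral>\<^sup>+z. ennreal ((f z - g z)\<^sup>2) \<partial>lborel)
       \<le> 3 * ennreal (\<eta>/9) + 3 * ennreal (\<eta>/9) + 3 * ennreal (\<eta>/9)"
      using s(2) V0 by (intro add_mono mult_left_mono fg) (auto simp: ennreal_mult[symmetric] intro!: ennreal_leI)
    also have "\<dots> = ennreal \<eta>"
    proof -
      have "3 * ennreal (\<eta>/9) = ennreal (\<eta>/3)" using ennreal_mult'[of 3 "\<eta>/9"] by simp
      then show ?thesis using ennreal_plus[of "\<eta>/3" "\<eta>/3"] ennreal_plus[of "2*\<eta>/3" "\<eta>/3"] \<eta> by simp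
    qed
    finally show ?thesis using \<eta>(2) by (rule order.strict_trans1)
  qed
  show "\<forall>\<^sub>F h in at 0. (\<integral>\<^sup>+z. ennreal ((f (z - h) - f z)\<^sup>2) \<partial>lborel) < e"
    unfolding eventually_at by (rule exI[of _ "min d 1"]) (use d small in \<open>auto simp: dist_norm\<close>)
qed auto

lemma abs_mult_le_squares: "\<bar>a * b\<bar> \<le> a\<^sup>2 + (b::real)\<^sup>2"
proof -
  have "2 * (\<bar>a\<bar> * \<bar>b\<bar>) \<le> a\<^sup>2 + b\<^sup>2" using sum_squares_bound[of "\<bar>a\<bar>" "\<bar>b\<bar>"] by (simp add: mult.assoc)
  moreover have "0 \<le> \<bar>a\<bar> * \<bar>b\<bar>" by simp
  ultimately show ?thesis unfolding abs_mult by linarith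
qed

lemma L2_integrable_square:
  fixes f :: "'a::euclidean_space \<Rightarrow> real"
  assumes [measurable]: "f \<in> borel_measurable borel" and "sqnorm f < \<infinity>"
  shows "integrable lborel (\<lambda>z. (f z)\<^sup>2)"
  using assms(2) by (intro integrableI_nonneg) auto

lemma integrable_mult_L2:
  fixes f g :: "'a::euclidean_space \<Rightarrow> real"
  assumes [measurable]: "f \<in> borel_measurable borel" "g \<in> borel_measurable borel"
    and "sqnorm f < \<infinity>" "sqnorm g < \<infinity>"
  shows "integrable lborel (\<lambda>z. f z * g z)"
proof (rule Bochner_Integration.integrable_bound)
  show "integrable lborel (\<lambda>z. (f z)\<^sup>2 + (g z)\<^sup>2)" using assms by (intro Bochner_Integration.integrable_add L2_integrable_square)
  show "AE z in lborel. norm (f z * g z) \<le> norm ((f z)\<^sup>2 + (g z)\<^sup>2)"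
    using abs_mult_le_squares by (intro AE_I2) (simp add: abs_of_nonneg)
qed measurable

lemma integrable_shift_product:
  fixes m :: "'p::euclidean_space \<Rightarrow> real" and q :: "'x::euclidean_space \<Rightarrow> real"
  assumes m: "integrable lborel m" and q: "integrable lborel q" and s[measurable]: "s \<in> borel_measurable borel"
  shows "integrable (lborel \<Otimes>\<^sub>M lborel) (\<lambda>(p, z). m p * q (z - s p))"
proof -
  have [measurable]: "m \<in> borel_measurable borel" "q \<in> borel_measurable borel" using m q by auto
  have I: "(LINT z|lborel. \<bar>q (z - s p)\<bar>) = (LINT z|lborel. \<bar>q z\<bar>)" for p
    by (rule integral_lborel_shift(2)) measurable
  show ?thesis
  proof (rule lborel_pair.Fubini_integrable)
    show "integrable lborel (\<lambda>p. LINT z|lborel. norm (case (p, z) of (p, z) \<Rightarrow> m p * q (z - s p)))"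
      using m by (simp add: abs_mult I)
    show "AE p in lborel. integrable lborel (\<lambda>z. case (p, z) of (p, z) \<Rightarrow> m p * q (z - s p))"
      using integrable_lborel_affine[OF q, of 1 "- s _"] by (auto simp: add.commute)
  qed measurable
qed

text \<open>
  Provides the hypothesis of Fubini's theorem in each exchange of a spatial average with a
  pairing.
\<close>

lemma integrable_shift_pairing:
  fixes m :: "'p::euclidean_space \<Rightarrow> real" and f \<zeta> :: "'x::euclidean_space \<Rightarrow> real"
  assumes m: "integrable lborel m" and s[measurable]: "s \<in> borel_measurable borel"
    and f[measurable]: "f \<in> borel_measurable borel" and fL: "sqnorm f < \<infinity>"
    and \<zeta>[measurable]: "\<zeta> \<in> borel_measurable borel" and \<zeta>L: "sqnorm \<zeta> < \<infinity>"
  shows "integrable (lborel \<Otimes>\<^sub>M lborel) (\<lambda>(p, z). m p * (f (z - s p) * \<zeta> z))"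
proof (rule Bochner_Integration.integrable_bound)
  have "integrable (lborel \<Otimes>\<^sub>M lborel) (\<lambda>x. (\<lambda>(p, z). \<bar>m p\<bar> * (f (z - s p))\<^sup>2) x + (\<lambda>(p, z). \<bar>m p\<bar> * (\<zeta> (z - (\<lambda>_. 0) p))\<^sup>2) x)"
    by (intro Bochner_Integration.integrable_add integrable_shift_product[where q = "\<lambda>z. (f z)\<^sup>2"]
        integrable_shift_product[where q = "\<lambda>z. (\<zeta> z)\<^sup>2"] integrable_abs m L2_integrable_square f fL \<zeta> \<zeta>L s) simp
  then show "integrable (lborel \<Otimes>\<^sub>M lborel) (\<lambda>(p, z). \<bar>m p\<bar> * ((f (z - s p))\<^sup>2 + (\<zeta> z)\<^sup>2))"
    by (simp add: case_prod_unfold distrib_left)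
  show "AE x in lborel \<Otimes>\<^sub>M lborel. norm (case x of (p, z) \<Rightarrow> m p * (f (z - s p) * \<zeta> z)) \<le> norm (case x of (p, z) \<Rightarrow> \<bar>m p\<bar> * ((f (z - s p))\<^sup>2 + (\<zeta> z)\<^sup>2))"
    using abs_mult_le_squares by (intro AE_I2) (auto simp: abs_mult[of "m _"] intro!: mult_left_mono)
  have [measurable]: "m \<in> borel_measurable borel" using m by auto
  show "(\<lambda>(p, z). m p * (f (z - s p) * \<zeta> z)) \<in> borel_measurable (lborel \<Otimes>\<^sub>M lborel)" by measurable
qed

text \<open>
  By the Cauchy--Schwarz inequality with weight \<open>\<bar>m\<bar>\<close>, the square of the average is at most the
  mass of \<open>\<bar>m\<bar>\<close> times the average of squares. Integration over \<open>z\<close> leaves the average of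
  \<open>\<parallel>f(\<cdot> - \<epsilon> s p) - f\<parallel>\<^sup>2\<close>, which tends to \<open>0\<close> for each \<open>p\<close> and is at most \<open>4 \<parallel>f\<parallel>\<^sup>2\<close>. Dominated
  convergence concludes. For the kernel of the nonlocal problem, \<open>m\<close> is the integrand of a
  second moment, which has no further decay.
\<close>

lemma averaged_increment_small:
  fixes m :: "'p::euclidean_space \<Rightarrow> real" and f :: "'x::euclidean_space \<Rightarrow> real"
  assumes m: "integrable lborel m" and s[measurable]: "s \<in> borel_measurable borel"
    and f[measurable]: "f \<in> borel_measurable borel" and fL: "sqnorm f < \<infinity>"
  obtains \<rho> :: "real \<Rightarrow> ennreal" where "(\<rho> \<longlongrightarrow> 0) (at_right 0)" "\<And>\<epsilon>. \<rho> \<epsilon> < \<infinity>"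
    "\<And>\<epsilon>. (\<integral>\<^sup>+z. ennreal ((LINT p|lborel. m p * (f (z - \<epsilon> *\<^sub>R s p) - f z))\<^sup>2) \<partial>lborel) \<le> \<rho> \<epsilon>"
proof -
  have [measurable]: "m \<in> borel_measurable borel" using m by auto
  have [measurable]: "f \<in> borel \<rightarrow>\<^sub>M borel" by measurable
  define M where "M h = (\<integral>\<^sup>+z. ennreal ((f (z - h) - f z)\<^sup>2) \<partial>lborel)" for h
  define C where "C = (\<integral>\<^sup>+p. ennreal \<bar>m p\<bar> \<partial>lborel)"
  have C: "C < \<infinity>" unfolding C_def using integrable_iff_bounded[of lborel m] m by simp
  define \<rho> where "\<rho> \<epsilon> = C * (\<integral>\<^sup>+p. ennreal \<bar>m p\<bar> * M (\<epsilon> *\<^sub>R s p) \<partial>lborel)" for \<epsilon> :: real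
  have Mm[measurable]: "M \<in> borel_measurable borel"
    unfolding M_def[abs_def] by (rule lborel.borel_measurable_nn_integral) measurable
  have Mle: "M h \<le> 4 * sqnorm f" for h
  proof -
    have [measurable]: "(\<lambda>z. ennreal ((f (z - h))\<^sup>2)) \<in> borel_measurable lborel" by measurable
    have "M h \<le> (\<integral>\<^sup>+z. 2 * ennreal ((f (z - h))\<^sup>2) + 2 * ennreal ((f z)\<^sup>2) \<partial>lborel)"
      unfolding M_def
    proof (rule nn_integral_mono)
      fix z
      have "ennreal ((f (z - h) - f z)\<^sup>2) \<le> ennreal (2 * (f (z - h))\<^sup>2 + 2 * (f z)\<^sup>2)"
        by (intro ennreal_leI square_diff_le)
      also have "\<dots> = 2 * ennreal ((f (z - h))\<^sup>2) + 2 * ennreal ((f z)\<^sup>2)" by (simp add: ennreal_plus ennreal_mult')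
      finally show "ennreal ((f (z - h) - f z)\<^sup>2) \<le> \<dots>" .
    qed
    also have "\<dots> = 2 * (\<integral>\<^sup>+z. ennreal ((f (z - h))\<^sup>2) \<partial>lborel) + 2 * sqnorm f"
      by (simp add: nn_integral_add nn_integral_cmult)
    also have "(\<integral>\<^sup>+z. ennreal ((f (z - h))\<^sup>2) \<partial>lborel) = sqnorm f"
      by (rule nn_integral_lborel_shift(2)) measurable
    finally show ?thesis by (simp add: distrib_right[symmetric])
  qed
  have M0: "M 0 = 0" by (simp add: M_def)
  have Mlim: "(M \<longlongrightarrow> 0) (nhds 0)"
    using L2_translation_continuous[OF f fL] M0 tendsto_at_iff_tendsto_nhds[of M 0]
    unfolding M_def[symmetric] by simp
  show ?thesis
  proof (rule that[of \<rho>])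
    show "(\<rho> \<longlongrightarrow> 0) (at_right 0)"
      unfolding tendsto_at_iff_sequentially comp_def
    proof (intro allI impI)
      fix X :: "nat \<Rightarrow> real" assume X: "X \<longlonglongrightarrow> 0"
      have "(\<lambda>n. \<integral>\<^sup>+p. ennreal \<bar>m p\<bar> * M (X n *\<^sub>R s p) \<partial>lborel) \<longlonglongrightarrow> (\<integral>\<^sup>+p. 0 \<partial>(lborel :: 'p measure))"
      proof (rule nn_integral_dominated_convergence[where w = "\<lambda>p. ennreal \<bar>m p\<bar> * (4 * sqnorm f)"])
        show "AE p in lborel. ennreal \<bar>m p\<bar> * M (X n *\<^sub>R s p) \<le> ennreal \<bar>m p\<bar> * (4 * sqnorm f)" for n
          by (intro AE_I2 mult_left_mono Mle) auto
        have "(\<integral>\<^sup>+p. ennreal \<bar>m p\<bar> * (4 * sqnorm f) \<partial>lborel) = C * (4 * sqnorm f)"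
          unfolding C_def by (rule nn_integral_multc) measurable
        also have "\<dots> < \<infinity>" using C fL by (simp add: ennreal_mult_less_top)
        finally show "(\<integral>\<^sup>+p. ennreal \<bar>m p\<bar> * (4 * sqnorm f) \<partial>lborel) < \<infinity>" .
        show "AE p in lborel. (\<lambda>n. ennreal \<bar>m p\<bar> * M (X n *\<^sub>R s p)) \<longlonglongrightarrow> 0"
        proof (rule AE_I2)
          fix p
          have "(\<lambda>n. X n *\<^sub>R s p) \<longlonglongrightarrow> 0 *\<^sub>R s p" by (intro tendsto_intros X)
          then have "(\<lambda>n. M (X n *\<^sub>R s p)) \<longlonglongrightarrow> 0" by (intro filterlim_compose[OF Mlim]) simp
          then have "(\<lambda>n. ennreal \<bar>m p\<bar> * M (X n *\<^sub>R s p)) \<longlonglongrightarrow> ennreal \<bar>m p\<bar> * 0"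
            by (intro ennreal_tendsto_cmult) auto
          then show "(\<lambda>n. ennreal \<bar>m p\<bar> * M (X n *\<^sub>R s p)) \<longlonglongrightarrow> 0" by simp
        qed
      qed measurable
      then have "(\<lambda>n. C * (\<integral>\<^sup>+p. ennreal \<bar>m p\<bar> * M (X n *\<^sub>R s p) \<partial>lborel)) \<longlonglongrightarrow> C * 0"
        using C by (intro ennreal_tendsto_cmult) auto
      then show "(\<lambda>n. \<rho> (X n)) \<longlonglongrightarrow> 0" by (simp add: \<rho>_def)
    qed
    have "(\<integral>\<^sup>+p. ennreal \<bar>m p\<bar> * M (\<epsilon> *\<^sub>R s p) \<partial>lborel) \<le> (\<integral>\<^sup>+p. ennreal \<bar>m p\<bar> * (4 * sqnorm f) \<partial>lborel)" for \<epsilon>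
      by (intro nn_integral_mono mult_left_mono Mle) auto
    also have "\<dots> = C * (4 * sqnorm f)"
      unfolding C_def by (rule nn_integral_multc) measurable
    also have "\<dots> < \<infinity>" using C fL by (simp add: ennreal_mult_less_top)
    finally show "\<rho> \<epsilon> < \<infinity>" for \<epsilon>
      using C unfolding \<rho>_def by (auto simp: ennreal_mult_less_top)
    fix \<epsilon> :: real
    let ?d = "\<lambda>p z. f (z - \<epsilon> *\<^sub>R s p) - f z"
    have "(\<integral>\<^sup>+z. ennreal ((LINT p|lborel. m p * ?d p z)\<^sup>2) \<partial>lborel) \<le> (\<integral>\<^sup>+z. C * (\<integral>\<^sup>+p. ennreal (\<bar>m p\<bar> * (?d p z)\<^sup>2) \<partial>lborel) \<partial>lborel)"
    proof (rule nn_integral_mono)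
      fix z
      have [measurable]: "(\<lambda>p. ?d p z) \<in> borel_measurable borel" by measurable
      have "ennreal ((LINT p|lborel. m p * ?d p z)\<^sup>2) = (ennreal \<bar>LINT p|lborel. m p * ?d p z\<bar>)\<^sup>2"
        by (simp add: ennreal_power)
      also have "ennreal \<bar>LINT p|lborel. m p * ?d p z\<bar> \<le> (\<integral>\<^sup>+p. ennreal \<bar>m p * ?d p z\<bar> \<partial>lborel)"
      proof (cases "integrable lborel (\<lambda>p. m p * ?d p z)")
        case True
        have "ennreal \<bar>LINT p|lborel. m p * ?d p z\<bar> \<le> ennreal (LINT p|lborel. \<bar>m p * ?d p z\<bar>)"
          by (intro ennreal_leI integral_abs_bound)
        also have "\<dots> = (\<integral>\<^sup>+p. ennreal \<bar>m p * ?d p z\<bar> \<partial>lborel)"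
          using True by (subst nn_integral_eq_integral) auto
        finally show ?thesis .
      qed (simp add: not_integrable_integral_eq)
      also have "(\<integral>\<^sup>+p. ennreal \<bar>m p * ?d p z\<bar> \<partial>lborel) = (\<integral>\<^sup>+p. ennreal (sqrt \<bar>m p\<bar>) * ennreal (sqrt \<bar>m p\<bar> * \<bar>?d p z\<bar>) \<partial>lborel)"
        by (intro nn_integral_cong) (simp add: ennreal_mult[symmetric] abs_mult mult.assoc[symmetric])
      also have "(\<integral>\<^sup>+p. ennreal (sqrt \<bar>m p\<bar>) * ennreal (sqrt \<bar>m p\<bar> * \<bar>?d p z\<bar>) \<partial>lborel)\<^sup>2
          \<le> (\<integral>\<^sup>+p. (ennreal (sqrt \<bar>m p\<bar>))\<^sup>2 \<partial>lborel) * (\<integral>\<^sup>+p. (ennreal (sqrt \<bar>m p\<bar> * \<bar>?d p z\<bar>))\<^sup>2 \<partial>lborel)"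
        by (rule Cauchy_Schwarz_nn_integral) measurable
      also have "\<dots> = C * (\<integral>\<^sup>+p. ennreal (\<bar>m p\<bar> * (?d p z)\<^sup>2) \<partial>lborel)"
        by (simp add: C_def ennreal_power power_mult_distrib)
      finally show "ennreal ((LINT p|lborel. m p * ?d p z)\<^sup>2) \<le> C * (\<integral>\<^sup>+p. ennreal (\<bar>m p\<bar> * (?d p z)\<^sup>2) \<partial>lborel)"
        by (simp add: power_mono)
    qed
    also have "\<dots> = C * (\<integral>\<^sup>+z. \<integral>\<^sup>+p. ennreal (\<bar>m p\<bar> * (?d p z)\<^sup>2) \<partial>lborel \<partial>lborel)"
      by (rule nn_integral_cmult) (rule lborel.borel_measurable_nn_integral, measurable)
    also have "(\<integral>\<^sup>+z. \<integral>\<^sup>+p. ennreal (\<bar>m p\<bar> * (?d p z)\<^sup>2) \<partial>lborel \<partial>lborel) = (\<integral>\<^sup>+p. \<integral>\<^sup>+z. ennreal (\<bar>m p\<bar> * (?d p z)\<^sup>2) \<partial>lborel \<partial>lborel)"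
      by (rule lborel_pair.Fubini') measurable
    also have "\<dots> = (\<integral>\<^sup>+p. ennreal \<bar>m p\<bar> * M (\<epsilon> *\<^sub>R s p) \<partial>lborel)"
      unfolding M_def by (intro nn_integral_cong) (simp add: ennreal_mult nn_integral_cmult)
    finally show "(\<integral>\<^sup>+z. ennreal ((LINT p|lborel. m p * ?d p z)\<^sup>2) \<partial>lborel) \<le> \<rho> \<epsilon>"
      by (simp add: \<rho>_def)
  qed
qed

section \<open>Test functions\<close>

lemma partial_translate:
  assumes "\<phi> differentiable (at (z + c))"
  shows "partial b (\<lambda>z. \<phi> (z + c)) z = partial b \<phi> (z + c)"
proof -
  have "(\<phi> has_derivative frechet_derivative \<phi> (at (z + c))) (at (z + c))" using assms by (simp add: frechet_derivative_works)
  then have "((\<lambda>z. \<phi> (z + c)) has_derivative frechet_derivative \<phi> (at (z + c))) (at z)"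
    by (intro has_derivative_compose[of "\<lambda>z. z + c" "\<lambda>h. h" z UNIV \<phi>]) (auto intro!: derivative_eq_intros)
  then show ?thesis by (simp add: partial_eq) (simp add: partial_def)
qed

lemma Ck_on_differentiable: "Ck_on (Suc m) UNIV \<phi> \<Longrightarrow> \<phi> differentiable (at z)"
  by (auto simp: differentiable_on_def)

lemma Ck_on_translate: "Ck_on m UNIV \<phi> \<Longrightarrow> Ck_on m UNIV (\<lambda>z. \<phi> (z + c))"
proof (induction m arbitrary: \<phi>)
  case 0
  then show ?case by (auto intro!: continuous_on_compose2[of UNIV \<phi> UNIV "\<lambda>z. z + c"] continuous_intros)
next
  case (Suc m)
  have "partial b (\<lambda>z. \<phi> (z + c)) = (\<lambda>z. partial b \<phi> (z + c))" for b
    using partial_translate Ck_on_differentiable[OF Suc.prems] by blast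
  moreover have "(\<lambda>z. \<phi> (z + c)) differentiable (at z)" for z
    by (rule differentiable_compose[of \<phi> "\<lambda>z. z + c"]) (auto intro: Ck_on_differentiable[OF Suc.prems])
  ultimately show ?case using Suc by (auto simp: differentiable_on_def)
qed

lemma test_function_smooth: "test_function Q \<phi> \<Longrightarrow> Ck_on m UNIV \<phi>"
  by (simp add: test_function_def smooth_on_def)

lemma test_function_differentiable: "test_function Q \<phi> \<Longrightarrow> \<phi> differentiable (at z)"
  using Ck_on_differentiable[OF test_function_smooth[of Q \<phi> "Suc 0"]] .

lemma test_function_partial:
  assumes \<phi>: "test_function Q \<phi>" and b: "b \<in> Basis"
  shows "test_function Q (partial b \<phi>)"
proof -
  have "partial b \<phi> z = 0" if z: "z \<notin> closure {z. \<phi> z \<noteq> 0}" for z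
  proof -
    have "((\<lambda>_. 0) has_derivative (\<lambda>_. 0)) (at z)" by simp
    then have "(\<phi> has_derivative (\<lambda>_. 0)) (at z)"
      by (rule has_derivative_transform_within_open[of _ _ _ _ "- closure {z. \<phi> z \<noteq> 0}"])
         (use z closure_subset[of "{z. \<phi> z \<noteq> 0}"] in auto)
    then show ?thesis by (rule partial_eq)
  qed
  then have sub: "closure {z. partial b \<phi> z \<noteq> 0} \<subseteq> closure {z. \<phi> z \<noteq> 0}"
    by (intro closure_minimal) auto
  have "Ck_on m UNIV (partial b \<phi>)" for m using test_function_smooth[OF \<phi>, of "Suc m"] b by simp
  moreover have "compact (closure {z. partial b \<phi> z \<noteq> 0})"
    using \<phi> bounded_subset[OF compact_imp_bounded sub] by (simp add: compact_eq_bounded_closed test_function_def)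
  ultimately show ?thesis using \<phi> sub by (auto simp: test_function_def smooth_on_def)
qed

lemma test_function_translate:
  fixes \<phi> :: "real \<times> 'a::euclidean_space \<Rightarrow> real"
  assumes \<phi>: "test_function (cylinder T) \<phi>"
  shows "test_function (cylinder T) (\<lambda>z. \<phi> (z + (0, h)))"
proof -
  let ?S = "{z. \<phi> z \<noteq> 0}"
  have eq: "{z. \<phi> (z + (0, h)) \<noteq> 0} = (+) (- (0, h)) ` ?S"
  proof (intro set_eqI iffI)
    fix z assume "z \<in> {z. \<phi> (z + (0, h)) \<noteq> 0}"
    then show "z \<in> (+) (- (0, h)) ` ?S" by (intro image_eqI[of _ _ "z + (0, h)"]) (auto simp: zero_prod_def)
  qed (auto simp: algebra_simps)
  have c: "closure {z. \<phi> (z + (0, h)) \<noteq> 0} = (+) (- (0, h)) ` closure ?S"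
    unfolding eq by (rule closure_translation)
  have "compact (closure ?S)" "closure ?S \<subseteq> cylinder T" using \<phi> by (auto simp: test_function_def)
  then show ?thesis
    using Ck_on_translate[OF test_function_smooth[OF \<phi>], of _ "(0, h)"] compact_translation[of "closure ?S" "- (0, h)"]
    unfolding test_function_def smooth_on_def c by auto
qed

lemma test_function_facts:
  fixes \<phi> :: "'a::euclidean_space \<Rightarrow> real"
  assumes \<phi>: "test_function Q \<phi>"
  shows "continuous_on UNIV \<phi>" and "\<phi> \<in> borel_measurable borel" and "sqnorm \<phi> < \<infinity>"
    and "\<exists>B. \<forall>z. \<bar>\<phi> z\<bar> \<le> B" and "z \<notin> Q \<Longrightarrow> \<phi> z = 0"
proof -
  show c: "continuous_on UNIV \<phi>" using Ck_on_continuous[OF test_function_smooth[OF \<phi>]] .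
  then show [measurable]: "\<phi> \<in> borel_measurable borel" by (rule borel_measurable_continuous_onI)
  let ?K = "closure {z. \<phi> z \<noteq> 0}"
  have K: "compact ?K" "?K \<subseteq> Q" using \<phi> by (auto simp: test_function_def)
  have out: "\<phi> z = 0" if "z \<notin> ?K" for z using that closure_subset[of "{z. \<phi> z \<noteq> 0}"] by auto
  show "z \<notin> Q \<Longrightarrow> \<phi> z = 0" using out[of z] K(2) by blast
  have "bounded (\<phi> ` ?K)" using K c by (intro compact_imp_bounded compact_continuous_image) (auto intro: continuous_on_subset)
  then obtain B where B: "\<And>z. z \<in> ?K \<Longrightarrow> \<bar>\<phi> z\<bar> \<le> B" unfolding bounded_iff by auto
  have bd: "\<bar>\<phi> z\<bar> \<le> max B 0" for z using B[of z] out[of z] by (cases "z \<in> ?K") auto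
  then show "\<exists>B. \<forall>z. \<bar>\<phi> z\<bar> \<le> B" by blast
  have "sqnorm \<phi> \<le> (\<integral>\<^sup>+z. ennreal ((max B 0)\<^sup>2) * indicator ?K z \<partial>lborel)"
  proof (rule nn_integral_mono)
    fix z
    have "(\<phi> z)\<^sup>2 \<le> (max B 0)\<^sup>2" using bd[of z] by (simp add: abs_le_square_iff[symmetric])
    then show "ennreal ((\<phi> z)\<^sup>2) \<le> ennreal ((max B 0)\<^sup>2) * indicator ?K z" using out[of z] by (auto simp: indicator_def ennreal_leI)
  qed
  also have "\<dots> = ennreal ((max B 0)\<^sup>2) * emeasure lborel ?K"
    by (rule nn_integral_cmult_indicator) simp
  also have "\<dots> < \<infinity>" using emeasure_compact_finite[OF K(1)] by (simp add: ennreal_mult_less_top)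
  finally show "sqnorm \<phi> < \<infinity>" .
qed

section \<open>Consistency of the nonlocal diffusion\<close>

lemma integral_product_functions:
  fixes f :: "'p::euclidean_space \<Rightarrow> real" and g :: "'q::euclidean_space \<Rightarrow> real"
  assumes f: "integrable lborel f" and g: "integrable lborel g"
  shows "integrable lborel (\<lambda>z. f (fst z) * g (snd z))"
    and "(LINT z|lborel. f (fst z) * g (snd z)) = (LINT p|lborel. f p) * (LINT q|lborel. g q)"
proof -
  have I: "integrable (lborel \<Otimes>\<^sub>M lborel) (\<lambda>(p, q). f p * g q)"
    using integrable_product_functions[OF lborel.sigma_finite_measure_axioms lborel.sigma_finite_measure_axioms f g]
    by (simp add: case_prod_unfold)
  then show "integrable lborel (\<lambda>z. f (fst z) * g (snd z))" by (simp add: lborel_prod case_prod_unfold)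
  have "(LINT p|lborel. LINT q|lborel. f p * g q) = (LINT z|lborel. f (fst z) * g (snd z))"
    using lborel_pair.integral_fst[OF I] by (simp add: lborel_prod case_prod_unfold)
  then show "(LINT z|lborel. f (fst z) * g (snd z)) = (LINT p|lborel. f p) * (LINT q|lborel. g q)" by simp
qed

text \<open>
  The weight in the integral remainder of Taylor's formula. Its integral \<open>1/2\<close> cancels the
  factor \<open>2\<close> in the second moments \<open>2 A\<close>.
\<close>

lemma taylor_weight:
  shows "integrable lborel (\<lambda>r. (1 - r) * indicator {0..1::real} r)"
    and "(LINT r|lborel. (1 - r) * indicator {0..1::real} r) = 1 / 2"
proof -
  have c: "continuous_on {0..1::real} (\<lambda>r. 1 - r)" by (intro continuous_intros)
  show I: "integrable lborel (\<lambda>r. (1 - r) * indicator {0..1::real} r)"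
    using borel_integrable_atLeastAtMost'[OF c] by (simp add: set_integrable_def mult.commute)
  have "(LINT r|lborel. (1 - r) * indicator {0..1::real} r) = (1 - 1\<^sup>2/2) - (0 - 0\<^sup>2/2)"
    by (rule integral_FTC_Icc_real[where F = "\<lambda>r. r - r\<^sup>2/2"]) (auto intro!: derivative_eq_intros)
  then show "(LINT r|lborel. (1 - r) * indicator {0..1::real} r) = 1 / 2" by simp
qed

lemma taylor_integral:
  fixes \<phi> :: "'a::euclidean_space \<Rightarrow> real" and z h :: 'a
  assumes \<phi>: "Ck_on 2 UNIV \<phi>"
  defines "H \<equiv> \<lambda>z. \<Sum>(b, c)\<in>Basis \<times> Basis. (h \<bullet> b) * (h \<bullet> c) * partial b (partial c \<phi>) z"
  shows "\<phi> (z + h) = \<phi> z + (\<Sum>c\<in>Basis. (h \<bullet> c) * partial c \<phi> z) + (LINT r|lborel. (1 - r) * indicator {0..1} r * H (z + r *\<^sub>R h))"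
proof -
  have \<phi>': "Ck_on (Suc (Suc 0)) UNIV \<phi>" using \<phi> by (simp add: numeral_2_eq_2)
  have lin: "f' h = (\<Sum>c\<in>Basis. (h \<bullet> c) * f' c)" if "(f has_derivative f') F" for f :: "'a \<Rightarrow> real" and f' F
  proof -
    have "linear f'" using that by (rule has_derivative_linear)
    have "f' h = f' (\<Sum>c\<in>Basis. (h \<bullet> c) *\<^sub>R c)" by (simp add: euclidean_representation)
    also have "\<dots> = (\<Sum>c\<in>Basis. (h \<bullet> c) * f' c)" using \<open>linear f'\<close> by (simp add: linear_sum linear_scale)
    finally show ?thesis .
  qed
  have der: "((\<lambda>r. f (z + r *\<^sub>R h)) has_real_derivative (\<Sum>c\<in>Basis. (h \<bullet> c) * partial c f (z + r *\<^sub>R h))) (at r)"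
    if f: "Ck_on (Suc m) UNIV f" for f m r
  proof -
    let ?F = "frechet_derivative f (at (z + r *\<^sub>R h))"
    have F: "(f has_derivative ?F) (at (z + r *\<^sub>R h))" using Ck_on_SucD(1)[OF f] by simp
    have "((\<lambda>r. z + r *\<^sub>R h) has_derivative (\<lambda>s. s *\<^sub>R h)) (at r)" by (auto intro!: derivative_eq_intros)
    then have "((\<lambda>r. f (z + r *\<^sub>R h)) has_derivative (\<lambda>s. ?F (s *\<^sub>R h))) (at r)" using F by (rule has_derivative_compose)
    moreover have "?F (s *\<^sub>R h) = s * (\<Sum>c\<in>Basis. (h \<bullet> c) * partial c f (z + r *\<^sub>R h))" for s
      using lin[OF F] has_derivative_linear[OF F] by (simp add: linear_scale partial_def)
    ultimately show ?thesis
      unfolding has_field_derivative_def by (auto elim!: has_derivative_eq_rhs simp: fun_eq_iff)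
  qed
  define D where "D w = (\<Sum>c\<in>Basis. (h \<bullet> c) * partial c \<phi> w)" for w
  have p1: "Ck_on (Suc 0) UNIV (partial c \<phi>)" if "c \<in> Basis" for c using \<phi>' that by (simp only: Ck_on.simps(2)[of "Suc 0"])
  have d1: "((\<lambda>r. \<phi> (z + r *\<^sub>R h)) has_real_derivative D (z + r *\<^sub>R h)) (at r)" for r
    unfolding D_def by (rule der[OF \<phi>'])
  have "((\<lambda>r. \<Sum>c\<in>Basis. (h \<bullet> c) * partial c \<phi> (z + r *\<^sub>R h)) has_real_derivative (\<Sum>c\<in>Basis. (h \<bullet> c) * (\<Sum>b\<in>Basis. (h \<bullet> b) * partial b (partial c \<phi>) (z + r *\<^sub>R h)))) (at r)" for r
    by (intro DERIV_sum DERIV_cmult der[OF p1])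
  moreover have "(\<Sum>c\<in>Basis. (h \<bullet> c) * (\<Sum>b\<in>Basis. (h \<bullet> b) * partial b (partial c \<phi>) w)) = H w" for w
    unfolding H_def sum.cartesian_product[symmetric] sum_distrib_left by (subst sum.swap) (simp add: ac_simps)
  ultimately have d2: "((\<lambda>r. D (z + r *\<^sub>R h)) has_real_derivative H (z + r *\<^sub>R h)) (at r)" for r
    by (simp add: D_def)
  have Hc: "continuous_on UNIV H"
    unfolding H_def case_prod_unfold
    by (intro continuous_intros continuous_on_sum) (use p1 in \<open>auto dest: Ck_on_SucD(2) intro: Ck_on_continuous\<close>)
  have "(LINT r|lborel. ((1 - r) * H (z + r *\<^sub>R h)) * indicator {0..1} r) = ((1 - 1) * D (z + 1 *\<^sub>R h) + \<phi> (z + 1 *\<^sub>R h)) - ((1 - 0) * D (z + 0 *\<^sub>R h) + \<phi> (z + 0 *\<^sub>R h))"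
  proof (rule integral_FTC_Icc_real)
    show "((\<lambda>r. (1 - r) * D (z + r *\<^sub>R h) + \<phi> (z + r *\<^sub>R h)) has_real_derivative (1 - r) * H (z + r *\<^sub>R h)) (at r)" for r
      by (auto intro!: derivative_eq_intros d1 d2)
    have "continuous_on UNIV (\<lambda>r. (1 - r) * H (z + r *\<^sub>R h))"
      by (intro continuous_intros continuous_on_compose2[OF Hc]) auto
    then show "isCont (\<lambda>r. (1 - r) * H (z + r *\<^sub>R h)) r" for r by (simp add: continuous_on_eq_continuous_at)
  qed simp
  then show ?thesis by (simp add: D_def ac_simps)
qed

text \<open>
  Formally, \<open>v(x - \<epsilon> y) = v(x) - \<epsilon> y \<bullet> \<nabla>v(x) + \<epsilon>\<^sup>2 \<integral>\<^sub>0\<^sup>1 (1 - r) y\<^sup>T D\<^sup>2v(x - r \<epsilon> y) y dr\<close>. Average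
  with \<open>k\<close>: the first moments vanish, and subtracting \<open>A \<Delta> v\<close> replaces \<open>D\<^sup>2v(x - r \<epsilon> y)\<close> by its
  increment from \<open>D\<^sup>2v(x)\<close>. So the residual is the average of translation increments with weight
  \<open>m q (y, r) = k(y) y\<^sub>i y\<^sub>j (1 - r)\<close>, where \<open>q = (i, j)\<close>, and \<open>averaged_increment_small\<close> applies.

  Since \<open>v\<close> has only weak second derivatives \<open>a\<close>, the identity is verified against test
  functions, with Taylor's formula for the test function, and the fundamental lemma turns it
  into an identity almost everywhere.
\<close>

theorem nonlocal_consistency:
  fixes k :: "'a::euclidean_space \<Rightarrow> real" and v :: "real \<times> 'a \<Rightarrow> real" and a :: "'a \<times> 'a \<Rightarrow> real \<times> 'a \<Rightarrow> real"
  assumes k[measurable]: "k \<in> borel_measurable borel" and kint: "integrable lborel k" 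
    and M1: "\<And>i. i \<in> Basis \<Longrightarrow> integrable lborel (\<lambda>y. k y * (y \<bullet> i))" "\<And>i. i \<in> Basis \<Longrightarrow> (LINT y|lborel. k y * (y \<bullet> i)) = 0"
    and M2: "\<And>i j. i \<in> Basis \<Longrightarrow> j \<in> Basis \<Longrightarrow> integrable lborel (\<lambda>y. k y * ((y \<bullet> i) * (y \<bullet> j)))"
      "\<And>i j. i \<in> Basis \<Longrightarrow> j \<in> Basis \<Longrightarrow> (LINT y|lborel. k y * ((y \<bullet> i) * (y \<bullet> j))) = (if i = j then 2 * A else 0)"
    and k1: "(LINT y|lborel. k y) = 1"
    and v[measurable]: "v \<in> borel_measurable borel" and vL: "sqnorm v < \<infinity>"
    and a: "\<And>q. q \<in> Basis \<times> Basis \<Longrightarrow> a q \<in> borel_measurable borel" 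
    and aL: "\<And>q. q \<in> Basis \<times> Basis \<Longrightarrow> sqnorm (a q) < \<infinity>"
    and weak: "\<And>\<phi> i j. test_function (cylinder T) \<phi> \<Longrightarrow> i \<in> Basis \<Longrightarrow> j \<in> Basis \<Longrightarrow>
        (LINT z|lborel. v z * partial (0, i) (partial (0, j) \<phi>) z) = (LINT z|lborel. a (i, j) z * \<phi> z)"
  obtains \<rho> :: "real \<Rightarrow> ennreal" where "(\<rho> \<longlongrightarrow> 0) (at_right 0)" "\<And>\<epsilon>. \<rho> \<epsilon> < \<infinity>"
    "\<And>\<epsilon>. 0 < \<epsilon> \<Longrightarrow> (\<integral>\<^sup>+z. indicator (cylinder T) z * ennreal ((nonlocal_diffusion k \<epsilon> v z - A * (\<Sum>i\<in>Basis. a (i, i) z))\<^sup>2) \<partial>lborel) \<le> \<rho> \<epsilon>"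
proof -
  let ?B = "Basis \<times> Basis :: ('a \<times> 'a) set"
  let ?Q = "cylinder T :: (real \<times> 'a) set"
  have Q: "open ?Q" by (intro open_Times) auto
  define m where "m q p = k (fst p) * ((fst p \<bullet> fst q) * (fst p \<bullet> snd q)) * ((1 - snd p) * indicator {0..1} (snd p))" for q :: "'a \<times> 'a" and p :: "'a \<times> real"
  \<comment> \<open>For \<open>p = (y, r)\<close>, the translation by \<open>\<epsilon> s p\<close> is the one by \<open>r \<epsilon> y\<close> in space.\<close>
  define s where "s p = (0::real, snd p *\<^sub>R fst p)" for p :: "'a \<times> real"
  have [measurable]: "s \<in> borel_measurable borel" unfolding s_def borel_prod[symmetric] by measurable
  have mi: "integrable lborel (m q)" if "q \<in> ?B" for q
    unfolding m_def by (rule integral_product_functions(1)[OF M2(1) taylor_weight(1)]) (use that in auto)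
  have mI: "(LINT p|lborel. m q p) = (if fst q = snd q then A else 0)" if "q \<in> ?B" for q
    unfolding m_def using that by (subst integral_product_functions(2)[OF M2(1) taylor_weight(1)]) (auto simp: M2(2) taylor_weight(2))
  have mm[measurable]: "m q \<in> borel_measurable borel" if "q \<in> ?B" for q using mi[OF that] by auto
  define \<Delta> where "\<Delta> \<epsilon> q z = (LINT p|lborel. m q p * (a q (z - \<epsilon> *\<^sub>R s p) - a q z))" for \<epsilon> q z
  have "\<exists>\<rho>. (\<rho> \<longlongrightarrow> 0) (at_right 0) \<and> (\<forall>\<epsilon>. \<rho> \<epsilon> < \<infinity>) \<and> (\<forall>\<epsilon>. sqnorm (\<Delta> \<epsilon> q) \<le> \<rho> \<epsilon>)" if q: "q \<in> ?B" for q
  proof -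
    obtain \<rho> where "(\<rho> \<longlongrightarrow> 0) (at_right 0)" "\<And>\<epsilon>. \<rho> \<epsilon> < \<infinity>"
      "\<And>\<epsilon>. (\<integral>\<^sup>+z. ennreal ((LINT p|lborel. m q p * (a q (z - \<epsilon> *\<^sub>R s p) - a q z))\<^sup>2) \<partial>lborel) \<le> \<rho> \<epsilon>"
      using averaged_increment_small[OF mi[OF q] \<open>s \<in> borel_measurable borel\<close> a[OF q] aL[OF q]] by blast
    then show ?thesis unfolding \<Delta>_def by (intro exI[of _ \<rho>]) simp
  qed
  then obtain \<rho>q where \<rho>q: "\<And>q. q \<in> ?B \<Longrightarrow> (\<rho>q q \<longlongrightarrow> 0) (at_right 0)"
      "\<And>q \<epsilon>. q \<in> ?B \<Longrightarrow> \<rho>q q \<epsilon> < \<infinity>"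
      "\<And>q \<epsilon>. q \<in> ?B \<Longrightarrow> sqnorm (\<Delta> \<epsilon> q) \<le> \<rho>q q \<epsilon>" by metis
  define c where "c = real (card ?B)"
  define \<rho> where "\<rho> \<epsilon> = ennreal c * (\<Sum>q\<in>?B. \<rho>q q \<epsilon>)" for \<epsilon>
  show ?thesis
  proof (rule that[of \<rho>])
    have "((\<lambda>\<epsilon>. \<Sum>q\<in>?B. \<rho>q q \<epsilon>) \<longlongrightarrow> (\<Sum>q\<in>?B. 0)) (at_right 0)" by (intro tendsto_sum \<rho>q(1))
    then have "((\<lambda>\<epsilon>. ennreal c * (\<Sum>q\<in>?B. \<rho>q q \<epsilon>)) \<longlongrightarrow> ennreal c * 0) (at_right 0)" by (intro ennreal_tendsto_cmult) auto
    then show "(\<rho> \<longlongrightarrow> 0) (at_right 0)" by (simp add: \<rho>_def[abs_def])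
    show "\<rho> \<epsilon> < \<infinity>" for \<epsilon>
    proof -
      have "(\<Sum>q\<in>?B. \<rho>q q \<epsilon>) < top" using \<rho>q(2) by (subst ennreal_sum_less_top) (auto simp: less_top)
      then show ?thesis by (simp add: \<rho>_def ennreal_mult_less_top)
    qed
    fix \<epsilon> :: real assume \<epsilon>: "0 < \<epsilon>"
    \<comment> \<open>The candidate for the residual \<open>R\<close>.\<close>
    define F where "F z = (\<Sum>q\<in>?B. \<Delta> \<epsilon> q z)" for z
    define R where "R z = nonlocal_diffusion k \<epsilon> v z - A * (\<Sum>i\<in>Basis. a (i, i) z)" for z
    have \<Delta>m[measurable]: "\<Delta> \<epsilon> q \<in> borel_measurable borel" if q: "q \<in> ?B" for q
    proof -
      note [measurable] = a[OF q] mm[OF q]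
      have "(\<lambda>z. LINT p|lborel. m q p * (a q (z - \<epsilon> *\<^sub>R s p) - a q z)) \<in> borel_measurable borel"
        by (rule lborel.borel_measurable_lebesgue_integral[unfolded borel_prod]) measurable
      then show ?thesis by (simp add: \<Delta>_def[abs_def])
    qed
    have Fm[measurable]: "F \<in> borel_measurable borel" unfolding F_def by measurable
    have aiim: "(\<lambda>z. \<Sum>i\<in>Basis. a (i, i) z) \<in> borel_measurable borel" by (intro borel_measurable_sum a) auto
    have Rm[measurable]: "R \<in> borel_measurable borel" unfolding R_def using aiim by measurable
    \<comment> \<open>Each term of \<open>R\<close> and \<open>F\<close> is paired with a square integrable function; the
      indicators of boxes among these give the local integrability that the fundamental lemma
      needs.\<close>
    have a\<zeta>: "integrable (lborel \<Otimes>\<^sub>M lborel) (\<lambda>(p, z). m q p * (a q (z - \<epsilon> *\<^sub>R s p) * \<zeta> z))"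
      and a\<zeta>0: "integrable (lborel \<Otimes>\<^sub>M lborel) (\<lambda>(p, z). m q p * (a q z * \<zeta> z))"
      if q: "q \<in> ?B" and \<zeta>: "\<zeta> \<in> borel_measurable borel" "sqnorm \<zeta> < \<infinity>" for q \<zeta>
      using integrable_shift_pairing[OF mi[OF q], of "\<lambda>p. \<epsilon> *\<^sub>R s p", OF _ a[OF q] aL[OF q] \<zeta>]
        integrable_shift_pairing[OF mi[OF q], of "\<lambda>p. 0", OF _ a[OF q] aL[OF q] \<zeta>] by simp_all
    have \<Delta>\<zeta>: "integrable lborel (\<lambda>z. \<Delta> \<epsilon> q z * \<zeta> z) \<and>
        (LINT z|lborel. \<Delta> \<epsilon> q z * \<zeta> z) = (LINT p|lborel. m q p * ((LINT z|lborel. a q (z - \<epsilon> *\<^sub>R s p) * \<zeta> z) - (LINT z|lborel. a q z * \<zeta> z)))"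
      if q: "q \<in> ?B" and \<zeta>: "\<zeta> \<in> borel_measurable borel" "sqnorm \<zeta> < \<infinity>" for q \<zeta>
    proof -
      note [measurable] = a[OF q] mm[OF q] \<zeta>(1)
      have I: "integrable (lborel \<Otimes>\<^sub>M lborel) (\<lambda>(p, z). m q p * ((a q (z - \<epsilon> *\<^sub>R s p) - a q z) * \<zeta> z))"
        using Bochner_Integration.integrable_diff[OF a\<zeta>[OF q \<zeta>] a\<zeta>0[OF q \<zeta>]] by (simp add: case_prod_unfold algebra_simps)
      have eq: "\<Delta> \<epsilon> q z * \<zeta> z = (LINT p|lborel. m q p * ((a q (z - \<epsilon> *\<^sub>R s p) - a q z) * \<zeta> z))" for z
        unfolding \<Delta>_def by (simp flip: integral_mult_left_zero add: mult.assoc)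
      have az: "integrable lborel (\<lambda>z. a q (z - \<epsilon> *\<^sub>R s p) * \<zeta> z)" "integrable lborel (\<lambda>z. a q z * \<zeta> z)" for p
      proof -
        have "(\<integral>\<^sup>+z. ennreal ((a q (z - \<epsilon> *\<^sub>R s p))\<^sup>2) \<partial>lborel) < \<infinity>"
          using aL[OF q] nn_integral_lborel_shift(2)[of "\<lambda>z. ennreal ((a q z)\<^sup>2)" "\<epsilon> *\<^sub>R s p"] by simp
        then show "integrable lborel (\<lambda>z. a q (z - \<epsilon> *\<^sub>R s p) * \<zeta> z)" by (intro integrable_mult_L2 \<zeta>) auto
        show "integrable lborel (\<lambda>z. a q z * \<zeta> z)" by (intro integrable_mult_L2 \<zeta> aL[OF q]) auto
      qed
      show ?thesis unfolding eq
      proof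
        show "integrable lborel (\<lambda>z. LINT p|lborel. m q p * ((a q (z - \<epsilon> *\<^sub>R s p) - a q z) * \<zeta> z))"
          using lborel_pair.integrable_snd[OF I] .
        have "(LINT z|lborel. LINT p|lborel. m q p * ((a q (z - \<epsilon> *\<^sub>R s p) - a q z) * \<zeta> z)) = (LINT p|lborel. LINT z|lborel. m q p * ((a q (z - \<epsilon> *\<^sub>R s p) - a q z) * \<zeta> z))"
          by (rule lborel_pair.Fubini_integral[OF I])
        also have "\<dots> = (LINT p|lborel. m q p * ((LINT z|lborel. a q (z - \<epsilon> *\<^sub>R s p) * \<zeta> z) - (LINT z|lborel. a q z * \<zeta> z)))"
          by (intro Bochner_Integration.integral_cong refl) (simp add: left_diff_distrib Bochner_Integration.integral_diff[OF az])
        finally show "(LINT z|lborel. LINT p|lborel. m q p * ((a q (z - \<epsilon> *\<^sub>R s p) - a q z) * \<zeta> z)) = \<dots>" .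
      qed
    qed
    have K\<zeta>: "integrable (lborel \<Otimes>\<^sub>M lborel) (\<lambda>(y, z). k y * (v (z - (0, \<epsilon> *\<^sub>R y)) * \<zeta> z))"
      if \<zeta>: "\<zeta> \<in> borel_measurable borel" "sqnorm \<zeta> < \<infinity>" for \<zeta>
      by (rule integrable_shift_pairing[OF kint _ v vL \<zeta>, of "\<lambda>y. (0, \<epsilon> *\<^sub>R y)"]) (simp add: borel_prod[symmetric])
    have avg_eq: "space_average k \<epsilon> v z * \<zeta> z = (LINT y|lborel. k y * (v (z - (0, \<epsilon> *\<^sub>R y)) * \<zeta> z))" for z \<zeta>
      by (cases z) (simp add: space_average_def mult.assoc flip: integral_mult_left_zero)
    have avg\<zeta>: "integrable lborel (\<lambda>z. space_average k \<epsilon> v z * \<zeta> z)"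
      if \<zeta>: "\<zeta> \<in> borel_measurable borel" "sqnorm \<zeta> < \<infinity>" for \<zeta>
      unfolding avg_eq using lborel_pair.integrable_snd[OF K\<zeta>[OF \<zeta>]] .
    have v\<zeta>: "integrable lborel (\<lambda>z. v z * \<zeta> z)"
      if \<zeta>: "\<zeta> \<in> borel_measurable borel" "sqnorm \<zeta> < \<infinity>" for \<zeta>
      by (intro integrable_mult_L2 v vL \<zeta>)
    have aii\<zeta>: "integrable lborel (\<lambda>z. a q z * \<zeta> z)"
      if q: "q \<in> ?B" and \<zeta>: "\<zeta> \<in> borel_measurable borel" "sqnorm \<zeta> < \<infinity>" for \<zeta> q
      by (intro integrable_mult_L2 a[OF q] aL[OF q] \<zeta>)
    have R\<zeta>: "integrable lborel (\<lambda>z. R z * \<zeta> z)"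
      "(LINT z|lborel. R z * \<zeta> z) = ((LINT z|lborel. space_average k \<epsilon> v z * \<zeta> z) - (LINT z|lborel. v z * \<zeta> z)) / \<epsilon>\<^sup>2
         - A * (\<Sum>i\<in>Basis. LINT z|lborel. a (i, i) z * \<zeta> z)"
      if \<zeta>: "\<zeta> \<in> borel_measurable borel" "sqnorm \<zeta> < \<infinity>" for \<zeta>
    proof -
      have eq: "R z * \<zeta> z = (space_average k \<epsilon> v z * \<zeta> z - v z * \<zeta> z) / \<epsilon>\<^sup>2 - A * (\<Sum>i\<in>Basis. a (i, i) z * \<zeta> z)" for z
        by (simp add: R_def algebra_simps diff_divide_distrib sum_distrib_left sum_distrib_right)
      have I1: "integrable lborel (\<lambda>z. (space_average k \<epsilon> v z * \<zeta> z - v z * \<zeta> z) / \<epsilon>\<^sup>2)"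
        using avg\<zeta>[OF \<zeta>] v\<zeta>[OF \<zeta>] by auto
      have I2: "integrable lborel (\<lambda>z. A * (\<Sum>i\<in>Basis. a (i, i) z * \<zeta> z))"
        using aii\<zeta>[OF _ \<zeta>] by (intro integrable_mult_right Bochner_Integration.integrable_sum) auto
      show "integrable lborel (\<lambda>z. R z * \<zeta> z)" unfolding eq by (rule Bochner_Integration.integrable_diff[OF I1 I2])
      show "(LINT z|lborel. R z * \<zeta> z) = ((LINT z|lborel. space_average k \<epsilon> v z * \<zeta> z) - (LINT z|lborel. v z * \<zeta> z)) / \<epsilon>\<^sup>2
         - A * (\<Sum>i\<in>Basis. LINT z|lborel. a (i, i) z * \<zeta> z)"
        unfolding eq Bochner_Integration.integral_diff[OF I1 I2]
        using avg\<zeta>[OF \<zeta>] v\<zeta>[OF \<zeta>] aii\<zeta>[OF _ \<zeta>] by (simp add: Bochner_Integration.integral_sum)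
    qed
    have F\<zeta>: "integrable lborel (\<lambda>z. F z * \<zeta> z)"
      "(LINT z|lborel. F z * \<zeta> z) = (\<Sum>q\<in>?B. LINT z|lborel. \<Delta> \<epsilon> q z * \<zeta> z)"
      if \<zeta>: "\<zeta> \<in> borel_measurable borel" "sqnorm \<zeta> < \<infinity>" for \<zeta>
      unfolding F_def sum_distrib_right using \<Delta>\<zeta>[OF _ \<zeta>]
      by (auto intro!: Bochner_Integration.integrable_sum Bochner_Integration.integral_sum simp del: mem_Times_iff)
    have AE0: "AE z in lborel. z \<in> ?Q \<longrightarrow> R z - F z = 0"
    proof (rule fundamental_lemma_variations[OF Q])
      show "(\<lambda>z. R z - F z) \<in> borel_measurable borel" by measurable
      fix b d :: "real \<times> 'a"
      have i1: "indicat_real (cbox b d) \<in> borel_measurable borel" by simp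
      have "(\<integral>\<^sup>+z. ennreal ((indicat_real (cbox b d) z)\<^sup>2) \<partial>lborel) = (\<integral>\<^sup>+z. indicator (cbox b d) z \<partial>lborel)"
        by (intro nn_integral_cong) (simp add: indicator_def)
      also have "\<dots> < \<infinity>" using emeasure_lborel_cbox_finite[of b d] by simp
      finally have i2: "(\<integral>\<^sup>+z. ennreal ((indicat_real (cbox b d) z)\<^sup>2) \<partial>lborel) < \<infinity>" .
      show "integrable lborel (\<lambda>z. indicat_real (cbox b d) z * (R z - F z))"
        using Bochner_Integration.integrable_diff[OF R\<zeta>(1)[OF i1 i2] F\<zeta>(1)[OF i1 i2]] by (simp add: algebra_simps)
    next
      fix \<phi> assume \<phi>: "test_function ?Q \<phi>"
      note \<phi>m = test_function_facts(2)[OF \<phi>] and \<phi>L = test_function_facts(3)[OF \<phi>]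
      note [measurable] = \<phi>m
      define \<alpha> where "\<alpha> q h = (LINT z|lborel. a q (z - (0, h)) * \<phi> z)" for q h
      define b where "b i = (LINT z|lborel. v z * partial (0, i) \<phi> z)" for i
      define V where "V h = (LINT z|lborel. v (z - (0, h)) * \<phi> z)" for h
      have Btest: "test_function ?Q (partial (0, i) \<phi>)" if "i \<in> Basis" for i
        by (rule test_function_partial[OF \<phi>]) (use that in \<open>simp add: Basis_prod_def\<close>)
      have Btest2: "test_function ?Q (partial (0, i) (partial (0, j) \<phi>))" if "i \<in> Basis" "j \<in> Basis" for i j
        by (rule test_function_partial[OF Btest[OF that(2)]]) (use that in \<open>simp add: Basis_prod_def\<close>)
      \<comment> \<open>Taylor's formula for \<open>V h\<close>, the pairing of a translate of \<open>v\<close> with \<open>\<phi>\<close>: move the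
        translation to \<open>\<phi>\<close>, expand there, and move both derivatives to \<open>v\<close>.\<close>
      have V: "V h = V 0 + (\<Sum>i\<in>Basis. (h \<bullet> i) * b i) + (\<Sum>q\<in>?B. (h \<bullet> fst q) * (h \<bullet> snd q) * (LINT r|lborel. ((1 - r) * indicator {0..1} r) * \<alpha> q (r *\<^sub>R h)))" for h
      proof -
        let ?H = "\<lambda>q z. partial (0, fst q) (partial (0, snd q) \<phi>) z"
        have Hm: "?H q \<in> borel_measurable borel" and HL: "sqnorm (?H q) < \<infinity>" if "q \<in> ?B" for q
          using test_function_facts(2,3)[OF Btest2] that by auto
        have pair: "integrable (lborel \<Otimes>\<^sub>M lborel) (\<lambda>(r, z). ((1 - r) * indicator {0..1} r) * (?H q (z - (0, - r *\<^sub>R h)) * v z))" if q: "q \<in> ?B" for q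
          by (rule integrable_shift_pairing[OF taylor_weight(1) _ Hm[OF q] HL[OF q] v vL, of "\<lambda>r. (0, - r *\<^sub>R h)"]) (simp add: borel_prod[symmetric])
        have "V h = (LINT z|lborel. v ((z + (0, h)) - (0, h)) * \<phi> (z + (0, h)))"
          unfolding V_def by (rule integral_lborel_shift(1)[symmetric]) measurable
        also have "\<dots> = (LINT z|lborel. v z * \<phi> z + (\<Sum>i\<in>Basis. (h \<bullet> i) * (v z * partial (0, i) \<phi> z)) + 
            (\<Sum>q\<in>?B. (h \<bullet> fst q) * (h \<bullet> snd q) * (LINT r|lborel. ((1 - r) * indicator {0..1} r) * (?H q (z - (0, - r *\<^sub>R h)) * v z))))"
        proof (intro Bochner_Integration.integral_cong refl)
          fix z
          have sB: "(\<Sum>c\<in>(Basis :: (real \<times> 'a) set). g c) = g (1, 0) + (\<Sum>i\<in>Basis. g (0, i))" for g :: "real \<times> 'a \<Rightarrow> real"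
          proof -
            have "(\<Sum>c\<in>(\<lambda>u. (u, 0)) ` Basis \<union> (\<lambda>u. (0, u)) ` Basis. g c) = (\<Sum>c\<in>(\<lambda>u. (u, 0)) ` Basis. g c) + (\<Sum>c\<in>(\<lambda>u. (0, u)) ` Basis. g c)"
              by (rule sum.union_disjoint) auto
            then show ?thesis by (simp add: Basis_prod_def sum.reindex inj_on_def)
          qed
          have ir: "integrable lborel (\<lambda>r. ((1 - r) * indicator {0..1} r) * ?H q (z + r *\<^sub>R (0, h)))" if q: "q \<in> ?B" for q
          proof -
            obtain BB where BB: "\<And>z. \<bar>?H q z\<bar> \<le> BB" 
              using test_function_facts(4)[OF Btest2[of "fst q" "snd q"]] q unfolding mem_Times_iff by blast
            note [measurable] = Hm[OF q]
            show ?thesis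
              by (rule integrable_mult_bounded[OF taylor_weight(1) _ BB]) (simp add: borel_prod[symmetric])
          qed
          have "\<phi> (z + (0, h)) = \<phi> z + (\<Sum>i\<in>Basis. (h \<bullet> i) * partial (0, i) \<phi> z) + 
             (LINT r|lborel. (1 - r) * indicator {0..1} r * (\<Sum>q\<in>?B. (h \<bullet> fst q) * (h \<bullet> snd q) * ?H q (z + r *\<^sub>R (0, h))))"
            using taylor_integral[OF test_function_smooth[OF \<phi>], of z "(0, h)"]
            unfolding sum.cartesian_product[symmetric] sB by (simp add: sum.cartesian_product case_prod_unfold)
          also have "(LINT r|lborel. (1 - r) * indicator {0..1} r * (\<Sum>q\<in>?B. (h \<bullet> fst q) * (h \<bullet> snd q) * ?H q (z + r *\<^sub>R (0, h)))) =
             (LINT r|lborel. (\<Sum>q\<in>?B. (h \<bullet> fst q) * (h \<bullet> snd q) * ((1 - r) * indicator {0..1} r * ?H q (z + r *\<^sub>R (0, h)))))"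
            by (intro Bochner_Integration.integral_cong refl) (simp add: sum_distrib_left mult.left_commute)
          also have "\<dots> = (\<Sum>q\<in>?B. (h \<bullet> fst q) * (h \<bullet> snd q) * (LINT r|lborel. (1 - r) * indicator {0..1} r * ?H q (z + r *\<^sub>R (0, h))))"
            using ir by (subst Bochner_Integration.integral_sum) auto
          finally have "v z * \<phi> (z + (0, h)) = v z * \<phi> z + (\<Sum>i\<in>Basis. (h \<bullet> i) * (v z * partial (0, i) \<phi> z)) + 
            (\<Sum>q\<in>?B. (h \<bullet> fst q) * (h \<bullet> snd q) * ((LINT r|lborel. (1 - r) * indicator {0..1} r * ?H q (z + r *\<^sub>R (0, h))) * v z))"
            by (simp add: distrib_left sum_distrib_left mult.left_commute mult.commute)
          then show "v (z + (0, h) - (0, h)) * \<phi> (z + (0, h)) = v z * \<phi> z + (\<Sum>i\<in>Basis. (h \<bullet> i) * (v z * partial (0, i) \<phi> z)) + 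
            (\<Sum>q\<in>?B. (h \<bullet> fst q) * (h \<bullet> snd q) * (LINT r|lborel. ((1 - r) * indicator {0..1} r) * (?H q (z - (0, - r *\<^sub>R h)) * v z)))"
            by (cases z) (simp add: mult.assoc[symmetric])
        qed
        also have "\<dots> = (LINT z|lborel. v z * \<phi> z) + (\<Sum>i\<in>Basis. (h \<bullet> i) * b i) + 
            (\<Sum>q\<in>?B. (h \<bullet> fst q) * (h \<bullet> snd q) * (LINT z|lborel. LINT r|lborel. ((1 - r) * indicator {0..1} r) * (?H q (z - (0, - r *\<^sub>R h)) * v z)))"
        proof -
          have I1: "integrable lborel (\<lambda>z. v z * \<phi> z)" by (rule v\<zeta>[OF \<phi>m \<phi>L])
          have I2: "integrable lborel (\<lambda>z. (h \<bullet> i) * (v z * partial (0, i) \<phi> z))" if "i \<in> Basis" for i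
            using v\<zeta>[OF test_function_facts(2,3)[OF Btest[OF that]]] by simp
          have I3: "integrable lborel (\<lambda>z. (h \<bullet> fst q) * (h \<bullet> snd q) * (LINT r|lborel. ((1 - r) * indicator {0..1} r) * (?H q (z - (0, - r *\<^sub>R h)) * v z)))" if "q \<in> ?B" for q
            using lborel_pair.integrable_snd[OF pair[OF that]] by (intro integrable_mult_right)
          have S2: "(LINT z|lborel. (\<Sum>i\<in>Basis. (h \<bullet> i) * (v z * partial (0, i) \<phi> z))) = (\<Sum>i\<in>Basis. (h \<bullet> i) * b i)"
            by (subst Bochner_Integration.integral_sum[OF I2]) (simp_all add: b_def)
          have S3: "(LINT z|lborel. (\<Sum>q\<in>?B. (h \<bullet> fst q) * (h \<bullet> snd q) * (LINT r|lborel. ((1 - r) * indicator {0..1} r) * (?H q (z - (0, - r *\<^sub>R h)) * v z))))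
             = (\<Sum>q\<in>?B. (h \<bullet> fst q) * (h \<bullet> snd q) * (LINT z|lborel. LINT r|lborel. ((1 - r) * indicator {0..1} r) * (?H q (z - (0, - r *\<^sub>R h)) * v z)))"
            by (subst Bochner_Integration.integral_sum[OF I3]) simp_all
          have I2': "integrable lborel (\<lambda>z. \<Sum>i\<in>Basis. (h \<bullet> i) * (v z * partial (0, i) \<phi> z))"
            by (rule Bochner_Integration.integrable_sum[OF I2])
          have I3': "integrable lborel (\<lambda>z. \<Sum>q\<in>?B. (h \<bullet> fst q) * (h \<bullet> snd q) * (LINT r|lborel. ((1 - r) * indicator {0..1} r) * (?H q (z - (0, - r *\<^sub>R h)) * v z)))"
            by (rule Bochner_Integration.integrable_sum[OF I3])
          show ?thesis unfolding S2[symmetric] S3[symmetric]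
            by (rule trans[OF Bochner_Integration.integral_add[OF Bochner_Integration.integrable_add[OF I1 I2'] I3']])
               (rule arg_cong2[where f = "(+)", OF Bochner_Integration.integral_add[OF I1 I2'] refl])
        qed
        also have "(LINT z|lborel. v z * \<phi> z) = V 0" by (simp add: V_def zero_prod_def[symmetric])
        also have "(\<Sum>q\<in>?B. (h \<bullet> fst q) * (h \<bullet> snd q) * (LINT z|lborel. LINT r|lborel. ((1 - r) * indicator {0..1} r) * (?H q (z - (0, - r *\<^sub>R h)) * v z)))
          = (\<Sum>q\<in>?B. (h \<bullet> fst q) * (h \<bullet> snd q) * (LINT r|lborel. ((1 - r) * indicator {0..1} r) * \<alpha> q (r *\<^sub>R h)))"
        proof (intro sum.cong refl arg_cong2[where f = "(*)"])
          fix q assume q: "q \<in> ?B"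
          note [measurable] = a[OF q]
          have "(LINT z|lborel. LINT r|lborel. ((1 - r) * indicator {0..1} r) * (?H q (z - (0, - r *\<^sub>R h)) * v z)) =
            (LINT r|lborel. LINT z|lborel. ((1 - r) * indicator {0..1} r) * (?H q (z - (0, - r *\<^sub>R h)) * v z))"
            by (rule lborel_pair.Fubini_integral[OF pair[OF q]])
          also have "\<dots> = (LINT r|lborel. ((1 - r) * indicator {0..1} r) * \<alpha> q (r *\<^sub>R h))"
          proof (intro Bochner_Integration.integral_cong refl)
            fix r :: real
            let ?\<phi>r = "\<lambda>z. \<phi> (z + (0, r *\<^sub>R h))"
            have tr: "test_function ?Q ?\<phi>r" by (rule test_function_translate[OF \<phi>])
            have p1: "partial (0, j) ?\<phi>r = (\<lambda>z. partial (0, j) \<phi> (z + (0, r *\<^sub>R h)))" for j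
              using partial_translate[OF test_function_differentiable[OF \<phi>]] by blast
            have p2: "partial (0, i) (\<lambda>z. partial (0, j) \<phi> (z + (0, r *\<^sub>R h))) = (\<lambda>z. partial (0, i) (partial (0, j) \<phi>) (z + (0, r *\<^sub>R h)))" if "j \<in> Basis" for i j
              using partial_translate[OF test_function_differentiable[OF Btest[OF that]]] by blast
            have eqz: "z - (0, - r *\<^sub>R h) = z + (0, r *\<^sub>R h)" for z :: "real \<times> 'a" by (cases z) simp
            have "(LINT z|lborel. ?H q (z - (0, - r *\<^sub>R h)) * v z) = (LINT z|lborel. v z * partial (0, fst q) (partial (0, snd q) ?\<phi>r) z)"
              using q unfolding eqz by (subst p1, subst p2) (auto simp: mult.commute)
            also have "\<dots> = (LINT z|lborel. a (fst q, snd q) z * ?\<phi>r z)" by (rule weak[OF tr]) (use q in auto)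
            also have "\<dots> = (LINT z|lborel. a q (z - (0, r *\<^sub>R h)) * ?\<phi>r (z - (0, r *\<^sub>R h)))"
              unfolding prod.collapse by (rule integral_lborel_shift(2)[symmetric]) measurable
            finally show "(LINT z|lborel. ((1 - r) * indicator {0..1} r) * (?H q (z - (0, - r *\<^sub>R h)) * v z)) = ((1 - r) * indicator {0..1} r) * \<alpha> q (r *\<^sub>R h)"
              by (simp add: \<alpha>_def)
          qed
          finally show "(LINT z|lborel. LINT r|lborel. ((1 - r) * indicator {0..1} r) * (?H q (z - (0, - r *\<^sub>R h)) * v z)) = \<dots>" .
        qed
        finally show ?thesis .
      qed
      have \<alpha>i: "integrable lborel (\<lambda>p. m q p * \<alpha> q (\<epsilon> *\<^sub>R snd p *\<^sub>R fst p))" if q: "q \<in> ?B" for q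
        using lborel_pair.integrable_fst[OF a\<zeta>[OF q \<phi>m \<phi>L]] by (simp add: \<alpha>_def s_def)
      have \<alpha>prod: "integrable lborel (\<lambda>y. k y * ((y \<bullet> fst q) * (y \<bullet> snd q) * (LINT r|lborel. ((1 - r) * indicator {0..1} r) * \<alpha> q (r *\<^sub>R \<epsilon> *\<^sub>R y))))"
        "(LINT y|lborel. k y * ((y \<bullet> fst q) * (y \<bullet> snd q) * (LINT r|lborel. ((1 - r) * indicator {0..1} r) * \<alpha> q (r *\<^sub>R \<epsilon> *\<^sub>R y)))) = (LINT p|lborel. m q p * \<alpha> q (\<epsilon> *\<^sub>R snd p *\<^sub>R fst p))"
        if q: "q \<in> ?B" for q
      proof -
        have I: "integrable (lborel \<Otimes>\<^sub>M lborel) (\<lambda>(y, r). m q (y, r) * \<alpha> q (\<epsilon> *\<^sub>R r *\<^sub>R y))"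
          using \<alpha>i[OF q] by (simp add: lborel_prod case_prod_unfold)
        have e: "(LINT r|lborel. m q (y, r) * \<alpha> q (\<epsilon> *\<^sub>R r *\<^sub>R y)) = k y * ((y \<bullet> fst q) * (y \<bullet> snd q) * (LINT r|lborel. ((1 - r) * indicator {0..1} r) * \<alpha> q (r *\<^sub>R \<epsilon> *\<^sub>R y)))" for y
          by (simp add: m_def mult.assoc mult.commute[of \<epsilon>])
        show "integrable lborel (\<lambda>y. k y * ((y \<bullet> fst q) * (y \<bullet> snd q) * (LINT r|lborel. ((1 - r) * indicator {0..1} r) * \<alpha> q (r *\<^sub>R \<epsilon> *\<^sub>R y))))"
          using lborel_pair.integrable_fst[OF I] unfolding e .
        show "(LINT y|lborel. k y * ((y \<bullet> fst q) * (y \<bullet> snd q) * (LINT r|lborel. ((1 - r) * indicator {0..1} r) * \<alpha> q (r *\<^sub>R \<epsilon> *\<^sub>R y)))) = (LINT p|lborel. m q p * \<alpha> q (\<epsilon> *\<^sub>R snd p *\<^sub>R fst p))"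
          using lborel_pair.integral_fst[OF I] unfolding e by (simp add: lborel_prod case_prod_unfold)
      qed
      let ?I = "\<lambda>q y. LINT r|lborel. ((1 - r) * indicator {0..1} r) * \<alpha> q (r *\<^sub>R \<epsilon> *\<^sub>R y)"
      \<comment> \<open>Average the expansion of \<open>V (\<epsilon> y)\<close> with \<open>k\<close>.\<close>
      have "(LINT z|lborel. space_average k \<epsilon> v z * \<phi> z) = (LINT y|lborel. LINT z|lborel. k y * (v (z - (0, \<epsilon> *\<^sub>R y)) * \<phi> z))"
        unfolding avg_eq by (rule lborel_pair.Fubini_integral[OF K\<zeta>[OF \<phi>m \<phi>L]])
      also have "\<dots> = (LINT y|lborel. k y * V 0 + (\<Sum>i\<in>Basis. \<epsilon> * b i * (k y * (y \<bullet> i))) + (\<Sum>q\<in>?B. \<epsilon>\<^sup>2 * (k y * ((y \<bullet> fst q) * (y \<bullet> snd q) * ?I q y))))"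
      proof (intro Bochner_Integration.integral_cong refl)
        fix y
        have "(LINT z|lborel. k y * (v (z - (0, \<epsilon> *\<^sub>R y)) * \<phi> z)) = k y * V (\<epsilon> *\<^sub>R y)" by (simp add: V_def)
        also have "\<dots> = k y * V 0 + (\<Sum>i\<in>Basis. \<epsilon> * b i * (k y * (y \<bullet> i))) + (\<Sum>q\<in>?B. \<epsilon>\<^sup>2 * (k y * ((y \<bullet> fst q) * (y \<bullet> snd q) * ?I q y)))"
          by (subst V) (simp add: distrib_left sum_distrib_left power2_eq_square ac_simps)
        finally show "(LINT z|lborel. k y * (v (z - (0, \<epsilon> *\<^sub>R y)) * \<phi> z)) = \<dots>" .
      qed
      also have "\<dots> = (LINT y|lborel. k y * V 0) + (LINT y|lborel. (\<Sum>i\<in>Basis. \<epsilon> * b i * (k y * (y \<bullet> i)))) + (LINT y|lborel. (\<Sum>q\<in>?B. \<epsilon>\<^sup>2 * (k y * ((y \<bullet> fst q) * (y \<bullet> snd q) * ?I q y))))"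
      proof -
        have I1: "integrable lborel (\<lambda>y. k y * V 0)" using kint by simp
        have I2: "integrable lborel (\<lambda>y. \<Sum>i\<in>Basis. \<epsilon> * b i * (k y * (y \<bullet> i)))" using M1(1) by (intro Bochner_Integration.integrable_sum integrable_mult_right)
        have I3: "integrable lborel (\<lambda>y. \<Sum>q\<in>?B. \<epsilon>\<^sup>2 * (k y * ((y \<bullet> fst q) * (y \<bullet> snd q) * ?I q y)))" using \<alpha>prod(1) by (intro Bochner_Integration.integrable_sum integrable_mult_right)
        show ?thesis
          unfolding Bochner_Integration.integral_add[OF Bochner_Integration.integrable_add[OF I1 I2] I3] Bochner_Integration.integral_add[OF I1 I2] ..
      qed
      also have "(LINT y|lborel. k y * V 0) = V 0" using k1 by simp
      also have "(LINT y|lborel. (\<Sum>i\<in>Basis. \<epsilon> * b i * (k y * (y \<bullet> i)))) = 0"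
        using M1 by (subst Bochner_Integration.integral_sum) auto
      also have "(LINT y|lborel. (\<Sum>q\<in>?B. \<epsilon>\<^sup>2 * (k y * ((y \<bullet> fst q) * (y \<bullet> snd q) * ?I q y)))) = \<epsilon>\<^sup>2 * (\<Sum>q\<in>?B. LINT p|lborel. m q p * \<alpha> q (\<epsilon> *\<^sub>R snd p *\<^sub>R fst p))"
        using \<alpha>prod by (subst Bochner_Integration.integral_sum) (auto simp: sum_distrib_left simp del: mem_Times_iff)
      finally have S1: "((LINT z|lborel. space_average k \<epsilon> v z * \<phi> z) - V 0) / \<epsilon>\<^sup>2 = (\<Sum>q\<in>?B. LINT p|lborel. m q p * \<alpha> q (\<epsilon> *\<^sub>R snd p *\<^sub>R fst p))"
        using \<epsilon> by simp
      have S2: "A * (\<Sum>i\<in>Basis. LINT z|lborel. a (i, i) z * \<phi> z) = (\<Sum>q\<in>?B. LINT p|lborel. m q p * \<alpha> q 0)"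
      proof -
        have "(\<Sum>q\<in>?B. LINT p|lborel. m q p * \<alpha> q 0) = (\<Sum>q\<in>?B. (if fst q = snd q then A else 0) * \<alpha> q 0)"
          by (intro sum.cong refl) (simp add: mI)
        also have "\<dots> = (\<Sum>i\<in>Basis. \<Sum>j\<in>Basis. (if i = j then A else 0) * \<alpha> (i, j) 0)"
          by (simp add: sum.cartesian_product case_prod_unfold)
        also have "\<dots> = (\<Sum>i\<in>Basis. \<Sum>j\<in>Basis. if i = j then A * \<alpha> (i, i) 0 else 0)"
          by (intro sum.cong refl) auto
        also have "\<dots> = (\<Sum>i\<in>Basis. A * \<alpha> (i, i) 0)" by (simp add: sum.delta)
        finally show ?thesis by (simp add: \<alpha>_def sum_distrib_left zero_prod_def[symmetric])
      qed
      have S3: "(LINT z|lborel. F z * \<phi> z) = (\<Sum>q\<in>?B. LINT p|lborel. m q p * \<alpha> q (\<epsilon> *\<^sub>R snd p *\<^sub>R fst p)) - (\<Sum>q\<in>?B. LINT p|lborel. m q p * \<alpha> q 0)"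
        unfolding F\<zeta>(2)[OF \<phi>m \<phi>L] sum_subtractf[symmetric]
      proof (intro sum.cong refl)
        fix q assume q: "q \<in> ?B"
        have "(LINT z|lborel. \<Delta> \<epsilon> q z * \<phi> z) = (LINT p|lborel. m q p * (\<alpha> q (\<epsilon> *\<^sub>R snd p *\<^sub>R fst p) - \<alpha> q 0))"
          using \<Delta>\<zeta>[OF q \<phi>m \<phi>L] by (simp add: \<alpha>_def s_def zero_prod_def[symmetric])
        also have "\<dots> = (LINT p|lborel. m q p * \<alpha> q (\<epsilon> *\<^sub>R snd p *\<^sub>R fst p)) - (LINT p|lborel. m q p * \<alpha> q 0)"
          unfolding right_diff_distrib using \<alpha>i[OF q] mi[OF q] by (intro Bochner_Integration.integral_diff) auto
        finally show "(LINT z|lborel. \<Delta> \<epsilon> q z * \<phi> z) = \<dots>" .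
      qed
      have "(LINT z|lborel. (R z - F z) * \<phi> z) = (LINT z|lborel. R z * \<phi> z) - (LINT z|lborel. F z * \<phi> z)"
        unfolding left_diff_distrib by (rule Bochner_Integration.integral_diff[OF R\<zeta>(1)[OF \<phi>m \<phi>L] F\<zeta>(1)[OF \<phi>m \<phi>L]])
      also have "\<dots> = 0"
        unfolding R\<zeta>(2)[OF \<phi>m \<phi>L] S3 S2 using S1 by (simp add: V_def zero_prod_def[symmetric])
      finally show "(LINT z|lborel. (R z - F z) * \<phi> z) = 0" .
    qed
    have "(\<integral>\<^sup>+z. indicator ?Q z * ennreal ((R z)\<^sup>2) \<partial>lborel) \<le> (\<integral>\<^sup>+z. ennreal c * (\<Sum>q\<in>?B. ennreal ((\<Delta> \<epsilon> q z)\<^sup>2)) \<partial>lborel)"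
    proof (rule nn_integral_mono_AE)
      show "AE z in lborel. indicator ?Q z * ennreal ((R z)\<^sup>2) \<le> ennreal c * (\<Sum>q\<in>?B. ennreal ((\<Delta> \<epsilon> q z)\<^sup>2))"
        using AE0
      proof eventually_elim
        case (elim z)
        have "(F z)\<^sup>2 \<le> c * (\<Sum>q\<in>?B. (\<Delta> \<epsilon> q z)\<^sup>2)"
          using Cauchy_Schwarz_ineq_sum[of "\<lambda>_. 1" "\<lambda>q. \<Delta> \<epsilon> q z" ?B] by (simp add: F_def c_def)
        then have "ennreal ((F z)\<^sup>2) \<le> ennreal (c * (\<Sum>q\<in>?B. (\<Delta> \<epsilon> q z)\<^sup>2))" by (rule ennreal_leI)
        also have "\<dots> = ennreal c * (\<Sum>q\<in>?B. ennreal ((\<Delta> \<epsilon> q z)\<^sup>2))" 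
          by (simp add: ennreal_mult sum_nonneg c_def sum_ennreal)
        finally show ?case using elim by (auto simp: indicator_def)
      qed
    qed
    also have "\<dots> = ennreal c * (\<Sum>q\<in>?B. \<integral>\<^sup>+z. ennreal ((\<Delta> \<epsilon> q z)\<^sup>2) \<partial>lborel)"
    proof -
      have [measurable]: "(\<lambda>z. ennreal ((\<Delta> \<epsilon> q z)\<^sup>2)) \<in> borel_measurable lborel" if "q \<in> ?B" for q using \<Delta>m[OF that] by measurable
      show ?thesis by (subst nn_integral_cmult) (simp_all add: nn_integral_sum del: mem_Times_iff sum_ennreal)
    qed
    also have "\<dots> \<le> \<rho> \<epsilon>" unfolding \<rho>_def by (intro mult_left_mono sum_mono \<rho>q(3)) auto
    finally show "(\<integral>\<^sup>+z. indicator ?Q z * ennreal ((nonlocal_diffusion k \<epsilon> v z - A * (\<Sum>i\<in>Basis. a (i, i) z))\<^sup>2) \<partial>lborel) \<le> \<rho> \<epsilon>"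
      by (simp only: R_def)
  qed
qed

section \<open>The energy estimate\<close>

text \<open>
  The square of an integral is a double integral over a square, whose two triangles contribute
  equally. This replaces differentiation of \<open>Z\<^sup>2\<close>, as the primitive \<open>Z\<close> is only absolutely
  continuous.
\<close>

lemma square_of_primitive:
  fixes \<phi> :: "real \<Rightarrow> real"
  assumes \<phi>: "integrable lborel \<phi>"
  shows "(LINT \<tau>|lborel. indicator {0..t} \<tau> * \<phi> \<tau>)\<^sup>2
       = 2 * (LINT \<tau>|lborel. indicator {0..t} \<tau> * (\<phi> \<tau> * (LINT s|lborel. indicator {0..\<tau>} s * \<phi> s)))"
proof -
  have [measurable]: "\<phi> \<in> borel_measurable borel" using \<phi> by auto
  define f where "f \<tau> = indicator {0..t} \<tau> * \<phi> \<tau>" for \<tau>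
  have f: "integrable lborel f"
    unfolding f_def by (rule integrable_real_mult_indicator[of "{0..t}" lborel \<phi>, simplified mult.commute[of "\<phi> _"]]) (auto intro: \<phi>)
  have [measurable]: "f \<in> borel_measurable borel" using f by auto
  have ff: "integrable (lborel \<Otimes>\<^sub>M lborel) (\<lambda>(a, b). f a * f b)"
    using integrable_product_functions[OF lborel.sigma_finite_measure_axioms lborel.sigma_finite_measure_axioms f f] by (simp add: case_prod_unfold)
  have lower: "integrable (lborel \<Otimes>\<^sub>M lborel) (\<lambda>(a, b). indicator {..a} b * (f a * f b))"
    by (rule Bochner_Integration.integrable_bound[OF ff]) (auto simp: indicator_def)
  have upper: "integrable (lborel \<Otimes>\<^sub>M lborel) (\<lambda>(a, b). indicator {a..} b * (f a * f b))"
    by (rule Bochner_Integration.integrable_bound[OF ff]) (auto simp: indicator_def)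
  have fa: "integrable lborel (\<lambda>b. indicator {..a} b * (f a * f b))" "integrable lborel (\<lambda>b. indicator {a..} b * (f a * f b))" for a
    by (rule Bochner_Integration.integrable_bound[OF integrable_mult_right[OF f, of "f a"]]; auto simp: indicator_def)+
  have "(LINT \<tau>|lborel. f \<tau>)\<^sup>2 = (LINT a|lborel. LINT b|lborel. f a * f b)"
    by (simp add: power2_eq_square)
  also have "\<dots> = (LINT a|lborel. (LINT b|lborel. indicator {..a} b * (f a * f b)) + (LINT b|lborel. indicator {a..} b * (f a * f b)))"
  proof (intro Bochner_Integration.integral_cong refl)
    fix a
    have "(LINT b|lborel. f a * f b) = (LINT b|lborel. indicator {..a} b * (f a * f b) + indicator {a..} b * (f a * f b))"
    proof (rule integral_cong_AE)
      show "AE b in lborel. f a * f b = indicator {..a} b * (f a * f b) + indicator {a..} b * (f a * f b)"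
        using AE_lborel_singleton[of a] by eventually_elim (auto simp: indicator_def)
    qed measurable
    then show "(LINT b|lborel. f a * f b) = (LINT b|lborel. indicator {..a} b * (f a * f b)) + (LINT b|lborel. indicator {a..} b * (f a * f b))"
      by (simp add: Bochner_Integration.integral_add[OF fa])
  qed
  also have "\<dots> = (LINT a|lborel. LINT b|lborel. indicator {..a} b * (f a * f b)) + (LINT a|lborel. LINT b|lborel. indicator {a..} b * (f a * f b))"
    using lborel_pair.integrable_fst[OF lower] lborel_pair.integrable_fst[OF upper] by (rule Bochner_Integration.integral_add)
  also have "(LINT a|lborel. LINT b|lborel. indicator {a..} b * (f a * f b)) = (LINT b|lborel. LINT a|lborel. indicator {a..} b * (f a * f b))"
    by (rule lborel_pair.Fubini_integral[OF upper, symmetric])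
  also have "\<dots> = (LINT a|lborel. LINT b|lborel. indicator {..a} b * (f a * f b))"
    by (intro Bochner_Integration.integral_cong refl) (auto simp: indicator_def mult.commute)
  also have "(LINT a|lborel. LINT b|lborel. indicator {..a} b * (f a * f b)) = (LINT \<tau>|lborel. indicator {0..t} \<tau> * (\<phi> \<tau> * (LINT s|lborel. indicator {0..\<tau>} s * \<phi> s)))"
  proof (intro Bochner_Integration.integral_cong refl)
    fix a
    have "indicator {..a} b * (f a * f b) = (indicator {0..t} a * \<phi> a) * (indicator {0..a} b * \<phi> b)" for b
      by (auto simp: f_def indicator_def)
    then show "(LINT b|lborel. indicator {..a} b * (f a * f b)) = indicator {0..t} a * (\<phi> a * (LINT s|lborel. indicator {0..a} s * \<phi> s))"
      by simp
  qed
  finally show ?thesis by (simp add: f_def)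
qed

text \<open>
  The weight \<open>T - t\<close> has derivative \<open>-1\<close> and vanishes at \<open>T\<close>. Hence the pairing of \<open>Z' = \<phi>\<close>
  with \<open>(T - t) Z\<close> yields \<open>Z\<^sup>2\<close> integrated over time rather than at a final time.
\<close>

lemma energy_identity_in_time:
  fixes \<phi> :: "real \<Rightarrow> real"
  assumes \<phi>: "integrable lborel \<phi>"
  defines "Z \<equiv> \<lambda>t. LINT s|lborel. indicator {0..t} s * \<phi> s"
  shows "(LINT t|lborel. indicator {0..T} t * (Z t)\<^sup>2) = 2 * (LINT t|lborel. indicator {0..T} t * ((T - t) * \<phi> t * Z t))"
proof -
  have [measurable]: "\<phi> \<in> borel_measurable borel" using \<phi> by auto
  have [measurable]: "Z \<in> borel_measurable borel"
    unfolding Z_def by (rule lborel.borel_measurable_lebesgue_integral[unfolded borel_prod]) measurable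
  have Zb: "\<bar>Z t\<bar> \<le> (LINT s|lborel. \<bar>\<phi> s\<bar>)" for t
  proof -
    have "integrable lborel (\<lambda>s. indicator {0..t} s * \<phi> s)"
      by (rule Bochner_Integration.integrable_bound[OF \<phi>]) (auto simp: indicator_def)
    then show ?thesis unfolding Z_def using \<phi>
      by (intro abs_integral_le_AE) (auto simp: indicator_def)
  qed
  have \<phi>Z: "integrable lborel (\<lambda>\<tau>. \<phi> \<tau> * Z \<tau>)" by (rule integrable_mult_bounded[OF \<phi> _ Zb]) measurable
  have i1: "integrable lborel (indicat_real {0..T})" by simp
  have P: "integrable (lborel \<Otimes>\<^sub>M lborel) (\<lambda>(t, \<tau>). indicator {0..T} t * (\<phi> \<tau> * Z \<tau>))"
    using integrable_product_functions[OF lborel.sigma_finite_measure_axioms lborel.sigma_finite_measure_axioms i1 \<phi>Z] by (simp add: case_prod_unfold)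
  have I: "integrable (lborel \<Otimes>\<^sub>M lborel) (\<lambda>(t, \<tau>). indicator {0..T} t * (indicator {0..t} \<tau> * (\<phi> \<tau> * Z \<tau>)))"
    by (rule Bochner_Integration.integrable_bound[OF P]) (auto simp: indicator_def)
  have "(LINT t|lborel. indicator {0..T} t * (Z t)\<^sup>2) = (LINT t|lborel. 2 * (LINT \<tau>|lborel. indicator {0..T} t * (indicator {0..t} \<tau> * (\<phi> \<tau> * Z \<tau>))))"
    unfolding Z_def by (intro Bochner_Integration.integral_cong refl) (simp add: square_of_primitive[OF \<phi>])
  also have "\<dots> = 2 * (LINT t|lborel. LINT \<tau>|lborel. indicator {0..T} t * (indicator {0..t} \<tau> * (\<phi> \<tau> * Z \<tau>)))" by simp
  also have "(LINT t|lborel. LINT \<tau>|lborel. indicator {0..T} t * (indicator {0..t} \<tau> * (\<phi> \<tau> * Z \<tau>))) = (LINT \<tau>|lborel. LINT t|lborel. indicator {0..T} t * (indicator {0..t} \<tau> * (\<phi> \<tau> * Z \<tau>)))"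
    by (rule lborel_pair.Fubini_integral[OF I, symmetric])
  also have "\<dots> = (LINT \<tau>|lborel. indicator {0..T} \<tau> * ((T - \<tau>) * \<phi> \<tau> * Z \<tau>))"
  proof (intro Bochner_Integration.integral_cong refl)
    fix \<tau>
    have eq: "(\<lambda>t. indicator {0..T} t * (indicator {0..t} \<tau> * (\<phi> \<tau> * Z \<tau>))) = (\<lambda>t. (indicator {0..T} \<tau> * (\<phi> \<tau> * Z \<tau>)) * indicator {\<tau>..T} t)"
      by (auto simp: indicator_def)
    have "(LINT t|lborel. indicator {0..T} t * (indicator {0..t} \<tau> * (\<phi> \<tau> * Z \<tau>))) = (indicator {0..T} \<tau> * (\<phi> \<tau> * Z \<tau>)) * measure lborel {\<tau>..T}"
      unfolding eq by simp
    then show "(LINT t|lborel. indicator {0..T} t * (indicator {0..t} \<tau> * (\<phi> \<tau> * Z \<tau>))) = indicator {0..T} \<tau> * ((T - \<tau>) * \<phi> \<tau> * Z \<tau>)"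
      by (auto simp: indicator_def)
  qed
  finally show ?thesis .
qed

text \<open>
  Cauchy--Schwarz in time.
\<close>

lemma time_primitive_L2:
  fixes G :: "real \<times> 'a::euclidean_space \<Rightarrow> real"
  assumes [measurable]: "G \<in> borel_measurable borel" and T: "0 < T"
    and GL: "(\<integral>\<^sup>+z. ennreal (indicator (cylinder T) z * (G z)\<^sup>2) \<partial>lborel) < \<infinity>"
  shows "(\<integral>\<^sup>+z. ennreal ((indicator (cylinder T) z * time_primitive G z)\<^sup>2) \<partial>lborel) < \<infinity>"
proof -
  let ?Q = "cylinder T :: (real \<times> 'a) set"
  have [measurable]: "G \<in> borel_measurable (borel \<Otimes>\<^sub>M borel)" "?Q \<in> sets (borel \<Otimes>\<^sub>M borel)" by (simp_all add: borel_prod)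
  define E where "E x = (\<integral>\<^sup>+\<tau>. ennreal (indicator ?Q (\<tau>, x) * (G (\<tau>, x))\<^sup>2) \<partial>lborel)" for x
  have Em[measurable]: "E \<in> borel_measurable borel" unfolding E_def[abs_def] by (rule lborel.borel_measurable_nn_integral) measurable
  have EI: "(\<integral>\<^sup>+x. E x \<partial>lborel) = (\<integral>\<^sup>+z. ennreal (indicator ?Q z * (G z)\<^sup>2) \<partial>lborel)"
    unfolding E_def lborel_prod[symmetric] by (rule lborel_pair.nn_integral_snd) measurable
  have pt: "ennreal ((indicator ?Q (t, x) * time_primitive G (t, x))\<^sup>2) \<le> (ennreal T * indicator {0..T} t) * E x" for t x
  proof (cases "t \<in> {0<..<T}")
    case True
    have "ennreal ((time_primitive G (t, x))\<^sup>2) = (ennreal \<bar>time_primitive G (t, x)\<bar>)\<^sup>2" by (simp add: ennreal_power)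
    also have "ennreal \<bar>time_primitive G (t, x)\<bar> \<le> (\<integral>\<^sup>+\<tau>. ennreal \<bar>indicator {0..t} \<tau> * G (\<tau>, x)\<bar> \<partial>lborel)"
    proof (cases "integrable lborel (\<lambda>\<tau>. indicator {0..t} \<tau> * G (\<tau>, x))")
      case True
      have "ennreal \<bar>time_primitive G (t, x)\<bar> \<le> ennreal (LINT \<tau>|lborel. \<bar>indicator {0..t} \<tau> * G (\<tau>, x)\<bar>)"
        unfolding time_primitive_def fst_conv snd_conv by (intro ennreal_leI integral_abs_bound)
      also have "\<dots> = (\<integral>\<^sup>+\<tau>. ennreal \<bar>indicator {0..t} \<tau> * G (\<tau>, x)\<bar> \<partial>lborel)"
        using True by (subst nn_integral_eq_integral) auto
      finally show ?thesis .
    qed (simp add: time_primitive_def not_integrable_integral_eq)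
    also have "\<dots> \<le> (\<integral>\<^sup>+\<tau>. indicator {0..T} \<tau> * ennreal (indicator ?Q (\<tau>, x) * \<bar>G (\<tau>, x)\<bar>) \<partial>lborel)"
    proof (rule nn_integral_mono_AE)
      show "AE \<tau> in lborel. ennreal \<bar>indicator {0..t} \<tau> * G (\<tau>, x)\<bar> \<le> indicator {0..T} \<tau> * ennreal (indicator ?Q (\<tau>, x) * \<bar>G (\<tau>, x)\<bar>)"
        using AE_lborel_singleton[of "0::real"] by eventually_elim (use True in \<open>auto simp: indicator_def\<close>)
    qed
    also have "(\<integral>\<^sup>+\<tau>. indicator {0..T} \<tau> * ennreal (indicator ?Q (\<tau>, x) * \<bar>G (\<tau>, x)\<bar>) \<partial>lborel)\<^sup>2
       \<le> (\<integral>\<^sup>+\<tau>. (indicator {0..T} \<tau>)\<^sup>2 \<partial>lborel) * (\<integral>\<^sup>+\<tau>. (ennreal (indicator ?Q (\<tau>, x) * \<bar>G (\<tau>, x)\<bar>))\<^sup>2 \<partial>lborel)"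
      by (rule Cauchy_Schwarz_nn_integral) measurable
    also have "(\<integral>\<^sup>+\<tau>. (indicator {0..T} \<tau>)\<^sup>2 \<partial>lborel) = (\<integral>\<^sup>+\<tau>. indicator {0..T} \<tau> \<partial>lborel)"
      by (intro nn_integral_cong) (simp add: indicator_def)
    also have "\<dots> = ennreal T" using T by (simp add: emeasure_lborel_Icc_eq)
    also have "(\<integral>\<^sup>+\<tau>. (ennreal (indicator ?Q (\<tau>, x) * \<bar>G (\<tau>, x)\<bar>))\<^sup>2 \<partial>lborel) = E x"
      unfolding E_def by (intro nn_integral_cong) (auto simp: ennreal_power indicator_def)
    finally show ?thesis using True by (simp add: power_mono)
  qed (auto simp: indicator_def)
  have "(\<integral>\<^sup>+z. ennreal ((indicator ?Q z * time_primitive G z)\<^sup>2) \<partial>lborel) \<le> (\<integral>\<^sup>+z. (ennreal T * indicator {0..T} (fst z)) * E (snd z) \<partial>lborel)"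
    using pt by (intro nn_integral_mono) (auto simp del: time_primitive_def)
  also have "\<dots> = (\<integral>\<^sup>+t. \<integral>\<^sup>+x. (ennreal T * indicator {0..T} t) * E x \<partial>lborel \<partial>lborel)"
    unfolding lborel_prod[symmetric] by (subst lborel.nn_integral_fst[symmetric]) auto
  also have "\<dots> = (\<integral>\<^sup>+t. (ennreal T * indicator {0..T} t) * (\<integral>\<^sup>+x. E x \<partial>lborel) \<partial>lborel)"
    by (simp add: nn_integral_cmult)
  also have "\<dots> = (\<integral>\<^sup>+t. ennreal T * indicator {0..T} t \<partial>lborel) * (\<integral>\<^sup>+x. E x \<partial>lborel)"
    by (rule nn_integral_multc) measurable
  also have "\<dots> < \<infinity>" using GL EI T by (simp add: nn_integral_cmult ennreal_mult_less_top emeasure_lborel_Icc_eq)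
  finally show ?thesis .
qed

lemma space_average_shift: "space_average k \<epsilon> u z = (LINT y|lborel. k y * u (z - (0, \<epsilon> *\<^sub>R y)))"
  by (cases z) (simp add: space_average_def)

lemma space_average_integrable_AE:
  fixes k :: "'a::euclidean_space \<Rightarrow> real"
  assumes kint: "integrable lborel k" and u[measurable]: "u \<in> borel_measurable borel" and uL: "sqnorm u < \<infinity>"
  shows "AE z in lborel. integrable lborel (\<lambda>y. k y * u (z - (0, \<epsilon> *\<^sub>R y)))"
proof -
  have [measurable]: "k \<in> borel_measurable borel" using kint by auto
  have "integrable (lborel \<Otimes>\<^sub>M lborel) (\<lambda>(y, z). k y * (u (z - (0, \<epsilon> *\<^sub>R y)))\<^sup>2)"
    by (rule integrable_shift_product[OF kint L2_integrable_square[OF u uL]]) (simp add: borel_prod[symmetric])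
  then have "AE z in lborel. integrable lborel (\<lambda>y. k y * (u (z - (0, \<epsilon> *\<^sub>R y)))\<^sup>2)"
    by (rule lborel_pair.AE_integrable_snd)
  then show ?thesis
  proof eventually_elim
    case (elim z)
    show ?case
    proof (rule Bochner_Integration.integrable_bound)
      show "integrable lborel (\<lambda>y. \<bar>k y * (u (z - (0, \<epsilon> *\<^sub>R y)))\<^sup>2\<bar> + \<bar>k y\<bar>)" using elim kint by auto
      have "(\<lambda>y. u (z - (0, \<epsilon> *\<^sub>R y))) \<in> borel_measurable borel" by (rule measurable_compose[OF _ u]) (intro borel_measurable_continuous_onI continuous_intros)
      then show "(\<lambda>y. k y * u (z - (0, \<epsilon> *\<^sub>R y))) \<in> borel_measurable lborel" by simp
      show "AE y in lborel. norm (k y * u (z - (0, \<epsilon> *\<^sub>R y))) \<le> norm (\<bar>k y * (u (z - (0, \<epsilon> *\<^sub>R y)))\<^sup>2\<bar> + \<bar>k y\<bar>)"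
      proof (rule AE_I2)
        fix y
        have "\<bar>k y\<bar> * \<bar>u (z - (0, \<epsilon> *\<^sub>R y))\<bar> \<le> \<bar>k y\<bar> * ((u (z - (0, \<epsilon> *\<^sub>R y)))\<^sup>2 + 1)"
          using abs_mult_le_squares[of "u (z - (0, \<epsilon> *\<^sub>R y))" 1] by (intro mult_left_mono) auto
        then show "norm (k y * u (z - (0, \<epsilon> *\<^sub>R y))) \<le> norm (\<bar>k y * (u (z - (0, \<epsilon> *\<^sub>R y)))\<^sup>2\<bar> + \<bar>k y\<bar>)"
          by (simp add: abs_mult distrib_left)
      qed
    qed
  qed
qed

text \<open>
  The operator \<open>L\<close> is nonpositive: \<open>\<integral> u (\<cdot> - c) u \<le> \<integral> u\<^sup>2\<close> for every translation, and \<open>k\<close> is a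
  probability density.
\<close>

lemma space_average_contraction:
  fixes k :: "'a::euclidean_space \<Rightarrow> real"
  assumes kint: "integrable lborel k" and k0: "\<And>y. 0 \<le> k y" and k1: "(LINT y|lborel. k y) = 1"
    and u[measurable]: "u \<in> borel_measurable borel" and uL: "sqnorm u < \<infinity>"
  shows "integrable lborel (\<lambda>z. space_average k \<epsilon> u z * u z)"
    and "(LINT z|lborel. space_average k \<epsilon> u z * u z) \<le> (LINT z|lborel. (u z)\<^sup>2)"
proof -
  have I: "integrable (lborel \<Otimes>\<^sub>M lborel) (\<lambda>(y, z). k y * (u (z - (0, \<epsilon> *\<^sub>R y)) * u z))"
    by (rule integrable_shift_pairing[OF kint _ u uL u uL, of "\<lambda>y. (0, \<epsilon> *\<^sub>R y)"]) (simp add: borel_prod[symmetric])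
  have eq: "space_average k \<epsilon> u z * u z = (LINT y|lborel. k y * (u (z - (0, \<epsilon> *\<^sub>R y)) * u z))" for z
    by (simp add: space_average_shift mult.assoc flip: integral_mult_left_zero)
  show "integrable lborel (\<lambda>z. space_average k \<epsilon> u z * u z)"
    unfolding eq using lborel_pair.integrable_snd[OF I] .
  let ?S = "LINT z|lborel. (u z)\<^sup>2"
  have le: "(LINT z|lborel. u (z - c) * u z) \<le> ?S" for c
  proof -
    have u2: "integrable lborel (\<lambda>z. (u z)\<^sup>2)" by (rule L2_integrable_square[OF u uL])
    have u2c: "integrable lborel (\<lambda>z. (u (z - c))\<^sup>2)"
      using integrable_lborel_affine[OF u2, of 1 "- c"] by simp
    have ucL: "(\<integral>\<^sup>+z. ennreal ((u (z - c))\<^sup>2) \<partial>lborel) < \<infinity>"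
      using uL nn_integral_lborel_shift(2)[of "\<lambda>z. ennreal ((u z)\<^sup>2)" c] by simp
    have "(LINT z|lborel. u (z - c) * u z) \<le> (LINT z|lborel. (1/2) * (u (z - c))\<^sup>2 + (1/2) * (u z)\<^sup>2)"
    proof (rule integral_mono)
      show "integrable lborel (\<lambda>z. u (z - c) * u z)" by (rule integrable_mult_L2[OF _ u ucL uL]) measurable
      show "integrable lborel (\<lambda>z. (1/2) * (u (z - c))\<^sup>2 + (1/2) * (u z)\<^sup>2)" using u2 u2c by auto
      show "u (z - c) * u z \<le> (1/2) * (u (z - c))\<^sup>2 + (1/2) * (u z)\<^sup>2" for z
        using sum_squares_bound[of "u (z - c)" "u z"] by simp
    qed
    also have "\<dots> = (1/2) * (LINT z|lborel. (u (z - c))\<^sup>2) + (1/2) * ?S"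
      using u2 u2c by simp
    also have "(LINT z|lborel. (u (z - c))\<^sup>2) = ?S" by (rule integral_lborel_shift(2)) measurable
    finally show ?thesis by simp
  qed
  have "(LINT z|lborel. space_average k \<epsilon> u z * u z) = (LINT y|lborel. LINT z|lborel. k y * (u (z - (0, \<epsilon> *\<^sub>R y)) * u z))"
    unfolding eq by (rule lborel_pair.Fubini_integral[OF I])
  also have "\<dots> \<le> (LINT y|lborel. k y * ?S)"
  proof (rule integral_mono)
    show "integrable lborel (\<lambda>y. LINT z|lborel. k y * (u (z - (0, \<epsilon> *\<^sub>R y)) * u z))" using lborel_pair.integrable_fst[OF I] .
    show "integrable lborel (\<lambda>y. k y * ?S)" using kint by simp
    show "(LINT z|lborel. k y * (u (z - (0, \<epsilon> *\<^sub>R y)) * u z)) \<le> k y * ?S" for y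
      using le[of "(0, \<epsilon> *\<^sub>R y)"] k0[of y] by (simp add: mult_left_mono)
  qed
  also have "\<dots> = ?S" using k1 by simp
  finally show "(LINT z|lborel. space_average k \<epsilon> u z * u z) \<le> ?S" .
qed

text \<open>
  With \<open>u = w - v\<close> and \<open>f = G - \<Theta>\<close>, so that \<open>u\<close> is the time primitive of \<open>f\<close>, the two problems
  give \<open>f = L u + R + (a - b)\<close> where \<open>R\<close> is the residual and \<open>a, b \<ge> 0\<close> are the slacks.
  Complementarity, \<open>a w = b v = 0\<close>, makes \<open>(a - b) u = - a v - b w \<le> 0\<close>. Multiply by \<open>(T - t) u\<close>
  and integrate: the left side is half the square of the norm of \<open>u\<close> by
  \<open>energy_identity_in_time\<close>, the term with \<open>L\<close> is nonpositive by \<open>space_average_contraction\<close>,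
  and \<open>(T - t) R u \<le> u\<^sup>2 / 4 + T\<^sup>2 R\<^sup>2\<close>.
\<close>

theorem energy_estimate:
  fixes k :: "'a::euclidean_space \<Rightarrow> real" and G \<Theta> \<Lambda> :: "real \<times> 'a \<Rightarrow> real"
  assumes kint: "integrable lborel k" and k0: "\<And>y. 0 \<le> k y" and k1: "(LINT y|lborel. k y) = 1"
    and \<epsilon>: "0 < \<epsilon>" and T: "0 < T"
    and G[measurable]: "G \<in> borel_measurable borel" and G0: "\<And>z. 0 \<le> G z"
    and \<Theta>[measurable]: "\<Theta> \<in> borel_measurable borel" and \<Theta>0: "\<And>z. 0 \<le> \<Theta> z"
    and GL: "(\<integral>\<^sup>+z. ennreal (indicator (cylinder T) z * (G z)\<^sup>2) \<partial>lborel) < \<infinity>"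
    and \<Theta>L: "(\<integral>\<^sup>+z. ennreal (indicator (cylinder T) z * (\<Theta> z)\<^sup>2) \<partial>lborel) < \<infinity>"
    and \<Lambda>[measurable]: "\<Lambda> \<in> borel_measurable borel"
    and nonlocal: "AE z in lborel. z \<in> cylinder T \<longrightarrow> 
        complementary (\<Gamma> (snd z) + nonlocal_diffusion k \<epsilon> (time_primitive G) z) (G z) (time_primitive G z)"
    and local: "AE z in lborel. z \<in> cylinder T \<longrightarrow> complementary (\<Gamma> (snd z) + \<Lambda> z) (\<Theta> z) (time_primitive \<Theta> z)"
    and \<rho>0: "0 \<le> \<rho>" and cons: "(\<integral>\<^sup>+z. indicator (cylinder T) z * ennreal (((space_average k \<epsilon> (\<lambda>z. indicator (cylinder T) z * time_primitive \<Theta> z) z 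
          - indicator (cylinder T) z * time_primitive \<Theta> z) / \<epsilon>\<^sup>2 - \<Lambda> z)\<^sup>2) \<partial>lborel) \<le> ennreal \<rho>"
  shows "(\<integral>\<^sup>+z. ennreal (indicator (cylinder T) z * (time_primitive G z - time_primitive \<Theta> z)\<^sup>2) \<partial>lborel) \<le> ennreal (4 * T\<^sup>2 * \<rho>)"
proof -
  let ?Q = "cylinder T :: (real \<times> 'a) set"
  have [measurable]: "k \<in> borel_measurable borel" using kint by auto
  have [measurable]: "?Q \<in> sets (borel \<Otimes>\<^sub>M borel)" by (simp add: borel_prod)
  define w where "w z = indicator ?Q z * time_primitive G z" for z
  define v where "v z = indicator ?Q z * time_primitive \<Theta> z" for z
  define u where "u z = w z - v z" for z
  define f where "f z = indicator ?Q z * (G z - \<Theta> z)" for z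
  define R where "R z = indicator ?Q z * (nonlocal_diffusion k \<epsilon> v z - \<Lambda> z)" for z
  have wm[measurable]: "w \<in> borel_measurable borel" unfolding w_def by measurable
  have vm[measurable]: "v \<in> borel_measurable borel" unfolding v_def by measurable
  have um[measurable]: "u \<in> borel_measurable borel" unfolding u_def by measurable
  have fm[measurable]: "f \<in> borel_measurable borel" unfolding f_def by measurable
  have Rm[measurable]: "R \<in> borel_measurable borel" unfolding R_def by measurable
  have wL: "sqnorm w < \<infinity>" unfolding w_def by (rule time_primitive_L2[OF G T GL])
  have vL: "sqnorm v < \<infinity>" unfolding v_def by (rule time_primitive_L2[OF \<Theta> T \<Theta>L])
  have diffL: "(\<integral>\<^sup>+z. ennreal ((g z - h z)\<^sup>2) \<partial>lborel) < \<infinity>"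
    if [measurable]: "g \<in> borel_measurable borel" "h \<in> borel_measurable borel" and gL: "sqnorm g < \<infinity>" and hL: "sqnorm h < \<infinity>"
    for g h :: "real \<times> 'a \<Rightarrow> real"
  proof -
    have "(\<integral>\<^sup>+z. ennreal ((g z - h z)\<^sup>2) \<partial>lborel) \<le> (\<integral>\<^sup>+z. 2 * ennreal ((g z)\<^sup>2) + 2 * ennreal ((h z)\<^sup>2) \<partial>lborel)"
    proof (rule nn_integral_mono)
      fix z
      have "ennreal ((g z - h z)\<^sup>2) \<le> ennreal (2 * (g z)\<^sup>2 + 2 * (h z)\<^sup>2)" by (intro ennreal_leI square_diff_le)
      then show "ennreal ((g z - h z)\<^sup>2) \<le> 2 * ennreal ((g z)\<^sup>2) + 2 * ennreal ((h z)\<^sup>2)" by (simp add: ennreal_plus ennreal_mult')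
    qed
    also have "\<dots> = 2 * sqnorm g + 2 * sqnorm h"
      by (subst nn_integral_add) (auto simp: nn_integral_cmult)
    also have "\<dots> < \<infinity>" using gL hL by (simp add: ennreal_mult_less_top)
    finally show ?thesis .
  qed
  have uL: "sqnorm u < \<infinity>" unfolding u_def by (rule diffL[OF _ _ wL vL]) measurable
  have fL: "sqnorm f < \<infinity>"
  proof -
    have e: "f z = indicator ?Q z * G z - indicator ?Q z * \<Theta> z" for z by (simp add: f_def right_diff_distrib)
    have i: "(indicator ?Q z * g)\<^sup>2 = indicator ?Q z * g\<^sup>2" for z and g :: real by (simp add: indicator_def)
    show ?thesis unfolding e by (rule diffL) (use GL \<Theta>L in \<open>simp_all add: i\<close>)
  qed
  have RLe: "sqnorm R \<le> ennreal \<rho>"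
  proof -
    have "ennreal ((R z)\<^sup>2) = indicator ?Q z * ennreal ((nonlocal_diffusion k \<epsilon> v z - \<Lambda> z)\<^sup>2)" for z
      by (auto simp: R_def indicator_def)
    then show ?thesis using cons by (simp add: v_def[abs_def])
  qed
  then have RL: "sqnorm R < \<infinity>" by (rule order.strict_trans1) simp
  have u2: "integrable lborel (\<lambda>z. (u z)\<^sup>2)" by (rule L2_integrable_square[OF um uL])
  have R2: "integrable lborel (\<lambda>z. (R z)\<^sup>2)" by (rule L2_integrable_square[OF Rm RL])
  \<comment> \<open>The weight \<open>T - t\<close>, cut off so that it is bounded for all times.\<close>
  define \<psi> where "\<psi> z = max 0 (min T (T - fst z))" for z :: "real \<times> 'a"
  have [measurable]: "\<psi> \<in> borel_measurable borel" unfolding \<psi>_def borel_prod[symmetric] by measurable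
  have \<psi>: "0 \<le> \<psi> z" "\<psi> z \<le> T" for z using T by (auto simp: \<psi>_def)
  have \<psi>fu: "integrable lborel (\<lambda>z. \<psi> z * (f z * u z))"
    using integrable_mult_bounded[OF integrable_mult_L2[OF fm um fL uL], of \<psi> T] \<psi> by (auto simp: mult.commute)
  have E: "(LINT z|lborel. (u z)\<^sup>2) = 2 * (LINT z|lborel. \<psi> z * (f z * u z))"
  proof -
    have sq: "(LINT x|lborel. LINT t|lborel. (u (t, x))\<^sup>2) = (LINT z|lborel. (u z)\<^sup>2)"
      using lborel_pair.integral_snd[of "\<lambda>t x. (u (t, x))\<^sup>2"] u2 by (simp add: lborel_prod case_prod_unfold)
    have pr: "(LINT x|lborel. LINT t|lborel. \<psi> (t, x) * (f (t, x) * u (t, x))) = (LINT z|lborel. \<psi> z * (f z * u z))"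
      using lborel_pair.integral_snd[of "\<lambda>t x. \<psi> (t, x) * (f (t, x) * u (t, x))"] \<psi>fu by (simp add: lborel_prod case_prod_unfold)
    have f2: "integrable (lborel \<Otimes>\<^sub>M lborel) (\<lambda>(t, x). (f (t, x))\<^sup>2)"
      using L2_integrable_square[OF fm fL] by (simp add: lborel_prod case_prod_unfold)
    have gi: "integrable (lborel \<Otimes>\<^sub>M lborel) (\<lambda>(t, x). (indicator ?Q (t, x) * g (t, x))\<^sup>2)"
      if [measurable]: "g \<in> borel_measurable borel" and "(\<integral>\<^sup>+z. ennreal (indicator ?Q z * (g z)\<^sup>2) \<partial>lborel) < \<infinity>" for g :: "real \<times> 'a \<Rightarrow> real"
    proof -
      have i: "(indicator ?Q z * g z)\<^sup>2 = indicator ?Q z * (g z)\<^sup>2" for z by (simp add: indicator_def)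
      have "integrable lborel (\<lambda>z. (indicator ?Q z * g z)\<^sup>2)" by (rule L2_integrable_square) (use that(2) in \<open>simp_all add: i\<close>)
      then show ?thesis by (simp add: lborel_prod case_prod_unfold)
    qed
    have "AE x in lborel. (LINT t|lborel. (u (t, x))\<^sup>2) = 2 * (LINT t|lborel. \<psi> (t, x) * (f (t, x) * u (t, x)))"
      using lborel_pair.AE_integrable_snd[OF gi[OF G GL]] lborel_pair.AE_integrable_snd[OF gi[OF \<Theta> \<Theta>L]]
    proof eventually_elim
      case (elim x)
      have L1: "integrable lborel (\<lambda>t. indicator ?Q (t, x) * g (t, x))"
        if gm: "g \<in> borel_measurable borel" and g2: "integrable lborel (\<lambda>t. (indicator ?Q (t, x) * g (t, x))\<^sup>2)" for g :: "real \<times> 'a \<Rightarrow> real"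
      proof (rule Bochner_Integration.integrable_bound)
        have [measurable]: "g \<in> borel_measurable (borel \<Otimes>\<^sub>M borel)" using gm by (simp add: borel_prod)
        have "integrable lborel (indicat_real {0..T})" by simp
        then show "integrable lborel (\<lambda>t. (indicator ?Q (t, x) * g (t, x))\<^sup>2 + indicat_real {0..T} t)" using g2 by auto
        show "(\<lambda>t. indicator ?Q (t, x) * g (t, x)) \<in> borel_measurable lborel" by measurable
        show "AE t in lborel. norm (indicator ?Q (t, x) * g (t, x)) \<le> norm ((indicator ?Q (t, x) * g (t, x))\<^sup>2 + indicat_real {0..T} t)"
          using abs_mult_le_squares[of "g (_, x)" 1] by (intro AE_I2) (auto simp: indicator_def)
      qed
      have LG: "integrable lborel (\<lambda>t. indicator ?Q (t, x) * G (t, x))" and L\<Theta>: "integrable lborel (\<lambda>t. indicator ?Q (t, x) * \<Theta> (t, x))"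
        using L1[OF G] L1[OF \<Theta>] elim by simp_all
      have fi: "integrable lborel (\<lambda>t. f (t, x))"
        using Bochner_Integration.integrable_diff[OF LG L\<Theta>] by (simp add: f_def right_diff_distrib)
      let ?Z = "\<lambda>t. LINT s|lborel. indicator {0..t} s * f (s, x)"
      have tp: "integrable lborel (\<lambda>s. indicator {0..t} s * (indicator ?Q (s, x) * g (s, x)))"
        "(LINT s|lborel. indicator {0..t} s * (indicator ?Q (s, x) * g (s, x))) = time_primitive g (t, x)"
        if gm: "g \<in> borel_measurable borel" and gi: "integrable lborel (\<lambda>t. indicator ?Q (t, x) * g (t, x))" and t: "t < T" for g :: "real \<times> 'a \<Rightarrow> real" and t
      proof -
        have [measurable]: "g \<in> borel_measurable (borel \<Otimes>\<^sub>M borel)" using gm by (simp add: borel_prod)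
        show "integrable lborel (\<lambda>s. indicator {0..t} s * (indicator ?Q (s, x) * g (s, x)))"
          by (rule Bochner_Integration.integrable_bound[OF gi]) (auto simp: indicator_def)
        show "(LINT s|lborel. indicator {0..t} s * (indicator ?Q (s, x) * g (s, x))) = time_primitive g (t, x)"
          unfolding time_primitive_def fst_conv snd_conv
        proof (rule integral_cong_AE)
          show "AE s in lborel. indicator {0..t} s * (indicator ?Q (s, x) * g (s, x)) = indicator {0..t} s * g (s, x)"
            using AE_lborel_singleton[of "0::real"] by eventually_elim (use t in \<open>auto simp: indicator_def\<close>)
        qed measurable
      qed
      have uZ: "u (t, x) = ?Z t" if t: "t \<in> {0<..<T}" for t
      proof -
        have "?Z t = (LINT s|lborel. indicator {0..t} s * (indicator ?Q (s, x) * G (s, x)) - indicator {0..t} s * (indicator ?Q (s, x) * \<Theta> (s, x)))"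
          by (intro Bochner_Integration.integral_cong refl) (simp add: f_def algebra_simps)
        also have "\<dots> = time_primitive G (t, x) - time_primitive \<Theta> (t, x)"
          using t by (subst Bochner_Integration.integral_diff) (simp_all add: tp[OF G LG] tp[OF \<Theta> L\<Theta>])
        finally show ?thesis using t by (simp add: u_def w_def v_def)
      qed
      have u0: "u (t, x) = 0" if "t \<notin> {0<..<T}" for t using that by (auto simp: u_def w_def v_def indicator_def)
      have [measurable]: "f \<in> borel_measurable (borel \<Otimes>\<^sub>M borel)" "u \<in> borel_measurable (borel \<Otimes>\<^sub>M borel)" "\<psi> \<in> borel_measurable (borel \<Otimes>\<^sub>M borel)"
        by (simp_all add: borel_prod)
      have Zm[measurable]: "?Z \<in> borel_measurable borel"
        by (rule lborel.borel_measurable_lebesgue_integral[unfolded borel_prod]) (simp add: borel_prod[symmetric])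
      have "(LINT t|lborel. (u (t, x))\<^sup>2) = (LINT t|lborel. indicator {0..T} t * (?Z t)\<^sup>2)"
      proof (rule integral_cong_AE)
        show "AE t in lborel. (u (t, x))\<^sup>2 = indicator {0..T} t * (?Z t)\<^sup>2"
          using AE_lborel_singleton[of "0::real"] AE_lborel_singleton[of T]
          by eventually_elim (use uZ u0 in \<open>auto simp: indicator_def\<close>)
      qed measurable
      also have "\<dots> = 2 * (LINT t|lborel. indicator {0..T} t * ((T - t) * f (t, x) * ?Z t))"
        by (rule energy_identity_in_time[OF fi])
      also have "(LINT t|lborel. indicator {0..T} t * ((T - t) * f (t, x) * ?Z t)) = (LINT t|lborel. \<psi> (t, x) * (f (t, x) * u (t, x)))"
      proof (rule integral_cong_AE)
        show "AE t in lborel. indicator {0..T} t * ((T - t) * f (t, x) * ?Z t) = \<psi> (t, x) * (f (t, x) * u (t, x))"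
          using AE_lborel_singleton[of "0::real"] AE_lborel_singleton[of T]
        proof eventually_elim
          case (elim t)
          show ?case using elim uZ[of t] u0[of t] by (cases "t \<in> {0<..<T}") (auto simp: indicator_def \<psi>_def)
        qed
      qed measurable
      finally show ?case .
    qed
    then have "(LINT x|lborel. LINT t|lborel. (u (t, x))\<^sup>2) = (LINT x|lborel. 2 * (LINT t|lborel. \<psi> (t, x) * (f (t, x) * u (t, x))))"
    proof (rule integral_cong_AE[rotated 2])
      have [measurable]: "f \<in> borel_measurable (borel \<Otimes>\<^sub>M borel)" "u \<in> borel_measurable (borel \<Otimes>\<^sub>M borel)" "\<psi> \<in> borel_measurable (borel \<Otimes>\<^sub>M borel)"
        by (simp_all add: borel_prod)
      show "(\<lambda>x. LINT t|lborel. (u (t, x))\<^sup>2) \<in> borel_measurable lborel" "(\<lambda>x. 2 * (LINT t|lborel. \<psi> (t, x) * (f (t, x) * u (t, x)))) \<in> borel_measurable lborel"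
        by measurable
    qed
    then show ?thesis by (simp add: sq pr)
  qed
  \<comment> \<open>The weight depends on time only and commutes with averaging in space, so its square
    root can be absorbed into \<open>u\<close>.\<close>
  define q where "q z = sqrt (\<psi> z) * u z" for z
  have qm[measurable]: "q \<in> borel_measurable borel" unfolding q_def by measurable
  have q2: "(q z)\<^sup>2 = \<psi> z * (u z)\<^sup>2" for z using \<psi> by (simp add: q_def power_mult_distrib)
  have qL: "sqnorm q < \<infinity>"
  proof -
    have "sqnorm q \<le> (\<integral>\<^sup>+z. ennreal T * ennreal ((u z)\<^sup>2) \<partial>lborel)"
      using \<psi> T by (intro nn_integral_mono) (simp add: q2 ennreal_mult[symmetric] mult_right_mono ennreal_leI)
    also have "\<dots> < \<infinity>" using uL by (simp add: nn_integral_cmult ennreal_mult_less_top)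
    finally show ?thesis .
  qed
  have qavg: "space_average k \<epsilon> q z * q z = \<psi> z * (space_average k \<epsilon> u z * u z)" for z
  proof -
    have "q (z - (0, \<epsilon> *\<^sub>R y)) = sqrt (\<psi> z) * u (z - (0, \<epsilon> *\<^sub>R y))" for y by (cases z) (simp add: q_def \<psi>_def)
    then have "space_average k \<epsilon> q z = (LINT y|lborel. sqrt (\<psi> z) * (k y * u (z - (0, \<epsilon> *\<^sub>R y))))"
      by (simp add: space_average_shift ac_simps)
    then have "space_average k \<epsilon> q z = sqrt (\<psi> z) * space_average k \<epsilon> u z"
      by (simp add: space_average_shift)
    then show ?thesis using \<psi>[of z] by (simp add: q_def mult.assoc mult.left_commute)
  qed
  note cq = space_average_contraction[OF kint k0 k1 qm qL, of \<epsilon>]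
  have key: "AE z in lborel. \<psi> z * (f z * u z) \<le> (space_average k \<epsilon> q z * q z - (q z)\<^sup>2) / \<epsilon>\<^sup>2 + ((u z)\<^sup>2 / 4 + T\<^sup>2 * (R z)\<^sup>2)"
    using nonlocal local space_average_integrable_AE[OF kint wm wL, of \<epsilon>] space_average_integrable_AE[OF kint vm vL, of \<epsilon>]
  proof eventually_elim
    case (elim z)
    have young: "\<psi> z * (R z * u z) \<le> (u z)\<^sup>2 / 4 + T\<^sup>2 * (R z)\<^sup>2"
    proof -
      have "\<psi> z * (R z * u z) \<le> \<psi> z * (\<bar>R z\<bar> * \<bar>u z\<bar>)"
        using \<psi> by (intro mult_left_mono) (auto simp: abs_mult[symmetric])
      also have "\<dots> \<le> T * (\<bar>R z\<bar> * \<bar>u z\<bar>)" using \<psi> by (intro mult_right_mono) auto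
      also have "\<dots> \<le> (u z)\<^sup>2 / 4 + T\<^sup>2 * (R z)\<^sup>2"
        using zero_le_power2[of "\<bar>u z\<bar> / 2 - T * \<bar>R z\<bar>"] by (simp add: power2_diff power_mult_distrib power_divide ac_simps)
      finally show ?thesis .
    qed
    show ?case
    proof (cases "z \<in> ?Q")
      case False
      then have "u z = 0" "q z = 0" by (auto simp: u_def w_def v_def q_def)
      then show ?thesis using T by simp
    next
      case True
      have inQ: "z - (0, \<epsilon> *\<^sub>R y) \<in> ?Q" for y using True by (cases z) auto
      let ?w = "time_primitive G z" and ?v = "time_primitive \<Theta> z"
      have wz: "w z = ?w" "v z = ?v" "f z = G z - \<Theta> z" using True by (auto simp: w_def v_def f_def)
      have Kw: "space_average k \<epsilon> (time_primitive G) z = space_average k \<epsilon> w z"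
        using inQ by (simp add: space_average_shift w_def)
      have Ku: "space_average k \<epsilon> u z = space_average k \<epsilon> w z - space_average k \<epsilon> v z"
        unfolding space_average_shift u_def right_diff_distrib using elim by (intro Bochner_Integration.integral_diff) auto
      have w0: "0 \<le> ?w" "0 \<le> ?v" using G0 \<Theta>0 by (auto simp: time_primitive_def intro!: integral_nonneg_AE)
      define a where "a = G z - \<Gamma> (snd z) - nonlocal_diffusion k \<epsilon> w z"
      define b where "b = \<Theta> z - \<Gamma> (snd z) - \<Lambda> z"
      have a: "0 \<le> a" "a * ?w = 0" and b: "0 \<le> b" "b * ?v = 0" using elim True unfolding Kw by (auto simp: a_def b_def wz diff_diff_eq)
      have "f z = nonlocal_diffusion k \<epsilon> w z - \<Lambda> z + (a - b)" by (simp add: wz a_def b_def)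
      also have "\<dots> = (space_average k \<epsilon> u z - u z) / \<epsilon>\<^sup>2 + R z + (a - b)"
        using True by (simp add: Ku R_def u_def diff_divide_distrib)
      finally have "f z * u z = (space_average k \<epsilon> u z * u z - (u z)\<^sup>2) / \<epsilon>\<^sup>2 + R z * u z + (a - b) * u z"
        by (simp add: distrib_right left_diff_distrib power2_eq_square)
      also have "(a - b) * u z = a * ?w - a * ?v - b * ?w + b * ?v" by (simp add: u_def wz algebra_simps)
      also have "\<dots> \<le> 0" using a b w0 mult_nonneg_nonneg[OF a(1) w0(2)] mult_nonneg_nonneg[OF b(1) w0(1)] by linarith
      finally have "f z * u z \<le> (space_average k \<epsilon> u z * u z - (u z)\<^sup>2) / \<epsilon>\<^sup>2 + R z * u z" by simp
      then have "\<psi> z * (f z * u z) \<le> \<psi> z * ((space_average k \<epsilon> u z * u z - (u z)\<^sup>2) / \<epsilon>\<^sup>2 + R z * u z)"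
        using \<psi> by (intro mult_left_mono) auto
      also have "\<dots> = (space_average k \<epsilon> q z * q z - (q z)\<^sup>2) / \<epsilon>\<^sup>2 + \<psi> z * (R z * u z)"
        by (simp add: qavg q2 distrib_left right_diff_distrib)
      finally show ?thesis using young by simp
    qed
  qed
  have I1: "integrable lborel (\<lambda>z. (space_average k \<epsilon> q z * q z - (q z)\<^sup>2) / \<epsilon>\<^sup>2)"
    using cq(1) L2_integrable_square[OF qm qL] by auto
  have I2: "integrable lborel (\<lambda>z. (u z)\<^sup>2 / 4 + T\<^sup>2 * (R z)\<^sup>2)" using u2 R2 by auto
  have "(LINT z|lborel. (u z)\<^sup>2) / 2 \<le> (LINT z|lborel. (space_average k \<epsilon> q z * q z - (q z)\<^sup>2) / \<epsilon>\<^sup>2 + ((u z)\<^sup>2 / 4 + T\<^sup>2 * (R z)\<^sup>2))"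
    using E integral_mono_AE[OF \<psi>fu Bochner_Integration.integrable_add[OF I1 I2] key] by simp
  also have "\<dots> = ((LINT z|lborel. space_average k \<epsilon> q z * q z) - (LINT z|lborel. (q z)\<^sup>2)) / \<epsilon>\<^sup>2 + ((LINT z|lborel. (u z)\<^sup>2) / 4 + T\<^sup>2 * (LINT z|lborel. (R z)\<^sup>2))"
    using Bochner_Integration.integral_add[OF I1 I2] cq(1) L2_integrable_square[OF qm qL] u2 R2 by simp
  also have "\<dots> \<le> 0 + ((LINT z|lborel. (u z)\<^sup>2) / 4 + T\<^sup>2 * (LINT z|lborel. (R z)\<^sup>2))"
    using cq(2) \<epsilon> by (intro add_right_mono divide_nonpos_nonneg) auto
  finally have "(LINT z|lborel. (u z)\<^sup>2) \<le> 4 * T\<^sup>2 * (LINT z|lborel. (R z)\<^sup>2)" by simp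
  also have "(LINT z|lborel. (R z)\<^sup>2) \<le> \<rho>"
    using RLe \<rho>0 by (simp add: nn_integral_eq_integral[OF R2] ennreal_le_iff)
  finally have "(LINT z|lborel. (u z)\<^sup>2) \<le> 4 * T\<^sup>2 * \<rho>" by (simp add: mult_left_mono)
  have uz: "indicator ?Q z * (time_primitive G z - time_primitive \<Theta> z)\<^sup>2 = (u z)\<^sup>2" for z
    by (simp add: u_def w_def v_def indicator_def)
  have "sqnorm u = ennreal (LINT z|lborel. (u z)\<^sup>2)"
    by (rule nn_integral_eq_integral[OF u2]) simp
  also have "\<dots> \<le> ennreal (4 * T\<^sup>2 * \<rho>)" by (rule ennreal_leI) fact
  finally show ?thesis unfolding uz .
qed

section \<open>From mean square to pointwise convergence\<close>

text \<open>
  If \<open>W \<epsilon>\<close> and \<open>W \<epsilon>'\<close> differ by more than \<open>\<eta>\<close> at a point outside \<open>N\<close>, they differ by at least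
  \<open>\<eta> / 2\<close> almost everywhere in a ball around it, provided \<open>\<epsilon>, \<epsilon>'\<close> are smaller than the radius,
  which does not depend on them. This contradicts mean square convergence once \<open>\<epsilon>, \<epsilon>'\<close> are
  small. So \<open>W \<epsilon>\<close> converges at each point outside \<open>N\<close>, over the continuum of all \<open>\<epsilon>\<close>, and the
  limit is identified along a sequence by Fatou's lemma.
\<close>

theorem pointwise_limit_of_almost_equicontinuous:
  fixes W :: "real \<Rightarrow> real \<Rightarrow> 'a::euclidean_space \<Rightarrow> real"
  assumes N: "AE x in lborel. x \<notin> N" and C0: "0 < C"
    and lip: "\<And>\<epsilon> t t' x x'. 0 < \<epsilon> \<Longrightarrow> \<epsilon> \<le> 1 \<Longrightarrow> t \<in> {0<..<T} \<Longrightarrow> t' \<in> {0<..<T} \<Longrightarrow> x \<notin> N \<Longrightarrow> x' \<notin> N \<Longrightarrow>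
        \<bar>W \<epsilon> t x - W \<epsilon> t' x'\<bar> \<le> C * (norm (x - x') + \<bar>t - t'\<bar> + \<epsilon>)"
    and v[measurable]: "v \<in> borel_measurable borel"
    and L2: "\<And>\<epsilon>. 0 < \<epsilon> \<Longrightarrow> \<epsilon> \<le> 1 \<Longrightarrow> \<exists>w. w \<in> borel_measurable borel \<and>
        (AE z in lborel. fst z \<in> {0<..<T} \<longrightarrow> W \<epsilon> (fst z) (snd z) = w z) \<and>
        (\<integral>\<^sup>+z. ennreal (indicator (cylinder T) z * (w z - v z)\<^sup>2) \<partial>lborel) \<le> ennreal (\<omega> \<epsilon>)"
    and \<omega>0: "\<And>\<epsilon>. 0 \<le> \<omega> \<epsilon>" and \<omega>: "(\<omega> \<longlongrightarrow> 0) (at_right 0)"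
  shows "AE z in lborel. fst z \<in> {0<..<T} \<longrightarrow> ((\<lambda>\<epsilon>. W \<epsilon> (fst z) (snd z)) \<longlongrightarrow> v z) (at_right 0)"
proof -
  let ?Q = "cylinder T :: (real \<times> 'a) set"
  have "\<exists>w. \<forall>\<epsilon>. 0 < \<epsilon> \<and> \<epsilon> \<le> 1 \<longrightarrow> w \<epsilon> \<in> borel_measurable borel \<and>
        (AE z in lborel. fst z \<in> {0<..<T} \<longrightarrow> W \<epsilon> (fst z) (snd z) = w \<epsilon> z) \<and>
        (\<integral>\<^sup>+z. ennreal (indicator ?Q z * (w \<epsilon> z - v z)\<^sup>2) \<partial>lborel) \<le> ennreal (\<omega> \<epsilon>)"
    using L2 by (intro choice) auto
  then obtain w where wm: "\<And>\<epsilon>. 0 < \<epsilon> \<Longrightarrow> \<epsilon> \<le> 1 \<Longrightarrow> w \<epsilon> \<in> borel_measurable borel"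
    and wW: "\<And>\<epsilon>. 0 < \<epsilon> \<Longrightarrow> \<epsilon> \<le> 1 \<Longrightarrow> AE z in lborel. fst z \<in> {0<..<T} \<longrightarrow> W \<epsilon> (fst z) (snd z) = w \<epsilon> z"
    and L2: "\<And>\<epsilon>. 0 < \<epsilon> \<Longrightarrow> \<epsilon> \<le> 1 \<Longrightarrow> (\<integral>\<^sup>+z. ennreal (indicator ?Q z * (w \<epsilon> z - v z)\<^sup>2) \<partial>lborel) \<le> ennreal (\<omega> \<epsilon>)"
    by blast
  have AEN: "AE z in (lborel :: (real \<times> 'a) measure). snd z \<notin> N" by (rule AE_lborel_snd[OF N])
  have cauchy: "\<exists>\<delta>>0. \<forall>\<epsilon> \<epsilon>'. 0 < \<epsilon> \<longrightarrow> \<epsilon> < \<delta> \<longrightarrow> 0 < \<epsilon>' \<longrightarrow> \<epsilon>' < \<delta> \<longrightarrow> \<bar>W \<epsilon> t x - W \<epsilon>' t x\<bar> \<le> \<eta>"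
    if t: "t \<in> {0<..<T}" and x: "x \<notin> N" and \<eta>: "0 < \<eta>" for t x \<eta>
  proof -
    \<comment> \<open>The ball of radius \<open>\<rho>\<close> lies in the cylinder, and for parameters below \<open>\<rho>\<close> each
      function varies by at most \<open>3 C \<rho> \<le> \<eta> / 4\<close> there.\<close>
    define \<rho> where "\<rho> = min (min t (T - t)) (min 1 (\<eta> / (12 * C)))"
    have \<rho>: "0 < \<rho>" "\<rho> \<le> t" "\<rho> \<le> T - t" "\<rho> \<le> 1" "\<rho> \<le> \<eta> / (12 * C)" using t \<eta> C0 by (auto simp: \<rho>_def)
    have C\<rho>: "C * (3 * \<rho>) \<le> \<eta> / 4" using \<rho>(5) C0 by (simp add: field_simps)
    let ?B = "ball (t, x) \<rho>"
    define m where "m = measure lborel ?B"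
    have Bf: "emeasure lborel ?B = ennreal m"
      unfolding m_def using emeasure_lborel_ball_finite[of "(t,x)" \<rho>] by (intro emeasure_eq_ennreal_measure) auto
    have m0: "0 < m" unfolding m_def using content_ball_pos[OF \<rho>(1), of "(t,x)"] by (simp add: measure_completion)
    \<comment> \<open>A gap of \<open>\<eta> / 2\<close> on the ball forces \<open>2 \<omega> \<epsilon> + 2 \<omega> \<epsilon>' \<ge> (\<eta> / 2)\<^sup>2 m = 8 c\<close>, whereas
      \<open>\<omega> < c\<close> bounds the left side by \<open>4 c\<close>.\<close>
    define c where "c = (\<eta>/2)\<^sup>2 * m / 8"
    have c0: "0 < c" using \<eta> m0 by (simp add: c_def)
    have "\<forall>\<^sub>F \<epsilon> in at_right 0. \<omega> \<epsilon> < c" using order_tendstoD(2)[OF \<omega> c0] .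
    then obtain d where d: "0 < d" "\<And>\<epsilon>. 0 < \<epsilon> \<Longrightarrow> \<epsilon> < d \<Longrightarrow> \<omega> \<epsilon> < c"
      by (auto simp: eventually_at_right_field)
    show ?thesis
    proof (intro exI[of _ "min d \<rho>"] conjI allI impI)
      show "0 < min d \<rho>" using d \<rho> by simp
      fix \<epsilon> \<epsilon>' assume e: "0 < \<epsilon>" "\<epsilon> < min d \<rho>" "0 < \<epsilon>'" "\<epsilon>' < min d \<rho>"
      then have e1: "\<epsilon> \<le> 1" "\<epsilon>' \<le> 1" using \<rho> by auto
      note [measurable] = wm[OF e(1) e1(1)] wm[OF e(3) e1(2)]
      show "\<bar>W \<epsilon> t x - W \<epsilon>' t x\<bar> \<le> \<eta>"
      proof (rule ccontr)
        assume big: "\<not> \<bar>W \<epsilon> t x - W \<epsilon>' t x\<bar> \<le> \<eta>"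
        have near: "\<bar>W e t x - W e s y\<bar> \<le> \<eta> / 4" if "0 < e" "e < \<rho>" "(s, y) \<in> ?B" "y \<notin> N" for e s y
        proof -
          have dd: "dist t s < \<rho>" "dist x y < \<rho>"
            using that(3) dist_fst_le[of "(t,x)" "(s,y)"] dist_snd_le[of "(t,x)" "(s,y)"] by auto
          have "\<bar>W e t x - W e s y\<bar> \<le> C * (norm (x - y) + \<bar>t - s\<bar> + e)"
            using that dd t x \<rho> by (intro lip) (auto simp: dist_real_def)
          also have "\<dots> \<le> C * (3 * \<rho>)" using dd that C0 by (intro mult_left_mono) (auto simp: dist_norm)
          finally show ?thesis using C\<rho> by simp
        qed
        have "ennreal ((\<eta>/2)\<^sup>2 * m) = (\<integral>\<^sup>+z. ennreal ((\<eta>/2)\<^sup>2) * indicator ?B z \<partial>lborel)"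
          by (simp add: nn_integral_cmult_indicator Bf ennreal_mult')
        also have "\<dots> \<le> (\<integral>\<^sup>+z. ennreal (2 * (indicator ?Q z * (w \<epsilon> z - v z)\<^sup>2) + 2 * (indicator ?Q z * (w \<epsilon>' z - v z)\<^sup>2)) \<partial>lborel)"
        proof (rule nn_integral_mono_AE)
          show "AE z in lborel. ennreal ((\<eta>/2)\<^sup>2) * indicator ?B z \<le> ennreal (2 * (indicator ?Q z * (w \<epsilon> z - v z)\<^sup>2) + 2 * (indicator ?Q z * (w \<epsilon>' z - v z)\<^sup>2))"
            using AEN wW[OF e(1) e1(1)] wW[OF e(3) e1(2)]
          proof eventually_elim
            case (elim z)
            show ?case
            proof (cases "z \<in> ?B")
              case True
              obtain s y where z: "z = (s, y)" by (cases z)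
              have "dist t s < \<rho>" using True dist_fst_le[of "(t,x)" z] z by auto
              then have s: "s \<in> {0<..<T}" using \<rho> by (auto simp: dist_real_def)
              have n1: "\<bar>W \<epsilon> t x - W \<epsilon> s y\<bar> \<le> \<eta> / 4" and n2: "\<bar>W \<epsilon>' t x - W \<epsilon>' s y\<bar> \<le> \<eta> / 4"
                using near[of \<epsilon> s y] near[of \<epsilon>' s y] e True elim z by auto
              have "\<eta> / 2 \<le> \<bar>w \<epsilon> z - w \<epsilon>' z\<bar>" using n1 n2 big elim s z by (auto simp: abs_if split: if_splits)
              then have "(\<eta> / 2)\<^sup>2 \<le> (w \<epsilon> z - w \<epsilon>' z)\<^sup>2" using \<eta> by (simp add: abs_le_square_iff[symmetric])
              also have "\<dots> \<le> 2 * (w \<epsilon> z - v z)\<^sup>2 + 2 * (w \<epsilon>' z - v z)\<^sup>2"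
                using zero_le_power2[of "(w \<epsilon> z - v z) + (w \<epsilon>' z - v z)"] by (simp add: power2_eq_square algebra_simps)
              finally show ?thesis using True s z by (simp add: ennreal_leI del: ennreal_plus)
            qed simp
          qed
        qed
        also have "\<dots> = 2 * (\<integral>\<^sup>+z. ennreal (indicator ?Q z * (w \<epsilon> z - v z)\<^sup>2) \<partial>lborel) + 2 * (\<integral>\<^sup>+z. ennreal (indicator ?Q z * (w \<epsilon>' z - v z)\<^sup>2) \<partial>lborel)"
          by (subst ennreal_plus; simp add: ennreal_mult' nn_integral_add nn_integral_cmult)
        also have "\<dots> \<le> 2 * ennreal (\<omega> \<epsilon>) + 2 * ennreal (\<omega> \<epsilon>')"
          using L2[OF e(1) e1(1)] L2[OF e(3) e1(2)] by (intro add_mono mult_left_mono) auto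
        also have "\<dots> \<le> 2 * ennreal c + 2 * ennreal c"
          using d(2)[of \<epsilon>] d(2)[of \<epsilon>'] e by (intro add_mono mult_left_mono ennreal_leI) auto
        also have "\<dots> = ennreal (4 * c)" 
        proof -
          have "2 * ennreal c = ennreal (2 * c)" using ennreal_mult'[of 2 c] by simp
          then show ?thesis using ennreal_plus[of "2 * c" "2 * c"] c0 by simp
        qed
        finally have "(\<eta>/2)\<^sup>2 * m \<le> 4 * c" using c0 by (simp add: ennreal_le_iff)
        moreover have "4 * c = ((\<eta>/2)\<^sup>2 * m) / 2" by (simp add: c_def)
        ultimately show False using c0 by linarith
      qed
    qed
  qed
  define h where "h = (\<lambda>n::nat. 1 / real (Suc n))"
  have hpos: "0 < h n" "h n \<le> 1" for n by (auto simp: h_def)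
  note [measurable] = wm[OF hpos]
  have h0: "h \<longlonglongrightarrow> 0" unfolding h_def by (rule LIMSEQ_Suc[OF lim_1_over_n])
  have hr: "filterlim h (at_right 0) sequentially"
    using h0 hpos by (auto simp: filterlim_at less_imp_neq[OF hpos(1), symmetric])
  have lim: "\<exists>u. (\<lambda>n. W (h n) t x) \<longlonglongrightarrow> u \<and> ((\<lambda>\<epsilon>. W \<epsilon> t x) \<longlongrightarrow> u) (at_right 0)"
    if t: "t \<in> {0<..<T}" and x: "x \<notin> N" for t x
  proof -
    have "Cauchy (\<lambda>n. W (h n) t x)"
    proof (rule metric_CauchyI)
      fix \<eta> :: real assume "0 < \<eta>"
      then obtain \<delta> where \<delta>: "\<delta> > 0" "\<And>\<epsilon> \<epsilon>'. 0 < \<epsilon> \<Longrightarrow> \<epsilon> < \<delta> \<Longrightarrow> 0 < \<epsilon>' \<Longrightarrow> \<epsilon>' < \<delta> \<Longrightarrow> \<bar>W \<epsilon> t x - W \<epsilon>' t x\<bar> \<le> \<eta> / 2"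
        using cauchy[OF t x, of "\<eta>/2"] by auto
      obtain M where "\<And>n. n \<ge> M \<Longrightarrow> h n < \<delta>"
        using order_tendstoD(2)[OF h0 \<delta>(1)] by (auto simp: eventually_sequentially)
      then have "dist (W (h m) t x) (W (h n) t x) < \<eta>" if "m \<ge> M" "n \<ge> M" for m n
        using \<delta>(2)[of "h m" "h n"] that hpos \<open>0 < \<eta>\<close> by (fastforce simp: dist_real_def)
      then show "\<exists>M. \<forall>m\<ge>M. \<forall>n\<ge>M. dist (W (h m) t x) (W (h n) t x) < \<eta>" by blast
    qed
    then obtain u where u: "(\<lambda>n. W (h n) t x) \<longlonglongrightarrow> u" by (auto simp: Cauchy_convergent_iff convergent_def)
    have "((\<lambda>\<epsilon>. W \<epsilon> t x) \<longlongrightarrow> u) (at_right 0)"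
    proof (rule tendstoI)
      fix \<eta> :: real assume "0 < \<eta>"
      then obtain \<delta> where \<delta>: "\<delta> > 0" "\<And>\<epsilon> \<epsilon>'. 0 < \<epsilon> \<Longrightarrow> \<epsilon> < \<delta> \<Longrightarrow> 0 < \<epsilon>' \<Longrightarrow> \<epsilon>' < \<delta> \<Longrightarrow> \<bar>W \<epsilon> t x - W \<epsilon>' t x\<bar> \<le> \<eta> / 2"
        using cauchy[OF t x, of "\<eta>/2"] by auto
      have "\<bar>W \<epsilon> t x - u\<bar> \<le> \<eta> / 2" if "0 < \<epsilon>" "\<epsilon> < \<delta>" for \<epsilon>
      proof (rule tendsto_upperbound)
        show "(\<lambda>n. \<bar>W \<epsilon> t x - W (h n) t x\<bar>) \<longlonglongrightarrow> \<bar>W \<epsilon> t x - u\<bar>" by (intro tendsto_intros u)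
        show "\<forall>\<^sub>F n in sequentially. \<bar>W \<epsilon> t x - W (h n) t x\<bar> \<le> \<eta> / 2"
          using order_tendstoD(2)[OF h0 \<delta>(1)] by eventually_elim (use \<delta>(2) that hpos in auto)
      qed simp
      then show "\<forall>\<^sub>F \<epsilon> in at_right 0. dist (W \<epsilon> t x) u < \<eta>"
        using \<delta>(1) \<open>0 < \<eta>\<close> unfolding eventually_at_right_field
        by (intro exI[of _ \<delta>]) (fastforce simp: dist_real_def)
    qed
    with u show ?thesis by blast
  qed
  let ?f = "\<lambda>n z. ennreal (indicator ?Q z * (w (h n) z - v z)\<^sup>2)"
  have "(\<integral>\<^sup>+z. liminf (\<lambda>n. ?f n z) \<partial>lborel) \<le> liminf (\<lambda>n. \<integral>\<^sup>+z. ?f n z \<partial>lborel)"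
    by (intro nn_integral_liminf) measurable
  also have "\<dots> \<le> liminf (\<lambda>n. ennreal (\<omega> (h n)))"
    by (intro Liminf_mono always_eventually allI L2 hpos)
  also have "\<dots> = 0"
    using tendsto_ennrealI[OF filterlim_compose[OF \<omega> hr]] by (simp add: lim_imp_Liminf)
  finally have "(\<integral>\<^sup>+z. liminf (\<lambda>n. ?f n z) \<partial>lborel) = 0" by simp
  then have "AE z in lborel. liminf (\<lambda>n. ?f n z) = 0"
    by (subst (asm) nn_integral_0_iff_AE) measurable
  moreover have "AE z in lborel. \<forall>n. fst z \<in> {0<..<T} \<longrightarrow> W (h n) (fst z) (snd z) = w (h n) z"
    unfolding AE_all_countable using wW hpos by blast
  ultimately show ?thesis using AEN
  proof eventually_elim
    case (elim z)
    show ?case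
    proof
      assume t: "fst z \<in> {0<..<T}"
      obtain u where u: "(\<lambda>n. W (h n) (fst z) (snd z)) \<longlonglongrightarrow> u" "((\<lambda>\<epsilon>. W \<epsilon> (fst z) (snd z)) \<longlongrightarrow> u) (at_right 0)"
        using lim[OF t, of "snd z"] elim by blast
      have "(\<lambda>n. w (h n) z) \<longlonglongrightarrow> u" using u(1) elim t by simp
      then have "(\<lambda>n. ?f n z) \<longlonglongrightarrow> ennreal (indicator ?Q z * (u - v z)\<^sup>2)"
        by (intro tendsto_ennrealI tendsto_intros)
      then have "liminf (\<lambda>n. ?f n z) = ennreal (indicator ?Q z * (u - v z)\<^sup>2)"
        by (simp add: lim_imp_Liminf)
      then have "ennreal (indicator ?Q z * (u - v z)\<^sup>2) = 0" using elim(1) by metis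
      then have "u = v z" using t by (cases z) (auto simp: ennreal_eq_0_iff)
      then show "((\<lambda>\<epsilon>. W \<epsilon> (fst z) (snd z)) \<longlongrightarrow> v z) (at_right 0)" using u(2) by simp
    qed
  qed
qed

section \<open>The Stefan problem as an obstacle problem\<close>

text \<open>
  Functions on the cylinder are Lebesgue measurable only; Borel versions, extended by \<open>0\<close>, make
  products and translates measurable.
\<close>

lemma borel_version_on:
  fixes f :: "'a::euclidean_space \<Rightarrow> real"
  assumes f: "f \<in> borel_measurable (lebesgue_on S)" and S: "S \<in> sets borel"
  obtains h where "h \<in> borel_measurable borel" "AE z in lborel. h z = (if z \<in> S then f z else 0)" "\<And>z. z \<notin> S \<Longrightarrow> h z = 0"
proof -
  have "(\<lambda>z. if z \<in> S then f z else 0) \<in> borel_measurable lebesgue"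
    using f S by (simp add: borel_measurable_if)
  then obtain h where h[measurable]: "h \<in> borel_measurable borel" and ae: "AE z in lborel. (if z \<in> S then f z else 0) = h z"
    by (rule borel_version)
  note [measurable] = S
  show ?thesis
  proof (rule that[of "\<lambda>z. if z \<in> S then h z else 0"])
    show "AE z in lborel. (if z \<in> S then h z else 0) = (if z \<in> S then f z else 0)"
      using ae by eventually_elim auto
  qed auto
qed

lemma set_integral_borel_version:
  fixes f g h :: "'a::euclidean_space \<Rightarrow> real"
  assumes f: "f \<in> borel_measurable (lebesgue_on S)" and S[measurable]: "S \<in> sets borel"
    and h[measurable]: "h \<in> borel_measurable borel" and g[measurable]: "g \<in> borel_measurable borel"
    and ae: "AE z in lborel. h z = (if z \<in> S then f z else 0)"
  shows "(LINT z:S|lebesgue. f z * g z) = (LINT z|lborel. h z * g z)"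
proof -
  have fm: "(\<lambda>z. if z \<in> S then f z else 0) \<in> borel_measurable lebesgue"
    using f S by (simp add: borel_measurable_if)
  have gm: "g \<in> borel_measurable lebesgue" "h \<in> borel_measurable lebesgue" by (auto intro: measurable_completion)
  have "(LINT z:S|lebesgue. f z * g z) = (LINT z|lebesgue. (if z \<in> S then f z else 0) * g z)"
    unfolding set_lebesgue_integral_def by (intro Bochner_Integration.integral_cong) (auto simp: indicator_def)
  also have "\<dots> = (LINT z|lebesgue. h z * g z)"
  proof (rule integral_cong_AE)
    show "(\<lambda>z. (if z \<in> S then f z else 0) * g z) \<in> borel_measurable lebesgue" "(\<lambda>z. h z * g z) \<in> borel_measurable lebesgue"
      using fm gm by (auto intro: borel_measurable_times)
    show "AE z in lebesgue. (if z \<in> S then f z else 0) * g z = h z * g z"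
      unfolding AE_completion_iff using ae by eventually_elim auto
  qed
  also have "\<dots> = (LINT z|lborel. h z * g z)" by (rule integral_completion) measurable
  finally show ?thesis .
qed

lemma Linf_Lp_L2:
  fixes f h :: "real \<times> 'a::euclidean_space \<Rightarrow> real"
  assumes f: "Linf_Lp T f" and T: "0 < T" and h[measurable]: "h \<in> borel_measurable borel"
    and ae: "AE z in lborel. h z = (if z \<in> cylinder T then f z else 0)"
  shows "sqnorm h < \<infinity>"
proof -
  obtain C where C: "AE t in lebesgue_on {0<..<T}. integrable lebesgue (\<lambda>x. \<bar>f (t, x)\<bar> powr 2) \<and> (LINT x|lebesgue. \<bar>f (t, x)\<bar> powr 2) \<le> C"
  proof -
    have "1 \<le> (2::real) \<longrightarrow> (\<exists>C. AE t in lebesgue_on {0<..<T}. integrable lebesgue (\<lambda>x. \<bar>f (t, x)\<bar> powr 2) \<and> (LINT x|lebesgue. \<bar>f (t, x)\<bar> powr 2) \<le> C)"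
      using f unfolding Linf_Lp_def by blast
    then show ?thesis using that by auto
  qed
  then have C': "AE t in lborel. t \<in> {0<..<T} \<longrightarrow> integrable lebesgue (\<lambda>x. \<bar>f (t, x)\<bar> powr 2) \<and> (LINT x|lebesgue. \<bar>f (t, x)\<bar> powr 2) \<le> C"
    by (subst (asm) AE_restrict_space_iff) (auto simp: AE_completion_iff)
  have [measurable]: "h \<in> borel_measurable (borel \<Otimes>\<^sub>M borel)" by (simp add: borel_prod)
  have aet: "AE t in lborel. AE x in lborel. h (t, x) = (if (t, x) \<in> cylinder T then f (t, x) else 0)"
  proof -
    have "AE z in lborel \<Otimes>\<^sub>M lborel. h z = (if z \<in> cylinder T then f z else 0)" using ae by (simp only: lborel_prod)
    then show ?thesis by (rule lborel_pair.AE_pair)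
  qed
  have "sqnorm h = (\<integral>\<^sup>+t. \<integral>\<^sup>+x. ennreal ((h (t, x))\<^sup>2) \<partial>lborel \<partial>lborel)"
    unfolding lborel_prod[symmetric] by (subst lborel.nn_integral_fst[symmetric]) auto
  also have "\<dots> \<le> (\<integral>\<^sup>+t. ennreal (max C 0) * indicator {0..T} t \<partial>lborel)"
  proof (rule nn_integral_mono_AE)
    show "AE t in lborel. (\<integral>\<^sup>+x. ennreal ((h (t, x))\<^sup>2) \<partial>lborel) \<le> ennreal (max C 0) * indicator {0..T} t"
      using C' aet
    proof eventually_elim
      case (elim t)
      show ?case
      proof (cases "t \<in> {0<..<T}")
        case True
        have "(\<integral>\<^sup>+x. ennreal ((h (t, x))\<^sup>2) \<partial>lborel) = (\<integral>\<^sup>+x. ennreal ((h (t, x))\<^sup>2) \<partial>lebesgue)"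
          by (rule nn_integral_completion[symmetric])
        also have "\<dots> = (\<integral>\<^sup>+x. ennreal (\<bar>f (t, x)\<bar> powr 2) \<partial>lebesgue)"
        proof (rule nn_integral_cong_AE)
          show "AE x in lebesgue. ennreal ((h (t, x))\<^sup>2) = ennreal (\<bar>f (t, x)\<bar> powr 2)"
            unfolding AE_completion_iff using elim(2)
          proof eventually_elim
            case (elim x)
            then show ?case using True by (cases "f (t, x) = 0") (simp_all add: powr_numeral)
          qed
        qed
        also have "\<dots> = ennreal (LINT x|lebesgue. \<bar>f (t, x)\<bar> powr 2)"
          using elim True by (intro nn_integral_eq_integral) auto
        also have "\<dots> \<le> ennreal (max C 0)" using elim True by (intro ennreal_leI) auto
        finally show ?thesis using True by simp
      next
        case False
        then have "AE x in lborel. h (t, x) = 0" using elim(2) by (auto elim!: eventually_mono)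
        then have "(\<integral>\<^sup>+x. ennreal ((h (t, x))\<^sup>2) \<partial>lborel) = (\<integral>\<^sup>+x. 0 \<partial>(lborel :: 'a measure))"
          by (intro nn_integral_cong_AE) (auto elim!: eventually_mono)
        then show ?thesis by simp
      qed
    qed
  qed
  also have "\<dots> < \<infinity>" using T by (simp add: nn_integral_cmult emeasure_lborel_Icc_eq ennreal_mult_less_top)
  finally show ?thesis .
qed

text \<open>
  Before the arrival time the temperature vanishes, so the lower limit of integration can be
  moved to \<open>0\<close>. The time \<open>0\<close>, at which \<open>\<theta>\<close> and \<open>\<Theta>\<close> may differ, has measure zero.
\<close>

lemma stefan_integral_eq_primitive:
  fixes \<theta> :: "real \<Rightarrow> 'a::euclidean_space \<Rightarrow> real"
  assumes \<Theta>m[measurable]: "\<Theta> \<in> borel_measurable borel" and \<Theta>: "\<And>t x. \<Theta> (t, x) = (if 0 < t then \<theta> t x else 0)"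
    and s0: "0 \<le> s x" and zero: "\<And>t. 0 < t \<Longrightarrow> ereal t \<le> s x \<Longrightarrow> \<theta> t x = 0" and t: "0 \<le> t"
  shows "stefan_integral \<theta> s t x = time_primitive \<Theta> (t, x)"
proof -
  define m where "m = real_of_ereal (min (s x) (ereal t))"
  have m: "0 \<le> m" "m \<le> t" "ereal m \<le> s x"
    using s0 t by (cases "s x"; auto simp: m_def min_def split: if_splits)+
  let ?g = "\<lambda>\<tau>. indicator {0..t} \<tau> * \<Theta> (\<tau>, x)"
  have [measurable]: "\<Theta> \<in> borel_measurable (borel \<Otimes>\<^sub>M borel)" by (simp add: borel_prod)
  have gm: "?g \<in> borel_measurable borel" by measurable
  have eq: "indicator {m..t} \<tau> *\<^sub>R \<theta> \<tau> x = (if \<tau> = 0 then indicator {m..t} 0 * \<theta> 0 x else ?g \<tau>)" for \<tau>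
  proof (cases "0 < \<tau> \<and> \<tau> < m")
    case True
    then have "ereal \<tau> \<le> s x" using m(3) by (meson ereal_less_eq(3) less_imp_le order_trans)
    then show ?thesis using True zero[of \<tau>] by (simp add: \<Theta> indicator_def)
  qed (use m in \<open>auto simp: \<Theta> indicator_def\<close>)
  have m2: "(\<lambda>\<tau>. if \<tau> = 0 then indicator {m..t} 0 * \<theta> 0 x else ?g \<tau>) \<in> borel_measurable borel" using gm by measurable
  have "stefan_integral \<theta> s t x = (LINT \<tau>|lebesgue. (if \<tau> = 0 then indicator {m..t} 0 * \<theta> 0 x else ?g \<tau>))"
    unfolding stefan_integral_def set_lebesgue_integral_def m_def[symmetric] eq ..
  also have "\<dots> = (LINT \<tau>|lborel. (if \<tau> = 0 then indicator {m..t} 0 * \<theta> 0 x else ?g \<tau>))"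
    by (rule integral_completion) (use m2 in simp)
  also have "\<dots> = (LINT \<tau>|lborel. ?g \<tau>)"
  proof (rule integral_cong_AE)
    show "AE \<tau> in lborel. (if \<tau> = 0 then indicator {m..t} 0 * \<theta> 0 x else ?g \<tau>) = ?g \<tau>"
      using AE_lborel_singleton[of "0::real"] by eventually_elim auto
  qed (use m2 gm in auto)
  finally show ?thesis by (simp add: time_primitive_def)
qed

lemma compact_in_cylinder:
  fixes K :: "(real \<times> 'a::euclidean_space) set"
  assumes K: "compact K" "K \<subseteq> cylinder T" and T: "0 < T"
  obtains t1 c d where "0 < t1" "t1 < T" "K \<subseteq> {0<..t1} \<times> cbox c d"
proof (cases "K = {}")
  case True
  then show ?thesis using that[of "T/2"] T by auto
next
  case False
  have "compact (fst ` K)" using K(1) by (intro compact_continuous_image continuous_intros)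
  then obtain z where z: "z \<in> K" "\<And>y. y \<in> K \<Longrightarrow> fst y \<le> fst z"
    using compact_attains_sup[of "fst ` K"] False by auto
  have "bounded (snd ` K)" using K(1) by (intro compact_imp_bounded compact_continuous_image continuous_intros)
  then obtain c d where cd: "snd ` K \<subseteq> cbox c d" using bounded_subset_cbox_symmetric by metis
  show ?thesis
  proof (rule that[of "fst z" c d])
    show "0 < fst z" "fst z < T" using z K by auto
    show "K \<subseteq> {0<..fst z} \<times> cbox c d"
    proof
      fix y assume "y \<in> K"
      then show "y \<in> {0<..fst z} \<times> cbox c d" using z(2)[of y] K(2) cd by (cases y) fastforce
    qed
  qed
qed

text \<open>
  Fubini's theorem exchanges the time integral defining the primitive with the pairing, and
  integrating \<open>\<partial>\<^sub>t \<phi>\<close> from \<open>\<tau>\<close> to \<open>T\<close> returns \<open>- \<phi>(\<tau>)\<close>. The result identifies the temperature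
  with the weak time derivative of its integral, which the variational inequality is about.
\<close>

theorem weak_time_derivative_of_primitive:
  fixes \<Theta> vt :: "real \<times> 'a::euclidean_space \<Rightarrow> real"
  assumes T: "0 < T" and \<Theta>m[measurable]: "\<Theta> \<in> borel_measurable borel" and \<Theta>0: "\<And>z. 0 \<le> \<Theta> z"
    and int: "AE x in lborel. \<forall>t\<ge>0. integrable lborel (\<lambda>\<tau>. indicator {0..t} \<tau> * \<Theta> (\<tau>, x))"
    and loc: "\<And>K. compact K \<Longrightarrow> K \<subseteq> cylinder T \<Longrightarrow> integrable lborel (\<lambda>z. indicator K z * time_primitive \<Theta> z)"
    and vtm[measurable]: "vt \<in> borel_measurable borel" and vtloc: "\<And>K. compact K \<Longrightarrow> K \<subseteq> cylinder T \<Longrightarrow> integrable lborel (\<lambda>z. indicator K z * vt z)"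
    and weak: "\<And>\<phi>. test_function (cylinder T) \<phi> \<Longrightarrow> (LINT z|lborel. time_primitive \<Theta> z * partial (1, 0) \<phi> z) = - (LINT z|lborel. vt z * \<phi> z)"
  shows "AE z in lborel. z \<in> cylinder T \<longrightarrow> \<Theta> z = vt z"
proof -
  let ?Q = "cylinder T :: (real \<times> 'a) set"
  have \<Theta>m'[measurable]: "\<Theta> \<in> borel_measurable (borel \<Otimes>\<^sub>M borel)" by (simp add: borel_prod)
  let ?V = "time_primitive \<Theta>"
  have Vm[measurable]: "?V \<in> borel_measurable borel" by measurable
  have Vm'[measurable]: "?V \<in> borel_measurable (borel \<Otimes>\<^sub>M borel)" by (simp add: borel_prod)
  have V0: "0 \<le> ?V z" for z using \<Theta>0 by (auto simp: time_primitive_def intro!: integral_nonneg_AE)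
  \<comment> \<open>Local integrability of \<open>\<Theta>\<close> is inherited from its primitive: up to time \<open>t1\<close> the
    integral of \<open>\<Theta>\<close> is at most the primitive at each time in \<open>[t1, t2]\<close>; average over these
    times.\<close>
  have \<Theta>box: "integrable lborel (\<lambda>z. indicator ({0<..t1} \<times> cbox c d) z * \<Theta> z)" if t1: "0 < t1" "t1 < T" for t1 and c d :: 'a
  proof -
    define t2 where "t2 = (t1 + T) / 2"
    have t2: "t1 < t2" "t2 < T" using t1 by (auto simp: t2_def)
    define J where "J x = (\<integral>\<^sup>+\<tau>. ennreal (indicator {0<..t1} \<tau> * \<Theta> (\<tau>, x)) \<partial>lborel)" for x
    have Jm[measurable]: "J \<in> borel_measurable borel" unfolding J_def[abs_def] by (rule lborel.borel_measurable_nn_integral) measurable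
    have K: "compact ({t1..t2} \<times> cbox c d)" "{t1..t2} \<times> cbox c d \<subseteq> ?Q" using t1 t2 by (auto intro!: compact_Times)
    have [measurable]: "{t1..t2} \<times> cbox c d \<in> sets (borel \<Otimes>\<^sub>M borel)" "{0<..t1} \<times> cbox c d \<in> sets (borel \<Otimes>\<^sub>M borel)" by auto
    have "ennreal (t2 - t1) * (\<integral>\<^sup>+x. indicator (cbox c d) x * J x \<partial>lborel) = (\<integral>\<^sup>+x. \<integral>\<^sup>+t. indicator {t1..t2} t * (indicator (cbox c d) x * J x) \<partial>lborel \<partial>lborel)"
      using t2 by (simp add: nn_integral_multc nn_integral_cmult)
    also have "\<dots> \<le> (\<integral>\<^sup>+x. \<integral>\<^sup>+t. ennreal (indicator ({t1..t2} \<times> cbox c d) (t, x) * ?V (t, x)) \<partial>lborel \<partial>lborel)"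
    proof (rule nn_integral_mono_AE)
      show "AE x in lborel. (\<integral>\<^sup>+t. indicator {t1..t2} t * (indicator (cbox c d) x * J x) \<partial>lborel) \<le> (\<integral>\<^sup>+t. ennreal (indicator ({t1..t2} \<times> cbox c d) (t, x) * ?V (t, x)) \<partial>lborel)"
        using int
      proof eventually_elim
        case (elim x)
        show ?case
        proof (rule nn_integral_mono)
          fix t
          show "indicator {t1..t2} t * (indicator (cbox c d) x * J x) \<le> ennreal (indicator ({t1..t2} \<times> cbox c d) (t, x) * ?V (t, x))"
          proof (cases "t \<in> {t1..t2} \<and> x \<in> cbox c d")
            case True
            have "J x \<le> (\<integral>\<^sup>+\<tau>. ennreal (indicator {0..t} \<tau> * \<Theta> (\<tau>, x)) \<partial>lborel)"
              unfolding J_def using True \<Theta>0 by (intro nn_integral_mono ennreal_leI) (auto simp: indicator_def)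
            also have "\<dots> = ennreal (?V (t, x))"
              unfolding time_primitive_def fst_conv snd_conv using elim True t1 \<Theta>0 by (intro nn_integral_eq_integral) auto
            finally show ?thesis using True by simp
          qed auto
        qed
      qed
    qed
    also have "\<dots> = (\<integral>\<^sup>+z. ennreal (indicator ({t1..t2} \<times> cbox c d) z * ?V z) \<partial>lborel)"
      unfolding lborel_prod[symmetric] by (rule lborel_pair.nn_integral_snd) measurable
    also have "\<dots> < \<infinity>"
      using loc[OF K] V0 by (simp add: nn_integral_eq_integral)
    finally have fin: "(\<integral>\<^sup>+x. indicator (cbox c d) x * J x \<partial>lborel) < \<infinity>"
      using t2 by (auto simp: ennreal_mult_less_top)
    have "(\<integral>\<^sup>+z. ennreal (indicator ({0<..t1} \<times> cbox c d) z * \<Theta> z) \<partial>lborel) = (\<integral>\<^sup>+x. \<integral>\<^sup>+t. ennreal (indicator ({0<..t1} \<times> cbox c d) (t, x) * \<Theta> (t, x)) \<partial>lborel \<partial>lborel)"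
      unfolding lborel_prod[symmetric] by (rule lborel_pair.nn_integral_snd[symmetric]) measurable
    also have "\<dots> = (\<integral>\<^sup>+x. indicator (cbox c d) x * J x \<partial>lborel)"
    proof (intro nn_integral_cong)
      fix x
      show "(\<integral>\<^sup>+t. ennreal (indicator ({0<..t1} \<times> cbox c d) (t, x) * \<Theta> (t, x)) \<partial>lborel) = indicator (cbox c d) x * J x"
        by (cases "x \<in> cbox c d") (auto simp: J_def indicator_def intro!: nn_integral_cong)
    qed
    finally have "(\<integral>\<^sup>+z. ennreal (indicator ({0<..t1} \<times> cbox c d) z * \<Theta> z) \<partial>lborel) < \<infinity>" using fin by simp
    then show ?thesis using \<Theta>0 by (intro integrableI_nonneg) (auto simp: borel_prod[symmetric])
  qed
  have \<Theta>loc: "integrable lborel (\<lambda>z. indicator K z * \<Theta> z)" if K: "compact K" "K \<subseteq> ?Q" for K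
  proof -
    obtain t1 c d where t1: "0 < t1" "t1 < T" "K \<subseteq> {0<..t1} \<times> cbox c d" using compact_in_cylinder[OF K T] .
    have [measurable]: "K \<in> sets borel" using K(1) by (simp add: borel_compact)
    show ?thesis
      by (rule Bochner_Integration.integrable_bound[OF \<Theta>box[OF t1(1,2), of c d]]) (use t1(3) in \<open>auto simp: indicator_def\<close>)
  qed
  have cmp: "integrable lborel (\<lambda>z. f z * \<phi> z)"
    if f: "f \<in> borel_measurable borel" "\<And>K. compact K \<Longrightarrow> K \<subseteq> ?Q \<Longrightarrow> integrable lborel (\<lambda>z. indicator K z * f z)" and \<phi>: "test_function ?Q \<phi>" for f \<phi>
  proof -
    let ?K = "closure {z. \<phi> z \<noteq> 0}"
    have K: "compact ?K" "?K \<subseteq> ?Q" using \<phi> by (auto simp: test_function_def)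
    obtain B where B: "\<And>z. \<bar>\<phi> z\<bar> \<le> B" using test_function_facts(4)[OF \<phi>] by blast
    have "integrable lborel (\<lambda>z. (indicator ?K z * f z) * \<phi> z)"
      by (rule integrable_mult_bounded[OF f(2)[OF K] _ B]) (use test_function_facts(2)[OF \<phi>] in simp)
    moreover have "(indicator ?K z * f z) * \<phi> z = f z * \<phi> z" for z
      using closure_subset[of "{z. \<phi> z \<noteq> 0}"] by (auto simp: indicator_def)
    ultimately show ?thesis by simp
  qed
  have "AE z in lborel. z \<in> ?Q \<longrightarrow> \<Theta> z - vt z = 0"
  proof (rule fundamental_lemma_variations)
    show "open ?Q" by (intro open_Times) auto
    show "(\<lambda>z. \<Theta> z - vt z) \<in> borel_measurable borel" by measurable
    show "integrable lborel (\<lambda>z. indicat_real (cbox a c) z * (\<Theta> z - vt z))" if "cbox a c \<subseteq> ?Q" for a c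
      using Bochner_Integration.integrable_diff[OF \<Theta>loc[OF compact_cbox that] vtloc[OF compact_cbox that]] by (simp add: right_diff_distrib)
    fix \<phi> assume \<phi>: "test_function ?Q \<phi>"
    have B1: "(1::real, 0::'a) \<in> Basis" by (simp add: Basis_prod_def)
    have \<phi>t: "test_function ?Q (partial (1, 0) \<phi>)" by (rule test_function_partial[OF \<phi> B1])
    note [measurable] = test_function_facts(2)[OF \<phi>] test_function_facts(2)[OF \<phi>t]
    have [measurable]: "\<phi> \<in> borel_measurable (borel \<Otimes>\<^sub>M borel)" "partial (1, 0) \<phi> \<in> borel_measurable (borel \<Otimes>\<^sub>M borel)" by (simp_all add: borel_prod)
    have iV: "integrable lborel (\<lambda>z. ?V z * partial (1, 0) \<phi> z)" by (rule cmp[OF Vm loc \<phi>t])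
    have i\<Theta>: "integrable lborel (\<lambda>z. \<Theta> z * \<phi> z)" by (rule cmp[OF \<Theta>m \<Theta>loc \<phi>])
    have der: "((\<lambda>t. \<phi> (t, x)) has_real_derivative partial (1, 0) \<phi> (t, x)) (at t)" for t x
    proof -
      let ?F = "frechet_derivative \<phi> (at (t, x))"
      have F: "(\<phi> has_derivative ?F) (at (t, x))" using test_function_differentiable[OF \<phi>] by (simp add: frechet_derivative_works)
      have "((\<lambda>t. (t, x)) has_derivative (\<lambda>h. (h, 0))) (at t)" by (auto intro!: derivative_eq_intros)
      then have "((\<lambda>t. \<phi> (t, x)) has_derivative (\<lambda>h. ?F (h, 0))) (at t)" using F by (rule has_derivative_compose)
      moreover have "?F (h, 0) = h * partial (1, 0) \<phi> (t, x)" for h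
        using linear_scale[OF has_derivative_linear[OF F], of h "(1, 0)"] by (simp add: partial_def)
      ultimately show ?thesis unfolding has_field_derivative_def by (auto elim!: has_derivative_eq_rhs simp: fun_eq_iff)
    qed
    have out: "\<phi> (t, x) = 0" "partial (1, 0) \<phi> (t, x) = 0" if "t \<notin> {0<..<T}" for t x
      using test_function_facts(5)[OF \<phi>, of "(t, x)"] test_function_facts(5)[OF \<phi>t, of "(t, x)"] that by auto
    have "AE x in lborel. (LINT t|lborel. ?V (t, x) * partial (1, 0) \<phi> (t, x)) = - (LINT t|lborel. \<Theta> (t, x) * \<phi> (t, x))"
      using int
    proof eventually_elim
      case (elim x)
      obtain B where B: "\<And>z. \<bar>partial (1, 0) \<phi> z\<bar> \<le> B" using test_function_facts(4)[OF \<phi>t] by blast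
      have i1: "integrable lborel (\<lambda>t. indicat_real {0..T} t * partial (1, 0) \<phi> (t, x))"
        by (rule integrable_mult_bounded[OF _ _ B]) auto
      have i2: "integrable lborel (\<lambda>\<tau>. indicator {0..T} \<tau> * \<Theta> (\<tau>, x))" using elim T by simp
      have P: "integrable (lborel \<Otimes>\<^sub>M lborel) (\<lambda>(t, \<tau>). (indicat_real {0..T} t * partial (1, 0) \<phi> (t, x)) * (indicator {0..T} \<tau> * \<Theta> (\<tau>, x)))"
        using integrable_product_functions[OF lborel.sigma_finite_measure_axioms lborel.sigma_finite_measure_axioms i1 i2] by (simp add: case_prod_unfold)
      have I: "integrable (lborel \<Otimes>\<^sub>M lborel) (\<lambda>(t, \<tau>). indicator {0..t} \<tau> * \<Theta> (\<tau>, x) * partial (1, 0) \<phi> (t, x))"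
        by (rule Bochner_Integration.integrable_bound[OF P]) (use out in \<open>auto simp: indicator_def abs_mult\<close>)
      have "(LINT t|lborel. ?V (t, x) * partial (1, 0) \<phi> (t, x)) = (LINT t|lborel. LINT \<tau>|lborel. indicator {0..t} \<tau> * \<Theta> (\<tau>, x) * partial (1, 0) \<phi> (t, x))"
        by (simp add: time_primitive_def)
      also have "\<dots> = (LINT \<tau>|lborel. LINT t|lborel. indicator {0..t} \<tau> * \<Theta> (\<tau>, x) * partial (1, 0) \<phi> (t, x))"
        by (rule lborel_pair.Fubini_integral[OF I, symmetric])
      also have "\<dots> = (LINT \<tau>|lborel. - (\<Theta> (\<tau>, x) * \<phi> (\<tau>, x)))"
      proof (rule integral_cong_AE)
        show "(\<lambda>\<tau>. LINT t|lborel. indicator {0..t} \<tau> * \<Theta> (\<tau>, x) * partial (1, 0) \<phi> (t, x)) \<in> borel_measurable lborel"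
          using lborel_pair.integrable_snd[OF I] by (rule borel_measurable_integrable)
        show "(\<lambda>\<tau>. - (\<Theta> (\<tau>, x) * \<phi> (\<tau>, x))) \<in> borel_measurable lborel" by measurable
        show "AE \<tau> in lborel. (LINT t|lborel. indicator {0..t} \<tau> * \<Theta> (\<tau>, x) * partial (1, 0) \<phi> (t, x)) = - (\<Theta> (\<tau>, x) * \<phi> (\<tau>, x))"
          using AE_lborel_singleton[of "0::real"]
        proof eventually_elim
          case (elim \<tau>)
          show "(LINT t|lborel. indicator {0..t} \<tau> * \<Theta> (\<tau>, x) * partial (1, 0) \<phi> (t, x)) = - (\<Theta> (\<tau>, x) * \<phi> (\<tau>, x))"
          proof (cases "\<tau> \<in> {0<..<T}")
            case True
            have eq: "(\<lambda>t. indicator {0..t} \<tau> * \<Theta> (\<tau>, x) * partial (1, 0) \<phi> (t, x)) = (\<lambda>t. \<Theta> (\<tau>, x) * (partial (1, 0) \<phi> (t, x) * indicator {\<tau>..T} t))"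
            proof
              fix t show "indicator {0..t} \<tau> * \<Theta> (\<tau>, x) * partial (1, 0) \<phi> (t, x) = \<Theta> (\<tau>, x) * (partial (1, 0) \<phi> (t, x) * indicator {\<tau>..T} t)"
                using True out(2)[of t x] by (cases "t < T") (auto simp: indicator_def)
            qed
            have "(LINT t|lborel. indicator {0..t} \<tau> * \<Theta> (\<tau>, x) * partial (1, 0) \<phi> (t, x)) = \<Theta> (\<tau>, x) * (LINT t|lborel. partial (1, 0) \<phi> (t, x) * indicator {\<tau>..T} t)"
              unfolding eq by simp
            also have "(LINT t|lborel. partial (1, 0) \<phi> (t, x) * indicator {\<tau>..T} t) = \<phi> (T, x) - \<phi> (\<tau>, x)"
            proof (rule integral_FTC_Icc_real)
              show "\<tau> \<le> T" using True by simp
              show "((\<lambda>t. \<phi> (t, x)) has_real_derivative partial (1, 0) \<phi> (t, x)) (at t)" for t by (rule der)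
              have "continuous_on UNIV (\<lambda>t. partial (1, 0) \<phi> (t, x))"
                by (intro continuous_on_compose2[OF test_function_facts(1)[OF \<phi>t]] continuous_intros) auto
              then show "isCont (\<lambda>t. partial (1, 0) \<phi> (t, x)) t" for t by (simp add: continuous_on_eq_continuous_at)
            qed
            finally show ?thesis using out(1)[of T x] by simp
          next
            case False
            have eq: "(\<lambda>t. indicator {0..t} \<tau> * \<Theta> (\<tau>, x) * partial (1, 0) \<phi> (t, x)) = (\<lambda>_. 0)"
            proof
              fix t show "indicator {0..t} \<tau> * \<Theta> (\<tau>, x) * partial (1, 0) \<phi> (t, x) = 0"
                using False elim out(2)[of t x] by (auto simp: indicator_def)
            qed
            show ?thesis unfolding eq using out(1)[OF False] by simp
          qed
        qed
      qed
      finally show ?case by simp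
    qed
    then have "(LINT x|lborel. LINT t|lborel. ?V (t, x) * partial (1, 0) \<phi> (t, x)) = (LINT x|lborel. - (LINT t|lborel. \<Theta> (t, x) * \<phi> (t, x)))"
      by (rule integral_cong_AE[rotated 2]) measurable
    moreover have "(LINT x|lborel. LINT t|lborel. ?V (t, x) * partial (1, 0) \<phi> (t, x)) = (LINT z|lborel. ?V z * partial (1, 0) \<phi> z)"
      using lborel_pair.integral_snd[of "\<lambda>t x. ?V (t, x) * partial (1, 0) \<phi> (t, x)"] iV by (simp add: lborel_prod case_prod_unfold)
    moreover have "(LINT x|lborel. LINT t|lborel. \<Theta> (t, x) * \<phi> (t, x)) = (LINT z|lborel. \<Theta> z * \<phi> z)"
      using lborel_pair.integral_snd[of "\<lambda>t x. \<Theta> (t, x) * \<phi> (t, x)"] i\<Theta> by (simp add: lborel_prod case_prod_unfold)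
    ultimately have "(LINT z|lborel. \<Theta> z * \<phi> z) = (LINT z|lborel. vt z * \<phi> z)" using weak[OF \<phi>] by simp
    then show "(LINT z|lborel. (\<Theta> z - vt z) * \<phi> z) = 0"
      using Bochner_Integration.integral_diff[OF i\<Theta> cmp[OF vtm vtloc \<phi>]] by (simp add: left_diff_distrib)
  qed
  then show ?thesis by eventually_elim auto
qed

text \<open>
  The temperature is Borel measurable on positive times, being continuous on the open set where
  it is positive and \<open>0\<close> elsewhere. By \<open>weak_time_derivative_of_primitive\<close> it is the weak time
  derivative in the variational inequality, which thereby takes the form of an obstacle problem
  for a time primitive. The functions \<open>a q\<close> are the weak second derivatives in space.
\<close>

theorem stefan_solution_structure:
  fixes \<gamma>\<^sub>0 \<Gamma> :: "real^'n \<Rightarrow> real" and \<theta> :: "real \<Rightarrow> real^'n \<Rightarrow> real"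
  assumes st: "stefan_solution A \<Omega>\<^sub>0 \<gamma>\<^sub>0 \<theta> s" and T: "0 < T"
    and \<Gamma>: "AE x in lborel. \<gamma>\<^sub>0 x = \<Gamma> x"
  obtains \<Theta> :: "real \<times> (real^'n) \<Rightarrow> real" and a :: "(real^'n) \<times> (real^'n) \<Rightarrow> real \<times> (real^'n) \<Rightarrow> real"
  where "\<Theta> \<in> borel_measurable borel" "\<And>z. 0 \<le> \<Theta> z"
    "\<And>t x. 0 \<le> t \<Longrightarrow> stefan_integral \<theta> s t x = time_primitive \<Theta> (t, x)"
    "(\<integral>\<^sup>+z. ennreal (indicator (cylinder T) z * (\<Theta> z)\<^sup>2) \<partial>lborel) < \<infinity>"
    "\<And>q. q \<in> Basis \<times> Basis \<Longrightarrow> a q \<in> borel_measurable borel"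
    "\<And>q. q \<in> Basis \<times> Basis \<Longrightarrow> sqnorm (a q) < \<infinity>"
    "\<And>\<phi> i j. test_function (cylinder T) \<phi> \<Longrightarrow> i \<in> Basis \<Longrightarrow> j \<in> Basis \<Longrightarrow>
        (LINT z|lborel. (indicator (cylinder T) z * time_primitive \<Theta> z) * partial (0, i) (partial (0, j) \<phi>) z) = (LINT z|lborel. a (i, j) z * \<phi> z)"
    "AE z in lborel. z \<in> cylinder T \<longrightarrow> complementary (\<Gamma> (snd z) + A * (\<Sum>i\<in>Basis. a (i, i) z)) (\<Theta> z) (time_primitive \<Theta> z)"
proof -
  let ?Q = "cylinder T :: (real \<times> (real^'n)) set"
  let ?P = "positivity_set \<theta>"
  define v where "v = (\<lambda>(t, x). stefan_integral \<theta> s t x)"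
  have th0: "\<And>t x. 0 \<le> t \<Longrightarrow> 0 \<le> \<theta> t x" and P: "open ?P" and ck: "Ck_on 2 ?P (\<lambda>(t, x). \<theta> t x)"
    and s: "s = arrival_time \<Omega>\<^sub>0 \<theta>"
    and sz: "\<And>x. x \<notin> closure \<Omega>\<^sub>0 \<Longrightarrow> 0 < s x \<and> (\<forall>t>0. ereal t \<le> s x \<longrightarrow> \<theta> t x = 0)"
    and int: "AE x in lebesgue. \<forall>t>0. set_integrable lebesgue {0..t} (\<lambda>\<tau>. \<theta> \<tau> x)"
    and var: "variational_solution A \<gamma>\<^sub>0 T v"
    using st T unfolding stefan_solution_def v_def by blast+
  define \<Theta> where "\<Theta> z = (if 0 < fst z then \<theta> (fst z) (snd z) else 0)" for z
  have \<Theta>m[measurable]: "\<Theta> \<in> borel_measurable borel"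
  proof -
    have "(\<lambda>(t, x). \<theta> t x) differentiable_on ?P" using ck by (simp add: numeral_2_eq_2)
    then have "continuous_on ?P (\<lambda>(t, x). \<theta> t x)" by (rule differentiable_imp_continuous_on)
    then have "(\<lambda>z. indicator ?P z *\<^sub>R (case z of (t, x) \<Rightarrow> \<theta> t x)) \<in> borel_measurable borel"
      using P by (intro borel_measurable_continuous_on_indicator) auto
    moreover have "(\<lambda>z. indicator ?P z *\<^sub>R (case z of (t, x) \<Rightarrow> \<theta> t x)) = \<Theta>"
    proof
      fix z
      show "indicator ?P z *\<^sub>R (case z of (t, x) \<Rightarrow> \<theta> t x) = \<Theta> z"
        using th0[of "fst z" "snd z"] by (cases z) (auto simp: \<Theta>_def positivity_set_def indicator_def)
    qed
    ultimately show ?thesis by simp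
  qed
  have \<Theta>m'[measurable]: "\<Theta> \<in> borel_measurable (borel \<Otimes>\<^sub>M borel)" by (simp add: borel_prod)
  have \<Theta>0: "0 \<le> \<Theta> z" for z using th0 by (simp add: \<Theta>_def)
  let ?V = "time_primitive \<Theta>"
  have sv: "stefan_integral \<theta> s t x = ?V (t, x)" if t: "0 \<le> t" for t x
  proof (rule stefan_integral_eq_primitive[OF \<Theta>m _ _ _ t])
    show "0 \<le> s x" using sz[of x] by (cases "x \<in> closure \<Omega>\<^sub>0") (auto simp: s arrival_time_def)
    show "\<theta> r x = 0" if "0 < r" "ereal r \<le> s x" for r
      using sz[of x] that by (cases "x \<in> closure \<Omega>\<^sub>0") (auto simp: s arrival_time_def)
  qed (simp add: \<Theta>_def)
  have vV: "v z = ?V z" if "z \<in> ?Q" for z using sv[of "fst z" "snd z"] that by (cases z) (auto simp: v_def)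
  obtain vt vx vxx where
      wt: "weak_partial ?Q (1, 0) v vt" and vtL: "Linf_Lp T vt"
    and wx: "\<And>i. weak_partial ?Q (0, axis i 1) v (vx i)" and vxL: "\<And>i. Linf_Lp T (vx i)"
    and wxx: "\<And>i j. weak_partial ?Q (0, axis j 1) (vx i) (vxx i j)" and vxxL: "\<And>i j. Linf_Lp T (vxx i j)"
    and vi: "AE (t, x) in lebesgue_on ?Q. vt (t, x) - A * (\<Sum>i\<in>UNIV. vxx i i (t, x)) \<ge> \<gamma>\<^sub>0 x \<and> v (t, x) \<ge> 0 \<and>
           (vt (t, x) - A * (\<Sum>i\<in>UNIV. vxx i i (t, x)) - \<gamma>\<^sub>0 x) * v (t, x) = 0"
    using var unfolding variational_solution_def by blast
  have Lm: "f \<in> borel_measurable (lebesgue_on ?Q)" if "Linf_Lp T f" for f using that by (simp add: Linf_Lp_def)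
  have Qb: "?Q \<in> sets borel" by measurable
  obtain ht where ht[measurable]: "ht \<in> borel_measurable borel" and htae: "AE z in lborel. ht z = (if z \<in> ?Q then vt z else 0)"
    using borel_version_on[OF Lm[OF vtL] Qb] by blast
  have htL: "sqnorm ht < \<infinity>" by (rule Linf_Lp_L2[OF vtL T ht htae])
  have "\<exists>hx. \<forall>i j. hx i j \<in> borel_measurable borel \<and> (AE z in lborel. hx i j z = (if z \<in> ?Q then vxx i j z else 0))"
  proof (intro choice allI)
    fix i j
    show "\<exists>h. h \<in> borel_measurable borel \<and> (AE z in lborel. h z = (if z \<in> ?Q then vxx i j z else 0))"
      using borel_version_on[OF Lm[OF vxxL] Qb] by blast
  qed
  then obtain hx where hx: "\<And>i j. hx i j \<in> borel_measurable borel" and hxae: "\<And>i j. AE z in lborel. hx i j z = (if z \<in> ?Q then vxx i j z else 0)"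
    by blast
  have hxL: "sqnorm (hx i j) < \<infinity>" for i j by (rule Linf_Lp_L2[OF vxxL T hx hxae])
  have vm: "v \<in> borel_measurable (lebesgue_on ?Q)"
  proof -
    have "?V \<in> borel_measurable lebesgue" by (rule measurable_completion) simp
    then have "?V \<in> borel_measurable (lebesgue_on ?Q)" by (rule measurable_restrict_space1)
    then show ?thesis by (rule measurable_cong[THEN iffD1, rotated]) (use vV in \<open>auto simp: space_restrict_space\<close>)
  qed
  have conv: "(LINT z:?Q|lebesgue. v z * g z) = (LINT z|lborel. (indicator ?Q z * ?V z) * g z)" if "g \<in> borel_measurable borel" for g
    by (rule set_integral_borel_version[OF vm Qb _ that]) (use vV in \<open>auto simp: indicator_def\<close>)
  have \<Theta>ht: "AE z in lborel. z \<in> ?Q \<longrightarrow> \<Theta> z = ht z"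
  proof (rule weak_time_derivative_of_primitive[OF T \<Theta>m \<Theta>0])
    show "AE x in lborel. \<forall>t\<ge>0. integrable lborel (\<lambda>\<tau>. indicator {0..t} \<tau> * \<Theta> (\<tau>, x))"
      using int unfolding AE_completion_iff
    proof eventually_elim
      case (elim x)
      show ?case
      proof (intro allI impI)
        fix t :: real assume t: "0 \<le> t"
        show "integrable lborel (\<lambda>\<tau>. indicator {0..t} \<tau> * \<Theta> (\<tau>, x))"
        proof (cases "t = 0")
          case True
          then have "(\<lambda>\<tau>. indicator {0..t} \<tau> * \<Theta> (\<tau>, x)) = (\<lambda>_. 0)" by (auto simp: indicator_def \<Theta>_def)
          then show ?thesis by simp
        next
          case False
          then have "integrable lebesgue (\<lambda>\<tau>. indicator {0..t} \<tau> *\<^sub>R \<theta> \<tau> x)" using elim t by (simp add: set_integrable_def)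
          then have "integrable lebesgue (\<lambda>\<tau>. indicator {0..t} \<tau> * \<Theta> (\<tau>, x))"
          proof (rule Bochner_Integration.integrable_bound)
            show "(\<lambda>\<tau>. indicator {0..t} \<tau> * \<Theta> (\<tau>, x)) \<in> borel_measurable lebesgue"
              by (rule measurable_completion) measurable
          qed (auto intro!: AE_I2 simp: \<Theta>_def indicator_def)
          then show ?thesis by (subst (asm) integrable_completion) auto
        qed
      qed
    qed
    show "integrable lborel (\<lambda>z. indicator K z * ?V z)" if K: "compact K" "K \<subseteq> ?Q" for K
    proof -
      have [measurable]: "K \<in> sets borel" using K(1) by (simp add: borel_compact)
      have "set_integrable lebesgue K v" using wt K by (simp add: weak_partial_def locally_integrable_def)
      then have "integrable lebesgue (\<lambda>z. indicator K z *\<^sub>R v z)" by (simp add: set_integrable_def)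
      moreover have "(\<lambda>z. indicator K z *\<^sub>R v z) = (\<lambda>z. indicator K z * ?V z)"
        using vV K(2) by (auto simp: indicator_def fun_eq_iff)
      ultimately have "integrable lebesgue (\<lambda>z. indicator K z * ?V z)" by simp
      then show ?thesis by (subst (asm) integrable_completion) auto
    qed
    show "ht \<in> borel_measurable borel" by (rule ht)
    show "integrable lborel (\<lambda>z. indicator K z * ht z)" if K: "compact K" "K \<subseteq> ?Q" for K
    proof (rule integrable_mult_L2[OF _ ht _ htL])
      have Kb: "K \<in> sets borel" using K(1) by (simp add: borel_compact)
      then show "indicat_real K \<in> borel_measurable borel" by simp
      have "(\<integral>\<^sup>+z. ennreal ((indicat_real K z)\<^sup>2) \<partial>lborel) = (\<integral>\<^sup>+z. indicator K z \<partial>lborel)"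
        by (intro nn_integral_cong) (simp add: indicator_def)
      also have "\<dots> < \<infinity>" using emeasure_compact_finite[OF K(1)] Kb by simp
      finally show "(\<integral>\<^sup>+z. ennreal ((indicat_real K z)\<^sup>2) \<partial>lborel) < \<infinity>" .
    qed
    fix \<phi> assume \<phi>: "test_function ?Q \<phi>"
    have \<phi>t: "test_function ?Q (partial (1, 0) \<phi>)" by (rule test_function_partial[OF \<phi>]) (simp add: Basis_prod_def)
    have "(LINT z|lborel. ?V z * partial (1, 0) \<phi> z) = (LINT z|lborel. (indicator ?Q z * ?V z) * partial (1, 0) \<phi> z)"
      by (intro Bochner_Integration.integral_cong refl) (use test_function_facts(5)[OF \<phi>t] in \<open>auto simp: indicator_def\<close>)
    also have "\<dots> = (LINT z:?Q|lebesgue. v z * partial (1, 0) \<phi> z)" by (rule conv[symmetric]) (rule test_function_facts(2)[OF \<phi>t])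
    also have "\<dots> = - (LINT z:?Q|lebesgue. vt z * \<phi> z)" using wt \<phi> by (simp add: weak_partial_def)
    also have "(LINT z:?Q|lebesgue. vt z * \<phi> z) = (LINT z|lborel. ht z * \<phi> z)"
      by (rule set_integral_borel_version[OF Lm[OF vtL] Qb ht test_function_facts(2)[OF \<phi>] htae])
    finally show "(LINT z|lborel. ?V z * partial (1, 0) \<phi> z) = - (LINT z|lborel. ht z * \<phi> z)" .
  qed
  \<comment> \<open>Translation between the index type of vectors and their standard basis.\<close>
  define ix where "ix b = (SOME i. b = axis i (1::real))" for b :: "real^'n"
  have ix: "ix (axis i 1) = i" for i
    unfolding ix_def by (rule some_equality) (auto simp: axis_eq_axis)
  have Bax: "\<exists>i. b = axis i 1" if "b \<in> Basis" for b :: "real^'n" using that by (auto simp: Basis_vec_def)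
  have axB: "axis i 1 \<in> (Basis :: (real^'n) set)" for i by (auto simp: Basis_vec_def)
  define a where "a q = hx (ix (fst q)) (ix (snd q))" for q
  have suma: "(\<Sum>b\<in>Basis. a (b, b) z) = (\<Sum>i\<in>UNIV. hx i i z)" for z
  proof -
    have eq: "(Basis :: (real^'n) set) = (\<lambda>i. axis i 1) ` UNIV" using Bax axB by auto
    have inj: "inj (\<lambda>i::'n. axis i (1::real))" by (simp add: inj_on_def axis_eq_axis)
    show ?thesis unfolding eq sum.reindex[OF inj] by (simp add: a_def ix)
  qed
  show ?thesis
  proof (rule that[of \<Theta> a])
    show "(\<integral>\<^sup>+z. ennreal (indicator ?Q z * (\<Theta> z)\<^sup>2) \<partial>lborel) < \<infinity>"
    proof -
      have "(\<integral>\<^sup>+z. ennreal (indicator ?Q z * (\<Theta> z)\<^sup>2) \<partial>lborel) \<le> sqnorm ht"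
        by (rule nn_integral_mono_AE) (use \<Theta>ht in eventually_elim, auto simp: indicator_def)
      then show ?thesis using htL by (rule order.strict_trans1)
    qed
    show "a q \<in> borel_measurable borel" for q unfolding a_def by (rule hx)
    show "sqnorm (a q) < \<infinity>" for q unfolding a_def by (rule hxL)
  next
    fix \<phi> and i j :: "real^'n" assume \<phi>: "test_function ?Q \<phi>" and "i \<in> Basis" "j \<in> Basis"
    then obtain i' j' where ij: "i = axis i' 1" "j = axis j' 1" using Bax by blast
    have \<phi>j: "test_function ?Q (partial (0, j) \<phi>)" by (rule test_function_partial[OF \<phi>]) (use \<open>j \<in> Basis\<close> in \<open>simp add: Basis_prod_def\<close>)
    have \<phi>ij: "test_function ?Q (partial (0, i) (partial (0, j) \<phi>))" by (rule test_function_partial[OF \<phi>j]) (use \<open>i \<in> Basis\<close> in \<open>simp add: Basis_prod_def\<close>)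
    have "(LINT z|lborel. (indicator ?Q z * ?V z) * partial (0, i) (partial (0, j) \<phi>) z) = (LINT z:?Q|lebesgue. v z * partial (0, i) (partial (0, j) \<phi>) z)"
      by (rule conv[symmetric]) (rule test_function_facts(2)[OF \<phi>ij])
    also have "\<dots> = - (LINT z:?Q|lebesgue. vx i' z * partial (0, j) \<phi> z)"
      using wx[of i'] \<phi>j unfolding ij by (simp add: weak_partial_def)
    also have "\<dots> = (LINT z:?Q|lebesgue. vxx i' j' z * \<phi> z)"
      using wxx[of j' i'] \<phi> unfolding ij by (simp add: weak_partial_def)
    also have "\<dots> = (LINT z|lborel. hx i' j' z * \<phi> z)"
      by (rule set_integral_borel_version[OF Lm[OF vxxL] Qb hx test_function_facts(2)[OF \<phi>] hxae])
    finally show "(LINT z|lborel. (indicator ?Q z * ?V z) * partial (0, i) (partial (0, j) \<phi>) z) = (LINT z|lborel. a (i, j) z * \<phi> z)"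
      by (simp add: a_def ij ix)
  next
    have vi': "AE z in lborel. z \<in> ?Q \<longrightarrow> vt z - A * (\<Sum>i\<in>UNIV. vxx i i z) \<ge> \<gamma>\<^sub>0 (snd z) \<and> v z \<ge> 0 \<and>
           (vt z - A * (\<Sum>i\<in>UNIV. vxx i i z) - \<gamma>\<^sub>0 (snd z)) * v z = 0"
    proof -
      have "?Q \<inter> space lebesgue \<in> sets lebesgue" using Qb by auto
      then show ?thesis using vi by (subst (asm) AE_restrict_space_iff) (auto simp: AE_completion_iff case_prod_unfold elim!: eventually_mono)
    qed
    have "AE z in lborel. \<forall>i. hx i i z = (if z \<in> ?Q then vxx i i z else 0)"
      using hxae by (simp add: AE_all_countable)
    then show "AE z in lborel. z \<in> ?Q \<longrightarrow> complementary (\<Gamma> (snd z) + A * (\<Sum>i\<in>Basis. a (i, i) z)) (\<Theta> z) (?V z)"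
      using vi' htae \<Theta>ht AE_lborel_snd[OF \<Gamma>]
    proof eventually_elim
      case (elim z)
      show ?case
      proof
        assume z: "z \<in> ?Q"
        have e: "(\<Sum>i\<in>Basis. a (i, i) z) = (\<Sum>i\<in>UNIV. vxx i i z)" "\<Theta> z = vt z" "\<Gamma> (snd z) = \<gamma>\<^sub>0 (snd z)" "?V z = v z"
          using elim z vV[OF z] by (simp_all add: suma)
        show "complementary (\<Gamma> (snd z) + A * (\<Sum>i\<in>Basis. a (i, i) z)) (\<Theta> z) (?V z)"
          using elim(2) z unfolding e by (auto simp: algebra_simps)
      qed
    qed
  qed (use \<Theta>m \<Theta>0 sv in auto)
qed

section \<open>Convergence of the nonlocal problem\<close>

theorem theorem1p3:
  fixes k \<gamma>\<^sub>0 :: "real^'n \<Rightarrow> real"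
    and A l\<^sub>0 :: real
    and \<Omega>\<^sub>0 N :: "(real^'n) set"
    and \<gamma> :: "real \<Rightarrow> real \<Rightarrow> real^'n \<Rightarrow> real"
    and \<theta> :: "real \<Rightarrow> real^'n \<Rightarrow> real"
    and s :: "real^'n \<Rightarrow> ereal"
  assumes "continuous_on UNIV k" and "bounded (range k)"
    and "\<And>x. 0 \<le> k x" and "0 < k 0"
    and "integrable lebesgue k" and "(LINT x|lebesgue. k x) = 1"
    and "0 < A"
    and "(\<lambda>\<xi>. fourier k \<xi> - complex_of_real (1 - A * (norm \<xi>)\<^sup>2))
           \<in> o[at 0](\<lambda>\<xi>. complex_of_real ((norm \<xi>)\<^sup>2))"
    and "smooth_bounded_domain \<Omega>\<^sub>0"
    and "0 < l\<^sub>0"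
    and "Linf \<gamma>\<^sub>0"
    and "AE x in lebesgue. x \<notin> closure \<Omega>\<^sub>0 \<longrightarrow> \<gamma>\<^sub>0 x = - l\<^sub>0"
    and "AE x in lebesgue. x \<in> closure \<Omega>\<^sub>0 \<longrightarrow> 0 \<le> \<gamma>\<^sub>0 x"
    and "\<not> (AE x in lebesgue. x \<in> closure \<Omega>\<^sub>0 \<longrightarrow> \<gamma>\<^sub>0 x = 0)"
    and "N \<in> null_sets lebesgue"
    and "\<And>\<epsilon>. 0 < \<epsilon> \<Longrightarrow> nonlocal_solution k \<gamma>\<^sub>0 N \<epsilon> (\<gamma> \<epsilon>)"
    and "stefan_solution A \<Omega>\<^sub>0 \<gamma>\<^sub>0 \<theta> s"
  shows "\<forall>T>0. AE (t, x) in lebesgue_on ({0<..<T} \<times> UNIV).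
           ((\<lambda>\<epsilon>. LINT \<tau>:{0..t}|lebesgue. max (\<gamma> \<epsilon> \<tau> x) 0) \<longlongrightarrow> stefan_integral \<theta> s t x) (at_right 0)"
proof (intro allI impI)
  fix T :: real assume T: "0 < T"
  let ?Q = "cylinder T :: (real \<times> (real^'n)) set"
  have k0: "\<And>y. 0 \<le> k y" by fact
  have km[measurable]: "k \<in> borel_measurable borel" using assms(1) by (rule borel_measurable_continuous_onI)
  have kint: "integrable lborel k" using assms(5) by (subst (asm) integrable_completion) auto
  have k1: "(LINT x|lborel. k x) = 1" using assms(6) by (subst (asm) integral_completion) auto
  note mom = fourier_expansion_moments[OF kint k0 k1 assms(8)]
  have M1: "integrable lborel (\<lambda>y. k y * (y \<bullet> i))" "(LINT y|lborel. k y * (y \<bullet> i)) = 0" for i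
    using mom(3,4)[of i] by (simp_all add: inner_commute mult.commute)
  \<comment> \<open>Polarization: \<open>fourier_expansion_moments\<close> gives the quadratic form of second moments.\<close>
  have M2: "integrable lborel (\<lambda>y. k y * ((y \<bullet> i) * (y \<bullet> j))) \<and> (LINT y|lborel. k y * ((y \<bullet> i) * (y \<bullet> j))) = 2 * A * (i \<bullet> j)" for i j
  proof -
    have e: "k y * ((y \<bullet> i) * (y \<bullet> j)) = (((i + j) \<bullet> y)\<^sup>2 * k y - ((i - j) \<bullet> y)\<^sup>2 * k y) / 4" for y
      by (simp add: inner_add_left inner_diff_left inner_commute power2_eq_square algebra_simps)
    have "(norm (i + j))\<^sup>2 - (norm (i - j))\<^sup>2 = 4 * (i \<bullet> j)"
      by (simp add: power2_norm_eq_inner inner_simps inner_commute)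
    then show ?thesis unfolding e using mom(1,2)[of "i + j"] mom(1,2)[of "i - j"]
      by (auto simp: right_diff_distrib[symmetric] simp flip: mult.assoc)
  qed
  obtain M where M0: "0 \<le> M" and \<gamma>M: "AE x in lebesgue. \<bar>\<gamma>\<^sub>0 x\<bar> \<le> M" using Linf_bounded_AE[OF \<open>Linf \<gamma>\<^sub>0\<close>] .
  \<comment> \<open>The one exceptional set for all \<open>\<epsilon>\<close>.\<close>
  define N\<^sub>1 where "N\<^sub>1 = N \<union> {x. \<not> \<bar>\<gamma>\<^sub>0 x\<bar> \<le> M}"
  have "AE x in lebesgue. x \<notin> N" using assms(15) by (rule AE_not_in)
  then have N1: "AE x in lborel. x \<notin> N\<^sub>1"
    using \<gamma>M unfolding AE_completion_iff by eventually_elim (simp add: N\<^sub>1_def)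
  have sub: "N \<subseteq> N\<^sub>1" and bd: "\<And>x. x \<notin> N\<^sub>1 \<Longrightarrow> \<bar>\<gamma>\<^sub>0 x\<bar> \<le> M" by (auto simp: N\<^sub>1_def)
  have "\<gamma>\<^sub>0 \<in> borel_measurable lebesgue" using \<open>Linf \<gamma>\<^sub>0\<close> by (simp add: Linf_def)
  then obtain \<Gamma> where \<Gamma>m[measurable]: "\<Gamma> \<in> borel_measurable borel" and \<Gamma>: "AE x in lborel. \<gamma>\<^sub>0 x = \<Gamma> x" by (rule borel_version)
  \<comment> \<open>The datum is negative outside a bounded set.\<close>
  have \<Gamma>L1: "(\<integral>\<^sup>+x. ennreal (max (\<Gamma> x) 0) \<partial>lborel) < \<infinity>"
  proof -
    have cpt: "compact (closure \<Omega>\<^sub>0)" using assms(9) by (simp add: smooth_bounded_domain_def compact_eq_bounded_closed bounded_closure)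
    have "(\<integral>\<^sup>+x. ennreal (max (\<Gamma> x) 0) \<partial>lborel) \<le> (\<integral>\<^sup>+x. ennreal M * indicator (closure \<Omega>\<^sub>0) x \<partial>lborel)"
    proof (rule nn_integral_mono_AE)
      show "AE x in lborel. ennreal (max (\<Gamma> x) 0) \<le> ennreal M * indicator (closure \<Omega>\<^sub>0) x"
        using \<Gamma> \<gamma>M[unfolded AE_completion_iff] assms(12)[unfolded AE_completion_iff]
        by eventually_elim (use M0 \<open>0 < l\<^sub>0\<close> in \<open>auto simp: indicator_def max_def ennreal_leI\<close>)
    qed
    also have "\<dots> = ennreal M * emeasure lborel (closure \<Omega>\<^sub>0)" by (rule nn_integral_cmult_indicator) simp
    also have "\<dots> < \<infinity>" using emeasure_compact_finite[OF cpt] by (simp add: ennreal_mult_less_top)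
    finally show ?thesis .
  qed
  define W where "W \<epsilon> t x = (LINT \<tau>:{0..t}|lebesgue. max (\<gamma> \<epsilon> \<tau> x) 0)" for \<epsilon> t x
  obtain \<Theta> and a where \<Theta>m[measurable]: "\<Theta> \<in> borel_measurable borel" and \<Theta>0: "\<And>z. 0 \<le> \<Theta> z"
    and sv: "\<And>t x. 0 \<le> t \<Longrightarrow> stefan_integral \<theta> s t x = time_primitive \<Theta> (t, x)"
    and \<Theta>L: "(\<integral>\<^sup>+z. ennreal (indicator ?Q z * (\<Theta> z)\<^sup>2) \<partial>lborel) < \<infinity>"
    and am: "\<And>q. q \<in> Basis \<times> Basis \<Longrightarrow> a q \<in> borel_measurable borel"
    and aL: "\<And>q. q \<in> Basis \<times> Basis \<Longrightarrow> sqnorm (a q) < \<infinity>"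
    and weak: "\<And>\<phi> i j. test_function ?Q \<phi> \<Longrightarrow> i \<in> Basis \<Longrightarrow> j \<in> Basis \<Longrightarrow>
        (LINT z|lborel. (indicator ?Q z * time_primitive \<Theta> z) * partial (0, i) (partial (0, j) \<phi>) z) = (LINT z|lborel. a (i, j) z * \<phi> z)"
    and loc: "AE z in lborel. z \<in> ?Q \<longrightarrow>
        complementary (\<Gamma> (snd z) + A * (\<Sum>i\<in>Basis. a (i, i) z)) (\<Theta> z) (time_primitive \<Theta> z)"
    using stefan_solution_structure[OF assms(17) T \<Gamma>] by blast
  define v where "v z = indicator ?Q z * time_primitive \<Theta> z" for z
  have vm[measurable]: "v \<in> borel_measurable borel" unfolding v_def by measurable
  have vL: "sqnorm v < \<infinity>" unfolding v_def by (rule time_primitive_L2[OF \<Theta>m T \<Theta>L])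
  have M2': "(LINT y|lborel. k y * ((y \<bullet> i) * (y \<bullet> j))) = (if i = j then 2 * A else 0)" if "i \<in> Basis" "j \<in> Basis" for i j
    using M2[of i j] that by (simp add: inner_Basis)
  let ?R = "\<lambda>\<epsilon>. \<integral>\<^sup>+z. indicator ?Q z * ennreal ((nonlocal_diffusion k \<epsilon> v z - A * (\<Sum>i\<in>Basis. a (i, i) z))\<^sup>2) \<partial>lborel"
  have "\<exists>\<rho> :: real \<Rightarrow> ennreal. (\<rho> \<longlongrightarrow> 0) (at_right 0) \<and> (\<forall>\<epsilon>. \<rho> \<epsilon> < \<infinity>) \<and> (\<forall>\<epsilon>>0. ?R \<epsilon> \<le> \<rho> \<epsilon>)"
  proof (rule nonlocal_consistency[where k = k and A = A and v = v and a = a and T = T])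
    fix \<rho> :: "real \<Rightarrow> ennreal"
    assume "(\<rho> \<longlongrightarrow> 0) (at_right 0)" "\<And>\<epsilon>. \<rho> \<epsilon> < \<infinity>" "\<And>\<epsilon>. 0 < \<epsilon> \<Longrightarrow> ?R \<epsilon> \<le> \<rho> \<epsilon>"
    then show ?thesis by (intro exI[of _ \<rho>]) simp
  qed ((rule km kint M1 M2[THEN conjunct1] M2' k1 vm vL am aL weak[folded v_def]; assumption)+)
  then obtain \<rho> :: "real \<Rightarrow> ennreal" where \<rho>: "(\<rho> \<longlongrightarrow> 0) (at_right 0)" and \<rho>f: "\<And>\<epsilon>. \<rho> \<epsilon> < \<infinity>"
    and cons: "\<And>\<epsilon>. 0 < \<epsilon> \<Longrightarrow> ?R \<epsilon> \<le> \<rho> \<epsilon>"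
    by blast
  have \<Lambda>m: "(\<lambda>z. A * (\<Sum>i\<in>Basis. a (i, i) z)) \<in> borel_measurable borel"
    by (intro borel_measurable_times borel_measurable_const borel_measurable_sum am) auto
  define \<omega> where "\<omega> \<epsilon> = 4 * T\<^sup>2 * enn2real (\<rho> \<epsilon>)" for \<epsilon>
  have \<omega>lim: "(\<omega> \<longlongrightarrow> 0) (at_right 0)"
  proof -
    have "((\<lambda>\<epsilon>. enn2real (\<rho> \<epsilon>)) \<longlongrightarrow> 0) (at_right 0)" by (rule tendsto_enn2real) (use \<rho> in simp_all)
    then have "((\<lambda>\<epsilon>. 4 * T\<^sup>2 * enn2real (\<rho> \<epsilon>)) \<longlongrightarrow> 4 * T\<^sup>2 * 0) (at_right 0)" by (rule tendsto_mult_left)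
    then show ?thesis by (simp add: \<omega>_def[abs_def])
  qed
  \<comment> \<open>Near the origin \<open>k > k 0 / 2\<close>, twice the height \<open>b\<close> of the two portions in the
    coupling.\<close>
  define b where "b = k 0 / 4"
  have b0: "0 < b" using \<open>0 < k 0\<close> by (simp add: b_def)
  obtain r where r: "0 < r" and kr: "\<And>y. norm y < 2 * r \<Longrightarrow> 2 * b \<le> k y"
  proof -
    have "isCont k 0" using assms(1) by (simp add: continuous_on_eq_continuous_at)
    then have "\<forall>\<^sub>F y in nhds 0. k 0 / 2 < k y"
      using \<open>0 < k 0\<close> by (intro order_tendstoD(1)[of k "k 0"]) (auto simp: isCont_def tendsto_nhds_iff)
    then obtain d where d: "0 < d" "\<And>y. dist y 0 < d \<Longrightarrow> k 0 / 2 < k y" by (auto simp: eventually_nhds_metric)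
    show ?thesis by (rule that[of "d / 2"]) (use d in \<open>auto simp: b_def intro: less_imp_le\<close>)
  qed
  \<comment> \<open>The constant from \<open>almost_lipschitz_of_averaging\<close>, with \<open>M T\<close> as the bound of the
    time integral and \<open>2 M\<close> as the bound of its nonlocal diffusion. The summand \<open>M\<close> in \<open>C\<close> is
    the Lipschitz constant in time.\<close>
  define C\<^sub>0 where "C\<^sub>0 = M * T + 2 * (2 * M) / (b * measure lborel (ball (0::real^'n) r))"
  have C00: "0 \<le> C\<^sub>0" using M0 T b0 by (simp add: C\<^sub>0_def)
  define C where "C = C\<^sub>0 / r + C\<^sub>0 + M + 1"
  have C0: "0 < C" using C00 r M0 by (simp add: C_def add_nonneg_pos)
  have L2: "\<exists>w. w \<in> borel_measurable borel \<and> (AE z in lborel. fst z \<in> {0<..<T} \<longrightarrow> W \<epsilon> (fst z) (snd z) = w z) \<and>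
        (\<integral>\<^sup>+z. ennreal (indicator ?Q z * (w z - v z)\<^sup>2) \<partial>lborel) \<le> ennreal (\<omega> \<epsilon>)"
    and lip: "\<And>t t' x x'. t \<in> {0<..<T} \<Longrightarrow> t' \<in> {0<..<T} \<Longrightarrow> x \<notin> N\<^sub>1 \<Longrightarrow> x' \<notin> N\<^sub>1 \<Longrightarrow>
        \<bar>W \<epsilon> t x - W \<epsilon> t' x'\<bar> \<le> C * (norm (x - x') + \<bar>t - t'\<bar> + \<epsilon>)"
    if e: "0 < \<epsilon>" "\<epsilon> \<le> 1" for \<epsilon>
  proof -
    obtain G where Gm[measurable]: "G \<in> borel_measurable borel" and G0: "\<And>z. 0 \<le> G z" and GM: "\<And>z. G z \<le> M"
      and GW: "AE x in lborel. \<forall>t\<ge>0. W \<epsilon> t x = time_primitive G (t, x)"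
      and Wt: "\<And>x s t. x \<notin> N\<^sub>1 \<Longrightarrow> 0 \<le> s \<Longrightarrow> s \<le> t \<Longrightarrow> 0 \<le> W \<epsilon> t x - W \<epsilon> s x"
        "\<And>x s t. x \<notin> N\<^sub>1 \<Longrightarrow> 0 \<le> s \<Longrightarrow> s \<le> t \<Longrightarrow> W \<epsilon> t x - W \<epsilon> s x \<le> M * (t - s)"
      and Wavg: "\<And>x t. x \<notin> N\<^sub>1 \<Longrightarrow> 0 \<le> t \<Longrightarrow> \<bar>space_average k \<epsilon> (time_primitive G) (t, x) - W \<epsilon> t x\<bar> \<le> 2 * M * \<epsilon>\<^sup>2"
      and Gvi: "AE x in lborel. \<forall>t\<ge>0.
        complementary (\<Gamma> x + nonlocal_diffusion k \<epsilon> (time_primitive G) (t, x)) (G (t, x)) (time_primitive G (t, x))"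
      and GL: "(\<integral>\<^sup>+z. ennreal (indicator ?Q z * (G z)\<^sup>2) \<partial>lborel) < \<infinity>"
    proof (rule nonlocal_solution_structure[OF km kint k1 k0 e(1) M0 sub N1 bd assms(16)[OF e(1)] \<Gamma>m \<Gamma> \<Gamma>L1, of "W \<epsilon>"], goal_cases)
      case (3 G)
      show ?case by (rule 3(1)[OF 3(2-10)]) (simp_all add: T)
    qed (simp_all add: W_def)
    note primitive = bounded_time_primitive[OF Gm G0 GM]
    show "\<exists>w. w \<in> borel_measurable borel \<and> (AE z in lborel. fst z \<in> {0<..<T} \<longrightarrow> W \<epsilon> (fst z) (snd z) = w z) \<and>
        (\<integral>\<^sup>+z. ennreal (indicator ?Q z * (w z - v z)\<^sup>2) \<partial>lborel) \<le> ennreal (\<omega> \<epsilon>)"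
    proof (intro exI[of _ "time_primitive G"] conjI)
      show "AE z in lborel. fst z \<in> {0<..<T} \<longrightarrow> W \<epsilon> (fst z) (snd z) = time_primitive G z"
        using AE_lborel_snd[OF GW] by eventually_elim auto
      have nl: "AE z in lborel. z \<in> ?Q \<longrightarrow>
          complementary (\<Gamma> (snd z) + nonlocal_diffusion k \<epsilon> (time_primitive G) z) (G z) (time_primitive G z)"
        using AE_lborel_snd[OF Gvi]
      proof eventually_elim
        case (elim z)
        then show ?case by (cases z) auto
      qed
      have c: "(\<integral>\<^sup>+z. indicator ?Q z * ennreal (((space_average k \<epsilon> (\<lambda>z. indicator ?Q z * time_primitive \<Theta> z) z 
            - indicator ?Q z * time_primitive \<Theta> z) / \<epsilon>\<^sup>2 - A * (\<Sum>i\<in>Basis. a (i, i) z))\<^sup>2) \<partial>lborel) \<le> ennreal (enn2real (\<rho> \<epsilon>))"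
        using cons[OF e(1)] \<rho>f[of \<epsilon>] by (simp add: v_def[abs_def] less_top[symmetric])
      have "(\<integral>\<^sup>+z. ennreal (indicator ?Q z * (time_primitive G z - time_primitive \<Theta> z)\<^sup>2) \<partial>lborel) \<le> ennreal (4 * T\<^sup>2 * enn2real (\<rho> \<epsilon>))"
        by (rule energy_estimate[OF kint k0 k1 e(1) T Gm G0 \<Theta>m \<Theta>0 GL \<Theta>L \<Lambda>m nl loc _ c]) simp
      moreover have eq: "indicator ?Q z * (time_primitive G z - v z)\<^sup>2 = indicator ?Q z * (time_primitive G z - time_primitive \<Theta> z)\<^sup>2" for z
        by (simp add: v_def indicator_def)
      ultimately show "(\<integral>\<^sup>+z. ennreal (indicator ?Q z * (time_primitive G z - v z)\<^sup>2) \<partial>lborel) \<le> ennreal (\<omega> \<epsilon>)"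
        by (simp only: \<omega>_def eq)
    qed measurable
    have W0: "W \<epsilon> 0 x = 0" for x
    proof -
      have "(LINT \<tau>|lebesgue. indicator {0::real} \<tau> *\<^sub>R max (\<gamma> \<epsilon> \<tau> x) 0) = (LINT \<tau>|lebesgue. indicator {0::real} \<tau> *\<^sub>R max (\<gamma> \<epsilon> 0 x) 0)"
        by (intro Bochner_Integration.integral_cong) (auto simp: indicator_def)
      then show ?thesis by (simp add: W_def set_lebesgue_integral_def)
    qed
    have MtT: "M * t \<le> M * T" if "t \<in> {0<..<T}" for t using that M0 by (intro mult_left_mono) auto
    have xlip: "W \<epsilon> t x' - W \<epsilon> t x \<le> (norm (x' - x) / r + \<epsilon>) * C\<^sub>0"
      if t: "t \<in> {0<..<T}" and x: "x \<notin> N\<^sub>1" "x' \<notin> N\<^sub>1" for t x x'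
      unfolding C\<^sub>0_def
    proof (rule almost_lipschitz_of_averaging[OF km kint k1 b0 r k0 kr e])
      have "time_primitive G \<in> borel_measurable (borel \<Otimes>\<^sub>M borel)" using time_primitive_measurable[OF Gm] by (simp add: borel_prod)
      then show "(\<lambda>x. time_primitive G (t, x)) \<in> borel_measurable borel" by measurable
      show "0 \<le> 2 * M" "0 \<le> M * T" using M0 T by auto
      show "0 \<le> time_primitive G (t, x)" for x by (rule primitive(2))
      show "time_primitive G (t, x) \<le> M * T" for x using primitive(4)[of t x] MtT[OF t] t by simp
      show "AE x in lborel. x \<notin> N\<^sub>1 \<and> W \<epsilon> t x = time_primitive G (t, x)"
        using N1 GW by eventually_elim (use t in simp)
      show "0 \<le> W \<epsilon> t x" if "x \<notin> N\<^sub>1" for x using Wt(1)[OF that, of 0 t] t W0 by simp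
      show "W \<epsilon> t x \<le> M * T" if "x \<notin> N\<^sub>1" for x using Wt(2)[OF that, of 0 t] t W0 MtT[OF t] by simp
      show "\<bar>(LINT y|lborel. k y * time_primitive G (t, x - \<epsilon> *\<^sub>R y)) - W \<epsilon> t x\<bar> \<le> 2 * M * \<epsilon>\<^sup>2" if "x \<notin> N\<^sub>1" for x
        using Wavg[OF that, of t] t by (simp add: space_average_def)
    qed (use x in auto)
    show "\<bar>W \<epsilon> t x - W \<epsilon> t' x'\<bar> \<le> C * (norm (x - x') + \<bar>t - t'\<bar> + \<epsilon>)"
      if t: "t \<in> {0<..<T}" "t' \<in> {0<..<T}" and x: "x \<notin> N\<^sub>1" "x' \<notin> N\<^sub>1" for t t' x x'
    proof -
      have "\<bar>W \<epsilon> t x - W \<epsilon> t x'\<bar> \<le> (norm (x - x') / r + \<epsilon>) * C\<^sub>0"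
        using xlip[OF t(1) x] xlip[OF t(1) x(2,1)] by (simp add: abs_le_iff norm_minus_commute)
      moreover have "\<bar>W \<epsilon> t x' - W \<epsilon> t' x'\<bar> \<le> M * \<bar>t - t'\<bar>"
        using Wt[OF x(2), of t t'] Wt[OF x(2), of t' t] t by (cases "t \<le> t'") auto
      ultimately have "\<bar>W \<epsilon> t x - W \<epsilon> t' x'\<bar> \<le> (norm (x - x') / r + \<epsilon>) * C\<^sub>0 + M * \<bar>t - t'\<bar>" by linarith
      also have "\<dots> = C\<^sub>0 / r * norm (x - x') + C\<^sub>0 * \<epsilon> + M * \<bar>t - t'\<bar>" by (simp add: algebra_simps)
      also have "\<dots> \<le> C * norm (x - x') + C * \<epsilon> + C * \<bar>t - t'\<bar>"
        using C00 r M0 e by (intro add_mono mult_right_mono) (auto simp: C_def)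
      finally show ?thesis by (simp add: algebra_simps)
    qed
  qed
  have "AE z in lborel. fst z \<in> {0<..<T} \<longrightarrow> ((\<lambda>\<epsilon>. W \<epsilon> (fst z) (snd z)) \<longlongrightarrow> v z) (at_right 0)"
    by (rule pointwise_limit_of_almost_equicontinuous[OF N1 C0 lip vm L2 _ \<omega>lim]) (auto simp: \<omega>_def)
  then have ae: "AE z in lborel. z \<in> ?Q \<longrightarrow> ((\<lambda>\<epsilon>. W \<epsilon> (fst z) (snd z)) \<longlongrightarrow> stefan_integral \<theta> s (fst z) (snd z)) (at_right 0)"
  proof eventually_elim
    case (elim z)
    show ?case
    proof
      assume z: "z \<in> ?Q"
      then have "v z = stefan_integral \<theta> s (fst z) (snd z)" using sv[of "fst z" "snd z"] by (cases z) (auto simp: v_def)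
      then show "((\<lambda>\<epsilon>. W \<epsilon> (fst z) (snd z)) \<longlongrightarrow> stefan_integral \<theta> s (fst z) (snd z)) (at_right 0)"
        using elim z by (cases z) auto
    qed
  qed
  have "?Q \<inter> space lebesgue \<in> sets lebesgue" using cylinder_measurable[of T] by auto
  then show "AE (t, x) in lebesgue_on ({0<..<T} \<times> UNIV).
           ((\<lambda>\<epsilon>. LINT \<tau>:{0..t}|lebesgue. max (\<gamma> \<epsilon> \<tau> x) 0) \<longlongrightarrow> stefan_integral \<theta> s t x) (at_right 0)"
    using ae by (subst AE_restrict_space_iff) (auto simp: AE_completion_iff case_prod_unfold W_def elim!: eventually_mono)
qed

end
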